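(* For every positive integer $k$, the set $\mathcal{L}_k=\{n\in\mathbb{N}:\omega^*(n)=k\}$ has a natural density, that is, the limit $$\delta_k=\lim_{x\to\infty}\frac{\#(\mathcal{L}_k\cap[1,x])}{x}$$ exists, and $\delta_k>0$. Moreover, $\sum_{k\ge1}\delta_k=1$.
   Context: $\mathbb{N}$ is the set of positive integers. For $n\in\mathbb{N}$, $\omega^*(n)$ denotes the number of positive divisors of $n$ of the form $p-1$ with $p$ prime. *)

theory Defs
  imports Complex_Main "HOL-Computational_Algebra.Primes"
begin

definition omega_star :: "nat \<Rightarrow> nat" where
  "omega_star n = card {d. 0 < d \<and> d dvd n \<and> (\<exists>p::nat. prime p \<and> d = p - 1)}"

definition L_set :: "nat \<Rightarrow> nat set" where
  "L_set k = {n. 0 < n \<and> omega_star n = k}"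

definition has_natural_density :: "nat set \<Rightarrow> real \<Rightarrow> bool" where
  "has_natural_density A \<delta> \<longleftrightarrow>
     ((\<lambda>x::real. real (card {n \<in> A. 1 \<le> real n \<and> real n \<le> x}) / x) \<longlongrightarrow> \<delta>) at_top"

end

theory Submission
  imports Defs "HOL-Number_Theory.Number_Theory" "HOL-Real_Asymp.Real_Asymp" "HOL-Analysis.Harmonic_Numbers" "HOL-Computational_Algebra.Squarefree"
begin

text \<open>
  Call \<open>d\<close> a shifted prime if \<open>d + 1\<close> is prime, so that \<open>omega_star n\<close> is the number of divisors of
  \<open>n\<close> that are shifted primes. The theorem rests on three facts.

  Large shifted primes rarely divide (\<open>shifted_prime_divisor_tail\<close>): for every \<open>\<epsilon> > 0\<close> there is \<open>Y\<close>
  such that, uniformly in \<open>x\<close>, at most \<open>\<epsilon> x\<close> of the integers up to \<open>x\<close> have a shifted prime divisor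
  above \<open>Y\<close>. The union bound is useless because the sum of \<open>1 / (p - 1)\<close> diverges. Instead one uses
  that a typical \<open>n\<close> has few prime factors below \<open>T\<close>, about \<open>ln (ln T)\<close> of them, whereas a product
  \<open>n = d * m\<close> with \<open>d > T\<close> tends to have about twice as many; the gain is a power of \<open>ln T\<close> for
  divisors between \<open>T\<close> and \<open>T\<^sup>2\<close>, which is summable along \<open>T = 2 ^ 2 ^ i\<close>. Outside a set of density
  at most \<open>\<epsilon>\<close> the value of \<open>omega_star\<close> is therefore decided by the divisors up to \<open>Y\<close>, hence by a
  function with period \<open>fact Y\<close> and values at most \<open>Y + 1\<close>. Periodicity gives the existence of the
  densities (\<open>L_set_density_exists\<close>), boundedness shows that no mass escapes to infinity
  (\<open>L_set_densities_sum\<close>).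

  Every \<open>k \<ge> 1\<close> is a value (\<open>omega_star_attained\<close>). From an even \<open>m\<close> one passes to a multiple with
  exactly one more shifted prime divisor. A minimal multiplier \<open>r\<close> that produces a new one can
  produce two only if \<open>r * g + 1\<close> and \<open>r * h + 1\<close> are both prime for two divisors \<open>g \<noteq> h\<close> of \<open>m\<close>
  (\<open>omega_star_single_jump\<close>), and such \<open>r\<close> are as sparse as prime pairs. Counting primes \<open>p\<close> with
  \<open>p = -1\<close> modulo \<open>4\<close> and modulo all small odd primes, from below by Dirichlet's method and from above
  by a sieve when a bad \<open>r\<close> divides \<open>p - 1\<close>, yields a prime whose \<open>p - 1\<close> has no bad divisor
  (\<open>exists_prime_without_double_jump\<close>).

  Positivity (\<open>L_set_density_positive\<close>): if \<open>omega_star n0 = k\<close>, then \<open>omega_star (n0 * m) = k\<close> as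
  soon as \<open>m\<close> is no multiple of \<open>d / gcd d n0\<close> for any shifted prime \<open>d\<close> that does not divide \<open>n0\<close>.
  The \<open>d\<close> above some bound exclude at most half of all \<open>m\<close>, and each of the finitely many others
  multiplies the remaining density by a factor at least \<open>1 - 1 / a\<close>, where \<open>a = d / gcd d n0 \<ge> 2\<close>.
\<close>

section \<open>Euler products and the elementary estimates of Chebyshev and Mertens\<close>

text \<open>Multiplying out the geometric series of the primes in \<open>S\<close> produces every integer composed of these
  primes, by unique factorisation. Stated for finite sets, it can be proved by adding one prime at a time
  to \<open>S\<close>, without convergence of double series.\<close>
lemma sum_multiplicative_le_euler_product:
  fixes g :: "nat \<Rightarrow> real"
  assumes "finite S" "\<And>p. p \<in> S \<Longrightarrow> prime p" "finite F"
    and "\<And>n. n \<in> F \<Longrightarrow> n > 0 \<and> prime_factors n \<subseteq> S"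
    and g1: "g 1 = 1" and gm: "\<And>m n. m > 0 \<Longrightarrow> n > 0 \<Longrightarrow> g (m * n) = g m * g n"
    and g0: "\<And>n. g n \<ge> 0" and gp: "\<And>p. p \<in> S \<Longrightarrow> g p < 1"
  shows "(\<Sum>n\<in>F. g n) \<le> (\<Prod>p\<in>S. 1 / (1 - g p))"
  using assms(1-4) gp
proof (induction S arbitrary: F rule: finite_induct)
  case empty
  have "n = 1" if "n \<in> F" for n
    using empty.prems(3)[OF that] by (auto simp: prime_factorization_empty_iff)
  hence "F \<subseteq> {1}" by blast
  hence "(\<Sum>n\<in>F. g n) \<le> (\<Sum>n\<in>{1}. g n)" by (intro sum_mono2) (use g0 in auto)
  thus ?case using g1 by simp
next
  case (insert p S)
  have p: "prime p" using insert by auto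
  define K where "K = Max (insert 0 (multiplicity p ` F))"
  define h where "h n = n div p ^ multiplicity p n" for n
  have gpow: "g (p ^ k) = g p ^ k" for k
    by (induction k) (use g1 gm p prime_gt_0_nat in auto)
  have dec: "n = p ^ multiplicity p n * h n" for n
    unfolding h_def by (simp add: multiplicity_dvd)
  have hpos: "h n > 0" if "n \<in> F" for n
    using dec[of n] insert.prems(3)[OF that] by (metis gr0I mult_0_right less_irrefl)
  have hS: "prime_factors (h n) \<subseteq> S" if "n \<in> F" for n
  proof
    fix q assume q: "q \<in> prime_factors (h n)"
    have "\<not> p dvd h n"
      unfolding h_def using insert.prems(3)[OF that] p
      by (intro multiplicity_decompose) auto
    hence "q \<noteq> p" using q by auto
    moreover have "q \<in> prime_factors n"
      using q insert.prems(3)[OF that] dec[of n]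
      by (metis dvd_mult in_prime_factors_iff less_irrefl)
    ultimately show "q \<in> S" using insert.prems(3)[OF that] by auto
  qed
  have inj: "inj_on (\<lambda>n. (multiplicity p n, h n)) F"
    by (rule inj_onI) (metis Pair_inject dec)
  have "(\<Sum>n\<in>F. g n) = (\<Sum>n\<in>F. g p ^ multiplicity p n * g (h n))"
  proof (rule sum.cong)
    fix n assume n: "n \<in> F"
    have "g n = g (p ^ multiplicity p n * h n)" using dec[of n] by metis
    thus "g n = g p ^ multiplicity p n * g (h n)"
      using gm[of "p ^ multiplicity p n" "h n"] hpos[OF n] p prime_gt_0_nat gpow by auto
  qed simp
  also have "\<dots> = (\<Sum>(k, m)\<in>(\<lambda>n. (multiplicity p n, h n)) ` F. g p ^ k * g m)"
    by (subst sum.reindex[OF inj]) simp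
  also have "\<dots> \<le> (\<Sum>(k, m)\<in>{..K} \<times> h ` F. g p ^ k * g m)"
  proof (rule sum_mono2)
    show "(\<lambda>n. (multiplicity p n, h n)) ` F \<subseteq> {..K} \<times> h ` F"
      unfolding K_def using insert.prems(2) by (auto intro!: Max_ge)
  qed (use insert.prems(2) g0 in auto)
  also have "\<dots> = (\<Sum>k\<le>K. g p ^ k) * (\<Sum>m\<in>h ` F. g m)"
    by (simp add: sum_product sum.cartesian_product)
  also have "\<dots> \<le> (1 / (1 - g p)) * (\<Prod>p\<in>S. 1 / (1 - g p))"
  proof (rule mult_mono)
    have gp: "g p < 1" using insert.prems by auto
    show "(\<Sum>k\<le>K. g p ^ k) \<le> 1 / (1 - g p)"
      using gp g0[of p] sum_gp0[of "g p" K] by (auto simp: divide_right_mono)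
    show "(\<Sum>m\<in>h ` F. g m) \<le> (\<Prod>p\<in>S. 1 / (1 - g p))"
    proof (rule insert.IH)
      fix n assume "n \<in> h ` F"
      then obtain m where m: "m \<in> F" "n = h m" by blast
      show "n > 0 \<and> prime_factors n \<subseteq> S" using hpos[OF m(1)] hS[OF m(1)] m(2) by simp
    qed (use insert.prems in auto)
    show "0 \<le> 1 / (1 - g p)" using gp by simp
  qed (use g0 in \<open>auto intro: sum_nonneg\<close>)
  also have "\<dots> = (\<Prod>p\<in>insert p S. 1 / (1 - g p))" using insert by simp
  finally show ?case .
qed

text \<open>Turns Euler products into exponentials of sums over primes; the quadratic terms add up to a
  constant.\<close>
lemma one_over_one_minus_le_exp:
  fixes x :: real assumes "0 \<le> x" "x \<le> 1 / 2"
  shows "1 / (1 - x) \<le> exp (x + 2 * x\<^sup>2)"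
proof -
  have "- ln (1 - x) \<le> x + 2 * x\<^sup>2"
    using ln_one_minus_pos_lower_bound[of x] assms by (simp add: power2_eq_square)
  hence "exp (- ln (1 - x)) \<le> exp (x + 2 * x\<^sup>2)" by simp
  moreover have "exp (- ln (1 - x)) = 1 / (1 - x)" using assms by (simp add: exp_minus inverse_eq_divide)
  ultimately show ?thesis by simp
qed

lemma sum_inverse_squares_le: "(\<Sum>n\<in>{1..N::nat}. 1 / (real n)\<^sup>2) \<le> 2"
proof -
  have "(\<Sum>n\<in>{1..N::nat}. 1 / (real n)\<^sup>2) \<le> 2 - 1 / real (max N 1)"
  proof (induction N)
    case (Suc N)
    show ?case
    proof (cases "N = 0")
      case False
      have "1 / (real (Suc N))\<^sup>2 \<le> 1 / real N - 1 / real (Suc N)"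
      proof -
        have "1 / (real (Suc N))\<^sup>2 \<le> 1 / (real N * real (Suc N))"
          using False by (intro divide_left_mono) (auto simp: power2_eq_square)
        also have "\<dots> = 1 / real N - 1 / real (Suc N)"
          using False by (simp add: field_simps)
        finally show ?thesis .
      qed
      moreover have "max N 1 = N" "max (Suc N) 1 = Suc N" using False by auto
      ultimately show ?thesis using Suc by simp
    qed simp
  qed simp
  also have "\<dots> \<le> 2" by simp
  finally show ?thesis .
qed

lemma sum_inverse_squares_subset_le:
  assumes "finite S" "0 \<notin> S"
  shows "(\<Sum>n\<in>S. 1 / (real n)\<^sup>2) \<le> 2"
proof -
  have "(\<Sum>n\<in>S. 1 / (real n)\<^sup>2) \<le> (\<Sum>n\<in>{1..Max (insert 0 S)}. 1 / (real n)\<^sup>2)"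
    using assms by (intro sum_mono2) (auto simp: Suc_le_eq intro!: gr0I)
  thus ?thesis using sum_inverse_squares_le order_trans by blast
qed

subsection \<open>Chebyshev\<close>

lemma ln_eq_sum_mangoldt:
  assumes "n > 0" shows "ln (real n) = (\<Sum>d | d dvd n. mangoldt d)"
  using mangoldt_sum[of n, where 'a = real] assms by simp

lemma sum_divisors_swap:
  fixes F :: "nat \<Rightarrow> nat \<Rightarrow> 'a :: comm_monoid_add"
  shows "(\<Sum>n\<in>{1..N}. \<Sum>d | d dvd n. F d (n div d)) = (\<Sum>d\<in>{1..N}. \<Sum>m\<in>{1..N div d}. F d m)"
proof -
  have "(\<Sum>n\<in>{1..N}. \<Sum>d | d dvd n. F d (n div d)) =
        (\<Sum>(n,d)\<in>(SIGMA n:{1..N}. {d. d dvd n}). F d (n div d))"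
    by (subst sum.Sigma) auto
  also have "\<dots> = (\<Sum>(d,m)\<in>(SIGMA d:{1..N}. {1..N div d}). F d m)"
    by (rule sum.reindex_bij_witness[of _ "\<lambda>(d,m). (d * m, d)" "\<lambda>(n,d). (d, n div d)"])
       (auto simp: div_le_mono Suc_le_eq dvd_div_eq_0_iff div_greater_zero_iff less_eq_div_iff_mult_less_eq
          mult.commute intro: le_trans[OF dvd_imp_le] elim: dvdE intro!: Nat.gr0I)
  also have "\<dots> = (\<Sum>d\<in>{1..N}. \<Sum>m\<in>{1..N div d}. F d m)"
    by (subst sum.Sigma) auto
  finally show ?thesis .
qed

text \<open>The identity behind the estimates of Chebyshev and Mertens: the logarithm is the divisor sum of
  the von Mangoldt function, and \<open>ln (fact N)\<close> is also known from Stirling.\<close>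
lemma ln_fact_mangoldt: "ln (fact N) = (\<Sum>d\<in>{1..N}. mangoldt d * real (N div d))"
proof -
  have "ln (fact N) = (\<Sum>n\<in>{1..N}. ln (real n))"
    unfolding fact_prod of_nat_prod by (subst ln_prod) auto
  also have "\<dots> = (\<Sum>n\<in>{1..N}. \<Sum>d | d dvd n. mangoldt d)"
    by (intro sum.cong) (auto simp: ln_eq_sum_mangoldt)
  also have "\<dots> = (\<Sum>d\<in>{1..N}. \<Sum>m\<in>{1..N div d}. mangoldt d)"
    by (rule sum_divisors_swap)
  finally show ?thesis by (simp add: mult.commute)
qed

text \<open>Every prime between \<open>n\<close> and \<open>2 * n\<close>, and more generally the whole mass of the von Mangoldt
  function there, is seen by the central binomial coefficient, which is at most \<open>4 ^ n\<close>.\<close>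
lemma psi_double: "(\<Sum>d\<in>{n<..2*n}. mangoldt d) \<le> real n * ln (4::real)"
proof -
  have "(\<Sum>d\<in>{n<..2*n}. mangoldt d :: real) \<le>
        (\<Sum>d\<in>{1..2*n}. mangoldt d * (real (2*n div d) - 2 * real (n div d)))"
  proof -
    have "(\<Sum>d\<in>{n<..2*n}. mangoldt d :: real) = (\<Sum>d\<in>{n<..2*n}. mangoldt d * (real (2*n div d) - 2 * real (n div d)))"
    proof (intro sum.cong refl)
      fix d assume d: "d \<in> {n<..2*n}"
      hence "n div d = 0" by simp
      moreover have "2 * n div d = 1" using d by (intro div_nat_eqI) auto
      ultimately show "mangoldt d = (mangoldt d :: real) * (real (2*n div d) - 2 * real (n div d))" by simp
    qed
    also have "\<dots> \<le> (\<Sum>d\<in>{1..2*n}. mangoldt d * (real (2*n div d) - 2 * real (n div d)))"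
    proof (intro sum_mono2)
      fix d assume "d \<in> {1..2*n} - {n<..2*n}"
      have "2 * (n div d) \<le> 2 * n div d"
        by (metis mult.commute div_mult1_eq le_add1 mult_2 div_le_mono times_div_less_eq_dividend
             less_eq_div_iff_mult_less_eq mult.assoc mult_le_mono2 not_gr_zero div_by_0 le0 mult_0_right)
      hence "2 * real (n div d) \<le> real (2 * n div d)" by (metis of_nat_le_iff of_nat_mult of_nat_numeral)
      thus "0 \<le> (mangoldt d :: real) * (real (2*n div d) - 2 * real (n div d))"
        by (simp add: mangoldt_nonneg)
    qed auto
    finally show ?thesis .
  qed
  also have "\<dots> = ln (fact (2*n)) - 2 * ln (fact n)"
  proof -
    have "(\<Sum>d\<in>{1..2*n}. mangoldt d * real (n div d)) = (\<Sum>d\<in>{1..n}. mangoldt d * real (n div d))"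
      by (intro sum.mono_neutral_right) auto
    thus ?thesis unfolding ln_fact_mangoldt
      by (simp add: right_diff_distrib sum_subtractf mult.left_commute[of _ 2] flip: sum_distrib_left)
  qed
  also have "\<dots> = ln (real ((2*n) choose n))"
  proof -
    have "real ((2*n) choose n) = fact (2*n) / (fact n * fact n)"
      by (subst binomial_fact) auto
    thus ?thesis by (simp add: ln_div ln_mult)
  qed
  also have "\<dots> \<le> ln (real (4 ^ n))"
  proof -
    have "(2*n) choose n \<le> 2 ^ (2*n)"
      using binomial_le_pow2 by blast
    hence "(2*n) choose n \<le> 4 ^ n" by (simp add: power_mult)
    moreover have "(2*n) choose n > 0" by simp
    ultimately show ?thesis by (metis ln_mono of_nat_0_less_iff of_nat_le_iff)
  qed
  also have "\<dots> = real n * ln 4" by (simp add: ln_realpow)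
  finally show ?thesis .
qed

lemma ln4_le: "ln (4::real) \<le> 2"
proof -
  have "ln (4::real) = 2 * ln 2" using ln_realpow[of 2 2] by simp
  thus ?thesis using ln_2_less_1 by simp
qed

lemma chebyshev_psi_le: "(\<Sum>d\<in>{1..N}. mangoldt d) \<le> 4 * real N"
proof (induction N rule: less_induct)
  case (less N)
  show ?case
  proof (cases "N \<le> 1")
    case True thus ?thesis by (cases N) auto
  next
    case False
    define n where "n = (N + 1) div 2"
    have n: "n < N" "N \<le> 2 * n" "2 * n \<le> N + 1" using False unfolding n_def by auto
    have "(\<Sum>d\<in>{1..N}. mangoldt d :: real) \<le> (\<Sum>d\<in>{1..2*n}. mangoldt d)"
      using n by (intro sum_mono2) (auto simp: mangoldt_nonneg)
    also have "{1..2*n} = {1..n} \<union> {n<..2*n}" by auto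
    also have "(\<Sum>d\<in>{1..n} \<union> {n<..2*n}. mangoldt d :: real) = (\<Sum>d\<in>{1..n}. mangoldt d) + (\<Sum>d\<in>{n<..2*n}. mangoldt d)"
      by (intro sum.union_disjoint) auto
    also have "\<dots> \<le> 4 * real n + real n * ln 4" using less[OF n(1)] psi_double[of n] by simp
    also have "\<dots> \<le> 4 * real n + real n * (2)" using ln4_le by (intro add_left_mono mult_left_mono) auto
    also have "\<dots> \<le> 4 * real N"
    proof (cases "N = 2")
      case True
      hence "n = 1" unfolding n_def by simp
      thus ?thesis using True by simp
    next
      case False2: False
      have "real (2 * n) \<le> real (N + 1)" using n(3) of_nat_le_iff by blast
      moreover have "N \<ge> 3" using False False2 by auto
      ultimately show ?thesis by simp
    qed
    finally show ?thesis .
  qed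
qed

subsection \<open>Mertens\<close>

lemma mertens_mangoldt_upper:
  assumes "N \<ge> 1" shows "(\<Sum>d\<in>{1..N}. mangoldt d / real d) \<le> ln (real N) + 4"
proof -
  have "real N * (\<Sum>d\<in>{1..N}. mangoldt d / real d) = (\<Sum>d\<in>{1..N}. mangoldt d * (real N / real d))"
    by (simp add: sum_distrib_left mult_ac)
  also have "\<dots> \<le> (\<Sum>d\<in>{1..N}. mangoldt d * (real (N div d) + 1))"
  proof (intro sum_mono mult_left_mono)
    fix d assume "d \<in> {1..N}"
    show "real N / real d \<le> real (N div d) + 1"
      using floor_divide_of_nat_eq[of N d, where 'a = real] by linarith
  qed (auto simp: mangoldt_nonneg)
  also have "\<dots> = ln (fact N) + (\<Sum>d\<in>{1..N}. mangoldt d)"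
    by (simp add: ln_fact_mangoldt distrib_left sum.distrib)
  also have "\<dots> \<le> real N * ln (real N) + 4 * real N"
  proof -
    have "(fact N :: real) \<le> real N ^ N" using fact_le_power[of N, where 'a = real] by simp
    hence "ln (fact N :: real) \<le> ln (real N ^ N)" using assms by (subst ln_le_cancel_iff) auto
    thus ?thesis using chebyshev_psi_le[of N] assms by (simp add: ln_realpow)
  qed
  finally have "real N * (\<Sum>d\<in>{1..N}. mangoldt d / real d) \<le> real N * (ln (real N) + 4)"
    by (simp add: algebra_simps)
  thus ?thesis using assms by simp
qed

lemma mertens_mangoldt_lower:
  assumes "N \<ge> 1" shows "(\<Sum>d\<in>{1..N}. mangoldt d / real d) \<ge> ln (real N) - 1"
proof -
  have "real N * (ln (real N) - 1) \<le> ln (fact N)"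
  proof -
    have "real N ^ N / fact N \<le> exp (real N)"
    proof -
      have "(\<Sum>n\<in>{N}. inverse (fact n) * real N ^ n) \<le> (\<Sum>n. inverse (fact n) * real N ^ n)"
        by (intro sum_le_suminf summable_exp) auto
      thus ?thesis by (simp add: exp_def field_simps)
    qed
    hence "real N ^ N \<le> exp (real N) * fact N" by (simp add: field_simps)
    hence "ln (real N ^ N) \<le> ln (exp (real N) * fact N)" using assms by (subst ln_le_cancel_iff) auto
    thus ?thesis using assms by (simp add: ln_realpow ln_mult algebra_simps)
  qed
  also have "\<dots> \<le> (\<Sum>d\<in>{1..N}. mangoldt d * (real N / real d))"
    unfolding ln_fact_mangoldt
  proof (intro sum_mono mult_left_mono)
    fix d assume "d \<in> {1..N}"
    show "real (N div d) \<le> real N / real d"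
      using floor_divide_of_nat_eq[of N d, where 'a = real] by linarith
  qed (auto simp: mangoldt_nonneg)
  also have "\<dots> = real N * (\<Sum>d\<in>{1..N}. mangoldt d / real d)"
    by (simp add: sum_distrib_left mult_ac)
  finally show ?thesis using assms by simp
qed

definition prime_recip_sum :: "nat \<Rightarrow> real" where
  "prime_recip_sum N = (\<Sum>p | prime p \<and> p \<le> N. 1 / real p)"

lemma finite_primes_le [simp, intro]: "finite {p::nat. prime p \<and> p \<le> N}"
  by (rule finite_subset[of _ "{..N}"]) auto

lemma sum_ln_prime_le:
  assumes "N \<ge> 1" shows "(\<Sum>p | prime p \<and> p \<le> N. ln (real p) / real p) \<le> ln (real N) + 4"
proof -
  have "(\<Sum>p | prime p \<and> p \<le> N. ln (real p) / real p) = (\<Sum>p | prime p \<and> p \<le> N. mangoldt p / real p)"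
    by (intro sum.cong) auto
  also have "\<dots> \<le> (\<Sum>d\<in>{1..N}. mangoldt d / real d)"
    by (intro sum_mono2) (auto simp: mangoldt_nonneg Suc_le_eq prime_gt_0_nat)
  finally show ?thesis using mertens_mangoldt_upper[OF assms] by simp
qed

text \<open>Partial summation from the bound for the sum of \<open>ln p / p\<close>, with the comparison of sums and
  integrals of \<open>1 / (x * ln x)\<close> built into an induction on the upper limit.\<close>
lemma prime_recip_sum_upper:
  assumes "N \<ge> 2" shows "prime_recip_sum N \<le> ln (ln (real N)) + 9"
proof -
  define a where "a n = (if prime n then ln (real n) / real n else 0)" for n :: nat
  define A where "A n = (\<Sum>k\<in>{2..n}. a k)" for n
  have A: "A n \<le> ln (real n) + 4" if "n \<ge> 1" for n
  proof -
    have "A n = (\<Sum>p | prime p \<and> p \<le> n. ln (real p) / real p)"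
      unfolding A_def a_def by (subst sum.inter_filter[symmetric])
        (auto intro!: sum.cong dest: prime_ge_2_nat)
    thus ?thesis using sum_ln_prime_le[OF that] by simp
  qed
  have eq: "(\<Sum>k\<in>{2..n}. a k / ln (real k)) \<le>
     A n / ln (real n) + ln (ln (real n)) - ln (ln 2) + 4 * (1 / ln 2 - 1 / ln (real n))" if "n \<ge> 2" for n
    using that
  proof (induction n rule: dec_induct)
    case base show ?case by (simp add: A_def)
  next
    case (step n)
    have l: "0 < ln (real n)" "ln (real n) < ln (real (Suc n))" using step by auto
    have d: "1 / ln (real n) - 1 / ln (real (Suc n)) \<ge> 0" using l by (simp add: frac_le)
    have "(\<Sum>k\<in>{2..Suc n}. a k / ln (real k)) = (\<Sum>k\<in>{2..n}. a k / ln (real k)) + a (Suc n) / ln (real (Suc n))"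
      using step by simp
    also have "a (Suc n) = A (Suc n) - A n" unfolding A_def using step by simp
    finally have 1: "(\<Sum>k\<in>{2..Suc n}. a k / ln (real k)) \<le> A n / ln (real n) + ln (ln (real n)) - ln (ln 2) + 4 * (1 / ln 2 - 1 / ln (real n))
       + (A (Suc n) - A n) / ln (real (Suc n))" using step by simp
    have "A n * (1 / ln (real n) - 1 / ln (real (Suc n))) \<le> (ln (real n) + 4) * (1 / ln (real n) - 1 / ln (real (Suc n)))"
      using A[of n] d step by (intro mult_right_mono) auto
    also have "\<dots> = (1 - ln (real n) / ln (real (Suc n))) + 4 * (1 / ln (real n) - 1 / ln (real (Suc n)))"
      using l by (simp add: right_diff_distrib distrib_right add_divide_distrib)
    also have "1 - ln (real n) / ln (real (Suc n)) \<le> ln (ln (real (Suc n))) - ln (ln (real n))"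
    proof -
      have "ln (ln (real n) / ln (real (Suc n))) \<le> ln (real n) / ln (real (Suc n)) - 1"
        using l by (intro ln_le_minus_one divide_pos_pos) linarith+
      moreover have "ln (ln (real n) / ln (real (Suc n))) = ln (ln (real n)) - ln (ln (real (Suc n)))"
        using l by (subst ln_div) (use l in auto)
      ultimately show ?thesis by simp
    qed
    finally show ?case using 1 by (simp add: algebra_simps diff_divide_distrib)
  qed
  have l2: "ln (2::real) \<ge> 2/3" using ln2_ge_two_thirds by simp
  have lN: "ln (real N) \<ge> ln 2" using assms by simp
  have "prime_recip_sum N = (\<Sum>k\<in>{2..N}. a k / ln (real k))"
    unfolding prime_recip_sum_def a_def
    by (rule sum.mono_neutral_cong_left) (auto dest: prime_ge_2_nat)
  also have "\<dots> \<le> A N / ln (real N) + ln (ln (real N)) - ln (ln 2) + 4 * (1 / ln 2 - 1 / ln (real N))"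
    by (rule eq[OF assms])
  also have "A N / ln (real N) \<le> (ln (real N) + 4) / ln (real N)"
    using A[of N] assms lN l2 by (intro divide_right_mono) auto
  also have "\<dots> = 1 + 4 / ln (real N)" using lN l2 by (simp add: field_simps)
  also have "- ln (ln 2) \<le> 1/(2::real)"
  proof -
    have "ln (inverse (ln 2)) \<le> inverse (ln 2) - (1::real)" using l2 by (intro ln_le_minus_one) auto
    moreover have "inverse (ln 2) \<le> (3/2::real)" using l2 by (simp add: field_simps)
    ultimately show ?thesis using l2 by (simp add: ln_inverse)
  qed
  hence "1 + 4 / ln (real N) + ln (ln (real N)) - ln (ln 2) + 4 * (1 / ln 2 - 1 / ln (real N)) \<le>
     ln (ln (real N)) + 3/2 + 4 / ln 2" by (simp add: algebra_simps)
  also have "4 / ln 2 \<le> (6::real)" using l2 by (simp add: field_simps)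
  finally show ?thesis by (simp add: algebra_simps)
qed

lemma prime_recip_sum_nonneg: "prime_recip_sum n \<ge> 0"
  unfolding prime_recip_sum_def by (rule sum_nonneg) auto

lemma prime_recip_sum_lower:
  assumes "N \<ge> 2" shows "prime_recip_sum N \<ge> ln (ln (real N)) - 4"
proof -
  let ?S = "{p. prime p \<and> p \<le> N}"
  have "ln (real N) \<le> ln (real N + 1)" using assms by simp
  also have "\<dots> \<le> (\<Sum>n\<in>{1..N}. 1 / real n)"
  proof (induction N)
    case (Suc N)
    have "ln (real N + 2) - ln (real N + 1) \<le> 1 / (real N + 1)"
    proof -
      have "ln (real N + 2) - ln (real N + 1) = ln (1 + 1 / (real N + 1))"
        using ln_div[of "real N + 2" "real N + 1"] by (simp add: field_simps)
      also have "\<dots> \<le> 1 / (real N + 1)" by (intro ln_add_one_self_le_self) auto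
      finally show ?thesis .
    qed
    thus ?case using Suc by (simp add: algebra_simps)
  qed simp
  also have "\<dots> \<le> (\<Prod>p\<in>?S. 1 / (1 - 1 / real p))"
  proof (rule sum_multiplicative_le_euler_product)
    fix n assume "n \<in> {1..N}"
    thus "n > 0 \<and> prime_factors n \<subseteq> ?S"
      by (auto intro: le_trans[OF dvd_imp_le] in_prime_factors_imp_prime dest: in_prime_factors_imp_dvd)
  next
    fix p assume "p \<in> ?S"
    thus "1 / real p < 1" using prime_ge_2_nat[of p] by simp
  qed auto
  also have "\<dots> \<le> (\<Prod>p\<in>?S. exp (1 / real p + 2 * (1 / (real p)\<^sup>2)))"
  proof (intro prod_mono conjI)
    fix p assume "p \<in> ?S"
    hence p: "p \<ge> 2" using prime_ge_2_nat by auto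
    show "0 \<le> 1 / (1 - 1 / real p)" using p by simp
    show "1 / (1 - 1 / real p) \<le> exp (1 / real p + 2 * (1 / (real p)\<^sup>2))"
      using one_over_one_minus_le_exp[of "1 / real p"] p by (simp add: power_divide)
  qed
  also have "\<dots> = exp (prime_recip_sum N + 2 * (\<Sum>p\<in>?S. 1 / (real p)\<^sup>2))"
    unfolding prime_recip_sum_def by (subst exp_sum[symmetric]) (auto simp: sum.distrib sum_distrib_left)
  also have "\<dots> \<le> exp (prime_recip_sum N + 4)"
    using sum_inverse_squares_subset_le[of ?S] by auto
  finally have "ln (real N) \<le> exp (prime_recip_sum N + 4)" .
  hence "ln (ln (real N)) \<le> ln (exp (prime_recip_sum N + 4))"
    using assms by (subst ln_le_cancel_iff) auto
  thus ?thesis by simp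
qed

section \<open>An upper bound sieve of Brun and Hooley\<close>

text \<open>The generating polynomial of the elementary symmetric functions of the weights, cut off at degree
  \<open>b\<close>. With negated indicator weights it is the sum of inclusion--exclusion truncated after \<open>b\<close> steps.\<close>
definition esym_trunc :: "nat \<Rightarrow> nat set \<Rightarrow> (nat \<Rightarrow> real) \<Rightarrow> real" where
  "esym_trunc b S w = (\<Sum>D | D \<subseteq> S \<and> card D \<le> b. \<Prod>p\<in>D. w p)"

lemma esym_trunc_0: "finite S \<Longrightarrow> esym_trunc 0 S w = 1"
proof -
  assume "finite S"
  hence "{D. D \<subseteq> S \<and> card D \<le> 0} = {{}}" by (auto dest: finite_subset)
  thus ?thesis by (simp add: esym_trunc_def)
qed

lemma esym_trunc_empty: "esym_trunc b {} w = 1"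
proof -
  have "{D. D \<subseteq> {} \<and> card D \<le> b} = {{}::nat set}" by auto
  thus ?thesis by (simp add: esym_trunc_def)
qed

lemma esym_trunc_insert:
  assumes "finite S" "p \<notin> S"
  shows "esym_trunc (Suc b) (insert p S) w = esym_trunc (Suc b) S w + w p * esym_trunc b S w"
proof -
  let ?A = "{D. D \<subseteq> S \<and> card D \<le> Suc b}" and ?B = "{D. D \<subseteq> S \<and> card D \<le> b}"
  have fin: "finite ?A" "finite ?B" using assms by auto
  have eq: "{D. D \<subseteq> insert p S \<and> card D \<le> Suc b} = ?A \<union> insert p ` ?B"
  proof (intro equalityI subsetI)
    fix D assume D: "D \<in> {D. D \<subseteq> insert p S \<and> card D \<le> Suc b}"
    show "D \<in> ?A \<union> insert p ` ?B"
    proof (cases "p \<in> D")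
      case True
      have fD: "finite D" using D assms finite_subset by auto
      have "D = insert p (D - {p})" "D - {p} \<subseteq> S" "card (D - {p}) \<le> b"
        using D True fD by auto
      thus ?thesis by blast
    qed (use D in auto)
  next
    fix D assume "D \<in> ?A \<union> insert p ` ?B"
    thus "D \<in> {D. D \<subseteq> insert p S \<and> card D \<le> Suc b}"
      using assms by (auto simp: card_insert_if finite_subset)
  qed
  have "esym_trunc (Suc b) (insert p S) w = (\<Sum>D\<in>?A. \<Prod>p\<in>D. w p) + (\<Sum>D\<in>insert p ` ?B. \<Prod>p\<in>D. w p)"
    unfolding esym_trunc_def eq using fin assms by (intro sum.union_disjoint) auto
  also have "(\<Sum>D\<in>insert p ` ?B. \<Prod>p\<in>D. w p) = (\<Sum>D\<in>?B. \<Prod>p\<in>insert p D. w p)"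
    using assms by (subst sum.reindex) (auto simp: inj_on_def insert_ident)
  also have "\<dots> = (\<Sum>D\<in>?B. w p * (\<Prod>p\<in>D. w p))"
  proof (intro sum.cong refl)
    fix D assume "D \<in> ?B"
    hence "finite D" "p \<notin> D" using assms finite_subset by auto
    thus "(\<Prod>p\<in>insert p D. w p) = w p * (\<Prod>p\<in>D. w p)" by simp
  qed
  finally show ?thesis by (simp add: esym_trunc_def sum_distrib_left)
qed

text \<open>The Bonferroni inequalities, for arbitrary weights in the unit interval. Adding one element to
  \<open>S\<close> combines the cases \<open>b\<close> and \<open>b + 1\<close>, whose errors have opposite signs.\<close>
lemma esym_trunc_alternating:
  assumes "finite S" "\<And>p. p \<in> S \<Longrightarrow> 0 \<le> w p \<and> w p \<le> 1"
  shows "0 \<le> (-1) ^ b * (esym_trunc b S (\<lambda>p. - w p) - (\<Prod>p\<in>S. 1 - w p))"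
  using assms
proof (induction S arbitrary: b rule: finite_induct)
  case empty thus ?case by (simp add: esym_trunc_empty)
next
  case (insert p S)
  show ?case
  proof (cases b)
    case 0
    have "(\<Prod>p\<in>insert p S. 1 - w p) \<le> 1" using insert.prems by (intro prod_le_1) auto
    thus ?thesis using 0 insert by (simp add: esym_trunc_0)
  next
    case (Suc c)
    let ?P = "\<Prod>p\<in>S. 1 - w p"
    have "(-1) ^ b * (esym_trunc b (insert p S) (\<lambda>p. - w p) - (\<Prod>p\<in>insert p S. 1 - w p)) =
       (-1) ^ Suc c * (esym_trunc (Suc c) S (\<lambda>p. - w p) - ?P) + w p * ((-1) ^ c * (esym_trunc c S (\<lambda>p. - w p) - ?P))"
      using insert.hyps unfolding Suc by (subst esym_trunc_insert) (auto simp: algebra_simps)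
    thus ?thesis using insert.IH[of "Suc c"] insert.IH[of c] insert.prems
      by (metis add_nonneg_nonneg insertI1 insertI2 mult_nonneg_nonneg)
  qed
qed

lemma esym_trunc_nonneg:
  assumes "\<And>p. p \<in> S \<Longrightarrow> 0 \<le> w p" shows "0 \<le> esym_trunc b S w"
  unfolding esym_trunc_def using assms by (intro sum_nonneg prod_nonneg) auto

lemma esym_trunc_le_power:
  assumes "finite S" "\<And>p. p \<in> S \<Longrightarrow> 0 \<le> w p"
  shows "esym_trunc b S w \<le> (1 + (\<Sum>p\<in>S. w p)) ^ b"
  using assms
proof (induction S arbitrary: b rule: finite_induct)
  case empty thus ?case by (simp add: esym_trunc_empty)
next
  case (insert p S)
  show ?case
  proof (cases b)
    case 0 thus ?thesis using insert by (simp add: esym_trunc_0)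
  next
    case (Suc c)
    let ?s = "1 + (\<Sum>p\<in>S. w p)"
    have s: "?s \<ge> 1" using insert.prems by (simp add: sum_nonneg)
    have wp: "w p \<ge> 0" using insert.prems by simp
    have "esym_trunc b (insert p S) w = esym_trunc (Suc c) S w + w p * esym_trunc c S w"
      unfolding Suc using insert.hyps by (subst esym_trunc_insert) auto
    also have "\<dots> \<le> ?s ^ Suc c + w p * ?s ^ c"
      using insert.IH[of "Suc c"] insert.IH[of c] insert.prems by (intro add_mono mult_left_mono) auto
    also have "\<dots> = ?s ^ c * (?s + w p)" by (simp add: algebra_simps)
    also have "\<dots> \<le> (?s + w p) ^ c * (?s + w p)"
      using s wp by (intro mult_right_mono power_mono) auto
    also have "\<dots> = (1 + (\<Sum>p\<in>insert p S. w p)) ^ b"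
      using insert.hyps unfolding Suc by (simp add: algebra_simps)
    finally show ?thesis .
  qed
qed

text \<open>The difference is the elementary symmetric function of degree \<open>b + 1\<close>, which is at most a power
  of the sum divided by a factorial because each product occurs \<open>fact (b + 1)\<close> times in the power.\<close>
lemma esym_trunc_diff_le:
  assumes "finite S" "\<And>p. p \<in> S \<Longrightarrow> 0 \<le> w p"
  shows "\<bar>esym_trunc (Suc b) S (\<lambda>p. - w p) - esym_trunc b S (\<lambda>p. - w p)\<bar>
           \<le> (\<Sum>p\<in>S. w p) ^ Suc b / fact (Suc b)"
  using assms
proof (induction S arbitrary: b rule: finite_induct)
  case empty thus ?case by (simp add: esym_trunc_empty)
next
  case (insert p S)
  let ?s = "\<Sum>p\<in>S. w p"
  let ?E = "\<lambda>b. esym_trunc b S (\<lambda>p. - w p)"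
  have s: "?s \<ge> 0" using insert.prems by (simp add: sum_nonneg)
  have wp: "w p \<ge> 0" using insert.prems by simp
  have IH: "\<bar>?E (Suc b) - ?E b\<bar> \<le> ?s ^ Suc b / fact (Suc b)" for b using insert.IH insert.prems by auto
  show ?case
  proof (cases b)
    case 0
    have "esym_trunc (Suc b) (insert p S) (\<lambda>p. - w p) - esym_trunc b (insert p S) (\<lambda>p. - w p) = (?E 1 - ?E 0) - w p"
      using insert.hyps 0 by (simp add: esym_trunc_insert esym_trunc_0)
    moreover have "\<bar>?E 1 - ?E 0\<bar> \<le> ?s" using IH[of 0] by simp
    ultimately have "\<bar>esym_trunc (Suc b) (insert p S) (\<lambda>p. - w p) - esym_trunc b (insert p S) (\<lambda>p. - w p)\<bar> \<le> ?s + w p"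
      using wp by linarith
    thus ?thesis using insert.hyps 0 by simp
  next
    case (Suc c)
    have "esym_trunc (Suc b) (insert p S) (\<lambda>p. - w p) - esym_trunc b (insert p S) (\<lambda>p. - w p) =
       (?E (Suc b) - ?E b) - w p * (?E (Suc c) - ?E c)"
      using insert.hyps unfolding Suc by (simp add: esym_trunc_insert algebra_simps)
    also have "\<bar>\<dots>\<bar> \<le> \<bar>?E (Suc b) - ?E b\<bar> + w p * \<bar>?E (Suc c) - ?E c\<bar>"
      using wp abs_triangle_ineq4[of "?E (Suc b) - ?E b" "w p * (?E (Suc c) - ?E c)"] by (simp add: abs_mult)
    also have "\<dots> \<le> ?s ^ Suc b / fact (Suc b) + w p * (?s ^ Suc c / fact (Suc c))"
      using IH wp by (intro add_mono mult_left_mono) auto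
    also have "\<dots> = (?s ^ Suc b + real (Suc b) * w p * ?s ^ b) / fact (Suc b)"
    proof -
      have "real (Suc b) * (w p * ?s ^ b) / (real (Suc b) * fact b) = w p * ?s ^ b / fact b"
        by (rule mult_divide_mult_cancel_left) simp
      thus ?thesis unfolding Suc[symmetric]
        by (simp add: add_divide_distrib mult.assoc del: of_nat_Suc)
    qed
    also have "\<dots> \<le> (?s + w p) ^ Suc b / fact (Suc b)"
    proof (intro divide_right_mono)
      have "?s ^ n + real n * w p * ?s ^ (n - 1) \<le> (?s + w p) ^ n" for n
      proof (induction n)
        case (Suc n)
        have "?s ^ Suc n + real (Suc n) * w p * ?s ^ n = ?s * (?s ^ n + real n * w p * ?s ^ (n - 1)) + w p * ?s ^ n"
          by (cases n) (auto simp: algebra_simps)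
        also have "\<dots> \<le> ?s * (?s + w p) ^ n + w p * (?s + w p) ^ n"
          using Suc s wp by (intro add_mono mult_left_mono power_mono) auto
        finally show ?case by (simp add: algebra_simps)
      qed simp
      from this[of "Suc b"] show "?s ^ Suc b + real (Suc b) * w p * ?s ^ b \<le> (?s + w p) ^ Suc b" by simp
    qed simp
    finally show ?thesis using insert.hyps by (simp add: add.commute)
  qed
qed

lemma esym_trunc_even_bounds:
  assumes S: "finite S" and w: "\<And>p. p \<in> S \<Longrightarrow> 0 \<le> w p \<and> w p \<le> 1" and b: "even b"
  shows "(\<Prod>p\<in>S. 1 - w p) \<le> esym_trunc b S (\<lambda>p. - w p)"
    and "esym_trunc b S (\<lambda>p. - w p) \<le> exp (- (\<Sum>p\<in>S. w p)) + (\<Sum>p\<in>S. w p) ^ Suc b / fact (Suc b)"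
proof -
  show "(\<Prod>p\<in>S. 1 - w p) \<le> esym_trunc b S (\<lambda>p. - w p)"
    using esym_trunc_alternating[OF S w, where b = b] b by simp
  have "esym_trunc (Suc b) S (\<lambda>p. - w p) \<le> (\<Prod>p\<in>S. 1 - w p)"
    using esym_trunc_alternating[OF S w, where b = "Suc b"] b by simp
  also have "\<dots> \<le> (\<Prod>p\<in>S. exp (- w p))"
  proof (intro prod_mono conjI)
    fix p assume "p \<in> S"
    thus "0 \<le> 1 - w p" using w by simp
    show "1 - w p \<le> exp (- w p)" using exp_ge_add_one_self[of "- w p"] by simp
  qed
  also have "\<dots> = exp (- (\<Sum>p\<in>S. w p))" using S by (simp add: exp_sum flip: sum_negf)
  finally show "esym_trunc b S (\<lambda>p. - w p) \<le> exp (- (\<Sum>p\<in>S. w p)) + (\<Sum>p\<in>S. w p) ^ Suc b / fact (Suc b)"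
    using esym_trunc_diff_le[OF S, where w = w and b = b] w by force
qed

text \<open>The combinatorial heart of Hooley's form of Brun's sieve: a product of truncations, one for each
  block of primes, is again a sum over sets, namely over those meeting each block in a bounded
  number of elements.\<close>
lemma prod_esym_trunc_blocks:
  fixes P :: "nat \<Rightarrow> nat set"
  assumes "\<And>i. i < t \<Longrightarrow> finite (P i)" "\<And>i j. i < t \<Longrightarrow> j < t \<Longrightarrow> i \<noteq> j \<Longrightarrow> P i \<inter> P j = {}"
  shows "(\<Prod>i<t. esym_trunc (b i) (P i) w) =
         (\<Sum>D | D \<subseteq> (\<Union>i<t. P i) \<and> (\<forall>i<t. card (D \<inter> P i) \<le> b i). \<Prod>p\<in>D. w p)"
  using assms
proof (induction t)
  case 0
  have "{D. D \<subseteq> (\<Union>i<0. P i) \<and> (\<forall>i<0. card (D \<inter> P i) \<le> b i)} = {{}}" by auto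
  thus ?case by simp
next
  case (Suc t)
  let ?A = "{D. D \<subseteq> (\<Union>i<t. P i) \<and> (\<forall>i<t. card (D \<inter> P i) \<le> b i)}"
  let ?B = "{D. D \<subseteq> P t \<and> card D \<le> b t}"
  have fin: "finite (\<Union>i<t. P i)" "finite (P t)" using Suc.prems by auto
  have disj: "(\<Union>i<t. P i) \<inter> P t = {}"
    using Suc.prems(2)[of _ t] by (fastforce simp: less_Suc_eq)
  have "(\<Prod>i<Suc t. esym_trunc (b i) (P i) w) = (\<Sum>D\<in>?A. \<Prod>p\<in>D. w p) * (\<Sum>E\<in>?B. \<Prod>p\<in>E. w p)"
    using Suc.IH Suc.prems by (simp add: esym_trunc_def)
  also have "\<dots> = (\<Sum>(D,E)\<in>?A \<times> ?B. (\<Prod>p\<in>D. w p) * (\<Prod>p\<in>E. w p))"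
    by (simp add: sum_product sum.cartesian_product)
  also have "\<dots> = (\<Sum>(D,E)\<in>?A \<times> ?B. \<Prod>p\<in>D \<union> E. w p)"
  proof (intro sum.cong refl, clarify)
    fix D E assume DE: "D \<subseteq> (\<Union>i<t. P i)" "E \<subseteq> P t"
    have "finite D" "finite E" "D \<inter> E = {}" using DE fin disj finite_subset by blast+
    thus "(\<Prod>p\<in>D. w p) * (\<Prod>p\<in>E. w p) = (\<Prod>p\<in>D \<union> E. w p)" by (simp add: prod.union_disjoint)
  qed
  also have "\<dots> = (\<Sum>D | D \<subseteq> (\<Union>i<Suc t. P i) \<and> (\<forall>i<Suc t. card (D \<inter> P i) \<le> b i). \<Prod>p\<in>D. w p)"
  proof (rule sum.reindex_bij_witness[of _ "\<lambda>D. (D \<inter> (\<Union>i<t. P i), D \<inter> P t)" "\<lambda>(D,E). D \<union> E"])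
    fix DE assume DE: "DE \<in> ?A \<times> ?B"
    obtain D E where [simp]: "DE = (D, E)" by fastforce
    have D: "D \<subseteq> (\<Union>i<t. P i)" "\<forall>i<t. card (D \<inter> P i) \<le> b i" and E: "E \<subseteq> P t" "card E \<le> b t" using DE by auto
    have 1: "(D \<union> E) \<inter> P t = E" using D E disj by blast
    have 2: "(D \<union> E) \<inter> P i = D \<inter> P i" if "i < t" for i using D E disj that by blast
    have 3: "(D \<union> E) \<inter> (\<Union>i<t. P i) = D" using D E disj by blast
    show "(case (case DE of (D, E) \<Rightarrow> D \<union> E) of D \<Rightarrow> (D \<inter> (\<Union>i<t. P i), D \<inter> P t)) = DE" using 1 3 by simp
    show "(case DE of (D, E) \<Rightarrow> D \<union> E) \<in> {D. D \<subseteq> (\<Union>i<Suc t. P i) \<and> (\<forall>i<Suc t. card (D \<inter> P i) \<le> b i)}"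
      using D(2) E 1 2 by (auto simp: less_Suc_eq dest!: subsetD[OF D(1)] subsetD[OF E(1)])
    show "(\<Prod>p\<in>(case DE of (D, E) \<Rightarrow> D \<union> E). w p) = (case DE of (D, E) \<Rightarrow> \<Prod>p\<in>D \<union> E. w p)" by simp
  next
    fix D assume D: "D \<in> {D. D \<subseteq> (\<Union>i<Suc t. P i) \<and> (\<forall>i<Suc t. card (D \<inter> P i) \<le> b i)}"
    show "(case (D \<inter> (\<Union>i<t. P i), D \<inter> P t) of (D, E) \<Rightarrow> D \<union> E) = D"
    proof -
      have "D \<subseteq> (\<Union>i<t. P i) \<union> P t" using D by (auto simp: less_Suc_eq dest!: subsetD)
      thus ?thesis by auto
    qed
    have "D \<inter> (\<Union>i<t. P i) \<inter> P i = D \<inter> P i" if "i < t" for i using that by blast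
    thus "(D \<inter> (\<Union>i<t. P i), D \<inter> P t) \<in> ?A \<times> ?B" using D by (auto simp: less_Suc_eq)
  qed
  finally show ?case .
qed

lemma card_residue_class_bound:
  fixes q a N :: nat assumes "q > 0"
  shows "\<bar>real (card {j\<in>{1..N}. [j = a] (mod q)}) - real N / real q\<bar> \<le> 1"
proof -
  define r where "r = a mod q"
  have r: "r < q" unfolding r_def using assms by simp
  have eq: "{j\<in>{1..N}. [j = a] (mod q)} = {j\<in>{1..N}. j mod q = r}" by (auto simp: Cong.cong_def r_def)
  have fl: "real (M div q) \<le> real M / real q" "real M / real q < real (M div q) + 1" for M
    using floor_divide_of_nat_eq[of M q, where 'a = real] by linarith+
  consider "r = 0" | "r > 0" "N < r" | "r > 0" "r \<le> N" by linarith
  thus ?thesis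
  proof cases
    case 1
    have "{j\<in>{1..N}. j mod q = r} = (\<lambda>k. k * q) ` {1..N div q}"
    proof (intro equalityI subsetI)
      fix j assume "j \<in> {j\<in>{1..N}. j mod q = r}"
      hence j: "1 \<le> j" "j \<le> N" "q dvd j" using 1 by auto
      hence "j = (j div q) * q" "j div q \<in> {1..N div q}" using assms dvd_imp_le[of q j]
        by (auto simp: div_le_mono Suc_le_eq div_greater_zero_iff)
      thus "j \<in> (\<lambda>k. k * q) ` {1..N div q}" by blast
    qed (use 1 assms in \<open>auto simp: less_eq_div_iff_mult_less_eq Suc_le_eq\<close>)
    moreover have "inj_on (\<lambda>k. k * q) {1..N div q}" using assms by (auto simp: inj_on_def)
    ultimately have "card {j\<in>{1..N}. j mod q = r} = N div q" by (simp add: card_image)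
    thus ?thesis using fl[of N] eq by simp
  next
    case 2
    have e: "{j\<in>{1..N}. j mod q = r} = {}" using 2 r by (auto)
    have "real N / real q \<le> 1" using 2 r by simp
    have c0: "card {j\<in>{1..N}. [j = a] (mod q)} = 0" by (simp only: eq e card.empty)
    show ?thesis unfolding c0 using \<open>real N / real q \<le> 1\<close> by simp
  next
    case 3
    have "{j\<in>{1..N}. j mod q = r} = (\<lambda>k. k * q + r) ` {0..(N - r) div q}"
    proof (intro equalityI subsetI)
      fix j assume j: "j \<in> {j\<in>{1..N}. j mod q = r}"
      have "j = (j div q) * q + r" using j by (metis (mono_tags, lifting) div_mult_mod_eq mem_Collect_eq)
      moreover from this have "(j div q) * q \<le> N - r"
        using j by (metis (mono_tags, lifting) add_le_imp_le_diff atLeastAtMost_iff mem_Collect_eq)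
      hence "j div q \<le> (N - r) div q" using assms by (simp add: less_eq_div_iff_mult_less_eq)
      ultimately show "j \<in> (\<lambda>k. k * q + r) ` {0..(N - r) div q}" by auto
    next
      fix j assume "j \<in> (\<lambda>k. k * q + r) ` {0..(N - r) div q}"
      then obtain k where k: "j = k * q + r" "k \<le> (N - r) div q" by fastforce
      have "k * q \<le> N - r" using k assms by (simp add: less_eq_div_iff_mult_less_eq)
      thus "j \<in> {j\<in>{1..N}. j mod q = r}" using k 3 r by auto
    qed
    moreover have "inj_on (\<lambda>k. k * q + r) {0..(N - r) div q}" using assms by (auto simp: inj_on_def)
    ultimately have "card {j\<in>{1..N}. j mod q = r} = (N - r) div q + 1" by (simp add: card_image)
    hence rc: "real (card {j\<in>{1..N}. [j = a] (mod q)}) = real ((N - r) div q) + 1" by (simp only: eq of_nat_add of_nat_1)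
    have "real (N - r) / real q = real N / real q - real r / real q" using 3 by (simp add: of_nat_diff diff_divide_distrib)
    moreover have "0 \<le> real r / real q" "real r / real q \<le> 1" using r by auto
    ultimately show ?thesis unfolding rc using fl[of "N - r"] by linarith
  qed
qed

text \<open>By the Chinese remainder theorem the condition describes a product of numbers of residue classes
  modulo \<open>q * \<Prod>D\<close>, and each class is hit with an error at most one. The induction moves the primes of
  \<open>D\<close> into the modulus \<open>q\<close> one by one, which is why \<open>q\<close> and \<open>a\<close> appear.\<close>
lemma card_crt_bound:
  fixes D :: "nat set" and \<Omega> :: "nat \<Rightarrow> nat set"
  assumes "finite D" "\<And>p. p \<in> D \<Longrightarrow> prime p \<and> \<Omega> p \<subseteq> {..<p}" "q > 0" "\<And>p. p \<in> D \<Longrightarrow> coprime p q"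
  shows "\<bar>real (card {j\<in>{1..N}. [j = a] (mod q) \<and> (\<forall>p\<in>D. j mod p \<in> \<Omega> p)}) -
            real N / real q * (\<Prod>p\<in>D. real (card (\<Omega> p)) / real p)\<bar> \<le> (\<Prod>p\<in>D. real (card (\<Omega> p)))"
  using assms
proof (induction D arbitrary: q a rule: finite_induct)
  case empty
  thus ?case using card_residue_class_bound[of q N a] by simp
next
  case (insert p D)
  have p: "prime p" "\<Omega> p \<subseteq> {..<p}" "coprime p q" "p > 0" using insert.prems prime_gt_0_nat by auto
  have finO: "finite (\<Omega> p)" using p finite_subset by blast
  have "\<exists>x. [x = a] (mod q) \<and> [x = c] (mod p)" for c
    using binary_chinese_remainder_nat[of q p a c] p by (auto simp: coprime_commute)
  then obtain f where f: "[f c = a] (mod q)" "[f c = c] (mod p)" for c by metis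
  let ?S = "\<lambda>a q. {j\<in>{1..N}. [j = a] (mod q) \<and> (\<forall>p\<in>D. j mod p \<in> \<Omega> p)}"
  have un: "{j\<in>{1..N}. [j = a] (mod q) \<and> (\<forall>p\<in>insert p D. j mod p \<in> \<Omega> p)} = (\<Union>c\<in>\<Omega> p. ?S (f c) (p * q))"
  proof (intro equalityI subsetI)
    fix j assume j: "j \<in> {j\<in>{1..N}. [j = a] (mod q) \<and> (\<forall>p\<in>insert p D. j mod p \<in> \<Omega> p)}"
    have "[j = f (j mod p)] (mod p)" using f(2)[of "j mod p"] by (simp add: cong_sym_eq)
    moreover have "[j = f (j mod p)] (mod q)" using f(1)[of "j mod p"] j by (auto simp: Cong.cong_def)
    ultimately have "[j = f (j mod p)] (mod p * q)" using p coprime_cong_mult_nat by blast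
    thus "j \<in> (\<Union>c\<in>\<Omega> p. ?S (f c) (p * q))" using j by auto
  next
    fix j assume "j \<in> (\<Union>c\<in>\<Omega> p. ?S (f c) (p * q))"
    then obtain c where c: "c \<in> \<Omega> p" "j \<in> ?S (f c) (p * q)" by auto
    have "[j = f c] (mod q)" "[j = f c] (mod p)" using c cong_modulus_mult_nat[of j "f c" q p] cong_modulus_mult_nat[of j "f c" p q]
      by (auto simp: mult.commute[of p q])
    hence "[j = a] (mod q)" "[j = c] (mod p)" using f cong_trans by blast+
    moreover from this have "j mod p = c" using c p by (auto simp: Cong.cong_def)
    ultimately show "j \<in> {j\<in>{1..N}. [j = a] (mod q) \<and> (\<forall>p\<in>insert p D. j mod p \<in> \<Omega> p)}" using c by auto
  qed
  have disj: "?S (f c) (p * q) \<inter> ?S (f d) (p * q) = {}" if cd: "c \<in> \<Omega> p" "d \<in> \<Omega> p" "c \<noteq> d" for c d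
  proof -
    have False if j: "[j = f c] (mod p * q)" "[j = f d] (mod p * q)" for j
    proof -
      have "[j = f c] (mod p)" "[j = f d] (mod p)" using j cong_modulus_mult_nat by blast+
      hence "[c = d] (mod p)" using f cong_trans cong_sym by meson
      thus False using cd subsetD[OF p(2) cd(1)] subsetD[OF p(2) cd(2)] by (auto simp: Cong.cong_def)
    qed
    thus ?thesis by blast
  qed
  have card: "card {j\<in>{1..N}. [j = a] (mod q) \<and> (\<forall>p\<in>insert p D. j mod p \<in> \<Omega> p)} = (\<Sum>c\<in>\<Omega> p. card (?S (f c) (p * q)))"
    unfolding un by (rule card_UN_disjoint) (use finO disj in auto)
  let ?m = "real N / real (p * q) * (\<Prod>p\<in>D. real (card (\<Omega> p)) / real p)"
  have "real N / real q * (\<Prod>p\<in>insert p D. real (card (\<Omega> p)) / real p) = (\<Sum>c\<in>\<Omega> p. ?m)"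
    using insert.hyps by (simp add: mult_ac)
  hence "\<bar>real (card {j\<in>{1..N}. [j = a] (mod q) \<and> (\<forall>p\<in>insert p D. j mod p \<in> \<Omega> p)}) -
            real N / real q * (\<Prod>p\<in>insert p D. real (card (\<Omega> p)) / real p)\<bar> =
        \<bar>\<Sum>c\<in>\<Omega> p. real (card (?S (f c) (p * q))) - ?m\<bar>"
    by (simp only: card of_nat_sum sum_subtractf)
  also have "\<dots> \<le> (\<Sum>c\<in>\<Omega> p. \<bar>real (card (?S (f c) (p * q))) - ?m\<bar>)" by (rule sum_abs)
  also have "\<dots> \<le> (\<Sum>c\<in>\<Omega> p. \<Prod>p\<in>D. real (card (\<Omega> p)))"
  proof (rule sum_mono)
    fix c
    show "\<bar>real (card (?S (f c) (p * q))) - ?m\<bar> \<le> (\<Prod>p\<in>D. real (card (\<Omega> p)))"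
    proof (rule insert.IH)
      fix r assume r: "r \<in> D"
      hence "coprime r p" using insert.hyps insert.prems(1)[of r] p primes_coprime[of r p] by auto
      thus "coprime r (p * q)" using insert.prems(3)[of r] r by simp
    qed (use insert.prems p in auto)
  qed
  also have "\<dots> = (\<Prod>p\<in>insert p D. real (card (\<Omega> p)))" using insert.hyps by simp
  finally show ?case .
qed

text \<open>The indicator of the sifted set is a product over the blocks, each factor of which is bounded by an
  even Bonferroni truncation. Expanding the product leaves one congruence count for each set of primes;
  the second product collects their rounding errors.\<close>
lemma sifted_le_blocks:
  fixes P :: "nat \<Rightarrow> nat set" and \<Omega> :: "nat \<Rightarrow> nat set"
  assumes fin: "\<And>i. i < t \<Longrightarrow> finite (P i)" and disj: "\<And>i j. i < t \<Longrightarrow> j < t \<Longrightarrow> i \<noteq> j \<Longrightarrow> P i \<inter> P j = {}"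
    and P: "\<And>i p. i < t \<Longrightarrow> p \<in> P i \<Longrightarrow> prime p \<and> \<Omega> p \<subseteq> {..<p}" and b: "\<And>i. i < t \<Longrightarrow> even (b i)"
  shows "real (card {j\<in>{1..N}. \<forall>i<t. \<forall>p\<in>P i. j mod p \<notin> \<Omega> p}) \<le>
     real N * (\<Prod>i<t. esym_trunc (b i) (P i) (\<lambda>p. - (real (card (\<Omega> p)) / real p))) +
     (\<Prod>i<t. esym_trunc (b i) (P i) (\<lambda>p. real (card (\<Omega> p))))"
proof -
  let ?DD = "{D. D \<subseteq> (\<Union>i<t. P i) \<and> (\<forall>i<t. card (D \<inter> P i) \<le> b i)}"
  define w where "w j p = (if j mod p \<in> \<Omega> p then 1 else 0 :: real)" for j p :: nat
  let ?\<rho> = "\<lambda>p. real (card (\<Omega> p))"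
  have finDD: "finite ?DD"
    by (rule finite_subset[of _ "Pow (\<Union>i<t. P i)"]) (use fin in auto)
  have blocks: "(\<Prod>i<t. esym_trunc (b i) (P i) w) = (\<Sum>D\<in>?DD. \<Prod>p\<in>D. w p)" for w
    by (rule prod_esym_trunc_blocks) (use fin disj in auto)
  have D: "finite D" "\<And>p. p \<in> D \<Longrightarrow> prime p \<and> \<Omega> p \<subseteq> {..<p}" if "D \<in> ?DD" for D
    using that P fin finite_subset[of D "\<Union>i<t. P i"] by (auto dest!: subsetD)
  have "real (card {j\<in>{1..N}. \<forall>i<t. \<forall>p\<in>P i. j mod p \<notin> \<Omega> p}) =
        (\<Sum>j\<in>{1..N}. if \<forall>i<t. \<forall>p\<in>P i. j mod p \<notin> \<Omega> p then 1 else 0)"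
    by (simp add: sum.If_cases Int_def)
  also have "\<dots> \<le> (\<Sum>j\<in>{1..N}. \<Prod>i<t. esym_trunc (b i) (P i) (\<lambda>p. - w j p))"
  proof (rule sum_mono)
    fix j
    have ge: "(\<Prod>p\<in>P i. 1 - w j p) \<le> esym_trunc (b i) (P i) (\<lambda>p. - w j p)" if "i < t" for i
      by (rule esym_trunc_even_bounds) (use that fin b in \<open>auto simp: w_def\<close>)
    have ge0: "0 \<le> (\<Prod>p\<in>P i. 1 - w j p)" for i by (intro prod_nonneg) (auto simp: w_def)
    have "(if \<forall>i<t. \<forall>p\<in>P i. j mod p \<notin> \<Omega> p then 1 else 0) \<le> (\<Prod>i<t. \<Prod>p\<in>P i. 1 - w j p)"
      using ge0 by (auto simp: w_def intro!: prod_nonneg)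
    also have "\<dots> \<le> (\<Prod>i<t. esym_trunc (b i) (P i) (\<lambda>p. - w j p))"
      by (intro prod_mono) (use ge ge0 in auto)
    finally show "(if \<forall>i<t. \<forall>p\<in>P i. j mod p \<notin> \<Omega> p then 1 else 0) \<le> (\<Prod>i<t. esym_trunc (b i) (P i) (\<lambda>p. - w j p))" .
  qed
  also have "\<dots> = (\<Sum>j\<in>{1..N}. \<Sum>D\<in>?DD. \<Prod>p\<in>D. - w j p)" by (simp only: blocks)
  also have "\<dots> = (\<Sum>D\<in>?DD. \<Sum>j\<in>{1..N}. \<Prod>p\<in>D. - w j p)" by (rule sum.swap)
  also have "\<dots> = (\<Sum>D\<in>?DD. (-1) ^ card D * real (card {j\<in>{1..N}. \<forall>p\<in>D. j mod p \<in> \<Omega> p}))"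
  proof (rule sum.cong[OF refl])
    fix D' assume D': "D' \<in> ?DD"
    have "(\<Sum>j\<in>{1..N}. \<Prod>p\<in>D'. - w j p) = (\<Sum>j\<in>{1..N}. (-1) ^ card D' * (if \<forall>p\<in>D'. j mod p \<in> \<Omega> p then 1 else 0))"
    proof (rule sum.cong[OF refl])
      fix j
      have "(\<Prod>p\<in>D'. - w j p) = (\<Prod>p\<in>D'. (-1) * w j p)" by simp
      also have "\<dots> = (-1) ^ card D' * (\<Prod>p\<in>D'. w j p)" by (simp only: prod.distrib prod_constant)
      also have "(\<Prod>p\<in>D'. w j p) = (if \<forall>p\<in>D'. j mod p \<in> \<Omega> p then 1 else 0)"
        using D(1)[OF D'] by (auto simp: w_def)
      finally show "(\<Prod>p\<in>D'. - w j p) = (-1) ^ card D' * (if \<forall>p\<in>D'. j mod p \<in> \<Omega> p then 1 else 0)" .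
    qed
    also have "\<dots> = (-1) ^ card D' * real (card {j\<in>{1..N}. \<forall>p\<in>D'. j mod p \<in> \<Omega> p})"
      by (simp add: sum.If_cases Int_def flip: sum_distrib_left)
    finally show "(\<Sum>j\<in>{1..N}. \<Prod>p\<in>D'. - w j p) = (-1) ^ card D' * real (card {j\<in>{1..N}. \<forall>p\<in>D'. j mod p \<in> \<Omega> p})" .
  qed
  also have "\<dots> \<le> (\<Sum>D\<in>?DD. real N * (\<Prod>p\<in>D. - (?\<rho> p / real p)) + (\<Prod>p\<in>D. ?\<rho> p))"
  proof (rule sum_mono)
    fix D' assume D': "D' \<in> ?DD"
    let ?c = "real (card {j\<in>{1..N}. \<forall>p\<in>D'. j mod p \<in> \<Omega> p})"
    have "\<bar>?c - real N * (\<Prod>p\<in>D'. ?\<rho> p / real p)\<bar> \<le> (\<Prod>p\<in>D'. ?\<rho> p)"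
      using card_crt_bound[of D' \<Omega> 1 N 0] D[OF D'] by simp
    moreover have "(\<Prod>p\<in>D'. - (?\<rho> p / real p)) = (-1) ^ card D' * (\<Prod>p\<in>D'. ?\<rho> p / real p)"
    proof -
      have "(\<Prod>p\<in>D'. - (?\<rho> p / real p)) = (\<Prod>p\<in>D'. (-1) * (?\<rho> p / real p))" by simp
      thus ?thesis by (simp only: prod.distrib prod_constant)
    qed
    moreover have "\<bar>(-1) ^ card D' * (x :: real)\<bar> = \<bar>x\<bar>" for x by (simp add: abs_mult)
    from this[of "?c - real N * (\<Prod>p\<in>D'. ?\<rho> p / real p)"]
    have "(-1) ^ card D' * ?c - (-1) ^ card D' * (real N * (\<Prod>p\<in>D'. ?\<rho> p / real p)) \<le> \<bar>?c - real N * (\<Prod>p\<in>D'. ?\<rho> p / real p)\<bar>"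
      unfolding right_diff_distrib by linarith
    ultimately show "(-1) ^ card D' * ?c \<le> real N * (\<Prod>p\<in>D'. - (?\<rho> p / real p)) + (\<Prod>p\<in>D'. ?\<rho> p)"
      by (simp add: algebra_simps)
  qed
  also have "\<dots> = real N * (\<Prod>i<t. esym_trunc (b i) (P i) (\<lambda>p. - (?\<rho> p / real p))) + (\<Prod>i<t. esym_trunc (b i) (P i) ?\<rho>)"
    by (simp only: blocks sum.distrib sum_distrib_left)
  finally show ?thesis .
qed

lemma prime_recip_sum_diff_eq:
  assumes "m \<le> n"
  shows "(\<Sum>p | prime p \<and> m < p \<and> p \<le> n. 1 / real p) = prime_recip_sum n - prime_recip_sum m"
proof -
  have "{p. prime p \<and> p \<le> n} = {p. prime p \<and> p \<le> m} \<union> {p. prime p \<and> m < p \<and> p \<le> n}"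
    using assms by auto
  hence "prime_recip_sum n = (\<Sum>p\<in>{p. prime p \<and> p \<le> m} \<union> {p. prime p \<and> m < p \<and> p \<le> n}. 1 / real p)"
    unfolding prime_recip_sum_def by simp
  also have "\<dots> = prime_recip_sum m + (\<Sum>p | prime p \<and> m < p \<and> p \<le> n. 1 / real p)"
    unfolding prime_recip_sum_def
    by (rule sum.union_disjoint) (auto intro: finite_subset[OF _ finite_primes_le[of n]])
  finally show ?thesis by simp
qed

lemma prime_recip_sum_diff_le:
  assumes "2 \<le> m" "2 \<le> n"
  shows "prime_recip_sum n - prime_recip_sum m \<le> ln (ln (real n)) - ln (ln (real m)) + 13"
  using prime_recip_sum_upper[of n] prime_recip_sum_lower[of m] assms by linarith

lemma ln_two_power: "ln (real (2 ^ k)) = real k * ln 2"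
  by (simp add: ln_realpow)

text \<open>Primes are grouped into the blocks between \<open>2 ^ 2 ^ i\<close> and \<open>2 ^ 2 ^ (i + 1)\<close>. On each block the sum
  of \<open>1 / p\<close> is bounded, so truncating at \<open>2 * (t - i)\<close> primes costs a factor \<open>1 + O(1 / (t - i)!)\<close>.
  The truncation is strongest for the large primes, and this keeps all moduli below a fixed power of
  \<open>2 ^ 2 ^ t\<close>.\<close>
lemma sieve_dyadic:
  fixes \<kappa> t N :: nat
  assumes P: "\<And>p. p \<in> P \<Longrightarrow> prime p \<and> 2 < p \<and> p \<le> 2 ^ 2 ^ t \<and> \<Omega> p \<subseteq> {..<p} \<and> card (\<Omega> p) \<le> \<kappa>"
  shows "real (card {j\<in>{1..N}. \<forall>p\<in>P. j mod p \<notin> \<Omega> p}) \<le>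
     real N * exp (exp (28 * real \<kappa>)) * exp (- (\<Sum>p\<in>P. real (card (\<Omega> p)) / real p)) + 2 ^ ((8 + 4 * \<kappa>) * 2 ^ t)"
proof -
  define B where "B i = {p\<in>P. 2 ^ 2 ^ i < p \<and> p \<le> (2::nat) ^ 2 ^ Suc i}" for i
  define W where "W i = (\<Sum>p\<in>B i. real (card (\<Omega> p)) / real p)" for i
  define K where "K = 14 * real \<kappa>"
  \<comment> \<open>even, so that truncation gives an upper bound; the block of the largest primes is cut at 2\<close>
  define b where "b i = 2 * (t - i)" for i
  have finP: "finite P" using P by (auto intro: finite_subset[OF _ finite_primes_le[of "2 ^ 2 ^ t"]])
  have finB: "finite (B i)" for i using finP by (simp add: B_def)
  have mono2: "(2::nat) ^ 2 ^ i \<le> 2 ^ 2 ^ j" if "i \<le> j" for i j using that by (simp add: power_increasing)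
  have disj: "B i \<inter> B j = {}" if "i < j" for i j
  proof -
    have "Suc i \<le> j" using that by simp
    hence "\<not> (p \<le> 2 ^ 2 ^ Suc i \<and> 2 ^ 2 ^ j < p)" for p :: nat using mono2[of "Suc i" j] by linarith
    thus ?thesis unfolding B_def by blast
  qed
  have disj': "B i \<inter> B j = {}" if "i \<noteq> j" for i j
    using disj[of i j] disj[of j i] that by (cases "i < j") auto
  have cover: "\<exists>i<s. 2 ^ 2 ^ i < p \<and> p \<le> (2::nat) ^ 2 ^ Suc i" if "2 < p" "p \<le> 2 ^ 2 ^ s" for p s :: nat
    using that
  proof (induction s)
    case (Suc s)
    thus ?case by (cases "p \<le> 2 ^ 2 ^ s") (auto simp: less_Suc_eq)
  qed simp
  have UB: "(\<Union>i<t. B i) = P"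
  proof (intro equalityI subsetI)
    fix p assume p: "p \<in> P"
    obtain i where "i < t" "2 ^ 2 ^ i < p \<and> p \<le> 2 ^ 2 ^ Suc i" using cover[of p t] P[OF p] by blast
    thus "p \<in> (\<Union>i<t. B i)" using p unfolding B_def by blast
  qed (auto simp: B_def)
  have \<rho>: "prime p" "0 \<le> real (card (\<Omega> p)) / real p" "real (card (\<Omega> p)) / real p \<le> 1"
    "real (card (\<Omega> p)) / real p \<le> real \<kappa> * (1 / real p)" if "p \<in> P" for p
  proof -
    show "prime p" using P[OF that] by simp
    hence "p > 0" by (rule prime_gt_0_nat)
    moreover have "card (\<Omega> p) \<le> card {..<p}" using P[OF that] by (intro card_mono) auto
    ultimately show "0 \<le> real (card (\<Omega> p)) / real p" "real (card (\<Omega> p)) / real p \<le> 1" by auto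
    show "real (card (\<Omega> p)) / real p \<le> real \<kappa> * (1 / real p)"
      using P[OF that] by (simp add: divide_right_mono)
  qed
  have WK: "0 \<le> W i" "W i \<le> K" for i
  proof -
    show "0 \<le> W i" unfolding W_def by (intro sum_nonneg) auto
    have "W i \<le> (\<Sum>p\<in>B i. real \<kappa> * (1 / real p))"
      unfolding W_def using \<rho> by (intro sum_mono) (auto simp: B_def)
    also have "\<dots> \<le> (\<Sum>p | prime p \<and> 2 ^ 2 ^ i < p \<and> p \<le> 2 ^ 2 ^ Suc i. real \<kappa> * (1 / real p))"
      by (intro sum_mono2) (auto simp: B_def \<rho>(1) intro: finite_subset[OF _ finite_primes_le[of "2 ^ 2 ^ Suc i"]])
    also have "\<dots> = real \<kappa> * (prime_recip_sum (2 ^ 2 ^ Suc i) - prime_recip_sum (2 ^ 2 ^ i))"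
      unfolding sum_distrib_left[symmetric] by (subst prime_recip_sum_diff_eq) (use mono2[of i "Suc i"] in auto)
    also have "prime_recip_sum (2 ^ 2 ^ Suc i) - prime_recip_sum (2 ^ 2 ^ i) \<le>
        ln (ln (real (2 ^ 2 ^ Suc i))) - ln (ln (real (2 ^ 2 ^ i))) + 13"
      by (rule prime_recip_sum_diff_le) (use power_increasing[of 1 _ "2::nat"] in \<open>auto\<close>)
    also have "ln (ln (real (2 ^ 2 ^ Suc i))) = ln (ln (real (2 ^ 2 ^ i))) + ln 2"
    proof -
      have "ln (real (2 ^ 2 ^ Suc i)) = 2 * ln (real (2 ^ 2 ^ i))" unfolding ln_two_power by simp
      moreover have "ln (real (2 ^ 2 ^ i)) > 0" unfolding ln_two_power by simp
      moreover have "ln (2 * u) = ln u + ln 2" if "u > 0" for u :: real using that by (simp add: ln_mult)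
      ultimately show ?thesis by metis
    qed
    also have "ln (ln (real (2 ^ 2 ^ i))) + ln 2 - ln (ln (real (2 ^ 2 ^ i))) + 13 \<le> (14::real)"
      using ln_2_less_1 by simp
    finally show "W i \<le> K" unfolding K_def by (simp add: mult.commute mult_right_mono)
  qed
  have main: "(\<Prod>i<t. esym_trunc (b i) (B i) (\<lambda>p. - (real (card (\<Omega> p)) / real p))) \<le>
      exp (exp (28 * real \<kappa>)) * exp (- (\<Sum>p\<in>P. real (card (\<Omega> p)) / real p))"
  proof -
    define e where "e i = exp K * (K ^ Suc (b i) / fact (Suc (b i)))" for i
    have "(\<Prod>i<t. esym_trunc (b i) (B i) (\<lambda>p. - (real (card (\<Omega> p)) / real p))) \<le> (\<Prod>i<t. exp (- W i + e i))"
    proof (intro prod_mono conjI)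
      fix i assume "i \<in> {..<t}"
      have w: "\<And>p. p \<in> B i \<Longrightarrow> 0 \<le> real (card (\<Omega> p)) / real p \<and> real (card (\<Omega> p)) / real p \<le> 1"
        using \<rho>(2,3) unfolding B_def by blast
      have ev: "even (b i)" by (simp add: b_def)
      note bd = esym_trunc_even_bounds[OF finB w ev]
      show "0 \<le> esym_trunc (b i) (B i) (\<lambda>p. - (real (card (\<Omega> p)) / real p))"
        by (rule order_trans[OF prod_nonneg bd(1)]) (use w in \<open>simp only: diff_ge_0_iff_ge\<close>)
      have "esym_trunc (b i) (B i) (\<lambda>p. - (real (card (\<Omega> p)) / real p)) \<le> exp (- W i) + W i ^ Suc (b i) / fact (Suc (b i))"
        using bd(2) unfolding W_def .
      also have "W i ^ Suc (b i) / fact (Suc (b i)) \<le> K ^ Suc (b i) / fact (Suc (b i))"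
        using WK[of i] by (intro divide_right_mono power_mono) auto
      also have "\<dots> = exp (- K) * e i" by (simp add: e_def exp_minus field_simps)
      also have "\<dots> \<le> exp (- W i) * e i"
        using WK[of i] by (intro mult_right_mono) (auto simp: e_def K_def)
      also have "exp (- W i) + exp (- W i) * e i = exp (- W i) * (1 + e i)" by (simp add: algebra_simps)
      also have "\<dots> \<le> exp (- W i) * exp (e i)" using exp_ge_add_one_self[of "e i"] by (intro mult_left_mono) auto
      finally show "esym_trunc (b i) (B i) (\<lambda>p. - (real (card (\<Omega> p)) / real p)) \<le> exp (- W i + e i)"
        by (simp only: exp_add)
    qed
    also have "\<dots> = exp (- (\<Sum>i<t. W i) + (\<Sum>i<t. e i))" by (simp only: exp_sum[symmetric] finite_lessThan sum.distrib sum_negf)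
    also have "(\<Sum>i<t. W i) = (\<Sum>p\<in>(\<Union>i<t. B i). real (card (\<Omega> p)) / real p)"
      unfolding W_def by (subst sum.UNION_disjoint) (use finB disj' in auto)
    also have "(\<Sum>i<t. e i) \<le> exp (28 * real \<kappa>)"
    proof -
      have "(\<Sum>i<t. e i) = exp K * (\<Sum>i<t. K ^ Suc (b i) / fact (Suc (b i)))"
        by (simp add: e_def sum_distrib_left)
      also have "(\<Sum>i<t. K ^ Suc (b i) / fact (Suc (b i))) = (\<Sum>m\<in>(\<lambda>i. Suc (b i)) ` {..<t}. K ^ m / fact m)"
        by (subst sum.reindex) (auto simp: inj_on_def b_def)
      also have "\<dots> \<le> exp K"
      proof -
        have "(\<Sum>m\<in>(\<lambda>i. Suc (b i)) ` {..<t}. inverse (fact m) * K ^ m) \<le> (\<Sum>m. inverse (fact m) * K ^ m)"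
          by (intro sum_le_suminf summable_exp) (auto simp: K_def)
        thus ?thesis by (simp add: exp_def field_simps)
      qed
      finally have "(\<Sum>i<t. e i) \<le> exp K * exp K" by (simp add: mult_left_mono)
      thus ?thesis by (simp add: K_def flip: exp_add)
    qed
    finally show ?thesis unfolding UB by (simp add: mult.commute exp_add[symmetric])
  qed
  have err: "(\<Prod>i<t. esym_trunc (b i) (B i) (\<lambda>p. real (card (\<Omega> p)))) \<le> 2 ^ ((8 + 4 * \<kappa>) * 2 ^ t)"
  proof -
    have "(\<Prod>i<t. esym_trunc (b i) (B i) (\<lambda>p. real (card (\<Omega> p)))) \<le> (\<Prod>i<t. 2 ^ ((2 ^ Suc i + \<kappa>) * b i))"
    proof (intro prod_mono conjI)
      fix i
      show "0 \<le> esym_trunc (b i) (B i) (\<lambda>p. real (card (\<Omega> p)))" by (rule esym_trunc_nonneg) auto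
      have "esym_trunc (b i) (B i) (\<lambda>p. real (card (\<Omega> p))) \<le> (1 + (\<Sum>p\<in>B i. real (card (\<Omega> p)))) ^ b i"
        by (rule esym_trunc_le_power) (use finB in auto)
      also have "\<dots> \<le> (2 ^ (2 ^ Suc i + \<kappa>)) ^ b i"
      proof (intro power_mono)
        have "(\<Sum>p\<in>B i. real (card (\<Omega> p))) \<le> (\<Sum>p\<in>B i. real \<kappa>)"
          using P by (intro sum_mono) (auto simp: B_def)
        also have "\<dots> = real (card (B i)) * real \<kappa>" by simp
        also have "card (B i) \<le> 2 ^ 2 ^ Suc i"
        proof -
          have "card (B i) \<le> card {1..(2::nat) ^ 2 ^ Suc i}"
            by (intro card_mono) (auto simp: B_def Suc_le_eq dest: P prime_gt_0_nat)
          thus ?thesis by simp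
        qed
        hence "real (card (B i)) * real \<kappa> \<le> 2 ^ 2 ^ Suc i * real \<kappa>"
          by (intro mult_right_mono) (auto simp flip: of_nat_le_iff)
        finally have "1 + (\<Sum>p\<in>B i. real (card (\<Omega> p))) \<le> 1 * 1 + 2 ^ 2 ^ Suc i * real \<kappa>" by simp
        also have "\<dots> \<le> 2 ^ 2 ^ Suc i * 1 + 2 ^ 2 ^ Suc i * real \<kappa>"
          by (intro add_mono mult_right_mono) auto
        also have "\<dots> = 2 ^ 2 ^ Suc i * real (\<kappa> + 1)" by (simp add: algebra_simps)
        also have "real (\<kappa> + 1) \<le> 2 ^ \<kappa>"
        proof -
          have "\<kappa> + 1 \<le> 2 ^ \<kappa>" using less_exp[of \<kappa>] by linarith
          thus ?thesis by (metis of_nat_le_iff of_nat_numeral of_nat_power)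
        qed
        finally show "1 + (\<Sum>p\<in>B i. real (card (\<Omega> p))) \<le> 2 ^ (2 ^ Suc i + \<kappa>)" by (simp add: power_add mult_left_mono)
      qed (simp add: sum_nonneg)
      finally show "esym_trunc (b i) (B i) (\<lambda>p. real (card (\<Omega> p))) \<le> 2 ^ ((2 ^ Suc i + \<kappa>) * b i)"
        by (simp add: power_mult)
    qed
    also have "\<dots> = 2 ^ (\<Sum>i<t. (2 ^ Suc i + \<kappa>) * b i)" by (simp add: power_sum)
    also have "\<dots> \<le> 2 ^ ((8 + 4 * \<kappa>) * 2 ^ t)"
    proof (intro power_increasing)
      have 1: "(\<Sum>i<t. 2 ^ Suc i * (2 * (t - i))) + 4 * t + 8 = 8 * (2::nat) ^ t" for t
      proof (induction t)
        case (Suc t)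
        have s2: "(\<Sum>i<t. 4 * 2 ^ i) + 4 = 4 * (2::nat) ^ t" by (induction t) auto
        have "(\<Sum>i<t. 2 ^ Suc i * (2 * (Suc t - i))) = (\<Sum>i<t. 2 ^ Suc i * (2 * (t - i)) + 4 * (2::nat) ^ i)"
        proof (intro sum.cong refl)
          fix i assume "i \<in> {..<t}"
          hence e: "Suc t - i = Suc (t - i)" by auto
          have "2 ^ Suc i * (2 * Suc u) = 2 ^ Suc i * (2 * u) + 4 * (2::nat) ^ i" for u by simp
          thus "2 ^ Suc i * (2 * (Suc t - i)) = 2 ^ Suc i * (2 * (t - i)) + 4 * (2::nat) ^ i" unfolding e .
        qed
        also have "\<dots> = (\<Sum>i<t. 2 ^ Suc i * (2 * (t - i))) + (\<Sum>i<t. 4 * 2 ^ i)" by (rule sum.distrib)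
        finally have "(\<Sum>i<Suc t. 2 ^ Suc i * (2 * (Suc t - i))) =
            (\<Sum>i<t. 2 ^ Suc i * (2 * (t - i))) + (\<Sum>i<t. 4 * 2 ^ i) + 4 * (2::nat) ^ t" by simp
        thus ?case using Suc s2 by simp
      qed simp
      have 2: "(\<Sum>i<t. 2 * (t - i)) + 2 \<le> 4 * (2::nat) ^ t" for t
      proof (induction t)
        case (Suc t)
        have "t < 2 ^ t" by (rule less_exp)
        have "(\<Sum>i<t. 2 * (Suc t - i)) = (\<Sum>i<t. 2 * (t - i) + 2)"
          by (intro sum.cong) (auto simp: Suc_diff_le)
        also have "\<dots> = (\<Sum>i<t. 2 * (t - i)) + 2 * t"
          by (simp only: sum.distrib sum_constant card_lessThan) simp
        finally have "(\<Sum>i<Suc t. 2 * (Suc t - i)) = (\<Sum>i<t. 2 * (t - i)) + 2 * t + 2" by simp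
        moreover have "(2::nat) ^ Suc t = 2 * 2 ^ t" by simp
        ultimately show ?case using Suc \<open>t < 2 ^ t\<close> by linarith
      qed simp
      have "(\<Sum>i<t. (2 ^ Suc i + \<kappa>) * b i) = (\<Sum>i<t. 2 ^ Suc i * (2 * (t - i))) + \<kappa> * (\<Sum>i<t. 2 * (t - i))"
        unfolding b_def by (simp only: distrib_right sum.distrib sum_distrib_left)
      also have "\<dots> \<le> 8 * 2 ^ t + \<kappa> * (4 * 2 ^ t)"
        using 1[of t] 2[of t] by (intro add_mono mult_left_mono) auto
      finally show "(\<Sum>i<t. (2 ^ Suc i + \<kappa>) * b i) \<le> (8 + 4 * \<kappa>) * 2 ^ t" by (simp add: algebra_simps)
    qed simp
    finally show ?thesis .
  qed
  have "{j\<in>{1..N}. \<forall>p\<in>P. j mod p \<notin> \<Omega> p} = {j\<in>{1..N}. \<forall>i<t. \<forall>p\<in>B i. j mod p \<notin> \<Omega> p}"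
    using UB by auto
  hence "real (card {j\<in>{1..N}. \<forall>p\<in>P. j mod p \<notin> \<Omega> p}) \<le>
     real N * (\<Prod>i<t. esym_trunc (b i) (B i) (\<lambda>p. - (real (card (\<Omega> p)) / real p))) +
     (\<Prod>i<t. esym_trunc (b i) (B i) (\<lambda>p. real (card (\<Omega> p))))"
    using sifted_le_blocks[of t B \<Omega> b N] finB disj' P by (auto simp: B_def b_def)
  also have "\<dots> \<le> real N * (exp (exp (28 * real \<kappa>)) * exp (- (\<Sum>p\<in>P. real (card (\<Omega> p)) / real p))) + 2 ^ ((8 + 4 * \<kappa>) * 2 ^ t)"
    using main err by (intro add_mono mult_left_mono) auto
  finally show ?thesis by (simp add: mult.assoc)
qed

text \<open>The upper bound sieve of dimension \<open>\<kappa>\<close>, uniform in the removed residue classes. Sifting only by the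
  primes up to \<open>z\<close>, a small fixed power of \<open>N\<close>, makes the rounding error harmless, and the primes
  between \<open>z\<close> and \<open>N\<close> contribute a bounded amount to the sum of \<open>1 / p\<close>.\<close>
theorem sieve_upper_bound:
  fixes \<kappa> :: nat
  shows "\<exists>C>0. \<forall>N P \<Omega>. N \<ge> 1 \<longrightarrow>
     (\<forall>p\<in>P. prime p \<and> p \<le> N \<and> \<Omega> p \<subseteq> {..<p} \<and> card (\<Omega> p) \<le> \<kappa>) \<longrightarrow>
     real (card {j\<in>{1..N}. \<forall>p\<in>P. j mod p \<notin> \<Omega> p}) \<le>
       C * real N * exp (- (\<Sum>p\<in>P. real (card (\<Omega> p)) / real p))"
proof -
  \<comment> \<open>one more than the exponent of the rounding error, which thus is at most N / z\<close>
  define A where "A = 9 + 4 * \<kappa>"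
  define k where "k = real \<kappa>"
  define C1 where "C1 = exp (k * 2 ^ A)"
  define C2 where "C2 = exp (k * (2 + ln (2 * real A) + 13))"
  define C where "C = C1 + C2 * (exp (exp (28 * k)) + exp (9 * k) * fact \<kappa>)"
  have C12: "C1 > 0" "C2 > 0" "C > 0" unfolding C1_def C2_def C_def by (simp_all add: add_pos_pos)
  show ?thesis
  proof (intro exI[of _ C] conjI allI impI)
    fix N :: nat and P and \<Omega> :: "nat \<Rightarrow> nat set"
    assume N: "N \<ge> 1" and "\<forall>p\<in>P. prime p \<and> p \<le> N \<and> \<Omega> p \<subseteq> {..<p} \<and> card (\<Omega> p) \<le> \<kappa>"
    hence P: "\<And>p. p \<in> P \<Longrightarrow> prime p \<and> p \<le> N \<and> \<Omega> p \<subseteq> {..<p} \<and> card (\<Omega> p) \<le> \<kappa>" by blast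
    have finP: "finite P" using P by (auto intro: finite_subset[OF _ finite_primes_le[of N]])
    let ?w = "\<lambda>p. real (card (\<Omega> p)) / real p"
    let ?S = "\<lambda>P. card {j\<in>{1..N}. \<forall>p\<in>P. j mod p \<notin> \<Omega> p}"
    have w: "0 \<le> ?w p" "?w p \<le> k * (1 / real p)" if "p \<in> P" for p
      using P[OF that] by (auto simp: k_def divide_right_mono)
    have wsum: "(\<Sum>p\<in>Q. ?w p) \<le> k * (\<Sum>p\<in>R. 1 / real p)" if "Q \<subseteq> P" "Q \<subseteq> R" "finite R" for Q R
    proof -
      have "(\<Sum>p\<in>Q. ?w p) \<le> (\<Sum>p\<in>Q. k * (1 / real p))" using w that by (intro sum_mono) auto
      also have "\<dots> \<le> (\<Sum>p\<in>R. k * (1 / real p))" using that by (intro sum_mono2) (auto simp: k_def)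
      finally show ?thesis by (simp add: sum_distrib_left)
    qed
    show "real (?S P) \<le> C * real N * exp (- (\<Sum>p\<in>P. ?w p))"
    proof (cases "N < 2 ^ A")
      case True
      have "(\<Sum>p\<in>P. ?w p) \<le> k * (\<Sum>p\<in>{1..N}. 1 / real p)"
        using P by (intro wsum) (auto simp: Suc_le_eq prime_gt_0_nat)
      also have "(\<Sum>p\<in>{1..N}. 1 / real p) \<le> (\<Sum>p\<in>{1..N}. 1)" by (intro sum_mono) auto
      also have "\<dots> \<le> 2 ^ A" using True by (simp flip: of_nat_le_iff)
      finally have "(\<Sum>p\<in>P. ?w p) \<le> k * 2 ^ A" by (simp add: k_def mult_left_mono)
      hence "1 \<le> C1 * exp (- (\<Sum>p\<in>P. ?w p))" unfolding C1_def by (simp flip: exp_add)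
      also have "\<dots> \<le> C * exp (- (\<Sum>p\<in>P. ?w p))"
        unfolding C_def using C12 by (intro mult_right_mono) auto
      finally have 1: "1 \<le> C * exp (- (\<Sum>p\<in>P. ?w p))" .
      have "?S P \<le> card {1..N}" by (intro card_mono) auto
      hence "real (?S P) \<le> real N * 1" by simp
      also have "\<dots> \<le> real N * (C * exp (- (\<Sum>p\<in>P. ?w p)))" using 1 by (intro mult_left_mono) auto
      finally show ?thesis by (simp add: mult_ac)
    next
      case False
      have ex: "\<exists>t. 2 ^ (A * 2 ^ t) \<le> N \<and> N < 2 ^ (A * 2 ^ Suc t)"
      proof -
        have "N < 2 ^ N" by (rule less_exp)
        also have "(2::nat) ^ N \<le> 2 ^ (A * 2 ^ N)"
        proof (intro power_increasing)
          have "N \<le> 1 * 2 ^ N" using less_exp[of N] by simp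
          also have "\<dots> \<le> A * 2 ^ N" by (intro mult_right_mono) (auto simp: A_def)
          finally show "N \<le> A * 2 ^ N" .
        qed simp
        finally have ex: "\<exists>t. N < 2 ^ (A * 2 ^ t)" by blast
        define s where "s = (LEAST t. N < 2 ^ (A * 2 ^ t))"
        have s: "N < 2 ^ (A * 2 ^ s)" unfolding s_def by (rule LeastI_ex[OF ex])
        have "s \<noteq> 0"
      proof
        assume "s = 0"
        thus False using s False by simp
      qed
        then obtain t where t: "s = Suc t" by (cases s) auto
        have "\<not> N < 2 ^ (A * 2 ^ t)" using not_less_Least[of t "\<lambda>t. N < 2 ^ (A * 2 ^ t)"] t unfolding s_def by simp
        thus ?thesis using s t not_less by metis
      qed
      then obtain t where t: "2 ^ (A * 2 ^ t) \<le> N" "N < 2 ^ (A * 2 ^ Suc t)" by blast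
      define z :: nat where "z = 2 ^ 2 ^ t"
      have z2: "z \<ge> 2" unfolding z_def using power_increasing[of 1 "2 ^ t" "2::nat"] by simp
      have zN: "z \<le> N" "2 ^ ((8 + 4 * \<kappa>) * 2 ^ t) * z \<le> N" "N < z ^ (2 * A)"
      proof -
        have "(2::nat) ^ ((8 + 4 * \<kappa>) * 2 ^ t) * z = 2 ^ (A * 2 ^ t)"
          unfolding z_def A_def by (simp add: algebra_simps flip: power_add)
        thus *: "2 ^ ((8 + 4 * \<kappa>) * 2 ^ t) * z \<le> N" using t by simp
        have "1 * z \<le> 2 ^ ((8 + 4 * \<kappa>) * 2 ^ t) * z" by (intro mult_right_mono) auto
        thus "z \<le> N" using * by linarith
        have "z ^ (2 * A) = 2 ^ (2 ^ t * (2 * A))" by (simp only: z_def power_mult)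
        also have "2 ^ t * (2 * A) = A * 2 ^ Suc t" by simp
        finally show "N < z ^ (2 * A)" using t(2) by simp
      qed
      define Q where "Q = {p\<in>P. 2 < p \<and> p \<le> z}"
      define V where "V = (\<Sum>p\<in>Q. ?w p)"
      have PQ: "(\<Sum>p\<in>P. ?w p) \<le> V + k * (2 + ln (2 * real A) + 13)"
      proof -
        have "p = 2 \<or> 2 < p" if "p \<in> P" for p
          using prime_ge_2_nat[of p] P[OF that] by linarith
        hence "P = Q \<union> ({p\<in>P. p = 2} \<union> {p\<in>P. z < p})"
          unfolding Q_def by (auto simp: not_le)
        also have "(\<Sum>p\<in>\<dots>. ?w p) = V + (\<Sum>p\<in>{p\<in>P. p = 2} \<union> {p\<in>P. z < p}. ?w p)"
          unfolding V_def by (intro sum.union_disjoint) (use finP in \<open>auto simp: Q_def\<close>)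
        finally have 1: "(\<Sum>p\<in>P. ?w p) = V + (\<Sum>p\<in>{p\<in>P. p = 2} \<union> {p\<in>P. z < p}. ?w p)" .
        have "(\<Sum>p\<in>{p\<in>P. p = 2} \<union> {p\<in>P. z < p}. ?w p) \<le> k * (\<Sum>p\<in>{2} \<union> {p. prime p \<and> z < p \<and> p \<le> N}. 1 / real p)"
          by (intro wsum) (use P in \<open>auto intro: finite_subset[OF _ finite_primes_le[of N]]\<close>)
        also have "(\<Sum>p\<in>{2} \<union> {p. prime p \<and> z < p \<and> p \<le> N}. 1 / real p) = 1/2 + (\<Sum>p | prime p \<and> z < p \<and> p \<le> N. 1 / real p)"
          using z2 by (subst sum.union_disjoint) (auto intro: finite_subset[OF _ finite_primes_le[of N]])
        also have "\<dots> \<le> 2 + (ln (ln (real N)) - ln (ln (real z)) + 13)"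
          using prime_recip_sum_diff_eq[OF zN(1)] prime_recip_sum_diff_le[of z N] z2 zN(1) by simp
        also have "ln (ln (real N)) \<le> ln (ln (real (z ^ (2 * A))))"
          using zN z2 by (subst ln_le_cancel_iff) (auto simp flip: of_nat_power)
        also have "ln (ln (real (z ^ (2 * A)))) = ln (2 * real A) + ln (ln (real z))"
          using z2 by (simp add: ln_realpow ln_mult A_def)
        finally have "(\<Sum>p\<in>{p\<in>P. p = 2} \<union> {p\<in>P. z < p}. ?w p) \<le> k * (2 + ln (2 * real A) + 13)"
          by (simp add: k_def mult_left_mono)
        thus ?thesis using 1 by linarith
      qed
      have z_inv: "1 / real z \<le> exp (9 * k) * fact \<kappa> * exp (- V)"
      proof -
        have "V \<le> k * prime_recip_sum z" unfolding V_def prime_recip_sum_def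
          by (intro wsum) (use P in \<open>auto simp: Q_def\<close>)
        also have "\<dots> \<le> k * (ln (ln (real z)) + 9)"
          using prime_recip_sum_upper[OF z2] by (intro mult_left_mono) (auto simp: k_def)
        finally have "exp V \<le> exp (9 * k) * exp (k * ln (ln (real z)))" by (simp add: algebra_simps flip: exp_add)
        also have "exp (k * ln (ln (real z))) = ln (real z) ^ \<kappa>"
          using z2 by (simp add: k_def exp_of_nat_mult)
        also have "\<dots> \<le> fact \<kappa> * real z"
        proof -
          have "(\<Sum>n\<in>{\<kappa>}. inverse (fact n) * ln (real z) ^ n) \<le> (\<Sum>n. inverse (fact n) * ln (real z) ^ n)"
            by (intro sum_le_suminf summable_exp) (use z2 in auto)
          hence "ln (real z) ^ \<kappa> / fact \<kappa> \<le> exp (ln (real z))" by (simp add: exp_def field_simps)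
          thus ?thesis using z2 by (simp add: field_simps)
        qed
        finally have "exp V \<le> exp (9 * k) * (fact \<kappa> * real z)" by (simp add: mult_left_mono)
        thus ?thesis using z2 by (simp add: exp_minus field_simps)
      qed
      have "?S P \<le> ?S Q" by (intro card_mono) (auto simp: Q_def)
      hence "real (?S P) \<le> real (?S Q)" by simp
      also have "\<dots> \<le> real N * exp (exp (28 * k)) * exp (- V) + 2 ^ ((8 + 4 * \<kappa>) * 2 ^ t)"
        unfolding V_def k_def by (rule sieve_dyadic) (use P in \<open>auto simp: Q_def z_def\<close>)
      also have "2 ^ ((8 + 4 * \<kappa>) * 2 ^ t) \<le> real N * (1 / real z)"
      proof -
        have "real (2 ^ ((8 + 4 * \<kappa>) * 2 ^ t) * z) \<le> real N" using zN(2) of_nat_le_iff by blast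
        thus ?thesis using z2 by (simp add: field_simps)
      qed
      also have "real N * (1 / real z) \<le> real N * (exp (9 * k) * fact \<kappa> * exp (- V))"
        using z_inv by (intro mult_left_mono) auto
      also have "real N * exp (exp (28 * k)) * exp (- V) + real N * (exp (9 * k) * fact \<kappa> * exp (- V)) =
          real N * (exp (exp (28 * k)) + exp (9 * k) * fact \<kappa>) * exp (- V)" by (simp add: algebra_simps)
      also have "\<dots> \<le> real N * (exp (exp (28 * k)) + exp (9 * k) * fact \<kappa>) * (C2 * exp (- (\<Sum>p\<in>P. ?w p)))"
        using PQ by (intro mult_left_mono) (auto simp: C2_def simp flip: exp_add)
      also have "\<dots> = (C - C1) * real N * exp (- (\<Sum>p\<in>P. ?w p))" by (simp add: C_def mult_ac)
      also have "\<dots> \<le> C * real N * exp (- (\<Sum>p\<in>P. ?w p))"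
        using C12 by (intro mult_right_mono) auto
      finally show ?thesis by simp
    qed
  qed (rule C12)
qed

section \<open>Simultaneous prime values of linear forms\<close>

text \<open>The primes up to \<open>ln x\<close> contribute at most \<open>ln (ln (ln x)) + O(1)\<close>; there are at most \<open>2 * ln x\<close>
  others dividing \<open>D\<close>, each contributing less than \<open>1 / ln x\<close>.\<close>
lemma sum_recip_prime_factors_bound:
  "\<exists>C>0. \<forall>D x. 1 \<le> D \<longrightarrow> real D \<le> x \<longrightarrow> 16 \<le> x \<longrightarrow>
      exp (\<Sum>p\<in>prime_factors D. 1 / real p) \<le> C * ln (ln x)"
proof (intro exI[of _ "exp 11"] conjI allI impI)
  fix D :: nat and x :: real assume D: "1 \<le> D" "real D \<le> x" "16 \<le> x"
  have x2: "ln x \<ge> 2"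
  proof -
    have "exp 2 = exp 1 * exp (1::real)" by (simp flip: exp_add)
    also have "\<dots> \<le> 3 * 3" using exp_le by (intro mult_mono) auto
    also have "\<dots> \<le> x" using D by simp
    finally show ?thesis using D by (simp add: ln_ge_iff)
  qed
  define Y where "Y = nat \<lfloor>ln x\<rfloor>"
  have Y: "Y \<ge> 2" "real Y \<le> ln x" "ln x < real Y + 1"
    unfolding Y_def using x2 by (auto simp: le_nat_iff le_floor_iff)
  let ?A = "{p\<in>prime_factors D. p \<le> Y}" and ?B = "{p\<in>prime_factors D. Y < p}"
  have "(\<Sum>p\<in>prime_factors D. 1 / real p) = (\<Sum>p\<in>?A \<union> ?B. 1 / real p)"
    by (intro sum.cong) auto
  also have "\<dots> = (\<Sum>p\<in>?A. 1 / real p) + (\<Sum>p\<in>?B. 1 / real p)"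
    by (intro sum.union_disjoint) auto
  also have "(\<Sum>p\<in>?A. 1 / real p) \<le> prime_recip_sum Y"
    unfolding prime_recip_sum_def by (intro sum_mono2) (auto intro: in_prime_factors_imp_prime)
  also have "\<dots> \<le> ln (ln (real Y)) + 9" by (rule prime_recip_sum_upper[OF Y(1)])
  also have "ln (ln (real Y)) \<le> ln (ln (ln x))" using Y x2 by (subst ln_le_cancel_iff) auto
  also have "(\<Sum>p\<in>?B. 1 / real p) \<le> (\<Sum>p\<in>?B. 1 / ln x)"
    using Y x2 by (intro sum_mono divide_left_mono) auto
  also have "\<dots> = real (card ?B) / ln x" by simp
  also have "\<dots> \<le> (2 * ln x) / ln x"
  proof (intro divide_right_mono)
    have "real (card ?B) \<le> real (card (prime_factors D))" by (simp add: card_mono)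
    moreover have "2 ^ card (prime_factors D) \<le> D"
    proof -
      have "(2::nat) ^ card (prime_factors D) = (\<Prod>p\<in>prime_factors D. 2)" by simp
      also have "\<dots> \<le> (\<Prod>p\<in>prime_factors D. p ^ multiplicity p D)"
      proof (intro prod_mono conjI)
        fix p assume p: "p \<in> prime_factors D"
        hence "2 \<le> p" "multiplicity p D > 0" by (auto simp: prime_factors_multiplicity prime_ge_2_nat)
        thus "2 \<le> p ^ multiplicity p D" by (metis Suc_leI self_le_power le_trans One_nat_def one_le_numeral)
      qed auto
      also have "\<dots> = D" using D(1) prime_factorization_nat[of D] by simp
      finally show ?thesis .
    qed
    hence "real (2 ^ card (prime_factors D)) \<le> x" using D(2) of_nat_le_iff order_trans by blast
    hence "ln (real (2 ^ card (prime_factors D))) \<le> ln x" using D by (subst ln_le_cancel_iff) auto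
    hence "real (card (prime_factors D)) * ln 2 \<le> ln x" unfolding ln_two_power .
    moreover have "real (card (prime_factors D)) * (1/2) \<le> real (card (prime_factors D)) * ln 2"
      using ln2_ge_two_thirds by (intro mult_left_mono) auto
    ultimately show "real (card ?B) \<le> 2 * ln x" by linarith
  qed (use x2 in auto)
  also have "(2 * ln x) / ln x = 2" using x2 by simp
  finally have "(\<Sum>p\<in>prime_factors D. 1 / real p) \<le> 11 + ln (ln (ln x))" by simp
  hence "exp (\<Sum>p\<in>prime_factors D. 1 / real p) \<le> exp (11 + ln (ln (ln x)))" by simp
  also have "\<dots> = exp 11 * ln (ln x)" using x2 by (simp add: exp_add)
  finally show "exp (\<Sum>p\<in>prime_factors D. 1 / real p) \<le> exp 11 * ln (ln x)" .
qed simp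

lemma power_le_fact_exp:
  fixes u :: real assumes "u \<ge> 0" shows "u ^ n \<le> fact n * exp u"
proof -
  have "(\<Sum>k\<in>{n}. inverse (fact k) * u ^ k) \<le> (\<Sum>k. inverse (fact k) * u ^ k)"
    by (intro sum_le_suminf summable_exp) (use assms in auto)
  thus ?thesis by (simp add: exp_def field_simps)
qed

text \<open>If all values \<open>c * b + d\<close> are prime and exceed \<open>sqrt B\<close>, then \<open>b\<close> avoids, for each prime up to
  \<open>sqrt B\<close>, the roots of all forms. Away from \<open>D\<close> the forms have exactly \<open>\<kappa>\<close> distinct roots modulo
  \<open>p\<close>: the divisibility conditions say that leading coefficients and resultants are invertible there.
  Discarding the primes that divide \<open>D\<close> costs the exponential factor.\<close>
lemma linear_forms_prime_count:
  fixes \<kappa> :: nat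
  shows "\<exists>C>0. \<forall>F D B. finite F \<longrightarrow> card F = \<kappa> \<longrightarrow> D \<ge> 1 \<longrightarrow> B \<ge> 2 \<longrightarrow>
     (\<forall>(c,d)\<in>F. c \<ge> 1 \<and> c dvd D) \<longrightarrow>
     (\<forall>(c,d)\<in>F. \<forall>(c',d')\<in>F. (c,d) \<noteq> (c',d') \<longrightarrow> (int c * int d' - int c' * int d) dvd int D) \<longrightarrow>
     real (card {b\<in>{1..B}. \<forall>(c,d)\<in>F. prime (c * b + d)}) \<le>
       C * real B / ln (real B) ^ \<kappa> * exp (real \<kappa> * (\<Sum>p\<in>prime_factors D. 1 / real p))"
proof -
  obtain C0 where C0: "C0 > 0" and sieve: "\<forall>N P \<Omega>. N \<ge> 1 \<longrightarrow>
     (\<forall>p\<in>P. prime p \<and> p \<le> N \<and> \<Omega> p \<subseteq> {..<p} \<and> card (\<Omega> p) \<le> \<kappa>) \<longrightarrow>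
     real (card {j\<in>{1..N}. \<forall>p\<in>P. j mod p \<notin> \<Omega> p}) \<le>
       C0 * real N * exp (- (\<Sum>p\<in>P. real (card (\<Omega> p)) / real p))"
    using sieve_upper_bound[of \<kappa>] by (elim exE conjE)
  define k where "k = real \<kappa>"
  define C where "C = 2 ^ \<kappa> * fact \<kappa> + C0 * exp (k * (ln 4 + 4)) + 2 ^ \<kappa>"
  have Cpos: "C > 0" unfolding C_def using C0 by (intro add_pos_pos) auto
  show ?thesis
  proof (intro exI[of _ C] conjI allI impI)
    fix F :: "(nat \<times> nat) set" and D B :: nat
    assume F: "finite F" "card F = \<kappa>" and D: "D \<ge> 1" and B: "B \<ge> 2"
      and cD: "\<forall>(c,d)\<in>F. c \<ge> 1 \<and> c dvd D"
      and det: "\<forall>(c,d)\<in>F. \<forall>(c',d')\<in>F. (c,d) \<noteq> (c',d') \<longrightarrow> (int c * int d' - int c' * int d) dvd int D"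
    let ?S = "{b\<in>{1..B}. \<forall>(c,d)\<in>F. prime (c * b + d)}"
    let ?s = "\<Sum>p\<in>prime_factors D. 1 / real p"
    have cF: "1 \<le> fst f \<and> fst f dvd D" if "f \<in> F" for f using cD that by (cases f) auto
    have s0: "?s \<ge> 0" by (intro sum_nonneg) auto
    have es: "exp (k * ?s) \<ge> 1" using s0 by (simp add: k_def)
    have lB: "ln (real B) > 0" using B by simp
    show "real (card ?S) \<le> C * real B / ln (real B) ^ \<kappa> * exp (real \<kappa> * ?s)"
    proof (cases "B < 4")
      case True
      have "card ?S \<le> card {1..B}" by (intro card_mono) auto
      hence "real (card ?S) \<le> real B" by simp
      also have "\<dots> \<le> real B * (2 ^ \<kappa> / ln (real B) ^ \<kappa>)"
      proof -
        have "ln (real B) \<le> ln 4" using True B by (subst ln_le_cancel_iff) auto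
        hence "ln (real B) \<le> 2" using ln4_le by linarith
        hence "ln (real B) ^ \<kappa> \<le> 2 ^ \<kappa>" using lB by (intro power_mono) auto
        hence "1 \<le> 2 ^ \<kappa> / ln (real B) ^ \<kappa>" using lB by simp
        from mult_left_mono[OF this, of "real B"] show ?thesis by simp
      qed
      also have "\<dots> \<le> C * real B / ln (real B) ^ \<kappa>"
        using lB C0 by (simp add: C_def divide_right_mono mult.commute mult_left_mono add_nonneg_nonneg)
      also have "\<dots> \<le> C * real B / ln (real B) ^ \<kappa> * exp (k * ?s)"
        using es lB Cpos mult_left_mono[OF es, of "C * real B / ln (real B) ^ \<kappa>"] by simp
      finally show ?thesis by (simp add: k_def)
    next
      case False
      define M where "M = nat \<lfloor>sqrt (real B)\<rfloor>"
      have M: "real M \<le> sqrt (real B)" "sqrt (real B) < real M + 1" "2 \<le> M"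
      proof -
        have "sqrt (real B) \<ge> sqrt 4" using False by (subst real_sqrt_le_iff) auto
        hence "sqrt (real B) \<ge> 2" by simp
        thus "real M \<le> sqrt (real B)" "sqrt (real B) < real M + 1" "2 \<le> M"
          unfolding M_def by (auto simp: le_nat_iff le_floor_iff)
      qed
      have MB: "M \<le> B"
      proof -
        have "real M * 1 \<le> real M * real M" using M by (intro mult_left_mono) auto
        also have "\<dots> \<le> sqrt (real B) * sqrt (real B)" using M by (intro mult_mono) auto
        finally show ?thesis by simp
      qed
      have lM: "ln (real B) \<le> 4 * ln (real M)"
      proof -
        have "real M + 1 \<le> real M ^ 2"
        proof -
          have "real M * 2 \<le> real M * real M" using M by (intro mult_left_mono) auto
          moreover have "real M \<ge> 2" using M(3) by simp
          ultimately show ?thesis unfolding power2_eq_square by linarith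
        qed
        hence "sqrt (real B) \<le> real M ^ 2" using M by linarith
        hence "sqrt (real B) ^ 2 \<le> (real M ^ 2) ^ 2" by (intro power_mono) auto
        hence "real B \<le> real M ^ 4" by simp
        hence "ln (real B) \<le> ln (real M ^ 4)" using B M by (subst ln_le_cancel_iff) auto
        thus ?thesis using M by (simp add: ln_realpow)
      qed
      define P where "P = {p. prime p \<and> p \<le> M \<and> \<not> p dvd D}"
      define \<Omega> where "\<Omega> p = {r\<in>{..<p}. \<exists>(c,d)\<in>F. p dvd c * r + d}" for p
      have finP: "finite P" unfolding P_def by (rule finite_subset[OF _ finite_primes_le[of M]]) auto
      have cardO: "card (\<Omega> p) = \<kappa>" if "p \<in> P" for p
      proof -
        have p: "prime p" "\<not> p dvd D" "p > 0" using that by (auto simp: P_def prime_gt_0_nat)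
        have ex: "\<exists>r<p. p dvd fst f * r + snd f" if "f \<in> F" for f
        proof -
          have "fst f dvd D" using cF that by blast
          hence "\<not> p dvd fst f" using p dvd_trans by blast
          hence "coprime (fst f) p" using p(1) by (metis coprime_commute prime_imp_coprime)
          then obtain u where u: "[fst f * u = 1] (mod p)" using cong_solve_coprime_nat[of "fst f" p] by auto
          define r where "r = (u * (p - 1) * snd f) mod p"
          have "[fst f * r + snd f = fst f * (u * (p - 1) * snd f) + snd f] (mod p)"
            unfolding r_def by (intro cong_add cong_mult) (auto simp: Cong.cong_def)
          also have "fst f * (u * (p - 1) * snd f) + snd f = (fst f * u) * ((p - 1) * snd f) + snd f" by (simp add: mult_ac)
          also have "[\<dots> = 1 * ((p - 1) * snd f) + snd f] (mod p)" by (intro cong_add cong_mult u) auto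
          also have "1 * ((p - 1) * snd f) + snd f = p * snd f" using p by (cases p) auto
          finally have "[fst f * r + snd f = 0] (mod p)" by (simp add: Cong.cong_def)
          hence "p dvd fst f * r + snd f" by (simp add: cong_0_iff)
          moreover have "r < p" unfolding r_def using p by simp
          ultimately show ?thesis by blast
        qed
        then obtain \<phi> where \<phi>: "\<And>f. f \<in> F \<Longrightarrow> \<phi> f < p \<and> p dvd fst f * \<phi> f + snd f" by metis
        have uniq: "r = r'" if "f \<in> F" "r < p" "r' < p" "p dvd fst f * r + snd f" "p dvd fst f * r' + snd f" for f r r'
        proof -
          have "fst f dvd D" using cF that by blast
          hence "\<not> p dvd fst f" using p dvd_trans by blast
          hence co: "coprime (fst f) p" using p(1) by (metis coprime_commute prime_imp_coprime)
          have "[fst f * r + snd f = fst f * r' + snd f] (mod p)"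
            using that(4,5) by (simp add: Cong.cong_def dvd_eq_mod_eq_0)
          hence "[fst f * r = fst f * r'] (mod p)" by (simp add: cong_add_rcancel_nat)
          hence "[r = r'] (mod p)" using co by (simp add: cong_mult_lcancel_nat)
          thus ?thesis using that by (simp add: Cong.cong_def)
        qed
        have inj: "inj_on \<phi> F"
        proof (rule inj_onI, rule ccontr)
          fix f g assume fg: "f \<in> F" "g \<in> F" "\<phi> f = \<phi> g" "f \<noteq> g"
          have "int p dvd int (fst f * \<phi> f + snd f)" "int p dvd int (fst g * \<phi> f + snd g)"
            using \<phi>[OF fg(1)] \<phi>[OF fg(2)] fg(3) by (simp_all only: int_dvd_int_iff)
          hence "int p dvd int (fst f) * int (fst g * \<phi> f + snd g) - int (fst g) * int (fst f * \<phi> f + snd f)"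
            by (intro dvd_diff dvd_mult)
          also have "int (fst f) * int (fst g * \<phi> f + snd g) - int (fst g) * int (fst f * \<phi> f + snd f) =
             int (fst f) * int (snd g) - int (fst g) * int (snd f)" by (simp add: algebra_simps)
          also have "\<dots> dvd int D" using det fg by (cases f; cases g) fastforce
          finally show False using p by (simp only: int_dvd_int_iff)
        qed
        have "\<Omega> p = \<phi> ` F"
        proof (intro equalityI subsetI)
          fix r assume "r \<in> \<Omega> p"
          then obtain f where f: "f \<in> F" "r < p" "p dvd fst f * r + snd f" unfolding \<Omega>_def by fastforce
          hence "r = \<phi> f" using uniq \<phi> by blast
          thus "r \<in> \<phi> ` F" using f by blast
        next
          fix r assume "r \<in> \<phi> ` F"
          thus "r \<in> \<Omega> p" using \<phi> unfolding \<Omega>_def by fastforce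
        qed
        thus ?thesis using inj F by (simp add: card_image)
      qed
      have sub: "?S \<subseteq> {1..M} \<union> {j\<in>{1..B}. \<forall>p\<in>P. j mod p \<notin> \<Omega> p}"
      proof
        fix b assume b: "b \<in> ?S"
        show "b \<in> {1..M} \<union> {j\<in>{1..B}. \<forall>p\<in>P. j mod p \<notin> \<Omega> p}"
        proof (cases "b \<le> M")
          case False
          have "b mod p \<notin> \<Omega> p" if p: "p \<in> P" for p
          proof
            assume "b mod p \<in> \<Omega> p"
            then obtain c d where cd: "(c,d) \<in> F" "p dvd c * (b mod p) + d" unfolding \<Omega>_def by auto
            have "[c * (b mod p) + d = c * b + d] (mod p)" by (intro cong_add cong_mult) (auto simp: Cong.cong_def)
            hence "p dvd c * b + d" using cd cong_dvd_iff by blast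
            moreover have "prime (c * b + d)" using b cd by auto
            ultimately have "p = c * b + d" using p by (auto simp: P_def primes_dvd_imp_eq)
            moreover have "c \<ge> 1" using cD cd by auto
            hence "1 * b \<le> c * b" by (intro mult_right_mono) auto
            moreover have "p \<le> M" using p by (simp add: P_def)
            ultimately show False using False by linarith
          qed
          thus ?thesis using b by auto
        qed (use b in auto)
      qed
      have "card ?S \<le> card ({1..M} \<union> {j\<in>{1..B}. \<forall>p\<in>P. j mod p \<notin> \<Omega> p})" by (intro card_mono sub) auto
      also have "\<dots> \<le> card {1..M} + card {j\<in>{1..B}. \<forall>p\<in>P. j mod p \<notin> \<Omega> p}" by (rule card_Un_le)
      finally have 1: "real (card ?S) \<le> real M + real (card {j\<in>{1..B}. \<forall>p\<in>P. j mod p \<notin> \<Omega> p})" by simp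
      have 2: "real (card {j\<in>{1..B}. \<forall>p\<in>P. j mod p \<notin> \<Omega> p}) \<le> C0 * real B * exp (- (\<Sum>p\<in>P. real (card (\<Omega> p)) / real p))"
        by (rule sieve[rule_format]) (use B MB cardO in \<open>auto simp: P_def \<Omega>_def\<close>)
      have sumP: "(\<Sum>p\<in>P. real (card (\<Omega> p)) / real p) \<ge> k * (ln (ln (real B)) - ln 4 - 4 - ?s)"
      proof -
        have "(\<Sum>p\<in>P. real (card (\<Omega> p)) / real p) = (\<Sum>p\<in>P. k * (1 / real p))"
          by (intro sum.cong) (auto simp: cardO k_def)
        also have "\<dots> = k * (\<Sum>p\<in>P. 1 / real p)" by (rule sum_distrib_left[symmetric])
        finally have e: "(\<Sum>p\<in>P. real (card (\<Omega> p)) / real p) = k * (\<Sum>p\<in>P. 1 / real p)" .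
        have "prime_recip_sum M \<le> (\<Sum>p\<in>P \<union> prime_factors D. 1 / real p)"
          unfolding prime_recip_sum_def using D finP
          by (intro sum_mono2) (auto simp: P_def prime_factors_dvd)
        also have "\<dots> \<le> (\<Sum>p\<in>P. 1 / real p) + ?s"
          by (subst sum.union_inter[symmetric]) (use finP in \<open>auto intro: sum_nonneg simp: sum_Un\<close>)
        finally have "(\<Sum>p\<in>P. 1 / real p) \<ge> prime_recip_sum M - ?s" by simp
        moreover have "prime_recip_sum M \<ge> ln (ln (real M)) - 4" by (rule prime_recip_sum_lower[OF M(3)])
        moreover have "ln (ln (real B)) \<le> ln 4 + ln (ln (real M))"
        proof -
          have "ln (ln (real B)) \<le> ln (4 * ln (real M))" using lM lB M by (subst ln_le_cancel_iff) auto
          also have "\<dots> = ln 4 + ln (ln (real M))" using M by (subst ln_mult) auto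
          finally show ?thesis .
        qed
        ultimately have "ln (ln (real B)) - ln 4 - 4 - ?s \<le> (\<Sum>p\<in>P. 1 / real p)" by linarith
        thus ?thesis unfolding e by (intro mult_left_mono) (auto simp: k_def)
      qed
      have 3: "exp (- (\<Sum>p\<in>P. real (card (\<Omega> p)) / real p)) \<le> exp (k * (ln 4 + 4)) * (1 / ln (real B) ^ \<kappa>) * exp (k * ?s)"
      proof -
        have "exp (- (\<Sum>p\<in>P. real (card (\<Omega> p)) / real p)) \<le> exp (k * (ln 4 + 4) + (- (k * ln (ln (real B)))) + k * ?s)"
          using sumP by (simp add: algebra_simps)
        also have "\<dots> = exp (k * (ln 4 + 4)) * exp (- (k * ln (ln (real B)))) * exp (k * ?s)" by (simp only: exp_add)
        also have "exp (- (k * ln (ln (real B)))) = 1 / ln (real B) ^ \<kappa>"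
          using lB by (simp add: exp_minus k_def exp_of_nat_mult inverse_eq_divide)
        finally show ?thesis .
      qed
      have 4: "real M \<le> 2 ^ \<kappa> * fact \<kappa> * real B / ln (real B) ^ \<kappa>"
      proof -
        have "ln (real B) ^ \<kappa> = (2 * ln (sqrt (real B))) ^ \<kappa>" using B by (simp add: ln_sqrt)
        also have "\<dots> = 2 ^ \<kappa> * ln (sqrt (real B)) ^ \<kappa>" by (rule power_mult_distrib)
        also have "\<dots> \<le> 2 ^ \<kappa> * (fact \<kappa> * exp (ln (sqrt (real B))))"
          using B by (intro mult_left_mono power_le_fact_exp) auto
        also have "exp (ln (sqrt (real B))) = sqrt (real B)" using B by simp
        finally have "real M * ln (real B) ^ \<kappa> \<le> sqrt (real B) * (2 ^ \<kappa> * (fact \<kappa> * sqrt (real B)))"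
          using M lB by (intro mult_mono) auto
        also have "\<dots> = 2 ^ \<kappa> * fact \<kappa> * (sqrt (real B) * sqrt (real B))" by (simp only: mult_ac)
        also have "\<dots> = 2 ^ \<kappa> * fact \<kappa> * real B" by simp
        finally show ?thesis using lB by (simp add: pos_le_divide_eq)
      qed
      have "real (card ?S) \<le> 2 ^ \<kappa> * fact \<kappa> * real B / ln (real B) ^ \<kappa> * exp (k * ?s) +
          C0 * real B * (exp (k * (ln 4 + 4)) * (1 / ln (real B) ^ \<kappa>) * exp (k * ?s))"
      proof -
        have "2 ^ \<kappa> * fact \<kappa> * real B / ln (real B) ^ \<kappa> * 1 \<le> 2 ^ \<kappa> * fact \<kappa> * real B / ln (real B) ^ \<kappa> * exp (k * ?s)"
          using es lB by (intro mult_left_mono) auto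
        moreover have "C0 * real B * exp (- (\<Sum>p\<in>P. real (card (\<Omega> p)) / real p)) \<le>
           C0 * real B * (exp (k * (ln 4 + 4)) * (1 / ln (real B) ^ \<kappa>) * exp (k * ?s))"
          using 3 C0 by (intro mult_left_mono) auto
        ultimately show ?thesis using 1 2 4 by linarith
      qed
      also have "\<dots> = (2 ^ \<kappa> * fact \<kappa> + C0 * exp (k * (ln 4 + 4))) * real B / ln (real B) ^ \<kappa> * exp (k * ?s)"
        by (simp add: add_divide_distrib distrib_right)
      also have "\<dots> \<le> C * real B / ln (real B) ^ \<kappa> * exp (k * ?s)"
        unfolding C_def using lB by (intro mult_right_mono divide_right_mono) auto
      finally show ?thesis by (simp add: k_def)
    qed
  qed (rule Cpos)
qed

section \<open>Weights depending on the number of prime factors\<close>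

text \<open>\<open>\<Omega>\<close> restricted to the primes up to \<open>T\<close>: multiplicity counts, which makes it completely additive.\<close>
definition om :: "nat \<Rightarrow> nat \<Rightarrow> nat" where
  "om T n = size (filter_mset (\<lambda>p. p \<le> T) (prime_factorization n))"

definition wt :: "nat \<Rightarrow> nat \<Rightarrow> real" where
  "wt T n = (1 / 2) ^ om T n"

lemma om_1 [simp]: "om T (Suc 0) = 0" by (simp add: om_def)

lemma om_mult: "m > 0 \<Longrightarrow> n > 0 \<Longrightarrow> om T (m * n) = om T m + om T n"
  by (simp add: om_def prime_factorization_mult)

lemma om_prime: "prime p \<Longrightarrow> om T p = (if p \<le> T then 1 else 0)"
  by (simp add: om_def prime_factorization_prime)

lemma wt_mult: "m > 0 \<Longrightarrow> n > 0 \<Longrightarrow> wt T (m * n) = wt T m * wt T n"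
  by (simp add: wt_def om_mult power_add)

lemma wt_bounds: "0 < wt T n" "wt T n \<le> 1"
  by (auto simp: wt_def power_le_one)

lemma wt_prime: "prime p \<Longrightarrow> wt T p = (if p \<le> T then 1 / 2 else 1)"
  by (simp add: wt_def om_prime)

text \<open>The Euler product over the primes up to \<open>T\<close> has exponent \<open>1/2\<close> instead of \<open>1\<close>, which saves the
  factor \<open>sqrt (ln T)\<close>.\<close>
lemma sum_wt_over_n_le:
  assumes "2 \<le> T" "T \<le> M"
  shows "(\<Sum>a\<in>{1..M}. wt T a / real a) \<le> exp 15 * ln (real M) / sqrt (ln (real T))"
proof -
  let ?S = "{p. prime p \<and> p \<le> M}"
  let ?g = "\<lambda>n. wt T n / real n"
  have lT: "ln (real T) > 0" "ln (real M) > 0" using assms by auto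
  have "(\<Sum>a\<in>{1..M}. ?g a) \<le> (\<Prod>p\<in>?S. 1 / (1 - ?g p))"
  proof (rule sum_multiplicative_le_euler_product)
    fix n assume "n \<in> {1..M}"
    thus "n > 0 \<and> prime_factors n \<subseteq> ?S"
      by (auto intro: le_trans[OF dvd_imp_le] in_prime_factors_imp_prime dest: in_prime_factors_imp_dvd)
  next
    fix p assume "p \<in> ?S"
    hence "real p \<ge> 2" using prime_ge_2_nat[of p] by simp
    thus "?g p < 1" using wt_bounds(2)[of T p] by (simp add: field_simps)
  next
    fix n show "0 \<le> ?g n" using wt_bounds(1)[of T n] by simp
  qed (auto simp: wt_def wt_mult om_mult power_add)
  also have "\<dots> \<le> (\<Prod>p\<in>?S. exp (?g p + 2 * (1 / (real p)\<^sup>2)))"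
  proof (intro prod_mono conjI)
    fix p assume p: "p \<in> ?S"
    hence p2: "real p \<ge> 2" using prime_ge_2_nat[of p] by simp
    have w: "0 < wt T p" "wt T p \<le> 1" using wt_bounds by auto
    have g: "0 \<le> ?g p" "?g p \<le> 1 / 2"
    proof -
      have "?g p \<le> 1 / real p" using w p2 by (intro divide_right_mono) auto
      also have "\<dots> \<le> 1 / 2" using p2 by (simp add: field_simps)
      finally show "?g p \<le> 1 / 2" .
    qed (use w in simp)
    show "0 \<le> 1 / (1 - ?g p)" using g(2) by (intro divide_nonneg_nonneg) linarith+
    have "1 / (1 - ?g p) \<le> exp (?g p + 2 * (?g p)\<^sup>2)" by (rule one_over_one_minus_le_exp[OF g])
    also have "(?g p)\<^sup>2 \<le> 1 / (real p)\<^sup>2"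
      unfolding power_divide using w p2 by (intro divide_right_mono power_le_one) auto
    finally show "1 / (1 - ?g p) \<le> exp (?g p + 2 * (1 / (real p)\<^sup>2))" by simp
  qed
  also have "\<dots> = exp ((\<Sum>p\<in>?S. ?g p) + 2 * (\<Sum>p\<in>?S. 1 / (real p)\<^sup>2))"
    by (subst exp_sum[symmetric]) (auto simp: sum.distrib sum_distrib_left)
  also have "\<dots> \<le> exp ((\<Sum>p\<in>?S. ?g p) + 4)"
    using sum_inverse_squares_subset_le[of ?S] by auto
  also have "(\<Sum>p\<in>?S. ?g p) = prime_recip_sum M - 1/2 * prime_recip_sum T"
  proof -
    have "(\<Sum>p\<in>?S. ?g p) = (\<Sum>p\<in>?S. 1 / real p - (if p \<le> T then 1/2 * (1 / real p) else 0))"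
      by (intro sum.cong) (auto simp: wt_prime)
    also have "\<dots> = prime_recip_sum M - (\<Sum>p\<in>?S. if p \<le> T then 1/2 * (1 / real p) else 0)"
      by (simp add: sum_subtractf prime_recip_sum_def)
    also have "(\<Sum>p\<in>?S. if p \<le> T then 1/2 * (1 / real p) else 0) = (\<Sum>p | prime p \<and> p \<le> T. 1/2 * (1 / real p))"
      using assms by (subst sum.inter_filter[symmetric]) (auto intro!: sum.cong)
    also have "\<dots> = 1/2 * prime_recip_sum T" unfolding prime_recip_sum_def by (rule sum_distrib_left[symmetric])
    finally show ?thesis .
  qed
  also have "exp (prime_recip_sum M - 1/2 * prime_recip_sum T + 4) \<le> exp (15 + ln (ln (real M)) - 1/2 * ln (ln (real T)))"
    using prime_recip_sum_upper[of M] prime_recip_sum_lower[of T] assms by simp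
  also have "\<dots> = exp 15 * ln (real M) / sqrt (ln (real T))"
  proof -
    have "exp (1/2 * ln (ln (real T))) = sqrt (ln (real T))"
      using lT by (simp add: ln_sqrt[symmetric])
    thus ?thesis using lT by (simp add: exp_add exp_diff)
  qed
  finally show ?thesis .
qed

lemma divisor_sum_flip:
  fixes n :: nat and g :: "nat \<Rightarrow> nat \<Rightarrow> 'a :: comm_monoid_add"
  assumes "n > 0" shows "(\<Sum>d | d dvd n. g (n div d) d) = (\<Sum>d | d dvd n. g d (n div d))"
proof -
  have 1: "n div (n div d) = d" "n div d dvd n" if "d dvd n" for d
    using that assms by (auto elim!: dvdE)
  show ?thesis
    by (rule sum.reindex_bij_witness[of _ "\<lambda>d. n div d" "\<lambda>d. n div d"]) (use 1 in auto)
qed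

text \<open>The classical device of inserting \<open>ln m = sum of mangoldt d\<close> over \<open>d dvd m\<close>, dropping the weight of
  \<open>d\<close> and using Chebyshev's bound reduces the sum to the logarithmically weighted one. The
  integers with \<open>ln m\<close> much smaller than \<open>ln M\<close> are handled by \<open>ln (M / m) \<le> M / m\<close>.\<close>
lemma sum_wt_le:
  assumes "2 \<le> T" "T \<le> M"
  shows "(\<Sum>m\<in>{1..M}. wt T m) \<le> 5 * exp 15 * real M / sqrt (ln (real T))"
proof -
  have lT: "ln (real T) > 0" "ln (real M) > 0" using assms by auto
  let ?G = "\<Sum>a\<in>{1..M}. wt T a / real a"
  have "(\<Sum>m\<in>{1..M}. wt T m * ln (real m)) = (\<Sum>m\<in>{1..M}. \<Sum>d | d dvd m. wt T m * mangoldt d)"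
    by (intro sum.cong refl) (use ln_eq_sum_mangoldt in \<open>auto simp: sum_distrib_left\<close>)
  also have "\<dots> \<le> (\<Sum>m\<in>{1..M}. \<Sum>d | d dvd m. wt T (m div d) * mangoldt d)"
  proof (intro sum_mono mult_right_mono)
    fix m d assume "m \<in> {1..M}" "d \<in> {d. d dvd m}"
    then obtain k where k: "m = d * k" "d > 0" "k > 0" by (auto elim!: dvdE intro: Nat.gr0I)
    have "wt T m = wt T d * wt T k" unfolding k(1) using k by (simp add: wt_mult)
    also have "\<dots> \<le> 1 * wt T k" using wt_bounds(2)[of T d] wt_bounds(1)[of T k] by (intro mult_right_mono) auto
    finally show "wt T m \<le> wt T (m div d)" using k by simp
  qed (simp add: mangoldt_nonneg)
  also have "\<dots> = (\<Sum>m\<in>{1..M}. \<Sum>d | d dvd m. wt T d * mangoldt (m div d))"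
    by (intro sum.cong refl divisor_sum_flip) auto
  also have "\<dots> = (\<Sum>d\<in>{1..M}. \<Sum>e\<in>{1..M div d}. wt T d * mangoldt e)" by (rule sum_divisors_swap)
  also have "\<dots> = (\<Sum>d\<in>{1..M}. wt T d * (\<Sum>e\<in>{1..M div d}. mangoldt e))" by (simp add: sum_distrib_left)
  also have "\<dots> \<le> (\<Sum>d\<in>{1..M}. wt T d * (4 * (real M / real d)))"
  proof (intro sum_mono mult_left_mono)
    fix d
    have "real (M div d) \<le> real M / real d"
      using floor_divide_of_nat_eq[of M d, where 'a = real] by linarith
    thus "(\<Sum>e\<in>{1..M div d}. mangoldt e) \<le> 4 * (real M / real d)"
      using chebyshev_psi_le[of "M div d"] by linarith
  qed (use wt_bounds(1) less_imp_le in auto)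
  also have "\<dots> = 4 * real M * ?G" by (simp add: sum_distrib_left mult_ac)
  finally have 1: "(\<Sum>m\<in>{1..M}. wt T m * ln (real m)) \<le> 4 * real M * ?G" .
  have 2: "(\<Sum>m\<in>{1..M}. wt T m * (ln (real M) - ln (real m))) \<le> (\<Sum>m\<in>{1..M}. wt T m * (real M / real m))"
  proof (intro sum_mono mult_left_mono)
    fix m assume m: "m \<in> {1..M}"
    have "ln (real M) - ln (real m) = ln (real M / real m)" using m by (simp add: ln_divide_pos)
    also have "\<dots> \<le> real M / real m - 1" using m by (intro ln_le_minus_one) auto
    finally show "ln (real M) - ln (real m) \<le> real M / real m" by simp
  qed (use wt_bounds(1) less_imp_le in auto)
  have "ln (real M) * (\<Sum>m\<in>{1..M}. wt T m) = (\<Sum>m\<in>{1..M}. wt T m * ln (real m)) + (\<Sum>m\<in>{1..M}. wt T m * (ln (real M) - ln (real m)))"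
    by (simp add: sum_distrib_left sum.distrib[symmetric] algebra_simps)
  also have "\<dots> \<le> 4 * real M * ?G + (\<Sum>m\<in>{1..M}. wt T m * (real M / real m))" using 1 2 by simp
  also have "(\<Sum>m\<in>{1..M}. wt T m * (real M / real m)) = real M * ?G" by (simp add: sum_distrib_left mult_ac)
  also have "4 * real M * ?G + real M * ?G = 5 * real M * ?G" by simp
  also have "\<dots> \<le> 5 * real M * (exp 15 * ln (real M) / sqrt (ln (real T)))"
    by (intro mult_left_mono sum_wt_over_n_le assms) auto
  also have "\<dots> = ln (real M) * (5 * exp 15 * real M / sqrt (ln (real T)))" by simp
  finally show ?thesis using lT by (simp only: mult_le_cancel_left_pos)
qed

text \<open>The function is a divisor sum: its Dirichlet convolution with \<open>\<mu>\<close> is nonnegative since \<open>y \<ge> 1\<close>.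
  Adding a prime \<open>p\<close> to \<open>S\<close> therefore multiplies the bound by
  \<open>1 + (y - 1) / p + (y - 1) * y / p\<^sup>2 + \<dots> = 1 + (y - 1) / (p - y)\<close>.\<close>
lemma sum_power_filter_primes_le:
  fixes y :: real
  assumes y: "1 \<le> y" "y \<le> 3/2" and S: "finite S" "\<And>p. p \<in> S \<Longrightarrow> prime p"
  shows "(\<Sum>n\<in>{1..N}. y ^ size (filter_mset (\<lambda>p. p \<in> S) (prime_factorization n)))
           \<le> real N * exp ((y - 1) * (\<Sum>p\<in>S. 1 / (real p - y)))"
  using S
proof (induction S arbitrary: N rule: finite_induct)
  case empty thus ?case by simp
next
  case (insert p S)
  have p: "prime p" "real p \<ge> 2" using insert.prems prime_ge_2_nat[of p] by auto
  let ?F = "\<lambda>n. y ^ size (filter_mset (\<lambda>p. p \<in> S) (prime_factorization n))"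
  let ?E = "exp ((y - 1) * (\<Sum>p\<in>S. 1 / (real p - y)))"
  have IH: "(\<Sum>n\<in>{1..N}. ?F n) \<le> real N * ?E" for N by (rule insert.IH) (use insert.prems in auto)
  have split: "size (filter_mset (\<lambda>q. q \<in> insert p S) (prime_factorization n)) =
      multiplicity p n + size (filter_mset (\<lambda>q. q \<in> S) (prime_factorization n))" if "n > 0" for n
  proof -
    have "filter_mset (\<lambda>q. q \<in> insert p S) A = filter_mset (\<lambda>q. q = p) A + filter_mset (\<lambda>q. q \<in> S) A" for A :: "nat multiset"
      using insert.hyps by (intro multiset_eqI) auto
    thus ?thesis using p by (simp add: filter_eq_replicate_mset count_prime_factorization_prime)
  qed
  have pw: "y ^ k = 1 + (\<Sum>j\<in>{1..k}. (y - 1) * y ^ (j - 1))" for k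
    by (induction k) (auto simp: algebra_simps)
  have Fpk: "?F (p ^ j * m) = ?F m" if "m > 0" for j m
  proof -
    have e: "filter_mset (\<lambda>q. q \<in> S) (prime_factorization (p ^ j)) = {#}"
      using p insert.hyps by (simp add: prime_factorization_prime_power)
    have "prime_factorization (p ^ j * m) = prime_factorization (p ^ j) + prime_factorization m"
      using that p by (intro prime_factorization_mult) auto
    thus ?thesis by (simp only: filter_union_mset e add_0)
  qed
  have fl: "real (N div p ^ j) \<le> real N / real p ^ j" for j
    using floor_divide_of_nat_eq[of N "p ^ j", where 'a = real] by (simp add: of_nat_power) linarith
  have "(\<Sum>n\<in>{1..N}. y ^ size (filter_mset (\<lambda>q. q \<in> insert p S) (prime_factorization n))) =
        (\<Sum>n\<in>{1..N}. ?F n * y ^ multiplicity p n)"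
    by (intro sum.cong refl) (use split in \<open>simp add: power_add\<close>)
  also have "\<dots> = (\<Sum>n\<in>{1..N}. ?F n) + (\<Sum>n\<in>{1..N}. \<Sum>j\<in>{1..multiplicity p n}. (y - 1) * y ^ (j - 1) * ?F n)"
    by (subst pw) (simp add: distrib_left sum.distrib sum_distrib_left mult_ac)
  also have "(\<Sum>n\<in>{1..N}. \<Sum>j\<in>{1..multiplicity p n}. (y - 1) * y ^ (j - 1) * ?F n) =
      (\<Sum>n\<in>{1..N}. \<Sum>j\<in>{1..N}. if p ^ j dvd n then (y - 1) * y ^ (j - 1) * ?F n else 0)"
  proof (rule sum.cong[OF refl])
    fix n assume n: "n \<in> {1..N}"
    have dv: "p ^ j dvd n \<longleftrightarrow> j \<le> multiplicity p n" for j
      using n p by (intro power_dvd_iff_le_multiplicity) auto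
    have "multiplicity p n \<le> N"
    proof -
      have "p ^ multiplicity p n dvd n" by (rule multiplicity_dvd)
      hence "p ^ multiplicity p n \<le> n" using n by (intro dvd_imp_le) auto
      moreover have "multiplicity p n < p ^ multiplicity p n" using p(1) prime_gt_1_nat[of p] by (intro power_gt_expt) auto
      ultimately show ?thesis using n by auto
    qed
    hence "{1..multiplicity p n} = {j\<in>{1..N}. j \<le> multiplicity p n}" by auto
    hence "{1..multiplicity p n} = {j\<in>{1..N}. p ^ j dvd n}" by (simp only: dv)
    thus "(\<Sum>j\<in>{1..multiplicity p n}. (y - 1) * y ^ (j - 1) * ?F n) = (\<Sum>j\<in>{1..N}. if p ^ j dvd n then (y - 1) * y ^ (j - 1) * ?F n else 0)"
      by (simp only: sum.inter_filter[OF finite_atLeastAtMost])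
  qed
  also have "\<dots> = (\<Sum>j\<in>{1..N}. \<Sum>n\<in>{1..N}. if p ^ j dvd n then (y - 1) * y ^ (j - 1) * ?F n else 0)" by (rule sum.swap)
  also have "\<dots> = (\<Sum>j\<in>{1..N}. (y - 1) * y ^ (j - 1) * (\<Sum>m\<in>{1..N div p ^ j}. ?F m))"
  proof (intro sum.cong refl)
    fix j
    have pj: "p ^ j > 0" using p by (simp add: prime_gt_0_nat)
    have "(\<Sum>n\<in>{1..N}. if p ^ j dvd n then (y - 1) * y ^ (j - 1) * ?F n else 0) =
        (\<Sum>n\<in>{n\<in>{1..N}. p ^ j dvd n}. (y - 1) * y ^ (j - 1) * ?F n)"
      by (rule sum.inter_filter[symmetric]) auto
    also have "\<dots> = (\<Sum>m\<in>{1..N div p ^ j}. (y - 1) * y ^ (j - 1) * ?F m)"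
    proof (rule sum.reindex_bij_witness[of _ "\<lambda>m. p ^ j * m" "\<lambda>n. n div p ^ j"])
      fix n assume "n \<in> {n\<in>{1..N}. p ^ j dvd n}"
      hence n: "p ^ j dvd n" "1 \<le> n" "n \<le> N" by auto
      from n(1) obtain m where "n = p ^ j * m" by (rule dvdE)
      note m = this n(2,3)
      hence m0: "m > 0" by (auto intro: Nat.gr0I)
      show "p ^ j * (n div p ^ j) = n" using m pj by simp
      have "m \<le> N div p ^ j" using m pj by (simp add: less_eq_div_iff_mult_less_eq mult.commute)
      thus "n div p ^ j \<in> {1..N div p ^ j}" using m m0 pj by simp
      have "n div p ^ j = m" using m pj by simp
      thus "(y - 1) * y ^ (j - 1) * ?F (n div p ^ j) = (y - 1) * y ^ (j - 1) * ?F n"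
        using Fpk[OF m0] m(1) by simp
    next
      fix m assume "m \<in> {1..N div p ^ j}"
      thus "p ^ j * m \<in> {n\<in>{1..N}. p ^ j dvd n}" using pj
        by (auto simp: less_eq_div_iff_mult_less_eq mult.commute Suc_le_eq)
      show "p ^ j * m div p ^ j = m" using pj by simp
    qed
    finally show "(\<Sum>n\<in>{1..N}. if p ^ j dvd n then (y - 1) * y ^ (j - 1) * ?F n else 0) =
       (y - 1) * y ^ (j - 1) * (\<Sum>m\<in>{1..N div p ^ j}. ?F m)" by (simp add: sum_distrib_left)
  qed
  also have "(\<Sum>n\<in>{1..N}. ?F n) + \<dots> \<le> real N * ?E + (\<Sum>j\<in>{1..N}. (y - 1) * y ^ (j - 1) * (real N / real p ^ j * ?E))"
  proof (intro add_mono IH sum_mono mult_left_mono)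
    fix j
    have "(\<Sum>m\<in>{1..N div p ^ j}. ?F m) \<le> real (N div p ^ j) * ?E" by (rule IH)
    also have "\<dots> \<le> real N / real p ^ j * ?E" using fl by (intro mult_right_mono) auto
    finally show "(\<Sum>m\<in>{1..N div p ^ j}. ?F m) \<le> real N / real p ^ j * ?E" .
  qed (use y in auto)
  also have "(\<Sum>j\<in>{1..N}. (y - 1) * y ^ (j - 1) * (real N / real p ^ j * ?E)) =
      real N * ?E * ((y - 1) / real p * (\<Sum>i<N. (y / real p) ^ i))"
  proof -
    have "(\<Sum>j\<in>{1..N}. (y - 1) * y ^ (j - 1) * (real N / real p ^ j * ?E)) =
        (\<Sum>i<N. (y - 1) * y ^ i * (real N / real p ^ Suc i * ?E))"
      by (rule sum.reindex_bij_witness[of _ Suc "\<lambda>j. j - 1"]) auto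
    also have "\<dots> = (\<Sum>i<N. real N * ?E * ((y - 1) / real p) * (y / real p) ^ i)"
      by (intro sum.cong refl) (simp add: power_divide)
    finally show ?thesis by (simp add: sum_distrib_left mult_ac)
  qed
  also have "\<dots> \<le> real N * ?E * ((y - 1) / real p * (1 / (1 - y / real p)))"
  proof (intro mult_left_mono)
    have r: "0 \<le> y / real p" "y / real p < 1" using y p by auto
    show "(\<Sum>i<N. (y / real p) ^ i) \<le> 1 / (1 - y / real p)"
    proof -
      have gp: "(\<Sum>i<N. z ^ i) = (1 - z ^ N) / (1 - z)" if "z \<noteq> 1" for z :: real
        using sum_gp_strict[of z N] that by simp
      have "(\<Sum>i<N. (y / real p) ^ i) = (1 - (y / real p) ^ N) / (1 - y / real p)" by (rule gp) (use r in linarith)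
      also have "\<dots> \<le> 1 / (1 - y / real p)"
        using r(2) zero_le_power[OF r(1), of N] by (intro divide_right_mono) linarith+
      finally show ?thesis .
    qed
  qed (use y in auto)
  also have "(y - 1) / real p * (1 / (1 - y / real p)) = (y - 1) * (1 / (real p - y))"
    using y p by (simp add: field_simps)
  also have "real N * ?E + real N * ?E * ((y - 1) * (1 / (real p - y))) = real N * ?E * (1 + (y - 1) * (1 / (real p - y)))"
    by (simp add: algebra_simps)
  also have "\<dots> \<le> real N * ?E * exp ((y - 1) * (1 / (real p - y)))"
    using exp_ge_add_one_self[of "(y - 1) * (1 / (real p - y))"] by (intro mult_left_mono) auto
  also have "\<dots> = real N * exp ((y - 1) * (\<Sum>p\<in>insert p S. 1 / (real p - y)))"
    using insert.hyps by (simp add: distrib_left exp_add mult_ac)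
  finally show ?case by simp
qed

text \<open>The moment bound behind the rarity of integers with more than \<open>13/10 * ln (ln T)\<close> prime factors up
  to \<open>T\<close>.\<close>
lemma sum_om_power_le:
  fixes y :: real
  assumes y: "1 \<le> y" "y \<le> 3/2"
  shows "(\<Sum>n\<in>{1..N}. y ^ om T n) \<le> real N * exp ((y - 1) * (prime_recip_sum T + 12))"
proof -
  let ?S = "{p. prime p \<and> p \<le> T}"
  have "(\<Sum>n\<in>{1..N}. y ^ om T n) = (\<Sum>n\<in>{1..N}. y ^ size (filter_mset (\<lambda>p. p \<in> ?S) (prime_factorization n)))"
  proof (intro sum.cong refl)
    fix n
    have "filter_mset (\<lambda>p. p \<le> T) (prime_factorization n) = filter_mset (\<lambda>p. p \<in> ?S) (prime_factorization n)"
      by (intro filter_mset_cong) auto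
    thus "y ^ om T n = y ^ size (filter_mset (\<lambda>p. p \<in> ?S) (prime_factorization n))" by (simp add: om_def)
  qed
  also have "\<dots> \<le> real N * exp ((y - 1) * (\<Sum>p\<in>?S. 1 / (real p - y)))"
    by (rule sum_power_filter_primes_le) (use y in auto)
  also have "(\<Sum>p\<in>?S. 1 / (real p - y)) \<le> (\<Sum>p\<in>?S. 1 / real p + 6 * (1 / (real p)\<^sup>2))"
  proof (intro sum_mono)
    fix p assume "p \<in> ?S"
    hence p: "real p \<ge> 2" using prime_ge_2_nat[of p] by simp
    have py: "real p - y \<ge> real p / 4" using p y by simp
    have "1 / (real p - y) - 1 / real p = y / ((real p - y) * real p)" using p y by (simp add: field_simps)
    also have "\<dots> \<le> (3/2) / ((real p / 4) * real p)"
      using p y py by (intro frac_le mult_mono mult_pos_pos) auto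
    also have "\<dots> = 6 * (1 / (real p)\<^sup>2)" using p by (simp add: power2_eq_square)
    finally show "1 / (real p - y) \<le> 1 / real p + 6 * (1 / (real p)\<^sup>2)" by simp
  qed
  also have "\<dots> = prime_recip_sum T + 6 * (\<Sum>p\<in>?S. 1 / (real p)\<^sup>2)"
    unfolding prime_recip_sum_def sum.distrib by (simp only: sum_distrib_left)
  also have "\<dots> \<le> prime_recip_sum T + 12" using sum_inverse_squares_subset_le[of ?S] by auto
  finally show ?thesis using y by (simp add: mult_left_mono)
qed

text \<open>Rankin's trick: on \<open>d > T\<close> one has \<open>1 \<le> (d / T) powr \<alpha>\<close>, and with \<open>\<alpha> = 1 / ln y\<close> the resulting Euler
  product over the primes up to \<open>y\<close> is still only a power of \<open>ln y\<close>.\<close>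
lemma sum_smooth_recip_le:
  assumes y: "ln (real y) \<ge> 4" and F: "finite F" "\<And>d. d \<in> F \<Longrightarrow> d > 0 \<and> T < d \<and> prime_factors d \<subseteq> {..y}" and T: "T \<ge> 1"
  shows "(\<Sum>d\<in>F. 1 / real d) \<le> exp 81 * ln (real y) ^ 9 * exp (- (ln (real T) / ln (real y)))"
proof -
  \<comment> \<open>the largest order of magnitude for which p powr \<alpha> stays bounded for all p up to y\<close>
  define \<alpha> where "\<alpha> = 1 / ln (real y)"
  have \<alpha>: "0 < \<alpha>" "\<alpha> \<le> 1/4" using y by (auto simp: \<alpha>_def field_simps)
  have y0: "y \<ge> 2" using y by (cases "y \<le> 1") (auto simp: le_Suc_eq)
  let ?g = "\<lambda>n. if n = 0 then 0 else real n powr (\<alpha> - 1)"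
  let ?S = "{p. prime p \<and> p \<le> y}"
  have "(\<Sum>d\<in>F. 1 / real d) \<le> (\<Sum>d\<in>F. real T powr (- \<alpha>) * ?g d)"
  proof (intro sum_mono)
    fix d assume "d \<in> F"
    hence d: "d > 0" "T < d" using F by auto
    have "1 / real d = real d powr (- \<alpha> + (\<alpha> - 1))"
      using d by (simp add: powr_minus_divide)
    also have "\<dots> = real d powr (- \<alpha>) * real d powr (\<alpha> - 1)" by (rule powr_add)
    also have "\<dots> \<le> real T powr (- \<alpha>) * real d powr (\<alpha> - 1)"
      using d T \<alpha> by (intro mult_right_mono powr_mono2') auto
    finally show "1 / real d \<le> real T powr (- \<alpha>) * ?g d" using d by simp
  qed
  also have "\<dots> = real T powr (- \<alpha>) * (\<Sum>d\<in>F. ?g d)" by (rule sum_distrib_left[symmetric])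
  also have "(\<Sum>d\<in>F. ?g d) \<le> (\<Prod>p\<in>?S. 1 / (1 - ?g p))"
  proof (rule sum_multiplicative_le_euler_product)
    fix d assume "d \<in> F"
    thus "d > 0 \<and> prime_factors d \<subseteq> ?S" using F by auto
  next
    fix p assume "p \<in> ?S"
    hence "real p > 1" "p \<noteq> 0" using prime_gt_1_nat[of p] by auto
    moreover from this have "real p powr (\<alpha> - 1) < real p powr 0" using \<alpha> by (intro powr_less_mono) auto
    ultimately show "?g p < 1" by simp
  qed (use F in \<open>auto simp: powr_mult\<close>)
  also have "\<dots> \<le> (\<Prod>p\<in>?S. exp (9 * (1 / real p)))"
  proof (intro prod_mono conjI)
    fix p assume p: "p \<in> ?S"
    hence p2: "real p \<ge> 2" using prime_ge_2_nat[of p] by simp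
    have g: "0 \<le> ?g p" "?g p \<le> 2/3"
    proof -
      have "real p powr (\<alpha> - 1) \<le> real p powr (- (3/4))" using \<alpha> p2 by (intro powr_mono) auto
      also have "\<dots> \<le> 2 powr (- (3/4))" using p2 by (intro powr_mono2') auto
      also have "\<dots> \<le> 2 / 3"
      proof -
        have "(2 powr (- (3/4))) ^ 4 = (2::real) powr (- 3)" by (simp add: powr_power)
        also have "\<dots> = 1 / 8" by (simp add: powr_minus)
        also have "\<dots> \<le> (2/3) ^ 4" by (simp add: power_divide)
        finally show ?thesis by (subst (asm) power_mono_iff) auto
      qed
      finally show "?g p \<le> 2/3" using p2 by simp
    qed simp
    show "0 \<le> 1 / (1 - ?g p)" using g by simp
    have e: "?g p \<le> 3 * (1 / real p)"
    proof -
      have "real p powr \<alpha> \<le> real y powr \<alpha>" using p \<alpha> by (intro powr_mono2) auto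
      also have "\<dots> = exp 1" using y y0 by (simp add: powr_def \<alpha>_def)
      also have "\<dots> \<le> 3" by (rule exp_le)
      finally have "real p powr \<alpha> / real p \<le> 3 / real p" by (intro divide_right_mono) auto
      moreover have "real p powr (\<alpha> - 1) = real p powr \<alpha> / real p" using p2 by (simp add: powr_diff)
      ultimately show ?thesis using p2 by simp
    qed
    have "1 / (1 - ?g p) \<le> 1 + 3 * ?g p" using g by (simp add: field_simps) (use g in \<open>auto simp: algebra_simps intro: mult_left_le\<close>)
    also have "\<dots> \<le> 1 + 9 * (1 / real p)" using e by simp
    also have "\<dots> \<le> exp (9 * (1 / real p))" by (rule exp_ge_add_one_self)
    finally show "1 / (1 - ?g p) \<le> exp (9 * (1 / real p))" .
  qed
  also have "\<dots> = exp (9 * prime_recip_sum y)"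
    unfolding prime_recip_sum_def by (subst exp_sum[symmetric]) (auto simp: sum_distrib_left)
  also have "\<dots> \<le> exp (9 * (ln (ln (real y)) + 9))" using prime_recip_sum_upper[OF y0] by simp
  also have "\<dots> = exp 81 * ln (real y) ^ 9"
  proof -
    have "exp (9 * ln (ln (real y))) = ln (real y) ^ 9"
      using exp_of_nat_mult[of 9 "ln (ln (real y))"] y by simp
    thus ?thesis by (simp add: distrib_left exp_add)
  qed
  also have "real T powr (- \<alpha>) * (exp 81 * ln (real y) ^ 9) = exp 81 * ln (real y) ^ 9 * exp (- (ln (real T) / ln (real y)))"
    using T by (simp add: powr_def \<alpha>_def)
  finally show ?thesis by (simp add: mult_left_mono)
qed

text \<open>The sieve for the two forms \<open>b\<close> and \<open>a * b + 1\<close>, whose resultant is \<open>1\<close>.\<close>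
lemma shifted_prime_pair_count:
  "\<exists>C>0. \<forall>a B. a \<ge> 1 \<longrightarrow> B \<ge> 2 \<longrightarrow>
     real (card {b\<in>{1..B}. prime b \<and> prime (a * b + 1)}) \<le>
       C * real B / ln (real B) ^ 2 * exp (2 * (\<Sum>p\<in>prime_factors a. 1 / real p))"
proof -
  obtain C where C: "C > 0" and bound: "\<forall>F D B. finite F \<longrightarrow> card F = 2 \<longrightarrow> D \<ge> 1 \<longrightarrow> B \<ge> 2 \<longrightarrow>
     (\<forall>(c,d)\<in>F. c \<ge> 1 \<and> c dvd D) \<longrightarrow>
     (\<forall>(c,d)\<in>F. \<forall>(c',d')\<in>F. (c,d) \<noteq> (c',d') \<longrightarrow> (int c * int d' - int c' * int d) dvd int D) \<longrightarrow>
     real (card {b\<in>{1..B}. \<forall>(c,d)\<in>F. prime (c * b + d)}) \<le>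
       C * real B / ln (real B) ^ 2 * exp (real 2 * (\<Sum>p\<in>prime_factors D. 1 / real p))"
    using linear_forms_prime_count[of 2] by (elim exE conjE)
  show ?thesis
  proof (intro exI[of _ C] conjI allI impI C)
    fix a B :: nat assume aB: "a \<ge> 1" "B \<ge> 2"
    have "real (card {b\<in>{1..B}. \<forall>(c,d)\<in>{(1,0),(a,1)}. prime (c * b + d)}) \<le>
       C * real B / ln (real B) ^ 2 * exp (real 2 * (\<Sum>p\<in>prime_factors a. 1 / real p))"
      by (rule bound[THEN spec, THEN spec, THEN spec, THEN mp, THEN mp, THEN mp, THEN mp, THEN mp, THEN mp])
         (use aB in auto)
    thus "real (card {b\<in>{1..B}. prime b \<and> prime (a * b + 1)}) \<le>
       C * real B / ln (real B) ^ 2 * exp (2 * (\<Sum>p\<in>prime_factors a. 1 / real p))"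
      by simp
  qed
qed

text \<open>Summation over the blocks \<open>(m, 2 * m]\<close>. The function \<open>G\<close> plays the role of the integral of the
  density from \<open>m\<close> to infinity, so that the block bounds telescope.\<close>
lemma dyadic_sum_le:
  fixes w :: "nat \<Rightarrow> real" and G :: "real \<Rightarrow> real"
  assumes y: "y \<ge> 2" and fin: "finite F" and Fy: "\<And>b. b \<in> F \<Longrightarrow> y < b"
    and block: "\<And>m. m \<ge> y \<Longrightarrow> (\<Sum>b\<in>{b\<in>F. m < b \<and> b \<le> 2 * m}. w b) \<le> G (ln (real m)) - G (ln (real (2 * m)))"
    and G0: "\<And>u. u > 0 \<Longrightarrow> G u \<ge> 0"
  shows "(\<Sum>b\<in>F. w b) \<le> G (ln (real y))"
proof -
  define m where "m i = y * 2 ^ i" for i :: nat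
  have my: "m i \<ge> y" for i by (simp add: m_def)
  have mS: "m (Suc i) = 2 * m i" for i by (simp add: m_def)
  obtain k where k: "\<And>b. b \<in> F \<Longrightarrow> b \<le> m k"
  proof -
    have "b \<le> m (Max (insert 0 F))" if "b \<in> F" for b
    proof -
      have "b \<le> Max (insert 0 F)" using that fin by (intro Max_ge) auto
      also have "\<dots> \<le> 2 ^ Max (insert 0 F)" using less_exp less_imp_le by blast
      also have "\<dots> \<le> m (Max (insert 0 F))" using y by (simp add: m_def)
      finally show ?thesis .
    qed
    thus ?thesis using that by blast
  qed
  have step: "(\<Sum>b\<in>{b\<in>F. b \<le> m i}. w b) \<le> G (ln (real y)) - G (ln (real (m i)))" for i
  proof (induction i)
    case 0
    have e: "{b\<in>F. b \<le> m 0} = {}" by (auto simp: m_def dest!: Fy)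
    show ?case unfolding e by (simp add: m_def)
  next
    case (Suc i)
    have "{b\<in>F. b \<le> m (Suc i)} = {b\<in>F. b \<le> m i} \<union> {b\<in>F. m i < b \<and> b \<le> 2 * m i}" unfolding mS by auto
    hence "(\<Sum>b\<in>{b\<in>F. b \<le> m (Suc i)}. w b) = (\<Sum>b\<in>{b\<in>F. b \<le> m i}. w b) + (\<Sum>b\<in>{b\<in>F. m i < b \<and> b \<le> 2 * m i}. w b)"
      using fin by (simp only:) (rule sum.union_disjoint, auto)
    thus ?case using Suc block[OF my[of i]] unfolding mS by linarith
  qed
  have "(\<Sum>b\<in>F. w b) = (\<Sum>b\<in>{b\<in>F. b \<le> m k}. w b)" using k by (intro sum.cong) auto
  also have "\<dots> \<le> G (ln (real y)) - G (ln (real (m k)))" by (rule step)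
  also have "\<dots> \<le> G (ln (real y))"
  proof -
    have "real (m k) \<ge> 2" using my[of k] y by linarith
    hence "ln (real (m k)) > 0" by simp
    thus ?thesis using G0 by simp
  qed
  finally show ?thesis .
qed

lemma dyadic_block_weight_le:
  fixes A :: "nat set" and K c h :: real
  assumes dens: "real (card {b\<in>A. b \<le> 2 * m}) \<le> K * real (2 * m) / ln (real (2 * m)) ^ 2"
    and F: "F \<subseteq> A" and A: "finite {b\<in>A. b \<le> 2 * m}" and m: "m \<ge> 2" and h: "h \<ge> 0"
    and w: "\<And>b. b \<in> F \<Longrightarrow> m < b \<Longrightarrow> b \<le> 2 * m \<Longrightarrow> w b \<le> h / real b"
  shows "(\<Sum>b\<in>{b\<in>F. m < b \<and> b \<le> 2 * m}. w b) \<le> h * (2 * K / ln (real (2 * m)) ^ 2)"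
proof -
  let ?B = "{b\<in>F. m < b \<and> b \<le> 2 * m}"
  have "(\<Sum>b\<in>?B. w b) \<le> (\<Sum>b\<in>?B. h / real m)"
  proof (rule sum_mono)
    fix b assume b: "b \<in> ?B"
    have "w b \<le> h / real b" using w b by auto
    also have "\<dots> \<le> h / real m" using b m h by (intro divide_left_mono) auto
    finally show "w b \<le> h / real m" .
  qed
  also have "\<dots> = h / real m * real (card ?B)" by simp
  also have "\<dots> \<le> h / real m * (K * real (2 * m) / ln (real (2 * m)) ^ 2)"
  proof (intro mult_left_mono)
    have "card ?B \<le> card {b\<in>A. b \<le> 2 * m}" using F A by (intro card_mono) auto
    thus "real (card ?B) \<le> K * real (2 * m) / ln (real (2 * m)) ^ 2" using dens by linarith
  qed (use h in auto)
  also have "\<dots> = h * (2 * K / ln (real (2 * m)) ^ 2)" using m by simp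
  finally show ?thesis .
qed

lemma ln_double:
  assumes "m \<ge> 2"
  shows "ln (real (2 * m)) - ln (real m) \<ge> 1/2" "ln (real m) > 0" "ln (real (2 * m)) > ln (real m)"
proof -
  have "ln (real (2 * m)) = ln 2 + ln (real m)" using assms by (simp add: ln_mult)
  thus "ln (real (2 * m)) - ln (real m) \<ge> 1/2" using ln2_ge_two_thirds by simp
  thus "ln (real (2 * m)) > ln (real m)" by linarith
  show "ln (real m) > 0" using assms by simp
qed

text \<open>The case \<open>G u = 4 * K / u\<close>: a set as sparse as the pairs of primes has convergent sum of reciprocals,
  as in Brun's theorem on twin primes.\<close>
lemma sum_recip_sparse_le:
  fixes A :: "nat set" and K :: real
  assumes K: "K \<ge> 0" and dens: "\<And>B. B \<ge> y \<Longrightarrow> real (card {b\<in>A. b \<le> B}) \<le> K * real B / ln (real B) ^ 2"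
    and fin: "finite F" "F \<subseteq> A" and Fy: "\<And>b. b \<in> F \<Longrightarrow> y < b" and y: "y \<ge> 2" and A: "\<And>B. finite {b\<in>A. b \<le> B}"
  shows "(\<Sum>b\<in>F. 1 / real b) \<le> 4 * K / ln (real y)"
proof (rule dyadic_sum_le[where G = "\<lambda>u. 4 * K / u", OF y fin(1) Fy])
  fix m assume m: "m \<ge> y"
  hence m2: "m \<ge> 2" using y by simp
  define u where "u = ln (real m)"
  define v where "v = ln (real (2 * m))"
  have uv: "u > 0" "v > u" "v - u \<ge> 1/2" using ln_double[OF m2] unfolding u_def v_def by auto
  have "(\<Sum>b\<in>{b\<in>F. m < b \<and> b \<le> 2 * m}. 1 / real b) \<le> 1 * (2 * K / v ^ 2)"
    unfolding v_def by (rule dyadic_block_weight_le[OF dens fin(2) A m2]) (use m in auto)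
  also have "1 / v ^ 2 \<le> 2 * (1 / u - 1 / v)"
  proof -
    have "1 / v ^ 2 \<le> 1 / (u * v)" using uv by (intro divide_left_mono) (auto simp: power2_eq_square)
    also have "\<dots> \<le> 2 * (v - u) / (u * v)" using uv by (intro divide_right_mono) auto
    also have "\<dots> = 2 * (1 / u - 1 / v)" using uv by (simp add: field_simps)
    finally show ?thesis .
  qed
  hence "1 * (2 * K / v ^ 2) \<le> 2 * K * (2 * (1 / u - 1 / v))"
    using mult_left_mono[of "1 / v ^ 2" "2 * (1 / u - 1 / v)" "2 * K"] K by simp
  finally show "(\<Sum>b\<in>{b\<in>F. m < b \<and> b \<le> 2 * m}. 1 / real b) \<le> 4 * K / ln (real m) - 4 * K / ln (real (2 * m))"
    unfolding u_def v_def by (simp add: right_diff_distrib)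
qed (use K in auto)

text \<open>The case \<open>G u = 8 * K * c / sqrt u\<close>. The weight loses half of the decay, and what remains still tends
  to zero.\<close>
lemma sum_weighted_sparse_le:
  fixes A :: "nat set" and K c :: real
  assumes K: "K \<ge> 0" and dens: "\<And>B. B \<ge> y \<Longrightarrow> real (card {b\<in>A. b \<le> B}) \<le> K * real B / ln (real B) ^ 2"
    and fin: "finite F" "F \<subseteq> A" and Fy: "\<And>b. b \<in> F \<Longrightarrow> y < b" and y: "y \<ge> 2" and A: "\<And>B. finite {b\<in>A. b \<le> B}"
    and c: "c \<ge> 0" and w: "\<And>b. b \<in> F \<Longrightarrow> w b \<le> c * sqrt (ln (real b))"
  shows "(\<Sum>b\<in>F. w b / real b) \<le> 8 * K * c / sqrt (ln (real y))"
proof (rule dyadic_sum_le[where G = "\<lambda>u. 8 * K * c / sqrt u", OF y fin(1) Fy])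
  fix m assume m: "m \<ge> y"
  hence m2: "m \<ge> 2" using y by simp
  define u where "u = ln (real m)"
  define v where "v = ln (real (2 * m))"
  have uv: "u > 0" "v > u" "v - u \<ge> 1/2" using ln_double[OF m2] unfolding u_def v_def by auto
  define s where "s = sqrt u"
  define t where "t = sqrt v"
  have st: "0 < s" "s < t" "s\<^sup>2 = u" "t\<^sup>2 = v" using uv unfolding s_def t_def by auto
  have "(\<Sum>b\<in>{b\<in>F. m < b \<and> b \<le> 2 * m}. w b / real b) \<le> (c * t) * (2 * K / v ^ 2)"
    unfolding v_def
  proof (rule dyadic_block_weight_le[OF dens fin(2) A m2])
    fix b assume b: "b \<in> F" "m < b" "b \<le> 2 * m"
    have "w b \<le> c * sqrt (ln (real b))" by (rule w[OF b(1)])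
    also have "\<dots> \<le> c * t" unfolding t_def v_def
      using b c m2 by (intro mult_left_mono real_sqrt_le_mono, subst ln_le_cancel_iff) auto
    finally show "w b / real b \<le> c * t / real b" by (intro divide_right_mono) auto
  qed (use m c st in auto)
  also have "\<dots> = 2 * K * c * (1 / t ^ 3)"
    using st by (simp add: power2_eq_square power3_eq_cube mult_ac flip: st(4))
  also have "\<dots> \<le> 2 * K * c * (4 * (1 / s - 1 / t))"
  proof (intro mult_left_mono)
    have "1 / 2 \<le> (t - s) * (t + s)" using uv(3) st by (simp add: algebra_simps power2_eq_square flip: st(3,4))
    also have "\<dots> \<le> (t - s) * (2 * t)" using st by (intro mult_left_mono) auto
    finally have "1 \<le> 4 * (t - s) * t" by (simp add: algebra_simps)
    hence "1 / t ^ 3 \<le> 4 * (t - s) * t / t ^ 3" using st by (intro divide_right_mono) auto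
    also have "\<dots> = 4 * (t - s) / (t * t)" using st by (simp add: power3_eq_cube)
    also have "\<dots> \<le> 4 * (t - s) / (s * t)" using st by (intro divide_left_mono mult_right_mono) auto
    also have "\<dots> = 4 * (1 / s - 1 / t)" using st by (simp add: field_simps)
    finally show "1 / t ^ 3 \<le> 4 * (1 / s - 1 / t)" .
  qed (use K c in auto)
  also have "\<dots> = 8 * K * c / sqrt u - 8 * K * c / sqrt v" unfolding s_def t_def by (simp add: right_diff_distrib)
  finally show "(\<Sum>b\<in>{b\<in>F. m < b \<and> b \<le> 2 * m}. w b / real b) \<le> 8 * K * c / sqrt (ln (real m)) - 8 * K * c / sqrt (ln (real (2 * m)))"
    unfolding u_def v_def .
qed (use K c in auto)

section \<open>Divisors of the form p - 1 beyond a large bound are rare\<close>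

text \<open>A weighted count of representations: each counted element needs only one witness of weight at least
  one.\<close>
lemma card_le_sum_witnesses:
  assumes "finite Tr" "finite G" "\<And>t. t \<in> Tr \<Longrightarrow> (0::real) \<le> w t" "\<And>n. n \<in> G \<Longrightarrow> \<exists>t\<in>Tr. \<phi> t = n \<and> 1 \<le> w t"
  shows "real (card G) \<le> (\<Sum>t\<in>Tr. w t)"
proof -
  obtain h where h: "\<And>n. n \<in> G \<Longrightarrow> h n \<in> Tr \<and> \<phi> (h n) = n \<and> 1 \<le> w (h n)" using assms(4) by metis
  have inj: "inj_on h G" by (rule inj_onI) (metis h)
  have "real (card G) = (\<Sum>n\<in>G. 1)" by simp
  also have "\<dots> \<le> (\<Sum>n\<in>G. w (h n))" using h by (intro sum_mono) auto
  also have "\<dots> = (\<Sum>t\<in>h ` G. w t)" by (simp add: sum.reindex[OF inj])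
  also have "\<dots> \<le> (\<Sum>t\<in>Tr. w t)" using h assms by (intro sum_mono2) auto
  finally show ?thesis .
qed

lemma real_div_le: "real (x div d) \<le> real x / real d"
  using floor_divide_of_nat_eq[of x d, where 'a = real] by linarith

lemma card_multiples_le:
  assumes "finite D"
  shows "real (card {n\<in>{1..x}. \<exists>d\<in>D. d dvd n}) \<le> real x * (\<Sum>d\<in>D. 1 / real d)"
proof -
  have "card {n\<in>{1..x}. \<exists>d\<in>D. d dvd n} = card (\<Union>d\<in>D. {n\<in>{1..x}. d dvd n})"
    by (intro arg_cong[where f = card]) auto
  also have "\<dots> \<le> (\<Sum>d\<in>D. card {n\<in>{1..x}. d dvd n})" by (rule card_UN_le[OF assms])
  finally have "real (card {n\<in>{1..x}. \<exists>d\<in>D. d dvd n}) \<le> (\<Sum>d\<in>D. real (card {n\<in>{1..x}. d dvd n}))"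
    by (simp flip: of_nat_sum)
  also have "\<dots> \<le> (\<Sum>d\<in>D. real x * (1 / real d))"
  proof (rule sum_mono)
    fix d
    have "card {n\<in>{1..x}. d dvd n} \<le> card ((\<lambda>k. d * k) ` {1..x div d})"
    proof (intro card_mono subsetI)
      fix n assume "n \<in> {n\<in>{1..x}. d dvd n}"
      then obtain k where k: "n = d * k" "1 \<le> n" "n \<le> x" by auto
      hence "d > 0" "k > 0" by (auto intro: Nat.gr0I)
      hence "k \<in> {1..x div d}" using k by (simp add: less_eq_div_iff_mult_less_eq mult.commute)
      thus "n \<in> (\<lambda>k. d * k) ` {1..x div d}" using k by blast
    qed auto
    also have "\<dots> \<le> x div d" using card_image_le[of "{1..x div d}" "\<lambda>k. d * k"] by simp
    finally have "real (card {n\<in>{1..x}. d dvd n}) \<le> real (x div d)" by simp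
    also have "\<dots> \<le> real x * (1 / real d)" using real_div_le[of x d] by simp
    finally show "real (card {n\<in>{1..x}. d dvd n}) \<le> real x * (1 / real d)" .
  qed
  finally show ?thesis by (simp add: sum_distrib_left)
qed

lemma shifted_prime_pair_count_loglog:
  "\<exists>C>0. \<forall>a B u. 1 \<le> a \<longrightarrow> real a \<le> u \<longrightarrow> 16 \<le> u \<longrightarrow> 2 \<le> B \<longrightarrow>
     real (card {b\<in>{1..B}. prime b \<and> prime (a * b + 1)}) \<le> C * ln (ln u) ^ 2 * real B / ln (real B) ^ 2"
proof -
  obtain C1 where C1: "C1 > 0" "\<forall>D x. 1 \<le> D \<longrightarrow> real D \<le> x \<longrightarrow> 16 \<le> x \<longrightarrow>
      exp (\<Sum>p\<in>prime_factors D. 1 / real p) \<le> C1 * ln (ln x)"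
    using sum_recip_prime_factors_bound by blast
  obtain C2 where C2: "C2 > 0" "\<forall>a B. a \<ge> 1 \<longrightarrow> B \<ge> 2 \<longrightarrow>
     real (card {b\<in>{1..B}. prime b \<and> prime (a * b + 1)}) \<le>
       C2 * real B / ln (real B) ^ 2 * exp (2 * (\<Sum>p\<in>prime_factors a. 1 / real p))"
    using shifted_prime_pair_count by blast
  show ?thesis
  proof (intro exI[of _ "C2 * C1 ^ 2"] conjI allI impI)
    fix a B :: nat and u :: real assume *: "1 \<le> a" "real a \<le> u" "16 \<le> u" "2 \<le> B"
    let ?s = "\<Sum>p\<in>prime_factors a. 1 / real p"
    have "exp (2 * ?s) = exp ?s ^ 2" by (simp add: exp_of_nat_mult[symmetric])
    also have "\<dots> \<le> (C1 * ln (ln u)) ^ 2" using C1 * by (intro power_mono) auto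
    finally have e: "exp (2 * ?s) \<le> C1 ^ 2 * ln (ln u) ^ 2" by (simp add: power_mult_distrib)
    have "real (card {b\<in>{1..B}. prime b \<and> prime (a * b + 1)}) \<le> C2 * real B / ln (real B) ^ 2 * exp (2 * ?s)"
      using C2 * by blast
    also have "\<dots> \<le> C2 * real B / ln (real B) ^ 2 * (C1 ^ 2 * ln (ln u) ^ 2)"
      using C2 * e by (intro mult_left_mono) auto
    finally show "real (card {b\<in>{1..B}. prime b \<and> prime (a * b + 1)}) \<le> C2 * C1 ^ 2 * ln (ln u) ^ 2 * real B / ln (real B) ^ 2"
      by (simp add: mult_ac)
  qed (use C1 C2 in auto)
qed

text \<open>The property that almost all integers have and that the count of large shifted prime divisors can
  exploit: few prime factors up to \<open>T\<close>, and no large divisor that is free of primes above \<open>y\<close>.\<close>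
definition typical :: "nat \<Rightarrow> nat \<Rightarrow> nat \<Rightarrow> nat \<Rightarrow> bool" where
  "typical T y N n \<longleftrightarrow> om T n \<le> N \<and> (\<forall>d. d dvd n \<longrightarrow> T < d \<longrightarrow> \<not> prime_factors d \<subseteq> {..y})"

text \<open>Here \<open>b\<close> is a prime factor of \<open>d\<close> above \<open>y\<close>. The bound on the number of prime factors enters through
  the inequality for the weights (Rankin's trick again): it lets \<open>a\<close> and \<open>m\<close> be summed independently,
  each with weight \<open>wt T\<close>.\<close>
lemma typical_decompose:
  assumes n: "n > 0" "typical T y N n" and d: "d dvd n" "prime (d + 1)" "T < d"
  shows "\<exists>a b m. n = a * b * m \<and> d = a * b \<and> a > 0 \<and> m > 0 \<and> prime b \<and> y < b \<and> prime (a * b + 1) \<and>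
           1 \<le> 2 ^ N * wt T a * wt T m"
proof -
  have "\<not> prime_factors d \<subseteq> {..y}" using n(2) d unfolding typical_def by blast
  then obtain b where b: "b \<in> prime_factors d" "y < b" by (meson atMost_iff not_le subsetI)
  hence pb: "prime b" "b dvd d" by auto
  then obtain a where a: "d = a * b" by (auto simp: mult.commute elim: dvdE)
  obtain m where m: "n = d * m" using d by blast
  have pos: "a > 0" "b > 0" "m > 0" using n a m by (auto intro: Nat.gr0I)
  have "wt T n = wt T a * wt T b * wt T m" unfolding m a using pos by (simp add: wt_mult)
  also have "\<dots> \<le> wt T a * 1 * wt T m"
    using less_imp_le[OF wt_bounds(1)] wt_bounds(2) by (intro mult_mono mult_nonneg_nonneg) auto
  finally have "wt T n \<le> wt T a * wt T m" by simp
  moreover have "(1/2) ^ N \<le> wt T n" unfolding wt_def using n(2) by (intro power_decreasing) (auto simp: typical_def)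
  ultimately have "2 ^ N * (1/2) ^ N \<le> 2 ^ N * (wt T a * wt T m)" by (intro mult_left_mono) auto
  hence "1 \<le> 2 ^ N * wt T a * wt T m" by (simp add: power_mult_distrib[symmetric])
  thus ?thesis using m a pos pb b d by blast
qed

lemma ln_nat_power: "x > 0 \<Longrightarrow> ln (real (x ^ k)) = real k * ln (real x)"
  by (simp add: ln_realpow)

text \<open>For fixed \<open>a\<close> and \<open>b\<close> the sum over \<open>m\<close> saves \<open>sqrt (ln T)\<close>, the sum over \<open>a\<close> saves another
  \<open>sqrt (ln T)\<close>, and the primes \<open>b > y\<close> with \<open>a * b + 1\<close> prime have sum of reciprocals \<open>O(1 / ln y)\<close>
  up to iterated logarithms.\<close>
lemma card_typical_small_divisor:
  "\<exists>C>0. \<forall>T y N x. 16 \<le> T \<longrightarrow> 2 \<le> y \<longrightarrow> T ^ 4 \<le> x \<longrightarrow>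
     real (card {n\<in>{1..x}. typical T y N n \<and> (\<exists>d. d dvd n \<and> prime (d + 1) \<and> T < d \<and> d \<le> T\<^sup>2)}) \<le>
       C * real x * 2 ^ N * ln (2 * ln (real T)) ^ 2 / ln (real y)"
proof -
  obtain C where C: "C > 0" "\<And>a B u. 1 \<le> a \<Longrightarrow> real a \<le> u \<Longrightarrow> 16 \<le> u \<Longrightarrow> 2 \<le> B \<Longrightarrow>
     real (card {b\<in>{1..B}. prime b \<and> prime (a * b + 1)}) \<le> C * ln (ln u) ^ 2 * real B / ln (real B) ^ 2"
    using shifted_prime_pair_count_loglog by blast
  show ?thesis
  proof (intro exI[of _ "5 * exp 15 * (exp 15 * 2) * (4 * C)"] conjI allI impI)
    fix T y N x :: nat assume T: "16 \<le> T" and y: "2 \<le> y" and x: "T ^ 4 \<le> x"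
    let ?l = "ln (real T)"
    let ?G = "{n\<in>{1..x}. typical T y N n \<and> (\<exists>d. d dvd n \<and> prime (d + 1) \<and> T < d \<and> d \<le> T\<^sup>2)}"
    define E where "E = ln (2 * ?l) ^ 2"
    define Bs where "Bs a = {b\<in>{1..T\<^sup>2}. prime b \<and> y < b \<and> prime (a * b + 1) \<and> a * b \<le> T\<^sup>2}" for a
    have l: "?l > 0" using T by simp
    have ly: "ln (real y) > 0" using y by simp
    have finB: "finite (Bs a)" for a unfolding Bs_def by simp
    let ?Tr = "SIGMA a:{1..T\<^sup>2}. SIGMA b:Bs a. {1..x div (a * b)}"
    let ?w = "\<lambda>(a,b,m). 2 ^ N * wt T a * wt T m"
    have "real (card ?G) \<le> (\<Sum>t\<in>?Tr. ?w t)"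
    proof (rule card_le_sum_witnesses[where \<phi> = "\<lambda>(a,b,m). a * b * m"])
      show "finite ?Tr" using finB by auto
      show "0 \<le> ?w t" for t using less_imp_le[OF wt_bounds(1)] by (auto split: prod.splits)
      fix n assume n: "n \<in> ?G"
      then obtain d where d: "d dvd n" "prime (d + 1)" "T < d" "d \<le> T\<^sup>2" by blast
      obtain a b m where abm: "n = a * b * m" "d = a * b" "a > 0" "m > 0" "prime b" "y < b" "prime (a * b + 1)" "1 \<le> 2 ^ N * wt T a * wt T m"
        using typical_decompose[of n T y N d] n d by auto
      have b0: "b > 0" using abm by (simp add: prime_gt_0_nat)
      have "a * 1 \<le> a * b" "1 * b \<le> a * b" using b0 abm by (intro mult_le_mono; simp)+
      hence "a \<le> T\<^sup>2" "b \<le> T\<^sup>2" using abm(2) d(4) by linarith+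
      hence "a \<in> {1..T\<^sup>2}" "b \<in> Bs a" using abm d b0 unfolding Bs_def by auto
      moreover have "m \<le> x div (a * b)" using n abm b0 by (simp add: less_eq_div_iff_mult_less_eq mult_ac)
      ultimately have "(a,b,m) \<in> ?Tr" using abm by auto
      thus "\<exists>t\<in>?Tr. (case t of (a,b,m) \<Rightarrow> a * b * m) = n \<and> 1 \<le> ?w t"
        by (rule bexI[rotated]) (simp add: abm(1) abm(8))
    qed auto
    also have "\<dots> = (\<Sum>a\<in>{1..T\<^sup>2}. \<Sum>b\<in>Bs a. \<Sum>m\<in>{1..x div (a * b)}. 2 ^ N * wt T a * wt T m)"
      using finB by (subst sum.Sigma[symmetric]; simp)+
    also have "\<dots> \<le> (\<Sum>a\<in>{1..T\<^sup>2}. \<Sum>b\<in>Bs a. 2 ^ N * wt T a * (5 * exp 15 * (real x / (real a * real b)) / sqrt ?l))"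
    proof (intro sum_mono)
      fix a b assume a: "a \<in> {1..T\<^sup>2}" and b: "b \<in> Bs a"
      have ab: "a * b \<le> T\<^sup>2" "a * b > 0" using a b by (auto simp: Bs_def prime_gt_0_nat)
      have "T * (a * b) \<le> T\<^sup>2 * T\<^sup>2" using ab T by (intro mult_le_mono) (auto simp: power2_eq_square)
      also have "\<dots> \<le> x" using x by (simp flip: power_add)
      finally have Tx: "T \<le> x div (a * b)" using ab by (simp add: less_eq_div_iff_mult_less_eq)
      have "(\<Sum>m\<in>{1..x div (a * b)}. wt T m) \<le> 5 * exp 15 * real (x div (a * b)) / sqrt ?l"
        by (rule sum_wt_le) (use T Tx in auto)
      also have "\<dots> \<le> 5 * exp 15 * (real x / (real a * real b)) / sqrt ?l"
        using real_div_le[of x "a * b"] l by (intro divide_right_mono mult_left_mono) auto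
      finally have "2 ^ N * wt T a * (\<Sum>m\<in>{1..x div (a * b)}. wt T m) \<le> 2 ^ N * wt T a * (5 * exp 15 * (real x / (real a * real b)) / sqrt ?l)"
        using wt_bounds(1)[of T a] by (intro mult_left_mono) auto
      thus "(\<Sum>m\<in>{1..x div (a * b)}. 2 ^ N * wt T a * wt T m) \<le> 2 ^ N * wt T a * (5 * exp 15 * (real x / (real a * real b)) / sqrt ?l)"
        by (simp add: sum_distrib_left)
    qed
    also have "\<dots> = (\<Sum>a\<in>{1..T\<^sup>2}. 2 ^ N * 5 * exp 15 * real x / sqrt ?l * (wt T a / real a) * (\<Sum>b\<in>Bs a. 1 / real b))"
      unfolding sum_distrib_left by (intro sum.cong refl) (simp add: mult_ac)
    also have "\<dots> \<le> (\<Sum>a\<in>{1..T\<^sup>2}. 2 ^ N * 5 * exp 15 * real x / sqrt ?l * (wt T a / real a) * (4 * (C * E) / ln (real y)))"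
    proof (intro sum_mono mult_left_mono)
      fix a assume a: "a \<in> {1..T\<^sup>2}"
      let ?A = "{b. prime b \<and> prime (a * b + 1)}"
      have T16: "16 \<le> T\<^sup>2" using T by (simp add: power2_eq_square) (use mult_le_mono[of 16 T 1 T] in simp)
      show "(\<Sum>b\<in>Bs a. 1 / real b) \<le> 4 * (C * E) / ln (real y)"
      proof (rule sum_recip_sparse_le[where A = ?A])
        show "0 \<le> C * E" using C by (simp add: E_def)
        fix B assume "y \<le> B"
        hence B: "2 \<le> B" using y by simp
        have "{b\<in>?A. b \<le> B} = {b\<in>{1..B}. prime b \<and> prime (a * b + 1)}" by (auto simp: Suc_le_eq prime_gt_0_nat)
        hence "real (card {b\<in>?A. b \<le> B}) = real (card {b\<in>{1..B}. prime b \<and> prime (a * b + 1)})" by simp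
        also have "\<dots> \<le> C * ln (ln (real (T\<^sup>2))) ^ 2 * real B / ln (real B) ^ 2"
          by (rule C(2)) (use a B T16 in \<open>auto simp flip: of_nat_power simp: numeral_le_real_of_nat_iff\<close>)
        also have "ln (ln (real (T\<^sup>2))) ^ 2 = E" unfolding E_def using T ln_nat_power[of T 2] by simp
        finally show "real (card {b\<in>?A. b \<le> B}) \<le> C * E * real B / ln (real B) ^ 2" .
      qed (use finB y in \<open>auto simp: Bs_def\<close>)
      show "0 \<le> 2 ^ N * 5 * exp 15 * real x / sqrt ?l * (wt T a / real a)"
        using wt_bounds(1)[of T a] l by (intro mult_nonneg_nonneg divide_nonneg_nonneg) auto
    qed
    also have "\<dots> = 2 ^ N * 5 * exp 15 * real x / sqrt ?l * (4 * (C * E) / ln (real y)) * (\<Sum>a\<in>{1..T\<^sup>2}. wt T a / real a)"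
      unfolding sum_distrib_left by (intro sum.cong refl) (simp add: mult_ac)
    also have "\<dots> \<le> 2 ^ N * 5 * exp 15 * real x / sqrt ?l * (4 * (C * E) / ln (real y)) * (exp 15 * (2 * ?l) / sqrt ?l)"
    proof (intro mult_left_mono)
      have "(\<Sum>a\<in>{1..T\<^sup>2}. wt T a / real a) \<le> exp 15 * ln (real (T\<^sup>2)) / sqrt ?l"
        by (rule sum_wt_over_n_le) (use T in \<open>auto simp: power2_eq_square\<close>)
      thus "(\<Sum>a\<in>{1..T\<^sup>2}. wt T a / real a) \<le> exp 15 * (2 * ?l) / sqrt ?l" using T ln_nat_power[of T 2] by simp
      show "0 \<le> 2 ^ N * 5 * exp 15 * real x / sqrt ?l * (4 * (C * E) / ln (real y))"
        using C l ly by (intro mult_nonneg_nonneg divide_nonneg_nonneg) (auto simp: E_def)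
    qed
    also have "\<dots> = 5 * exp 15 * (exp 15 * 2) * (4 * C) * real x * 2 ^ N * E / ln (real y) * (?l / (sqrt ?l * sqrt ?l))"
      by (simp only: times_divide_eq_left times_divide_eq_right mult_ac divide_divide_eq_left)
    also have "?l / (sqrt ?l * sqrt ?l) = 1" using l by simp
    finally show "real (card ?G) \<le> 5 * exp 15 * (exp 15 * 2) * (4 * C) * real x * 2 ^ N * ln (2 * ?l) ^ 2 / ln (real y)"
      by (simp add: E_def)
  qed (use C in auto)
qed

text \<open>When \<open>x\<close> is at most \<open>T ^ 4\<close>, the cofactor \<open>m\<close> may be too short to be summed last, so the sieve is
  applied to \<open>b\<close> in its full range \<open>b \<le> x / (a * m)\<close>, for fixed \<open>a\<close> and \<open>m\<close>.\<close>
lemma card_typical_large_divisor: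
  "\<exists>C>0. \<forall>T y N x. 16 \<le> T \<longrightarrow> 2 \<le> y \<longrightarrow> x \<le> T ^ 4 \<longrightarrow>
     real (card {n\<in>{1..x}. typical T y N n \<and> (\<exists>d. d dvd n \<and> prime (d + 1) \<and> T < d)}) \<le>
       C * real x * 2 ^ N * ln (4 * ln (real T)) ^ 2 * ln (real T) / ln (real y) ^ 2"
proof -
  obtain C where C: "C > 0" "\<And>a B u. 1 \<le> a \<Longrightarrow> real a \<le> u \<Longrightarrow> 16 \<le> u \<Longrightarrow> 2 \<le> B \<Longrightarrow>
     real (card {b\<in>{1..B}. prime b \<and> prime (a * b + 1)}) \<le> C * ln (ln u) ^ 2 * real B / ln (real B) ^ 2"
    using shifted_prime_pair_count_loglog by blast
  show ?thesis
  proof (intro exI[of _ "C * (exp 15 * 4) ^ 2"] conjI allI impI)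
    fix T y N x :: nat assume T: "16 \<le> T" and y: "2 \<le> y" and x: "x \<le> T ^ 4"
    let ?l = "ln (real T)"
    let ?G = "{n\<in>{1..x}. typical T y N n \<and> (\<exists>d. d dvd n \<and> prime (d + 1) \<and> T < d)}"
    define E where "E = ln (4 * ?l) ^ 2"
    have l: "?l > 0" using T by simp
    have ly: "ln (real y) > 0" using y by simp
    show "real (card ?G) \<le> C * (exp 15 * 4) ^ 2 * real x * 2 ^ N * ln (4 * ?l) ^ 2 * ?l / ln (real y) ^ 2"
    proof (cases "T \<le> x")
      case False
      have "d \<le> x" if "d dvd n" "n \<in> {1..x}" for d n
        using dvd_imp_le[OF that(1)] that(2) by simp
      moreover have "\<not> T < d" if "d \<le> x" for d using False that by simp
      ultimately have e: "?G = {}" by blast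
      have "0 \<le> C * (exp 15 * 4) ^ 2 * real x * 2 ^ N * ln (4 * ?l) ^ 2 * ?l / ln (real y) ^ 2"
        using C(1) l by (intro divide_nonneg_nonneg mult_nonneg_nonneg) auto
      thus ?thesis unfolding e by simp
    next
      case Tx: True
      define Bs where "Bs a m = {b\<in>{1..x div (a * m)}. prime b \<and> prime (a * b + 1) \<and> y < b}" for a m
      have finB: "finite (Bs a m)" for a m unfolding Bs_def by simp
      let ?Tr = "SIGMA a:{1..x}. SIGMA m:{1..x}. Bs a m"
      let ?w = "\<lambda>(a,m,b::nat). 2 ^ N * wt T a * wt T m"
      have "real (card ?G) \<le> (\<Sum>t\<in>?Tr. ?w t)"
      proof (rule card_le_sum_witnesses[where \<phi> = "\<lambda>(a,m,b). a * b * m"])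
        show "finite ?Tr" using finB by auto
        show "0 \<le> ?w t" for t using less_imp_le[OF wt_bounds(1)] by (auto split: prod.splits)
        fix n assume n: "n \<in> ?G"
        then obtain d where d: "d dvd n" "prime (d + 1)" "T < d" by blast
        obtain a b m where abm: "n = a * b * m" "d = a * b" "a > 0" "m > 0" "prime b" "y < b" "prime (a * b + 1)" "1 \<le> 2 ^ N * wt T a * wt T m"
          using typical_decompose[of n T y N d] n d by auto
        have b0: "b > 0" using abm by (simp add: prime_gt_0_nat)
        have "a dvd n" "m dvd n" "n > 0" using abm n by auto
        hence "a \<le> x" "m \<le> x" using n by (auto dest!: dvd_imp_le)
        moreover have "b \<le> x div (a * m)" using n abm by (simp add: less_eq_div_iff_mult_less_eq mult_ac)
        ultimately have "(a,m,b) \<in> ?Tr" using abm b0 by (auto simp: Bs_def)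
        thus "\<exists>t\<in>?Tr. (case t of (a,m,b) \<Rightarrow> a * b * m) = n \<and> 1 \<le> ?w t"
          by (rule bexI[rotated]) (simp add: abm(1) abm(8))
      qed auto
      also have "\<dots> = (\<Sum>a\<in>{1..x}. \<Sum>m\<in>{1..x}. \<Sum>b\<in>Bs a m. 2 ^ N * wt T a * wt T m)"
        using finB by (subst sum.Sigma[symmetric]; simp)+
      also have "\<dots> = (\<Sum>a\<in>{1..x}. \<Sum>m\<in>{1..x}. 2 ^ N * wt T a * wt T m * real (card (Bs a m)))"
        by (simp add: mult_ac)
      also have "\<dots> \<le> (\<Sum>a\<in>{1..x}. \<Sum>m\<in>{1..x}. 2 ^ N * wt T a * wt T m * (C * E / ln (real y) ^ 2 * (real x / (real a * real m))))"
      proof (intro sum_mono mult_left_mono)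
        fix a m assume a: "a \<in> {1..x}" and m: "m \<in> {1..x}"
        show "real (card (Bs a m)) \<le> C * E / ln (real y) ^ 2 * (real x / (real a * real m))"
        proof (cases "y \<le> x div (a * m)")
          case True
          have "16 * 1 \<le> T * T ^ 3" using T by (intro mult_le_mono) (auto)
          hence T16: "16 \<le> T ^ 4" by (simp add: power_Suc[symmetric] del: power_Suc)
          have "card (Bs a m) \<le> card {b\<in>{1..x div (a * m)}. prime b \<and> prime (a * b + 1)}"
            unfolding Bs_def by (intro card_mono) auto
          hence "real (card (Bs a m)) \<le> real (card {b\<in>{1..x div (a * m)}. prime b \<and> prime (a * b + 1)})" by simp
          also have "\<dots> \<le> C * ln (ln (real (T ^ 4))) ^ 2 * real (x div (a * m)) / ln (real (x div (a * m))) ^ 2"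
            by (rule C(2)) (use a x T16 True y in \<open>auto simp flip: of_nat_power simp: numeral_le_real_of_nat_iff\<close>)
          also have "ln (ln (real (T ^ 4))) ^ 2 = E" unfolding E_def using T ln_nat_power[of T 4] by simp
          also have "C * E * real (x div (a * m)) / ln (real (x div (a * m))) ^ 2 \<le> C * E * (real x / (real a * real m)) / ln (real y) ^ 2"
          proof (intro frac_le mult_left_mono power_mono)
            show "real (x div (a * m)) \<le> real x / (real a * real m)" using real_div_le[of x "a * m"] by simp
            show "ln (real y) \<le> ln (real (x div (a * m)))" using True y by (subst ln_le_cancel_iff) auto
          qed (use C ly in \<open>auto simp: E_def\<close>)
          finally show ?thesis by (simp add: mult_ac)
        next
          case False
          hence e: "Bs a m = {}" by (auto simp: Bs_def)
          show ?thesis unfolding e using C by (auto simp: E_def intro!: divide_nonneg_nonneg mult_nonneg_nonneg)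
        qed
        show "0 \<le> 2 ^ N * wt T a * wt T m" using wt_bounds(1)[of T a] wt_bounds(1)[of T m] by simp
      qed
      also have "\<dots> = 2 ^ N * (C * E / ln (real y) ^ 2 * real x) * ((\<Sum>a\<in>{1..x}. wt T a / real a) * (\<Sum>m\<in>{1..x}. wt T m / real m))"
        unfolding sum_product unfolding sum_distrib_left
        by (rule sum.cong[OF refl], rule sum.cong[OF refl]) (simp add: mult_ac)
      also have "\<dots> \<le> 2 ^ N * (C * E / ln (real y) ^ 2 * real x) * ((exp 15 * (4 * ?l) / sqrt ?l) * (exp 15 * (4 * ?l) / sqrt ?l))"
      proof -
        have "(\<Sum>a\<in>{1..x}. wt T a / real a) \<le> exp 15 * ln (real x) / sqrt ?l"
          by (rule sum_wt_over_n_le) (use T Tx in auto)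
        also have "\<dots> \<le> exp 15 * ln (real (T ^ 4)) / sqrt ?l"
          using x Tx T l by (intro divide_right_mono mult_left_mono, subst ln_le_cancel_iff) (auto simp flip: of_nat_power)
        also have "ln (real (T ^ 4)) = 4 * ?l" using T ln_nat_power[of T 4] by simp
        finally have s: "(\<Sum>a\<in>{1..x}. wt T a / real a) \<le> exp 15 * (4 * ?l) / sqrt ?l" .
        have s0: "(\<Sum>a\<in>{1..x}. wt T a / real a) \<ge> 0"
          using wt_bounds(1) less_imp_le by (intro sum_nonneg divide_nonneg_nonneg) auto
        show ?thesis using s s0 C by (intro mult_left_mono mult_mono) (auto simp: E_def intro!: divide_nonneg_nonneg mult_nonneg_nonneg)
      qed
      also have "\<dots> = C * (exp 15 * 4) ^ 2 * real x * 2 ^ N * E * ?l / ln (real y) ^ 2 * (?l / (sqrt ?l * sqrt ?l))"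
        by (simp add: power2_eq_square)
      also have "?l / (sqrt ?l * sqrt ?l) = 1" using l by simp
      finally show ?thesis by (simp add: E_def)
    qed
  qed (use C in auto)
qed

text \<open>Smooth divisors above \<open>T\<close> are rare by \<open>sum_smooth_recip_le\<close>; too many prime factors are rare by
  \<open>sum_om_power_le\<close>. The saving in the second case is \<open>ln T\<close> to the power
  \<open>13/10 * ln q - (q - 1)\<close>. For \<open>q = 21/16\<close>, near the optimum \<open>13/10\<close>, one has \<open>ln q \<ge> 1/4\<close> and hence
  an exponent of at least \<open>1/80\<close>.\<close>
lemma card_atypical_le:
  assumes T: "2 \<le> T" and y: "ln (real y) \<ge> 4" and N: "13/10 * prime_recip_sum T \<le> real (N + 1)"
  shows "real (card {n\<in>{1..x}. \<not> typical T y N n}) \<le>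
    real x * (exp 81 * ln (real y) ^ 9 * exp (- (ln (real T) / ln (real y))) + exp 4 * ln (real T) powr (- 1/80))"
proof -
  let ?D = "{d\<in>{1..x}. T < d \<and> prime_factors d \<subseteq> {..y}}"
  let ?H = "prime_recip_sum T"
  let ?B = "{n\<in>{1..x}. N < om T n}"
  have l: "ln (real T) > 0" using T by simp
  have "{n\<in>{1..x}. \<not> typical T y N n} \<subseteq> {n\<in>{1..x}. \<exists>d\<in>?D. d dvd n} \<union> ?B"
  proof
    fix n assume n: "n \<in> {n\<in>{1..x}. \<not> typical T y N n}"
    show "n \<in> {n\<in>{1..x}. \<exists>d\<in>?D. d dvd n} \<union> ?B"
    proof (cases "N < om T n")
      case False
      then obtain d where d: "d dvd n" "T < d" "prime_factors d \<subseteq> {..y}" using n by (auto simp: typical_def)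
      have "d \<le> x" using d n dvd_imp_le[of d n] by auto
      hence "d \<in> ?D" using d by auto
      thus ?thesis using d n by blast
    qed (use n in auto)
  qed
  hence "card {n\<in>{1..x}. \<not> typical T y N n} \<le> card ({n\<in>{1..x}. \<exists>d\<in>?D. d dvd n} \<union> ?B)" by (intro card_mono) auto
  also have "\<dots> \<le> card {n\<in>{1..x}. \<exists>d\<in>?D. d dvd n} + card ?B" by (rule card_Un_le)
  finally have 0: "real (card {n\<in>{1..x}. \<not> typical T y N n}) \<le> real (card {n\<in>{1..x}. \<exists>d\<in>?D. d dvd n}) + real (card ?B)" by simp
  have "real (card {n\<in>{1..x}. \<exists>d\<in>?D. d dvd n}) \<le> real x * (\<Sum>d\<in>?D. 1 / real d)"
    by (rule card_multiples_le) auto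
  also have "\<dots> \<le> real x * (exp 81 * ln (real y) ^ 9 * exp (- (ln (real T) / ln (real y))))"
    by (intro mult_left_mono sum_smooth_recip_le) (use y T in auto)
  finally have 1: "real (card {n\<in>{1..x}. \<exists>d\<in>?D. d dvd n}) \<le> real x * (exp 81 * ln (real y) ^ 9 * exp (- (ln (real T) / ln (real y))))" .
  define q where "q = (21/16 :: real)"
  have q: "exp (1/4) \<le> q" using exp_bound[of "1/4"] by (simp add: q_def power2_eq_square)
  have H0: "?H \<ge> 0" by (rule prime_recip_sum_nonneg)
  have "real (card ?B) * exp (13/40 * ?H) = (\<Sum>n\<in>?B. exp (13/40 * ?H))" by simp
  also have "\<dots> \<le> (\<Sum>n\<in>?B. q ^ om T n)"
  proof (rule sum_mono)
    fix n assume n: "n \<in> ?B"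
    have "exp (13/40 * ?H) \<le> exp (real (N + 1) * (1/4))" using N by simp
    also have "\<dots> = exp (1/4) ^ (N + 1)" by (rule exp_of_nat_mult)
    also have "\<dots> \<le> q ^ (N + 1)" using q by (intro power_mono) auto
    also have "\<dots> \<le> q ^ om T n" using n by (intro power_increasing) (auto simp: q_def)
    finally show "exp (13/40 * ?H) \<le> q ^ om T n" .
  qed
  also have "\<dots> \<le> (\<Sum>n\<in>{1..x}. q ^ om T n)" by (intro sum_mono2) (auto simp: q_def)
  also have "\<dots> \<le> real x * exp ((q - 1) * (?H + 12))" by (rule sum_om_power_le) (auto simp: q_def)
  finally have "real (card ?B) \<le> real x * exp ((q - 1) * (?H + 12)) * exp (- (13/40 * ?H))"
    by (simp add: exp_minus field_simps)
  also have "\<dots> = real x * exp (15/4 - ?H / 80)" by (simp add: q_def mult.assoc exp_add[symmetric] field_simps)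
  also have "\<dots> \<le> real x * exp (4 - ln (ln (real T)) / 80)"
    using prime_recip_sum_lower[OF T] by (intro mult_left_mono) (auto simp: field_simps)
  also have "exp (4 - ln (ln (real T)) / 80) = exp (4 + (- 1/80) * ln (ln (real T)))" by simp
  also have "\<dots> = exp 4 * ln (real T) powr (- 1/80)"
    using l by (simp only: powr_def exp_add) simp
  finally have 2: "real (card ?B) \<le> real x * (exp 4 * ln (real T) powr (- 1/80))" .
  show ?thesis using 0 1 2 by (simp add: distrib_left)
qed

text \<open>With \<open>N\<close> near \<open>13/10 * ln l\<close> this makes \<open>2 ^ N\<close> at most about \<open>l powr (39/40)\<close>. The exponent being
  less than \<open>1\<close> is what makes the whole argument work, and it dictates the choice of \<open>13/10\<close>.\<close>
lemma two_power_le_exp: "(2::real) ^ N \<le> exp (3/4 * real N)"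
proof -
  have "(2::real) \<le> 1 + 3/4 + (3/4)\<^sup>2 / 2" by (simp add: power2_eq_square)
  also have "\<dots> \<le> exp (3/4)" by (rule exp_lower_Taylor_quadratic) auto
  finally have "(2::real) ^ N \<le> exp (3/4) ^ N" by (intro power_mono) auto
  thus ?thesis by (simp add: exp_of_nat_mult[symmetric] mult.commute)
qed

text \<open>Here \<open>l\<close> stands for \<open>ln T\<close>. The powers of \<open>l\<close> in the summands are \<open>-7\<close>, \<open>-1/80\<close> and \<open>-1/40\<close> up to
  powers of \<open>ln l\<close>, all smaller than \<open>-1/100\<close>.\<close>
lemma block_asymptotics:
  fixes A B :: real
  shows "eventually (\<lambda>l. l > 2 \<and> l / (32 * ln l) \<ge> 4 \<and> 16 * ln l \<ge> 1 \<and>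
     exp 81 * l ^ 9 * exp (- (16 * ln l)) + exp 4 * l powr (- 1/80) + A * l powr (39/40) * ln (2 * l) ^ 2 * (32 * ln l / l)
        \<le> l powr (- 1/100) \<and>
     exp 81 * l ^ 9 * exp (- (16 * ln l)) + exp 4 * l powr (- 1/80) + B * l powr (39/40) * ln (4 * l) ^ 2 * l * (32 * ln l / l) ^ 2
        \<le> l powr (- 1/100)) at_top"
proof (intro eventually_conj)
  show "eventually (\<lambda>l::real. l > 2) at_top" by real_asymp
  show "eventually (\<lambda>l::real. l / (32 * ln l) \<ge> 4) at_top" by real_asymp
  show "eventually (\<lambda>l::real. 16 * ln l \<ge> 1) at_top" by real_asymp
  show "eventually (\<lambda>l. exp 81 * l ^ 9 * exp (- (16 * ln l)) + exp 4 * l powr (- 1/80) + A * l powr (39/40) * ln (2 * l) ^ 2 * (32 * ln l / l)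
        \<le> l powr (- 1/100)) at_top"
  proof -
    have "((\<lambda>l. (exp 81 * l ^ 9 * exp (- (16 * ln l)) + exp 4 * l powr (- 1/80) + A * l powr (39/40) * ln (2 * l) ^ 2 * (32 * ln l / l)) / l powr (- 1/100)) \<longlongrightarrow> 0) at_top"
      by real_asymp
    hence "eventually (\<lambda>l. (exp 81 * l ^ 9 * exp (- (16 * ln l)) + exp 4 * l powr (- 1/80) + A * l powr (39/40) * ln (2 * l) ^ 2 * (32 * ln l / l)) / l powr (- 1/100) < 1) at_top"
      by (rule order_tendstoD(2)) simp
    thus ?thesis using eventually_gt_at_top[of 0]
      by eventually_elim (simp add: divide_less_eq)
  qed
  show "eventually (\<lambda>l. exp 81 * l ^ 9 * exp (- (16 * ln l)) + exp 4 * l powr (- 1/80) + B * l powr (39/40) * ln (4 * l) ^ 2 * l * (32 * ln l / l) ^ 2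
        \<le> l powr (- 1/100)) at_top"
  proof -
    have "((\<lambda>l. (exp 81 * l ^ 9 * exp (- (16 * ln l)) + exp 4 * l powr (- 1/80) + B * l powr (39/40) * ln (4 * l) ^ 2 * l * (32 * ln l / l) ^ 2) / l powr (- 1/100)) \<longlongrightarrow> 0) at_top"
      by real_asymp
    hence "eventually (\<lambda>l. (exp 81 * l ^ 9 * exp (- (16 * ln l)) + exp 4 * l powr (- 1/80) + B * l powr (39/40) * ln (4 * l) ^ 2 * l * (32 * ln l / l) ^ 2) / l powr (- 1/100) < 1) at_top"
      by (rule order_tendstoD(2)) simp
    thus ?thesis using eventually_gt_at_top[of 0]
      by eventually_elim (simp add: divide_less_eq)
  qed
qed

text \<open>The parameters are \<open>ln y = ln T / (16 * ln (ln T))\<close> and \<open>N = 13/10 * ln (ln T)\<close>, approximately: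
  \<open>y\<close> is small enough for smooth divisors above \<open>T\<close> to be negligible and large enough for the sieve
  to save almost a full \<open>ln T\<close>, against the loss of \<open>2 ^ N\<close>.\<close>
lemma shifted_prime_divisor_block:
  "\<exists>T0\<ge>16. \<forall>T\<ge>T0. \<forall>x.
     (T ^ 4 \<le> x \<longrightarrow> real (card {n\<in>{1..x}. \<exists>d. d dvd n \<and> prime (d + 1) \<and> T < d \<and> d \<le> T\<^sup>2}) \<le> real x * ln (real T) powr (- 1/100)) \<and>
     (x \<le> T ^ 4 \<longrightarrow> real (card {n\<in>{1..x}. \<exists>d. d dvd n \<and> prime (d + 1) \<and> T < d}) \<le> real x * ln (real T) powr (- 1/100))"
proof -
  obtain CA where CA: "CA > 0" "\<And>T y N x. 16 \<le> T \<Longrightarrow> 2 \<le> y \<Longrightarrow> T ^ 4 \<le> x \<Longrightarrow>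
     real (card {n\<in>{1..x}. typical T y N n \<and> (\<exists>d. d dvd n \<and> prime (d + 1) \<and> T < d \<and> d \<le> T\<^sup>2)}) \<le>
       CA * real x * 2 ^ N * ln (2 * ln (real T)) ^ 2 / ln (real y)"
    using card_typical_small_divisor by blast
  obtain CB where CB: "CB > 0" "\<And>T y N x. 16 \<le> T \<Longrightarrow> 2 \<le> y \<Longrightarrow> x \<le> T ^ 4 \<Longrightarrow>
     real (card {n\<in>{1..x}. typical T y N n \<and> (\<exists>d. d dvd n \<and> prime (d + 1) \<and> T < d)}) \<le>
       CB * real x * 2 ^ N * ln (4 * ln (real T)) ^ 2 * ln (real T) / ln (real y) ^ 2"
    using card_typical_large_divisor by blast
  obtain l0 where l0: "\<And>l. l \<ge> l0 \<Longrightarrow> l > 2 \<and> l / (32 * ln l) \<ge> 4 \<and> 16 * ln l \<ge> 1 \<and>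
     exp 81 * l ^ 9 * exp (- (16 * ln l)) + exp 4 * l powr (- 1/80) + (CA * exp 9) * l powr (39/40) * ln (2 * l) ^ 2 * (32 * ln l / l)
        \<le> l powr (- 1/100) \<and>
     exp 81 * l ^ 9 * exp (- (16 * ln l)) + exp 4 * l powr (- 1/80) + (CB * exp 9) * l powr (39/40) * ln (4 * l) ^ 2 * l * (32 * ln l / l) ^ 2
        \<le> l powr (- 1/100)"
    using block_asymptotics[of "CA * exp 9" "CB * exp 9"] unfolding eventually_at_top_linorder by blast
  define T0 where "T0 = max 16 (nat \<lceil>exp l0\<rceil>)"
  show ?thesis
  proof (intro exI[of _ T0] conjI[of "T0 \<ge> 16"] allI impI)
    show "16 \<le> T0" by (simp add: T0_def)
    fix T x :: nat assume T: "T0 \<le> T"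
    have T16: "16 \<le> T" using T by (simp add: T0_def)
    define l where "l = ln (real T)"
    have "exp l0 \<le> real T" using T unfolding T0_def by linarith
    hence "l0 \<le> l" unfolding l_def using T16 by (subst ln_ge_iff) auto
    note L = l0[OF this]
    \<comment> \<open>T powr (1 / ln y) is then at least l ^ 16, which beats the power l ^ 9 in the bound for smooth divisors\<close>
    define u where "u = l / (16 * ln l)"
    define y where "y = nat \<lfloor>exp u\<rfloor>"
    define N where "N = nat \<lfloor>13/10 * prime_recip_sum T\<rfloor>"
    have lnl: "ln l > 0" using L by simp
    have u8: "u \<ge> 8" using L lnl unfolding u_def by (simp add: field_simps)
    have yb: "real y \<le> exp u" "exp u / 2 \<le> real y" "y \<ge> 2"
    proof -
      have e8: "exp u \<ge> 1 + u" by (rule exp_ge_add_one_self)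
      show "real y \<le> exp u" unfolding y_def by simp
      show "exp u / 2 \<le> real y" unfolding y_def using e8 u8 by linarith
      show "y \<ge> 2" unfolding y_def using e8 u8 by linarith
    qed
    have lny: "ln (real y) \<le> u" "u / 2 \<le> ln (real y)"
    proof -
      have "ln (real y) \<le> ln (exp u)" using yb by (subst ln_le_cancel_iff) auto
      thus "ln (real y) \<le> u" by simp
      have "ln (exp u / 2) \<le> ln (real y)" using yb by (subst ln_le_cancel_iff) auto
      moreover have "ln (exp u / 2) = u - ln 2" by (simp add: ln_div)
      ultimately show "u / 2 \<le> ln (real y)" using u8 ln_2_less_1 by linarith
    qed
    have lny4: "ln (real y) \<ge> 4" using lny u8 by simp
    have ul: "u \<le> l" using L lnl unfolding u_def by (simp add: divide_le_eq mult_le_cancel_left1)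
    have N1: "13/10 * prime_recip_sum T \<le> real (N + 1)" unfolding N_def by linarith
    have N2: "2 ^ N \<le> exp 9 * l powr (39/40)"
    proof -
      have "real N \<le> 13/10 * prime_recip_sum T" unfolding N_def using prime_recip_sum_nonneg[of T]
        by (intro of_nat_floor mult_nonneg_nonneg) auto
      also have "prime_recip_sum T \<le> ln l + 9" unfolding l_def using T16 by (intro prime_recip_sum_upper) auto
      finally have "3/4 * real N \<le> 39/40 * ln l + 9" by simp
      hence "exp (3/4 * real N) \<le> exp (39/40 * ln l + 9)" by simp
      also have "\<dots> = exp 9 * l powr (39/40)" using L by (simp add: exp_add powr_def)
      finally show ?thesis using two_power_le_exp[of N] by linarith
    qed
    have inv: "1 / ln (real y) \<le> 32 * ln l / l"
    proof -
      have "1 / ln (real y) \<le> 1 / (u / 2)" using lny u8 by (intro divide_left_mono) auto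
      also have "\<dots> = 32 * ln l / l" unfolding u_def using L lnl by simp
      finally show ?thesis .
    qed
    have atyp: "real (card {n\<in>{1..x}. \<not> typical T y N n}) \<le> real x * (exp 81 * l ^ 9 * exp (- (16 * ln l)) + exp 4 * l powr (- 1/80))" for x
    proof -
      have "real (card {n\<in>{1..x}. \<not> typical T y N n}) \<le>
        real x * (exp 81 * ln (real y) ^ 9 * exp (- (l / ln (real y))) + exp 4 * l powr (- 1/80))"
        unfolding l_def by (rule card_atypical_le) (use T16 lny4 N1 in auto)
      also have "\<dots> \<le> real x * (exp 81 * l ^ 9 * exp (- (16 * ln l)) + exp 4 * l powr (- 1/80))"
      proof (intro mult_left_mono add_mono mult_mono power_mono)
        show "ln (real y) \<le> l" using lny ul by simp
        have "l / u \<le> l / ln (real y)" using lny lny4 L by (intro divide_left_mono) auto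
        moreover have "l / u = 16 * ln l" unfolding u_def using L lnl by simp
        ultimately show "exp (- (l / ln (real y))) \<le> exp (- (16 * ln l))" by simp
      qed (use lny4 L in auto)
      finally show ?thesis .
    qed
    have cover: "real (card {n\<in>{1..x}. P n}) \<le> real (card {n\<in>{1..x}. typical T y N n \<and> P n}) + real (card {n\<in>{1..x}. \<not> typical T y N n})" for P
    proof -
      have "card {n\<in>{1..x}. P n} \<le> card ({n\<in>{1..x}. typical T y N n \<and> P n} \<union> {n\<in>{1..x}. \<not> typical T y N n})"
        by (intro card_mono) auto
      also have "\<dots> \<le> card {n\<in>{1..x}. typical T y N n \<and> P n} + card {n\<in>{1..x}. \<not> typical T y N n}" by (rule card_Un_le)
      finally show ?thesis by simp
    qed
    show "(T ^ 4 \<le> x \<longrightarrow> real (card {n\<in>{1..x}. \<exists>d. d dvd n \<and> prime (d + 1) \<and> T < d \<and> d \<le> T\<^sup>2}) \<le> real x * ln (real T) powr (- 1/100)) \<and>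
     (x \<le> T ^ 4 \<longrightarrow> real (card {n\<in>{1..x}. \<exists>d. d dvd n \<and> prime (d + 1) \<and> T < d}) \<le> real x * ln (real T) powr (- 1/100))"
    proof (intro conjI impI)
      assume x: "T ^ 4 \<le> x"
      have "real (card {n\<in>{1..x}. typical T y N n \<and> (\<exists>d. d dvd n \<and> prime (d + 1) \<and> T < d \<and> d \<le> T\<^sup>2)}) \<le>
         CA * real x * 2 ^ N * ln (2 * l) ^ 2 * (1 / ln (real y))"
        using CA(2)[OF T16 yb(3) x, of N] by (simp add: l_def)
      also have "\<dots> \<le> CA * real x * (exp 9 * l powr (39/40)) * ln (2 * l) ^ 2 * (32 * ln l / l)"
        using N2 inv CA(1) lny4 L by (intro mult_mono) auto
      also have "\<dots> = real x * ((CA * exp 9) * l powr (39/40) * ln (2 * l) ^ 2 * (32 * ln l / l))" by simp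
      finally have "real (card {n\<in>{1..x}. \<exists>d. d dvd n \<and> prime (d + 1) \<and> T < d \<and> d \<le> T\<^sup>2}) \<le>
         real x * (exp 81 * l ^ 9 * exp (- (16 * ln l)) + exp 4 * l powr (- 1/80) + (CA * exp 9) * l powr (39/40) * ln (2 * l) ^ 2 * (32 * ln l / l))"
        using cover[of "\<lambda>n. \<exists>d. d dvd n \<and> prime (d + 1) \<and> T < d \<and> d \<le> T\<^sup>2"] atyp[of x] unfolding distrib_left by linarith
      also have "\<dots> \<le> real x * l powr (- 1/100)" using L by (intro mult_left_mono) auto
      finally show "real (card {n\<in>{1..x}. \<exists>d. d dvd n \<and> prime (d + 1) \<and> T < d \<and> d \<le> T\<^sup>2}) \<le> real x * ln (real T) powr (- 1/100)"
        unfolding l_def .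
    next
      assume x: "x \<le> T ^ 4"
      have "real (card {n\<in>{1..x}. typical T y N n \<and> (\<exists>d. d dvd n \<and> prime (d + 1) \<and> T < d)}) \<le>
         CB * real x * 2 ^ N * ln (4 * l) ^ 2 * l * (1 / ln (real y)) ^ 2"
        using CB(2)[OF T16 yb(3) x, of N] by (simp add: l_def power_divide)
      also have "\<dots> \<le> CB * real x * (exp 9 * l powr (39/40)) * ln (4 * l) ^ 2 * l * (32 * ln l / l) ^ 2"
        using N2 inv CB(1) lny4 L by (intro mult_mono power_mono) auto
      also have "\<dots> = real x * ((CB * exp 9) * l powr (39/40) * ln (4 * l) ^ 2 * l * (32 * ln l / l) ^ 2)" by simp
      finally have "real (card {n\<in>{1..x}. \<exists>d. d dvd n \<and> prime (d + 1) \<and> T < d}) \<le>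
         real x * (exp 81 * l ^ 9 * exp (- (16 * ln l)) + exp 4 * l powr (- 1/80) + (CB * exp 9) * l powr (39/40) * ln (4 * l) ^ 2 * l * (32 * ln l / l) ^ 2)"
        using cover[of "\<lambda>n. \<exists>d. d dvd n \<and> prime (d + 1) \<and> T < d"] atyp[of x] unfolding distrib_left by linarith
      also have "\<dots> \<le> real x * l powr (- 1/100)" using L by (intro mult_left_mono) auto
      finally show "real (card {n\<in>{1..x}. \<exists>d. d dvd n \<and> prime (d + 1) \<and> T < d}) \<le> real x * ln (real T) powr (- 1/100)"
        unfolding l_def .
    qed
  qed
qed

text \<open>Along \<open>T = 2 ^ 2 ^ i\<close> the block bounds form a geometric series, since \<open>ln T\<close> doubles at each step.
  The blocks are used as long as \<open>T ^ 4 \<le> x\<close>; the first \<open>T\<close> beyond takes care of all larger divisors.\<close>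
theorem shifted_prime_divisor_tail:
  fixes \<epsilon> :: real assumes "\<epsilon> > 0"
  shows "\<exists>Y. \<forall>x. real (card {n\<in>{1..x}. \<exists>d. d dvd n \<and> prime (d + 1) \<and> Y < d}) \<le> \<epsilon> * real x"
proof -
  obtain T0 where T0: "T0 \<ge> 16" "\<And>T x. T \<ge> T0 \<Longrightarrow> T ^ 4 \<le> x \<Longrightarrow>
       real (card {n\<in>{1..x}. \<exists>d. d dvd n \<and> prime (d + 1) \<and> T < d \<and> d \<le> T\<^sup>2}) \<le> real x * ln (real T) powr (- 1/100)"
     "\<And>T x. T \<ge> T0 \<Longrightarrow> x \<le> T ^ 4 \<Longrightarrow>
       real (card {n\<in>{1..x}. \<exists>d. d dvd n \<and> prime (d + 1) \<and> T < d}) \<le> real x * ln (real T) powr (- 1/100)"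
    using shifted_prime_divisor_block by blast
  define q where "q = (2::real) powr (- 1/100)"
  define c where "c = ln (2::real) powr (- 1/100)"
  define t where "t i = (2::nat) ^ 2 ^ i" for i :: nat
  have q: "0 < q" "q < 1" unfolding q_def by (simp, subst powr_less_one) auto
  have c0: "c > 0" by (simp add: c_def)
  have lt: "ln (real (t i)) powr (- 1/100) = c * q ^ i" for i
    unfolding t_def ln_two_power c_def q_def
    by (simp add: powr_mult powr_power powr_powr mult.commute flip: powr_realpow)
  have t_Suc: "t (Suc i) = (t i)\<^sup>2" for i unfolding t_def by (simp add: power_mult mult.commute[of 2])
  have t_mono: "t i \<le> t j" if "i \<le> j" for i j unfolding t_def using that by (intro power_increasing) auto
  have t_ge: "i \<le> t i" for i
  proof -
    have "i < 2 ^ i" by (rule less_exp)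
    also have "(2::nat) ^ i < 2 ^ 2 ^ i" by (rule less_exp)
    finally show ?thesis by (simp add: t_def)
  qed
  have "(\<lambda>i. c / (1 - q) * q ^ i) \<longlonglongrightarrow> c / (1 - q) * 0"
    using q by (intro tendsto_intros LIMSEQ_realpow_zero) auto
  hence "eventually (\<lambda>i. c / (1 - q) * q ^ i < \<epsilon>) sequentially"
    using assms by (intro order_tendstoD(2)) auto
  then obtain i1 where i1: "\<And>i. i \<ge> i1 \<Longrightarrow> c / (1 - q) * q ^ i < \<epsilon>" unfolding eventually_sequentially by blast
  \<comment> \<open>t i is at least i, so every block from i0 on starts beyond T0\<close>
  define i0 where "i0 = max i1 T0"
  have tT: "T0 \<le> t i" if "i \<ge> i0" for i using t_ge[of i] that by (simp add: i0_def)
  have "real (card {n\<in>{1..x}. \<exists>d. d dvd n \<and> prime (d + 1) \<and> t i0 < d}) \<le> \<epsilon> * real x" for x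
  proof -
    have ex: "\<exists>k. k \<ge> i0 \<and> x \<le> t k ^ 4"
    proof (intro exI conjI)
      show "i0 \<le> max i0 x" by simp
      have "x \<le> t (max i0 x) ^ 1" using t_ge[of "max i0 x"] by simp
      also have "\<dots> \<le> t (max i0 x) ^ 4" by (intro power_increasing) (auto simp: t_def)
      finally show "x \<le> t (max i0 x) ^ 4" .
    qed
    define k where "k = (LEAST k. k \<ge> i0 \<and> x \<le> t k ^ 4)"
    have k: "k \<ge> i0" "x \<le> t k ^ 4" using LeastI_ex[OF ex] unfolding k_def by auto
    have below: "t i ^ 4 \<le> x" if "i0 \<le> i" "i < k" for i
      using not_less_Least[of i "\<lambda>k. k \<ge> i0 \<and> x \<le> t k ^ 4"] that unfolding k_def by auto
    let ?A = "\<lambda>i. {n\<in>{1..x}. \<exists>d. d dvd n \<and> prime (d + 1) \<and> t i < d \<and> d \<le> (t i)\<^sup>2}"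
    let ?B = "{n\<in>{1..x}. \<exists>d. d dvd n \<and> prime (d + 1) \<and> t k < d}"
    have locate: "(\<exists>i\<in>{i0..<j}. t i < d \<and> d \<le> (t i)\<^sup>2) \<or> t j < d" if "t i0 < d" "i0 \<le> j" for d j
      using that(2,1)
    proof (induction j rule: dec_induct)
      case (step j)
      thus ?case by (cases "d \<le> (t j)\<^sup>2") (auto simp: t_Suc not_le)
    qed auto
    have "{n\<in>{1..x}. \<exists>d. d dvd n \<and> prime (d + 1) \<and> t i0 < d} \<subseteq> (\<Union>i\<in>{i0..<k}. ?A i) \<union> ?B"
    proof
      fix n assume "n \<in> {n\<in>{1..x}. \<exists>d. d dvd n \<and> prime (d + 1) \<and> t i0 < d}"
      then obtain d where d: "n \<in> {1..x}" "d dvd n" "prime (d + 1)" "t i0 < d" by blast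
      from locate[OF d(4) k(1)] show "n \<in> (\<Union>i\<in>{i0..<k}. ?A i) \<union> ?B"
        using d by blast
    qed
    hence "card {n\<in>{1..x}. \<exists>d. d dvd n \<and> prime (d + 1) \<and> t i0 < d} \<le> card ((\<Union>i\<in>{i0..<k}. ?A i) \<union> ?B)"
      by (intro card_mono) auto
    also have "\<dots> \<le> card (\<Union>i\<in>{i0..<k}. ?A i) + card ?B" by (rule card_Un_le)
    also have "card (\<Union>i\<in>{i0..<k}. ?A i) \<le> (\<Sum>i\<in>{i0..<k}. card (?A i))" by (rule card_UN_le) auto
    finally have "real (card {n\<in>{1..x}. \<exists>d. d dvd n \<and> prime (d + 1) \<and> t i0 < d}) \<le> (\<Sum>i\<in>{i0..<k}. real (card (?A i))) + real (card ?B)"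
      by (simp flip: of_nat_sum of_nat_add)
    also have "\<dots> \<le> (\<Sum>i\<in>{i0..<k}. real x * (c * q ^ i)) + real x * (c * q ^ k)"
    proof (intro add_mono sum_mono)
      fix i assume "i \<in> {i0..<k}"
      thus "real (card (?A i)) \<le> real x * (c * q ^ i)" using T0(2)[OF tT below] lt by simp
    qed (use T0(3)[OF tT k(2)] k(1) lt in simp)
    also have "\<dots> = real x * c * (\<Sum>i\<in>{i0..<Suc k}. q ^ i)"
      using k(1) by (simp add: sum_distrib_left distrib_left mult_ac)
    also have "\<dots> \<le> real x * c * (q ^ i0 / (1 - q))"
    proof (intro mult_left_mono)
      have "(\<Sum>i\<in>{i0..<i0 + j}. q ^ i) * (1 - q) = q ^ i0 - q ^ (i0 + j)" for j
        by (induction j) (simp_all add: distrib_right right_diff_distrib)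
      from this[of "Suc k - i0"] have "(\<Sum>i\<in>{i0..<Suc k}. q ^ i) * (1 - q) = q ^ i0 - q ^ Suc k"
        using k(1) by (simp del: sum.op_ivl_Suc power_Suc)
      moreover have "0 \<le> q ^ Suc k" using q by simp
      ultimately have "(\<Sum>i\<in>{i0..<Suc k}. q ^ i) * (1 - q) \<le> q ^ i0" by linarith
      thus "(\<Sum>i\<in>{i0..<Suc k}. q ^ i) \<le> q ^ i0 / (1 - q)" using q by (simp add: pos_le_divide_eq del: sum.op_ivl_Suc)
    qed (use c0 in auto)
    also have "\<dots> = real x * (c / (1 - q) * q ^ i0)" by simp
    also have "\<dots> \<le> real x * \<epsilon>" using i1[of i0] by (intro mult_left_mono) (auto simp: i0_def)
    finally show ?thesis by (simp add: mult.commute)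
  qed
  thus ?thesis by blast
qed

section \<open>Dirichlet characters and primes in arithmetic progressions\<close>

text \<open>Dirichlet characters modulo \<open>W\<close>, as functions on the natural numbers that vanish off the units.\<close>
definition dchars :: "nat \<Rightarrow> (nat \<Rightarrow> complex) set" where
  "dchars W = {\<xi>. (\<forall>m n. \<xi> (m * n) = \<xi> m * \<xi> n) \<and> (\<forall>m n. [m = n] (mod W) \<longrightarrow> \<xi> m = \<xi> n) \<and>
                 (\<forall>n. \<xi> n \<noteq> 0 \<longleftrightarrow> coprime n W)}"

definition principal_char :: "nat \<Rightarrow> nat \<Rightarrow> complex" where
  "principal_char W n = (if coprime n W then 1 else 0)"

lemma dcharsD:
  assumes "\<xi> \<in> dchars W"
  shows "\<xi> (m * n) = \<xi> m * \<xi> n" "[m = n] (mod W) \<Longrightarrow> \<xi> m = \<xi> n" "\<xi> n = 0 \<longleftrightarrow> \<not> coprime n W"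
  using assms unfolding dchars_def by auto

lemma dchars_one: assumes "\<xi> \<in> dchars W" shows "\<xi> 1 = 1"
proof -
  have "\<xi> 1 * \<xi> 1 = \<xi> 1" using dcharsD(1)[OF assms, of 1 1] by simp
  moreover have "\<xi> 1 \<noteq> 0" using dcharsD(3)[OF assms, of 1] by simp
  ultimately show ?thesis by simp
qed

lemma dchars_power: assumes "\<xi> \<in> dchars W" shows "\<xi> (n ^ k) = \<xi> n ^ k"
  by (induction k) (use dcharsD(1)[OF assms] dchars_one[OF assms] in auto)

lemma dchars_root_of_unity:
  assumes "\<xi> \<in> dchars W" "coprime n W"
  shows "\<xi> n ^ totient W = 1"
proof -
  have "[n ^ totient W = 1] (mod W)" by (rule euler_theorem) fact
  hence "\<xi> (n ^ totient W) = \<xi> 1" by (rule dcharsD(2)[OF assms(1)])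
  thus ?thesis using dchars_power[OF assms(1)] dchars_one[OF assms(1)] by simp
qed

lemma norm_dchars:
  assumes "\<xi> \<in> dchars W" "W > 0" "coprime n W" shows "norm (\<xi> n) = 1"
proof -
  have "norm (\<xi> n) ^ totient W = 1" using dchars_root_of_unity[OF assms(1,3)] by (metis norm_one norm_power)
  thus ?thesis using assms(2) power_eq_imp_eq_base[of "norm (\<xi> n)" "totient W" 1] by simp
qed

lemma norm_dchars_le: assumes "\<xi> \<in> dchars W" "W > 0" shows "norm (\<xi> n) \<le> 1"
  using norm_dchars[OF assms, of n] dcharsD(3)[OF assms(1), of n] by (cases "coprime n W") auto

lemma principal_char_in: "principal_char W \<in> dchars W"
  unfolding dchars_def principal_char_def
  using cong_imp_coprime[of _ _ W] cong_sym[of _ _ W] by (auto simp: coprime_mult_left_iff coprime_commute)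

lemma dchars_times: "\<xi> \<in> dchars W \<Longrightarrow> \<psi> \<in> dchars W \<Longrightarrow> (\<lambda>n. \<xi> n * \<psi> n) \<in> dchars W"
  unfolding dchars_def by (auto simp: mult_ac)

lemma dchars_cnj: "\<xi> \<in> dchars W \<Longrightarrow> (\<lambda>n. cnj (\<xi> n)) \<in> dchars W"
  unfolding dchars_def by auto

lemma dchars_cnj_mult:
  assumes "\<xi> \<in> dchars W" "W > 0" "coprime n W" shows "cnj (\<xi> n) * \<xi> n = 1"
  using norm_dchars[OF assms] complex_norm_square[of "\<xi> n"] by (simp add: mult.commute)

text \<open>A character is determined by its values at finitely many residues, all of them roots of unity of
  order dividing \<open>totient W\<close> or zero.\<close>
lemma finite_dchars: assumes "W > 0" shows "finite (dchars W)"
proof -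
  let ?R = "insert 0 {z::complex. z ^ totient W = 1}"
  have fin: "finite ?R" using finite_roots_unity[of "totient W", where 'a = complex] assms
    by (simp add: Suc_le_eq)
  have "finite (dchars W)"
  proof (rule finite_imageD)
    show "finite ((\<lambda>\<xi>. restrict \<xi> {..<W}) ` dchars W)"
    proof (rule finite_subset)
      show "(\<lambda>\<xi>. restrict \<xi> {..<W}) ` dchars W \<subseteq> PiE {..<W} (\<lambda>_. ?R)"
      proof (rule image_subsetI)
        fix \<xi> assume \<xi>: "\<xi> \<in> dchars W"
        have "\<xi> n \<in> ?R" for n
          using dchars_root_of_unity[OF \<xi>, of n] dcharsD(3)[OF \<xi>, of n] by blast
        thus "restrict \<xi> {..<W} \<in> PiE {..<W} (\<lambda>_. ?R)" by (simp only: restrict_PiE_iff) blast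
      qed
      show "finite (PiE {..<W} (\<lambda>_. ?R))" by (intro finite_PiE fin) auto
    qed
    show "inj_on (\<lambda>\<xi>. restrict \<xi> {..<W}) (dchars W)"
    proof (rule inj_onI, rule ext)
      fix \<xi> \<psi> n assume *: "\<xi> \<in> dchars W" "\<psi> \<in> dchars W" "restrict \<xi> {..<W} = restrict \<psi> {..<W}"
      have c: "[n = n mod W] (mod W)" by (simp add: Cong.cong_def)
      have "n mod W < W" using assms by simp
      hence "\<xi> (n mod W) = \<psi> (n mod W)" using *(3) by (metis lessThan_iff restrict_apply')
      thus "\<xi> n = \<psi> n" using dcharsD(2)[OF *(1) c] dcharsD(2)[OF *(2) c] by simp
    qed
  qed
  thus ?thesis .
qed

text \<open>What Dirichlet's argument needs of the group of characters. For the moduli used below, which are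
  four times a squarefree odd number, it follows from the existence of primitive roots.\<close>
definition dchars_separate :: "nat \<Rightarrow> bool" where
  "dchars_separate W \<longleftrightarrow>
     (\<forall>m. coprime m W \<longrightarrow> \<not> [m = 1] (mod W) \<longrightarrow> (\<exists>\<xi>\<in>dchars W. \<xi> m \<noteq> 1))"

text \<open>Send the primitive root \<open>g\<close> of \<open>q\<close> to a root of unity of exact order \<open>totient q\<close>. The resulting
  character modulo \<open>q\<close> is injective on the units, so it separates \<open>n\<close> from \<open>1\<close>.\<close>
lemma dchar_separating_primroot:
  assumes W: "W > 0" and n: "coprime n W" and q: "q dvd W" "residue_primroot q g" "\<not> [n = 1] (mod q)"
  shows "\<exists>\<xi>\<in>dchars W. \<xi> n \<noteq> 1"
proof -
  define t where "t = totient q"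
  have q0: "q > 0" using q W by (auto intro: Nat.gr0I)
  have t0: "t > 0" using q0 by (simp add: t_def)
  define \<omega> where "\<omega> = cis (2 * pi / real t)"
  have g: "coprime q g" "ord q g = t" using q(2) by (auto simp: residue_primroot_def t_def)
  have ex: "\<exists>k. [g ^ k = m] (mod q)" if "coprime m W" for m
  proof (cases "q = 1")
    case False
    have "coprime m q" using coprime_divisors[of m m q W] that q(1) by simp
    hence "m mod q \<in> totatives q"
      using q0 False by (auto simp: totatives_def coprime_commute intro!: Nat.gr0I)
    hence "m mod q \<in> (\<lambda>i. g ^ i mod q) ` {..<totient q}"
      using residue_primroot_is_generator[of q g] q0 False q(2) by (auto simp: bij_betw_def)
    thus ?thesis by (auto simp: Cong.cong_def)
  qed (auto)
  define ind where "ind m = (SOME k. [g ^ k = m] (mod q))" for m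
  have ind: "[g ^ ind m = m] (mod q)" if "coprime m W" for m
    unfolding ind_def by (rule someI_ex[OF ex[OF that]])
  have \<omega>t: "\<omega> ^ t = 1" unfolding \<omega>_def using t0 by (simp add: Complex.DeMoivre)
  have \<omega>cong: "\<omega> ^ k = \<omega> ^ l" if "[k = l] (mod t)" for k l
  proof -
    have "\<omega> ^ k = \<omega> ^ (k mod t)" for k
    proof -
      have "\<omega> ^ k = \<omega> ^ (t * (k div t) + k mod t)" by simp
      also have "\<dots> = (\<omega> ^ t) ^ (k div t) * \<omega> ^ (k mod t)" by (simp only: power_add power_mult)
      finally show ?thesis using \<omega>t by simp
    qed
    from this[of k] this[of l] show ?thesis using that by (simp add: Cong.cong_def)
  qed
  have \<omega>1: "t dvd k" if "\<omega> ^ k = 1" for k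
  proof -
    have "cis (real k * (2 * pi / real t)) = 1" using that unfolding \<omega>_def by (simp add: Complex.DeMoivre)
    hence "cos (real k * (2 * pi / real t)) = 1" by (metis cis.sel(1) one_complex.sel(1))
    then obtain j :: int where "real k * (2 * pi / real t) = real_of_int j * 2 * pi" using cos_one_2pi_int by blast
    hence "real k = real_of_int j * real t" using t0 by (simp add: field_simps)
    hence "real_of_int (int k) = real_of_int (j * int t)" by simp
    hence "int k = j * int t" by (simp only: of_int_eq_iff)
    hence "int t dvd int k" by simp
    thus ?thesis by (simp only: int_dvd_int_iff)
  qed
  define \<xi> where "\<xi> m = (if coprime m W then \<omega> ^ ind m else 0)" for m
  have \<omega>0: "\<omega> \<noteq> 0" unfolding \<omega>_def by simp
  have mult: "\<xi> (a * b) = \<xi> a * \<xi> b" for a b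
  proof (cases "coprime a W \<and> coprime b W")
    case True
    hence "[g ^ ind (a * b) = a * b] (mod q)" by (intro ind) (simp add: coprime_mult_left_iff)
    moreover have "[g ^ ind a * g ^ ind b = a * b] (mod q)" using True ind by (intro cong_mult) auto
    ultimately have "[g ^ ind (a * b) = g ^ (ind a + ind b)] (mod q)"
      unfolding power_add by (metis cong_sym cong_trans)
    hence "[ind (a * b) = ind a + ind b] (mod t)" using order_divides_expdiff[OF g(1)] g(2) by simp
    hence "\<omega> ^ ind (a * b) = \<omega> ^ (ind a + ind b)" by (rule \<omega>cong)
    thus ?thesis using True by (simp add: \<xi>_def power_add coprime_mult_left_iff)
  qed (auto simp: \<xi>_def coprime_mult_left_iff)
  have per: "\<xi> a = \<xi> b" if "[a = b] (mod W)" for a b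
  proof (cases "coprime a W")
    case True
    hence b: "coprime b W" using that cong_imp_coprime by blast
    have "[a = b] (mod q)" using that q(1) cong_dvd_modulus_nat by blast
    hence "[g ^ ind a = g ^ ind b] (mod q)" using ind[OF True] ind[OF b] by (metis cong_sym cong_trans)
    hence "[ind a = ind b] (mod t)" using order_divides_expdiff[OF g(1)] g(2) by simp
    thus ?thesis using True b \<omega>cong by (simp add: \<xi>_def)
  next
    case False
    hence "\<not> coprime b W" using that cong_imp_coprime cong_sym by blast
    thus ?thesis using False by (simp add: \<xi>_def)
  qed
  have "\<xi> \<in> dchars W"
    unfolding dchars_def using mult per \<omega>0 by (auto simp: \<xi>_def)
  moreover have "\<xi> n \<noteq> 1"
  proof
    assume "\<xi> n = 1"
    hence "t dvd ind n" using n \<omega>1 by (simp add: \<xi>_def)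
    hence "[ind n = 0] (mod t)" by (simp add: cong_0_iff)
    hence "[g ^ ind n = g ^ 0] (mod q)" using order_divides_expdiff[OF g(1), of "ind n" 0] g(2) by metis
    hence "[n = 1] (mod q)" using ind[OF n] by (metis cong_sym cong_trans power_0)
    thus False using q(3) by simp
  qed
  ultimately show ?thesis by blast
qed

text \<open>Orthogonality. A character \<open>\<psi>\<close> with \<open>\<psi> n \<noteq> 1\<close> permutes the characters by multiplication and thereby
  multiplies the sum by \<open>\<psi> n\<close>, so the sum vanishes.\<close>
lemma sum_dchars:
  assumes "W > 0" and sep: "dchars_separate W"
  shows "(\<Sum>\<xi>\<in>dchars W. \<xi> n) = (if [n = 1] (mod W) then of_nat (card (dchars W)) else 0)"
proof -
  consider "[n = 1] (mod W)" | "\<not> [n = 1] (mod W)" "coprime n W" | "\<not> [n = 1] (mod W)" "\<not> coprime n W" by blast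
  thus ?thesis
  proof cases
    case 1
    have "\<xi> n = 1" if "\<xi> \<in> dchars W" for \<xi> using dcharsD(2)[OF that 1] dchars_one[OF that] by simp
    hence "(\<Sum>\<xi>\<in>dchars W. \<xi> n) = (\<Sum>\<xi>\<in>dchars W. 1)" by (intro sum.cong) auto
    thus ?thesis using 1 by simp
  next
    case 2
    obtain \<psi> where \<psi>: "\<psi> \<in> dchars W" "\<psi> n \<noteq> 1"
      using sep 2 unfolding dchars_separate_def by blast
    have "(\<Sum>\<xi>\<in>dchars W. \<xi> n) = (\<Sum>\<xi>\<in>dchars W. \<psi> n * \<xi> n)"
    proof (rule sum.reindex_bij_witness[of _ "\<lambda>\<xi> n. \<psi> n * \<xi> n" "\<lambda>\<xi> n. cnj (\<psi> n) * \<xi> n"])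
      fix \<xi> assume \<xi>: "\<xi> \<in> dchars W"
      have z: "\<xi> m = 0" if "\<not> coprime m W" for m using dcharsD(3)[OF \<xi>] that by simp
      have o: "cnj (\<psi> m) * \<psi> m = 1" if "coprime m W" for m using dchars_cnj_mult[OF \<psi>(1) assms(1) that] .
      show *: "(\<lambda>n. \<psi> n * (cnj (\<psi> n) * \<xi> n)) = \<xi>"
        using z o by (intro ext) (metis mult.assoc mult.commute mult_1 mult_zero_right)
      show "(\<lambda>n. cnj (\<psi> n) * (\<psi> n * \<xi> n)) = \<xi>"
        using z o by (intro ext) (metis mult.assoc mult_1 mult_zero_right)
      show "(\<lambda>n. cnj (\<psi> n) * \<xi> n) \<in> dchars W" by (intro dchars_times dchars_cnj \<psi> \<xi>)
      show "(\<lambda>n. \<psi> n * \<xi> n) \<in> dchars W" by (intro dchars_times \<psi> \<xi>)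
      show "\<psi> n * (cnj (\<psi> n) * \<xi> n) = \<xi> n" using fun_cong[OF *] .
    qed
    also have "\<dots> = \<psi> n * (\<Sum>\<xi>\<in>dchars W. \<xi> n)" by (rule sum_distrib_left[symmetric])
    finally have "(1 - \<psi> n) * (\<Sum>\<xi>\<in>dchars W. \<xi> n) = 0" by (simp add: algebra_simps)
    thus ?thesis using \<psi> 2 by auto
  next
    case 3
    have "\<xi> n = 0" if "\<xi> \<in> dchars W" for \<xi> using dcharsD(3)[OF that] 3 by simp
    hence "(\<Sum>\<xi>\<in>dchars W. \<xi> n) = 0" by (intro sum.neutral) blast
    thus ?thesis using 3 by simp
  qed
qed

lemma norm_sum_dchar_le:
  assumes "W > 0" "\<xi> \<in> dchars W" "\<xi> \<noteq> principal_char W"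
  shows "norm (\<Sum>n<N. \<xi> n) \<le> real W"
proof -
  have "\<exists>a. coprime a W \<and> \<xi> a \<noteq> 1"
  proof (rule ccontr)
    assume "\<nexists>a. coprime a W \<and> \<xi> a \<noteq> 1"
    hence "\<xi> n = principal_char W n" for n using dcharsD(3)[OF assms(2)] by (auto simp: principal_char_def)
    thus False using assms(3) by blast
  qed
  then obtain a where a: "coprime a W" "\<xi> a \<noteq> 1" by blast
  have full: "(\<Sum>n<W. \<xi> n) = 0"
  proof -
    have inj: "inj_on (\<lambda>n. (a * n) mod W) {..<W}"
    proof (rule inj_onI)
      fix x y assume xy: "x \<in> {..<W}" "y \<in> {..<W}" "a * x mod W = a * y mod W"
      hence "[a * x = a * y] (mod W)" by (simp add: Cong.cong_def)
      hence "[x = y] (mod W)" using a by (simp add: cong_mult_lcancel_nat)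
      thus "x = y" using xy by (simp add: Cong.cong_def)
    qed
    have "(\<lambda>n. (a * n) mod W) ` {..<W} = {..<W}"
      by (rule endo_inj_surj[OF _ _ inj]) (use assms in auto)
    hence "(\<Sum>n<W. \<xi> n) = (\<Sum>n<W. \<xi> ((a * n) mod W))"
      using sum.reindex[OF inj, of \<xi>] by simp
    also have "\<dots> = (\<Sum>n<W. \<xi> a * \<xi> n)"
      using dcharsD(2)[OF assms(2), of "a * _ mod W" "a * _"] dcharsD(1)[OF assms(2)]
      by (intro sum.cong) (auto simp: Cong.cong_def)
    also have "\<dots> = \<xi> a * (\<Sum>n<W. \<xi> n)" by (rule sum_distrib_left[symmetric])
    finally have "(1 - \<xi> a) * (\<Sum>n<W. \<xi> n) = 0" by (simp add: algebra_simps)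
    thus ?thesis using a by simp
  qed
  have shift: "(\<Sum>n<k*W + r. \<xi> n) = (\<Sum>n<r. \<xi> n)" for k r
  proof (induction k)
    case (Suc k)
    have "(\<Sum>n<Suc k * W + r. \<xi> n) = (\<Sum>n<W + (k * W + r). \<xi> n)" by (simp add: add.assoc)
    also have "\<dots> = (\<Sum>n<W. \<xi> n) + (\<Sum>n<k*W+r. \<xi> (n + W))"
    proof -
      have "(\<Sum>n<W + j. \<xi> n) = (\<Sum>n<W. \<xi> n) + (\<Sum>n<j. \<xi> (n + W))" for j
        by (induction j) (auto simp: add.commute)
      thus ?thesis .
    qed
    also have "(\<Sum>n<k*W+r. \<xi> (n + W)) = (\<Sum>n<k*W+r. \<xi> n)"
      by (rule sum.cong[OF refl], rule dcharsD(2)[OF assms(2)]) (simp add: Cong.cong_def)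
    finally have "(\<Sum>n<Suc k * W + r. \<xi> n) = (\<Sum>n<W. \<xi> n) + (\<Sum>n<k*W+r. \<xi> n)" .
    thus ?case by (simp only: full Suc add_0)
  qed simp
  have "(\<Sum>n<N. \<xi> n) = (\<Sum>n<N mod W. \<xi> n)" using shift[of "N div W" "N mod W"] by simp
  also have "norm \<dots> \<le> (\<Sum>n<N mod W. 1)" by (rule sum_norm_le) (use norm_dchars_le assms in auto)
  also have "\<dots> = real (N mod W)" by simp
  also have "\<dots> \<le> real W" using assms(1) by (simp add: less_imp_le)
  finally show ?thesis .
qed

text \<open>Abel summation against a nonnegative decreasing weight.\<close>
lemma norm_sum_weighted_le:
  fixes a :: "nat \<Rightarrow> complex" and g :: "nat \<Rightarrow> real"
  assumes bd: "\<And>N. norm (\<Sum>n<N. a n) \<le> B" and g0: "\<And>n. n \<ge> m \<Longrightarrow> g n \<ge> 0"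
    and dec: "\<And>n. n \<ge> m \<Longrightarrow> g (Suc n) \<le> g n"
  shows "norm (\<Sum>n\<in>{m..<N}. a n * of_real (g n)) \<le> 2 * B * g m"
proof (cases "m < N")
  case True
  define A where "A N = (\<Sum>n<N. a n)" for N
  have B0: "B \<ge> 0" using bd[of 0] by simp
  have "(\<Sum>n\<in>{m..<m + k}. a n * of_real (g n)) =
      A (m + k) * of_real (g (m + k)) - A m * of_real (g m) + (\<Sum>n\<in>{m..<m + k}. A (Suc n) * of_real (g n - g (Suc n)))" for k
    by (induction k) (auto simp: A_def algebra_simps)
  from this[of "N - m"] True have eq: "(\<Sum>n\<in>{m..<N}. a n * of_real (g n)) =
      A N * of_real (g N) - A m * of_real (g m) + (\<Sum>n\<in>{m..<N}. A (Suc n) * of_real (g n - g (Suc n)))" by simp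
  have tel: "(\<Sum>n\<in>{m..<m + k}. g n - g (Suc n)) = g m - g (m + k)" for k by (induction k) auto
  have "norm (\<Sum>n\<in>{m..<N}. A (Suc n) * of_real (g n - g (Suc n))) \<le> (\<Sum>n\<in>{m..<N}. B * (g n - g (Suc n)))"
    using bd dec by (intro sum_norm_le) (auto simp: norm_mult A_def simp del: of_real_diff sum.lessThan_Suc intro!: mult_mono B0)
  also have "\<dots> = B * (g m - g N)" using tel[of "N - m"] True by (simp flip: sum_distrib_left)
  finally have 1: "norm (\<Sum>n\<in>{m..<N}. A (Suc n) * of_real (g n - g (Suc n))) \<le> B * (g m - g N)" .
  have 2: "norm (A N * of_real (g N)) \<le> B * g N" "norm (A m * of_real (g m)) \<le> B * g m"
    using bd g0 True by (auto simp: norm_mult A_def intro!: mult_mono B0)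
  show ?thesis unfolding eq
    using norm_triangle_ineq[of "A N * of_real (g N) - A m * of_real (g m)" "\<Sum>n\<in>{m..<N}. A (Suc n) * of_real (g n - g (Suc n))"]
      norm_triangle_ineq4[of "A N * of_real (g N)" "A m * of_real (g m)"] 1 2 by (simp add: algebra_simps)
next
  case False
  have "B \<ge> 0" using bd[of 0] by simp
  thus ?thesis using False g0[of m] by simp
qed

subsection \<open>The value of the L-series at 1\<close>

text \<open>Convergence of the L-series at \<open>s = 1\<close> with an explicit rate, which replaces its analytic theory in all
  that follows.\<close>
lemma dchar_L_exists:
  assumes "W > 0" "\<xi> \<in> dchars W" "\<xi> \<noteq> principal_char W"
  shows "\<exists>L. \<forall>N. norm ((\<Sum>n\<in>{1..N}. \<xi> n / of_nat n) - L) \<le> 2 * real W / real (N + 1)"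
proof -
  define f where "f N = (\<Sum>n\<in>{1..N}. \<xi> n / of_nat n)" for N
  have diff: "norm (f N - f M) \<le> 2 * real W / real (M + 1)" if "M \<le> N" for M N
  proof -
    have "{1..N} = {1..M} \<union> {Suc M..<Suc N}" using that by auto
    hence "f N = f M + (\<Sum>n\<in>{Suc M..<Suc N}. \<xi> n / of_nat n)"
      unfolding f_def by (simp only:) (rule sum.union_disjoint, auto)
    hence "f N - f M = (\<Sum>n\<in>{Suc M..<Suc N}. \<xi> n * of_real (1 / real n))" by simp
    also have "norm \<dots> \<le> 2 * real W * (1 / real (Suc M))"
      by (rule norm_sum_weighted_le) (use norm_sum_dchar_le[OF assms] in \<open>auto simp: frac_le\<close>)
    finally show ?thesis by simp
  qed
  have "Cauchy f"
  proof (rule metric_CauchyI)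
    fix e :: real assume e: "e > 0"
    obtain K :: nat where K: "4 * real W / e < real K" using reals_Archimedean2 by blast
    have "dist (f m) (f n) < e" if "m \<ge> K" "n \<ge> K" for m n
    proof -
      have "norm (f m - f K) \<le> 2 * real W / real (K + 1)" "norm (f n - f K) \<le> 2 * real W / real (K + 1)"
        using diff that by auto
      moreover have "4 * real W / real (K + 1) < e" using K e by (simp add: field_simps)
      ultimately have "norm (f m - f K) + norm (f n - f K) < e" by simp
      thus ?thesis using norm_triangle_ineq4[of "f m - f K" "f n - f K"] by (simp add: dist_norm)
    qed
    thus "\<exists>M. \<forall>m\<ge>M. \<forall>n\<ge>M. dist (f m) (f n) < e" by blast
  qed
  then obtain L where L: "f \<longlonglongrightarrow> L" using Cauchy_convergent_iff convergentD by blast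
  have "norm (f N - L) \<le> 2 * real W / real (N + 1)" for N
  proof -
    have "(\<lambda>n. norm (f N - f n)) \<longlonglongrightarrow> norm (f N - L)" by (intro tendsto_intros L)
    thus ?thesis
      by (rule LIMSEQ_le_const2) (use diff norm_minus_commute in metis)
  qed
  thus ?thesis unfolding f_def by blast
qed

definition dchar_L :: "nat \<Rightarrow> (nat \<Rightarrow> complex) \<Rightarrow> complex" where
  "dchar_L W \<xi> = (SOME L. \<forall>N. norm ((\<Sum>n\<in>{1..N}. \<xi> n / of_nat n) - L) \<le> 2 * real W / real (N + 1))"

lemma dchar_L_bound:
  assumes "W > 0" "\<xi> \<in> dchars W" "\<xi> \<noteq> principal_char W"
  shows "norm ((\<Sum>n\<in>{1..N}. \<xi> n / of_nat n) - dchar_L W \<xi>) \<le> 2 * real W / real (N + 1)"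
  using someI_ex[OF dchar_L_exists[OF assms]] unfolding dchar_L_def by blast

lemma dchar_L_div_bound:
  assumes "W > 0" "\<xi> \<in> dchars W" "\<xi> \<noteq> principal_char W" "d > 0" "N > 0"
  shows "norm ((\<Sum>n\<in>{1..N div d}. \<xi> n / of_nat n) - dchar_L W \<xi>) \<le> 2 * real W * real d / real N"
proof -
  have "N < d * (N div d + 1)" using assms(4) by (metis Suc_eq_plus1 dividend_less_times_div mult_Suc_right)
  hence "real N < real d * real (N div d + 1)" by (metis of_nat_less_iff of_nat_mult)
  hence "1 / real (N div d + 1) \<le> real d / real N" using assms by (simp add: field_simps)
  hence "2 * real W * (1 / real (N div d + 1)) \<le> 2 * real W * (real d / real N)" by (intro mult_left_mono) auto
  thus ?thesis using dchar_L_bound[OF assms(1-3), of "N div d"] by simp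
qed

text \<open>The partial sums of \<open>- L' / L\<close> at \<open>1\<close>.\<close>
definition dchar_mertens :: "(nat \<Rightarrow> complex) \<Rightarrow> nat \<Rightarrow> complex" where
  "dchar_mertens \<xi> N = (\<Sum>n\<in>{1..N}. \<xi> n * of_real (mangoldt n) / of_nat n)"

lemma norm_sum_dchar_ln_le:
  assumes "W > 0" "\<xi> \<in> dchars W" "\<xi> \<noteq> principal_char W"
  shows "norm (\<Sum>n\<in>{1..N}. \<xi> n * of_real (ln (real n)) / of_nat n) \<le> 2 + 2 * real W"
proof -
  define g where "g n = ln (real n) / real n" for n :: nat
  have dec: "g (Suc n) \<le> g n" if "n \<ge> 3" for n
  proof -
    have n: "real n \<ge> 3" using that by simp
    have "ln (real n) \<ge> 1" using n exp_le by (subst ln_ge_iff) auto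
    moreover have "ln (real (Suc n)) - ln (real n) \<le> 1 / real n"
    proof -
      have "ln (real (Suc n)) - ln (real n) = ln (1 + 1 / real n)"
        using n ln_divide_pos[of "real (Suc n)" "real n"] by (simp add: field_simps)
      also have "\<dots> \<le> 1 / real n" using n by (intro ln_add_one_self_le_self) auto
      finally show ?thesis .
    qed
    moreover from calculation(1) have "1 / real n \<le> ln (real n) / real n" using n by (intro divide_right_mono) auto
    ultimately have "ln (real (Suc n)) - ln (real n) \<le> ln (real n) / real n" by linarith
    hence "real n * ln (real (Suc n)) \<le> real (Suc n) * ln (real n)" using n by (simp add: field_simps)
    thus ?thesis unfolding g_def using n by (simp add: field_simps)
  qed
  have g1: "g n \<le> 1" if "n \<ge> 1" for n
    using that ln_le_minus_one[of "real n"] by (simp add: g_def field_simps)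
  have g0: "g n \<ge> 0" for n by (cases n) (auto simp: g_def)
  have "(\<Sum>n\<in>{1..N}. \<xi> n * of_real (ln (real n)) / of_nat n) = (\<Sum>n\<in>{1..N}. \<xi> n * of_real (g n))"
    by (simp add: g_def)
  also have "\<dots> = (\<Sum>n\<in>{1..min N 2}. \<xi> n * of_real (g n)) + (\<Sum>n\<in>{3..<Suc N}. \<xi> n * of_real (g n))"
    by (subst sum.union_disjoint[symmetric]) (auto intro!: sum.cong)
  also have "norm \<dots> \<le> norm (\<Sum>n\<in>{1..min N 2}. \<xi> n * of_real (g n)) + norm (\<Sum>n\<in>{3..<Suc N}. \<xi> n * of_real (g n))"
    by (rule norm_triangle_ineq)
  also have "norm (\<Sum>n\<in>{1..min N 2}. \<xi> n * of_real (g n)) \<le> (\<Sum>n\<in>{1..min N 2}. 1)"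
    using norm_dchars_le[OF assms(2,1)] g0 g1
    by (intro sum_norm_le) (auto simp: norm_mult intro!: mult_le_one)
  also have "\<dots> \<le> 2" by simp
  also have "norm (\<Sum>n\<in>{3..<Suc N}. \<xi> n * of_real (g n)) \<le> 2 * real W * g 3"
    by (rule norm_sum_weighted_le) (use norm_sum_dchar_le[OF assms] dec g0 in auto)
  also have "\<dots> \<le> 2 * real W" using g1[of 3] by (simp add: mult_left_le)
  finally show ?thesis by simp
qed

text \<open>The sum of \<open>\<xi> n * ln n / n\<close> is bounded and, by \<open>ln = mangoldt * 1\<close>, is close to
  \<open>L(1) * dchar_mertens \<xi> N\<close>. One may divide by \<open>L(1)\<close> if it is not zero.\<close>
lemma dchar_mertens_bounded:
  assumes "W > 0" "\<xi> \<in> dchars W" "\<xi> \<noteq> principal_char W" "dchar_L W \<xi> \<noteq> 0" "N > 0"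
  shows "norm (dchar_mertens \<xi> N) \<le> (2 + 10 * real W) / norm (dchar_L W \<xi>)"
proof -
  let ?L = "dchar_L W \<xi>"
  let ?A = "\<lambda>M. \<Sum>n\<in>{1..M}. \<xi> n / of_nat n"
  have "(\<Sum>n\<in>{1..N}. \<xi> n * of_real (ln (real n)) / of_nat n) =
        (\<Sum>n\<in>{1..N}. \<Sum>d | d dvd n. (\<xi> d * of_real (mangoldt d) / of_nat d) * (\<xi> (n div d) / of_nat (n div d)))"
  proof (intro sum.cong refl)
    fix n assume n: "n \<in> {1..N}"
    have "\<xi> n * of_real (ln (real n)) / of_nat n = (\<Sum>d | d dvd n. \<xi> n * of_real (mangoldt d) / of_nat n)"
      using n ln_eq_sum_mangoldt[of n] by (simp add: sum_distrib_left sum_divide_distrib)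
    also have "\<dots> = (\<Sum>d | d dvd n. (\<xi> d * of_real (mangoldt d) / of_nat d) * (\<xi> (n div d) / of_nat (n div d)))"
    proof (intro sum.cong refl)
      fix d assume "d \<in> {d. d dvd n}"
      then obtain k where k: "n = d * k" by auto
      hence "d > 0" "k > 0" using n by (auto intro: Nat.gr0I)
      thus "\<xi> n * of_real (mangoldt d) / of_nat n = (\<xi> d * of_real (mangoldt d) / of_nat d) * (\<xi> (n div d) / of_nat (n div d))"
        unfolding k by (simp add: dcharsD(1)[OF assms(2)])
    qed
    finally show "\<xi> n * of_real (ln (real n)) / of_nat n = (\<Sum>d | d dvd n. (\<xi> d * of_real (mangoldt d) / of_nat d) * (\<xi> (n div d) / of_nat (n div d)))" .
  qed
  also have "\<dots> = (\<Sum>d\<in>{1..N}. (\<xi> d * of_real (mangoldt d) / of_nat d) * ?A (N div d))"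
    by (subst sum_divisors_swap) (simp add: sum_distrib_left)
  also have "\<dots> = dchar_mertens \<xi> N * ?L + (\<Sum>d\<in>{1..N}. (\<xi> d * of_real (mangoldt d) / of_nat d) * (?A (N div d) - ?L))"
    unfolding dchar_mertens_def sum_distrib_right sum.distrib[symmetric]
    by (intro sum.cong refl, simp only: distrib_left[symmetric], simp)
  finally have eq: "dchar_mertens \<xi> N * ?L = (\<Sum>n\<in>{1..N}. \<xi> n * of_real (ln (real n)) / of_nat n)
     - (\<Sum>d\<in>{1..N}. (\<xi> d * of_real (mangoldt d) / of_nat d) * (?A (N div d) - ?L))" by simp
  have "norm (\<Sum>d\<in>{1..N}. (\<xi> d * of_real (mangoldt d) / of_nat d) * (?A (N div d) - ?L)) \<le>
      (\<Sum>d\<in>{1..N}. (2 * real W / real N) * mangoldt d)"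
  proof (rule sum_norm_le)
    fix d assume d: "d \<in> {1..N}"
    have "norm ((\<xi> d * of_real (mangoldt d) / of_nat d) * (?A (N div d) - ?L)) =
        (norm (\<xi> d) * mangoldt d / real d) * norm (?A (N div d) - ?L)"
      by (simp add: norm_mult norm_divide mangoldt_nonneg del: of_real_mangoldt)
    also have "\<dots> \<le> (1 * mangoldt d / real d) * (2 * real W * real d / real N)"
      using d assms(5) norm_dchars_le[OF assms(2,1)] dchar_L_div_bound[OF assms(1-3)]
      by (intro mult_mono divide_right_mono) (auto simp: mangoldt_nonneg)
    also have "\<dots> = (2 * real W / real N) * mangoldt d" using d by simp
    finally show "norm ((\<xi> d * of_real (mangoldt d) / of_nat d) * (?A (N div d) - ?L)) \<le> (2 * real W / real N) * mangoldt d" .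
  qed
  also have "\<dots> = (2 * real W / real N) * (\<Sum>d\<in>{1..N}. mangoldt d)" by (rule sum_distrib_left[symmetric])
  also have "\<dots> \<le> (2 * real W / real N) * (4 * real N)"
    using chebyshev_psi_le[of N] by (intro mult_left_mono) auto
  also have "\<dots> = 8 * real W" using assms(5) by simp
  finally have "norm (dchar_mertens \<xi> N * ?L) \<le> (2 + 2 * real W) + 8 * real W"
    unfolding eq using norm_triangle_ineq4[of "\<Sum>n\<in>{1..N}. \<xi> n * of_real (ln (real n)) / of_nat n"]
      norm_sum_dchar_ln_le[OF assms(1-3), of N] by (smt (verit))
  thus ?thesis using assms(4) by (simp add: norm_mult pos_le_divide_eq)
qed

text \<open>The Moebius function.\<close>
definition mu :: "nat \<Rightarrow> real" where
  "mu n = (if squarefree n then (-1) ^ card (prime_factors n) else 0)"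

lemma abs_mu_le: "\<bar>mu n\<bar> \<le> 1" by (simp add: mu_def)

lemma sum_mu_divisors:
  assumes "n > 0" shows "(\<Sum>d | d dvd n. mu d) = (if n = 1 then 1 else 0)"
proof (cases "n = 1")
  case True thus ?thesis by (simp add: mu_def)
next
  case False
  obtain p where p: "prime p" "p dvd n" using prime_factor_nat[of n] False by auto
  let ?A = "{d. d dvd n \<and> squarefree d \<and> \<not> p dvd d}" and ?B = "{d. d dvd n \<and> squarefree d \<and> p dvd d}"
  have fin: "finite {d. d dvd n}" using assms by simp
  have "(\<Sum>d | d dvd n. mu d) = (\<Sum>d\<in>?A \<union> ?B. mu d)"
    using fin by (intro sum.mono_neutral_right) (auto simp: mu_def)
  also have "\<dots> = (\<Sum>d\<in>?A. mu d) + (\<Sum>d\<in>?B. mu d)"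
    by (intro sum.union_disjoint finite_subset[OF _ fin]) auto
  also have "(\<Sum>d\<in>?B. mu d) = (\<Sum>d\<in>?A. - mu d)"
  proof (rule sum.reindex_bij_witness[of _ "\<lambda>d. p * d" "\<lambda>d. d div p"])
    fix d assume d: "d \<in> ?B"
    then obtain e where e: "d = p * e" by auto
    have pe: "\<not> p dvd e"
    proof
      assume "p dvd e"
      hence "p ^ 2 dvd d" unfolding e by (simp add: power2_eq_square)
      hence "p dvd 1" using d unfolding squarefree_def by blast
      thus False using p by simp
    qed
    show "p * (d div p) = d" using e p by auto
    have sf: "squarefree e" using d e squarefree_multD by auto
    show A: "d div p \<in> ?A" using d e pe sf p by (auto intro: dvd_mult_right)
    have "e > 0" using d e assms by (auto intro!: Nat.gr0I)
    hence "prime_factors d = insert p (prime_factors e)" "p \<notin> prime_factors e"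
      using e p pe by (auto simp: prime_factors_product prime_prime_factors)
    hence "mu d = - mu e" using d sf by (simp add: mu_def)
    thus "- mu (d div p) = mu d" using e p by auto
  next
    fix d assume d: "d \<in> ?A"
    have "coprime p d" using p d prime_imp_coprime by blast
    thus "p * d \<in> ?B" using d p by (auto simp: squarefree_mult_coprime squarefree_prime divides_mult)
    show "p * d div p = d" using p by auto
  qed
  finally show ?thesis using False by (simp add: sum_negf)
qed

lemma sum_mu_ln_divisors:
  assumes "n > 0" shows "(\<Sum>d | d dvd n. mu d * ln (real d)) = - mangoldt n"
proof -
  have fin: "finite {d. d dvd k}" if "k > 0" for k :: nat using that by simp
  have "(\<Sum>d | d dvd n. mu d * (ln (real n) - ln (real d))) = (\<Sum>d | d dvd n. \<Sum>e | e dvd n div d. mu d * mangoldt e)"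
  proof (intro sum.cong refl)
    fix d assume "d \<in> {d. d dvd n}"
    then obtain k where k: "n = d * k" by auto
    hence pos: "d > 0" "k > 0" using assms by auto
    have "ln (real n) - ln (real d) = ln (real k)" using pos k by (simp add: ln_mult)
    also have "\<dots> = (\<Sum>e | e dvd n div d. mangoldt e)" using pos k ln_eq_sum_mangoldt by simp
    finally show "mu d * (ln (real n) - ln (real d)) = (\<Sum>e | e dvd n div d. mu d * mangoldt e)"
      by (simp add: sum_distrib_left)
  qed
  also have "\<dots> = (\<Sum>(d,e)\<in>(SIGMA d:{d. d dvd n}. {e. e dvd n div d}). mu d * mangoldt e)"
    using assms fin by (subst sum.Sigma) (auto elim!: dvdE)
  also have "\<dots> = (\<Sum>(e,d)\<in>(SIGMA e:{e. e dvd n}. {d. d dvd n div e}). mu d * mangoldt e)"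
    by (rule sum.reindex_bij_witness[of _ "\<lambda>(e,d). (d,e)" "\<lambda>(d,e). (e,d)"])
       (use assms in \<open>auto elim!: dvdE\<close>)
  also have "\<dots> = (\<Sum>e | e dvd n. \<Sum>d | d dvd n div e. mu d * mangoldt e)"
    using assms fin by (subst sum.Sigma) (auto elim!: dvdE)
  also have "\<dots> = (\<Sum>e | e dvd n. if n div e = 1 then mangoldt e else 0)"
  proof (intro sum.cong refl)
    fix e assume "e \<in> {e. e dvd n}"
    hence "n div e > 0" using assms by (auto elim!: dvdE)
    thus "(\<Sum>d | d dvd n div e. mu d * mangoldt e) = (if n div e = 1 then mangoldt e else 0)"
      using sum_mu_divisors[of "n div e"] by (simp flip: sum_distrib_right)
  qed
  also have "\<dots> = (\<Sum>e | e dvd n. if e = n then mangoldt e else 0)"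
    using assms by (intro sum.cong) (auto elim!: dvdE)
  also have "\<dots> = mangoldt n" using fin[OF assms] by simp
  finally have "ln (real n) * (\<Sum>d | d dvd n. mu d) - (\<Sum>d | d dvd n. mu d * ln (real d)) = mangoldt n"
    by (simp add: right_diff_distrib sum_subtractf sum_distrib_left mult.commute)
  thus ?thesis using sum_mu_divisors[OF assms] by (cases "n = 1") auto
qed

text \<open>If \<open>L(1) = 0\<close>, the sum behaves as if L had a simple zero at \<open>1\<close>: it is \<open>- ln N + O(1)\<close>. This comes
  from \<open>sum of \<mu> d * ln (N / d)\<close> over \<open>d dvd n\<close>, which is \<open>mangoldt n\<close>, plus \<open>ln N\<close> for \<open>n = 1\<close>, summed
  against \<open>\<xi> n / n\<close>: each inner sum over multiples of \<open>d\<close> is small because its limit \<open>L(1)\<close> vanishes.\<close>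
lemma dchar_mertens_L_zero:
  assumes "W > 0" "\<xi> \<in> dchars W" "\<xi> \<noteq> principal_char W" "dchar_L W \<xi> = 0" "N > 0"
  shows "norm (of_real (ln (real N)) + dchar_mertens \<xi> N) \<le> 2 * real W"
proof -
  let ?A = "\<lambda>M. \<Sum>n\<in>{1..M}. \<xi> n / of_nat n"
  define c where "c d = mu d * (ln (real N) - ln (real d))" for d
  have inner: "(\<Sum>d | d dvd n. c d) = (if n = 1 then ln (real N) else 0) + mangoldt n" if "n > 0" for n
    using sum_mu_divisors[OF that] sum_mu_ln_divisors[OF that]
    by (simp add: c_def right_diff_distrib sum_subtractf flip: sum_distrib_right)
  have "of_real (ln (real N)) + dchar_mertens \<xi> N =
    (\<Sum>n\<in>{1..N}. (\<xi> n / of_nat n) * of_real (if n = 1 then ln (real N) else 0)) + dchar_mertens \<xi> N"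
    using assms(5) dchars_one[OF assms(2)] by (simp add: if_distrib[of of_real] if_distrib[of "\<lambda>x. _ * x"] sum.delta cong: if_cong)
  also have "\<dots> = (\<Sum>n\<in>{1..N}. (\<xi> n / of_nat n) * of_real (\<Sum>d | d dvd n. c d))"
    unfolding dchar_mertens_def sum.distrib[symmetric] using inner
    by (intro sum.cong refl) (simp add: distrib_left)
  also have "\<dots> = (\<Sum>n\<in>{1..N}. \<Sum>d | d dvd n. (\<xi> d * of_real (c d) / of_nat d) * (\<xi> (n div d) / of_nat (n div d)))"
  proof (intro sum.cong refl)
    fix n assume n: "n \<in> {1..N}"
    have "(\<xi> n / of_nat n) * of_real (\<Sum>d | d dvd n. c d) = (\<Sum>d | d dvd n. (\<xi> n / of_nat n) * of_real (c d))"
      by (simp add: sum_distrib_left)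
    also have "\<dots> = (\<Sum>d | d dvd n. (\<xi> d * of_real (c d) / of_nat d) * (\<xi> (n div d) / of_nat (n div d)))"
    proof (intro sum.cong refl)
      fix d assume "d \<in> {d. d dvd n}"
      then obtain k where k: "n = d * k" by auto
      hence "d > 0" "k > 0" using n by (auto intro: Nat.gr0I)
      thus "(\<xi> n / of_nat n) * of_real (c d) = (\<xi> d * of_real (c d) / of_nat d) * (\<xi> (n div d) / of_nat (n div d))"
        unfolding k by (simp add: dcharsD(1)[OF assms(2)])
    qed
    finally show "(\<xi> n / of_nat n) * of_real (\<Sum>d | d dvd n. c d) = (\<Sum>d | d dvd n. (\<xi> d * of_real (c d) / of_nat d) * (\<xi> (n div d) / of_nat (n div d)))" .
  qed
  also have "\<dots> = (\<Sum>d\<in>{1..N}. (\<xi> d * of_real (c d) / of_nat d) * ?A (N div d))"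
    by (subst sum_divisors_swap) (simp add: sum_distrib_left)
  finally have eq: "of_real (ln (real N)) + dchar_mertens \<xi> N = (\<Sum>d\<in>{1..N}. (\<xi> d * of_real (c d) / of_nat d) * ?A (N div d))" .
  have "norm (\<Sum>d\<in>{1..N}. (\<xi> d * of_real (c d) / of_nat d) * ?A (N div d)) \<le>
      (\<Sum>d\<in>{1..N}. (2 * real W / real N) * (ln (real N) - ln (real d)))"
  proof (rule sum_norm_le)
    fix d assume d: "d \<in> {1..N}"
    have l: "ln (real N) - ln (real d) \<ge> 0" using d by simp
    have "\<bar>c d\<bar> \<le> 1 * (ln (real N) - ln (real d))"
      unfolding c_def abs_mult using l abs_mu_le[of d] by (intro mult_mono) auto
    hence "norm ((\<xi> d * of_real (c d) / of_nat d) * ?A (N div d)) \<le>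
        (1 * (ln (real N) - ln (real d)) / real d) * (2 * real W * real d / real N)"
      unfolding norm_mult norm_divide norm_of_real norm_of_nat
      using d l assms(5) norm_dchars_le[OF assms(2,1), of d] dchar_L_div_bound[OF assms(1-3), of d N] assms(4)
      by (intro mult_mono divide_right_mono) auto
    also have "\<dots> = (2 * real W / real N) * (ln (real N) - ln (real d))" using d by simp
    finally show "norm ((\<xi> d * of_real (c d) / of_nat d) * ?A (N div d)) \<le> (2 * real W / real N) * (ln (real N) - ln (real d))" .
  qed
  also have "\<dots> = (2 * real W / real N) * (real N * ln (real N) - ln (fact N))"
  proof -
    have "ln (fact N) = (\<Sum>n\<in>{1..N}. ln (real n))"
      unfolding fact_prod of_nat_prod by (subst ln_prod) auto
    thus ?thesis by (simp only: sum_distrib_left[symmetric] sum_subtractf sum_constant card_atLeastAtMost) simp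
  qed
  also have "\<dots> \<le> (2 * real W / real N) * real N"
  proof (intro mult_left_mono)
    have "real N ^ N / fact N \<le> exp (real N)"
    proof -
      have "(\<Sum>n\<in>{N}. inverse (fact n) * real N ^ n) \<le> (\<Sum>n. inverse (fact n) * real N ^ n)"
        by (intro sum_le_suminf summable_exp) auto
      thus ?thesis by (simp add: exp_def field_simps)
    qed
    hence "real N ^ N \<le> exp (real N) * fact N" by (simp add: field_simps)
    hence "ln (real N ^ N) \<le> ln (exp (real N) * fact N)" using assms by (subst ln_le_cancel_iff) auto
    thus "real N * ln (real N) - ln (fact N) \<le> real N" using assms by (simp add: ln_realpow ln_mult)
  qed auto
  also have "\<dots> = 2 * real W" using assms by simp
  finally show ?thesis unfolding eq .
qed

subsection \<open>Real characters\<close>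

lemma divisor_sum_prime_power_mult:
  fixes c :: "nat \<Rightarrow> real"
  assumes c: "\<And>m n. c (m * n) = c m * c n" "c 1 = 1" and p: "prime p" "\<not> p dvd m" "m > 0"
  shows "(\<Sum>d | d dvd p ^ k * m. c d) = (\<Sum>j\<le>k. c p ^ j) * (\<Sum>d | d dvd m. c d)"
proof -
  have cp: "c (p ^ j) = c p ^ j" for j by (induction j) (use c in auto)
  have mult: "multiplicity p (p ^ j * d) = j" if "d dvd m" for j d
  proof (rule multiplicity_eqI)
    have "\<not> p dvd d" using that p dvd_trans by blast
    thus "\<not> p ^ Suc j dvd p ^ j * d" using p(1) prime_gt_0_nat by (auto simp: mult.commute[of p])
  qed simp
  have "(\<Sum>j\<le>k. c p ^ j) * (\<Sum>d | d dvd m. c d) = (\<Sum>(j,d)\<in>{..k} \<times> {d. d dvd m}. c (p ^ j * d))"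
    by (simp add: sum_product sum.cartesian_product c cp)
  also have "\<dots> = (\<Sum>d\<in>(\<lambda>(j,d). p ^ j * d) ` ({..k} \<times> {d. d dvd m}). c d)"
  proof (subst sum.reindex)
    show "inj_on (\<lambda>(j,d). p ^ j * d) ({..k} \<times> {d. d dvd m})"
    proof (rule inj_onI, clarify)
      fix j d j' d' assume *: "d dvd m" "d' dvd m" "p ^ j * d = p ^ j' * d'"
      have "j = j'" using mult[OF *(1), of j] mult[OF *(2), of j'] *(3) by simp
      thus "j = j' \<and> d = d'" using *(3) p(1) prime_gt_0_nat by auto
    qed
  qed (auto intro: sum.cong)
  also have "(\<lambda>(j,d). p ^ j * d) ` ({..k} \<times> {d. d dvd m}) = {d. d dvd p ^ k * m}"
  proof (intro equalityI subsetI)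
    fix d assume "d \<in> {d. d dvd p ^ k * m}"
    then obtain b e where be: "d = b * e" "b dvd p ^ k" "e dvd m" using division_decomp[of d "p ^ k" m] by auto
    then obtain j where "j \<le> k" "b = p ^ j" using divides_primepow_nat[OF p(1)] by blast
    thus "d \<in> (\<lambda>(j,d). p ^ j * d) ` ({..k} \<times> {d. d dvd m})" using be by auto
  qed (auto intro: mult_dvd_mono le_imp_power_dvd)
  finally show ?thesis by simp
qed

text \<open>The divisor sum is multiplicative, and on a prime power it is \<open>1 + c p + c p ^ 2 + \<dots>\<close>, which is
  never negative and is at least \<open>1\<close> if the exponent is even.\<close>
lemma real_divisor_sum:
  fixes c :: "nat \<Rightarrow> real"
  assumes c: "\<And>m n. c (m * n) = c m * c n" "c 1 = 1" "\<And>n. c n \<in> {-1, 0, 1}" and n: "n > 0"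
  shows "0 \<le> (\<Sum>d | d dvd n. c d) \<and> ((\<exists>s. n = s\<^sup>2) \<longrightarrow> 1 \<le> (\<Sum>d | d dvd n. c d))"
  using n
proof (induction n rule: less_induct)
  case (less n)
  show ?case
  proof (cases "n = 1")
    case True thus ?thesis using c by simp
  next
    case False
    obtain p where p: "prime p" "p dvd n" using prime_factor_nat[of n] False by auto
    define k where "k = multiplicity p n"
    define m where "m = n div p ^ k"
    have nm: "n = p ^ k * m" unfolding m_def k_def by (simp add: multiplicity_dvd)
    have pm: "\<not> p dvd m"
      unfolding m_def k_def using less.prems p by (intro multiplicity_decompose) auto
    have k1: "k \<ge> 1" unfolding k_def using p less.prems by (simp add: Suc_le_eq prime_multiplicity_gt_zero_iff)
    have m0: "m > 0" using nm less.prems by (auto intro: Nat.gr0I)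
    have "m * 1 < m * p ^ k" using m0 k1 p prime_gt_1_nat[of p] one_less_power[of p k] by (intro mult_strict_left_mono) auto
    hence "m < n" using nm by (simp add: mult.commute)
    note IH = less.IH[OF this m0]
    have r: "(\<Sum>d | d dvd n. c d) = (\<Sum>j\<le>k. c p ^ j) * (\<Sum>d | d dvd m. c d)"
      unfolding nm by (rule divisor_sum_prime_power_mult) (use c p pm m0 in auto)
    have alt: "(\<Sum>j\<le>k. (-1) ^ j) = (if even k then 1 else (0::real))" for k by (induction k) auto
    have zer: "(\<Sum>j\<le>k. 0 ^ j) = (1::real)" for k by (induction k) auto
    have geo: "(\<Sum>j\<le>k. c p ^ j) \<ge> 0 \<and> (even k \<longrightarrow> (\<Sum>j\<le>k. c p ^ j) \<ge> 1)"
      using c(3)[of p] alt[of k] zer[of k] by auto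
    show ?thesis
    proof (intro conjI impI)
      show "0 \<le> (\<Sum>d | d dvd n. c d)" unfolding r using geo IH by simp
      assume "\<exists>s. n = s\<^sup>2"
      then obtain s where s: "n = s\<^sup>2" by blast
      have s0: "s > 0" using s less.prems by (auto intro: Nat.gr0I)
      define e where "e = multiplicity p s"
      have ke: "k = 2 * e" unfolding k_def e_def s using p s0
        by (simp add: prime_elem_multiplicity_power_distrib)
      obtain t where t: "s = p ^ e * t" using multiplicity_dvd[of p s] unfolding e_def by blast
      have "p ^ k * m = p ^ k * t\<^sup>2" using s nm t ke by (simp add: power_mult_distrib power_mult mult.commute[of 2])
      hence "m = t\<^sup>2" using p prime_gt_0_nat by simp
      hence "1 \<le> (\<Sum>d | d dvd m. c d)" using IH by blast
      moreover have "(\<Sum>j\<le>k. c p ^ j) \<ge> 1" using geo ke by simp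
      ultimately show "1 \<le> (\<Sum>d | d dvd n. c d)" unfolding r
        using mult_mono[of 1 "\<Sum>j\<le>k. c p ^ j" 1 "\<Sum>d | d dvd m. c d"] by simp
    qed
  qed
qed

text \<open>The weight \<open>x - n\<close> makes sums over multiples of \<open>d\<close> known with an error \<open>O(d)\<close> that is independent
  of \<open>x\<close>.\<close>
lemma tent_sum_approx:
  fixes x d :: nat assumes d: "d > 0"
  shows "\<bar>(\<Sum>m\<in>{1..x div d}. real x - real d * real m) - ((real x)\<^sup>2 / (2 * real d) - real x / 2)\<bar> \<le> real d / 2"
proof -
  define k where "k = x div d"
  define \<rho> where "\<rho> = x mod d"
  have x: "real x = real d * real k + real \<rho>" unfolding k_def \<rho>_def by (metis mult_div_mod_eq of_nat_add of_nat_mult)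
  have \<rho>: "real \<rho> < real d" unfolding \<rho>_def using d by simp
  have "(\<Sum>m\<in>{1..k}. real x - real d * real m) = real k * real x - real d * (real k * (real k + 1) / 2)" for k
    by (induction k) (auto simp: field_simps)
  hence G: "(\<Sum>m\<in>{1..x div d}. real x - real d * real m) = real k * real x - real d * (real k * (real k + 1) / 2)"
    unfolding k_def .
  have "(\<Sum>m\<in>{1..x div d}. real x - real d * real m) - ((real x)\<^sup>2 / (2 * real d) - real x / 2) =
      real \<rho> * (real d - real \<rho>) / (2 * real d)"
    unfolding G unfolding x using d by (simp add: field_simps power2_eq_square)
  moreover have "real \<rho> * (real d - real \<rho>) \<le> real d * real d" using \<rho> by (intro mult_mono) auto
  hence "real \<rho> * (real d - real \<rho>) / (2 * real d) \<le> real d * real d / (2 * real d)" by (intro divide_right_mono) auto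
  hence "real \<rho> * (real d - real \<rho>) / (2 * real d) \<le> real d / 2" using d by simp
  moreover have "real \<rho> * (real d - real \<rho>) / (2 * real d) \<ge> 0" using \<rho> by simp
  ultimately show ?thesis by linarith
qed

text \<open>Compare two evaluations of the sum of \<open>(\<Sum>d | d dvd n. \<xi> d) * (x - n)\<close> over \<open>n \<le> x\<close>. The squares alone
  contribute at least a multiple of \<open>x powr (3/2)\<close>. If \<open>L(1)\<close> vanished, summing over \<open>d\<close> first
  would give a smaller order of magnitude: for \<open>d \<le> D\<close> the main term is a partial sum of \<open>L(1)\<close>, and for
  \<open>d > D\<close> the sum over \<open>d\<close> oscillates.\<close>
lemma real_dchar_L_nonzero:
  assumes W: "W > 0" and \<xi>: "\<xi> \<in> dchars W" "\<xi> \<noteq> principal_char W" and re: "\<And>n. cnj (\<xi> n) = \<xi> n"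
  shows "dchar_L W \<xi> \<noteq> 0"
proof
  assume L0: "dchar_L W \<xi> = 0"
  define c where "c n = Re (\<xi> n)" for n
  have \<xi>c: "\<xi> n = of_real (c n)" for n
    unfolding c_def using re[of n] by (simp add: complex_eq_iff)
  have c_mult: "c (m * n) = c m * c n" for m n
    using dcharsD(1)[OF \<xi>(1), of m n] unfolding \<xi>c by (metis of_real_eq_iff of_real_mult)
  have c1: "c 1 = 1" using dchars_one[OF \<xi>(1)] unfolding c_def by simp
  have c_abs: "\<bar>c n\<bar> \<le> 1" for n using norm_dchars_le[OF \<xi>(1) W, of n] unfolding \<xi>c by simp
  have c_val: "c n \<in> {-1, 0, 1}" for n
  proof (cases "coprime n W")
    case True
    have "\<bar>c n\<bar> = 1" using norm_dchars[OF \<xi>(1) W True] unfolding \<xi>c by simp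
    thus ?thesis by auto
  next
    case False
    hence "\<xi> n = 0" using dcharsD(3)[OF \<xi>(1)] by simp
    thus ?thesis by (simp add: c_def)
  qed
  \<comment> \<open>the errors below add up to at most (4 W + 2) y^11, which this y makes smaller than y^12 / 8\<close>
  define y where "y = 32 * W + 17"
  define x where "x = y ^ 8"
  define D where "D = y ^ 5"
  have y: "y \<ge> 17" by (simp add: y_def)
  have x0: "x > 0" "D > 0" using y by (auto simp: x_def D_def)
  have Dx: "D \<le> x" unfolding D_def x_def using y by (intro power_increasing) auto
  let ?Y = "real y"
  have rx: "real x = ?Y ^ 8" "real D = ?Y ^ 5" by (auto simp: x_def D_def)
  define r where "r n = (\<Sum>d | d dvd n. c d)" for n
  have r: "0 \<le> r n" "(\<exists>s. n = s\<^sup>2) \<Longrightarrow> 1 \<le> r n" if "n > 0" for n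
    using real_divisor_sum[of c n, OF c_mult c1 c_val that] unfolding r_def by auto
  define S where "S = (\<Sum>n\<in>{1..x}. r n * (real x - real n))"
  have lower: "S \<ge> ?Y ^ 12 / 8"
  proof -
    define M where "M = y ^ 4 div 2"
    have M: "M\<^sup>2 * 2 \<le> x"
    proof -
      have "2 * M \<le> y ^ 4" by (simp add: M_def)
      hence "(2 * M) ^ 2 \<le> (y ^ 4) ^ 2" by (intro power_mono) auto
      thus ?thesis by (simp add: x_def power_mult_distrib flip: power_mult)
    qed
    have "?Y ^ 4 / 4 \<le> real M"
    proof -
      have "17 ^ 4 \<le> y ^ 4" using y by (intro power_mono) auto
      hence "y ^ 4 \<le> 4 * M" unfolding M_def by simp
      hence "real (y ^ 4) \<le> real (4 * M)" by (simp only: of_nat_le_iff)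
      thus ?thesis by simp
    qed
    hence "?Y ^ 12 / 8 \<le> real M * (?Y ^ 8 / 2)"
      using mult_right_mono[of "?Y ^ 4 / 4" "real M" "?Y ^ 8 / 2"] by (simp flip: power_add)
    also have "\<dots> = (\<Sum>n\<in>(\<lambda>m. m\<^sup>2) ` {1..M}. real x / 2)"
      by (subst sum.reindex) (auto simp: inj_on_def rx)
    also have "\<dots> \<le> (\<Sum>n\<in>(\<lambda>m. m\<^sup>2) ` {1..M}. r n * (real x - real n))"
    proof (rule sum_mono)
      fix n assume "n \<in> (\<lambda>m. m\<^sup>2) ` {1..M}"
      then obtain m where m: "n = m\<^sup>2" "1 \<le> m" "m \<le> M" by auto
      have "m\<^sup>2 \<le> M\<^sup>2" using m by (intro power_mono) auto
      hence "n * 2 \<le> x" using M m(1) by linarith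
      hence n2: "real x / 2 \<le> real x - real n" by (simp add: field_simps flip: of_nat_le_iff)
      have "1 * (real x / 2) \<le> r n * (real x - real n)"
        using r(2)[of n] m n2 by (intro mult_mono) auto
      thus "real x / 2 \<le> r n * (real x - real n)" by simp
    qed
    also have "\<dots> \<le> S" unfolding S_def
    proof (rule sum_mono2)
      show "(\<lambda>m. m\<^sup>2) ` {1..M} \<subseteq> {1..x}"
      proof
        fix n assume "n \<in> (\<lambda>m. m\<^sup>2) ` {1..M}"
        then obtain m where m: "n = m\<^sup>2" "1 \<le> m" "m \<le> M" by auto
        have "m\<^sup>2 \<le> M\<^sup>2" using m by (intro power_mono) auto
        hence "n \<le> x" using M m(1) by linarith
        thus "n \<in> {1..x}" using m by simp
      qed
    qed (use r in auto)
    finally show ?thesis .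
  qed
  have "S = (\<Sum>n\<in>{1..x}. \<Sum>d | d dvd n. c d * (real x - real d * real (n div d)))"
    unfolding S_def r_def sum_distrib_right
    by (intro sum.cong refl) (auto simp flip: of_nat_mult)
  also have "\<dots> = (\<Sum>d\<in>{1..x}. \<Sum>m\<in>{1..x div d}. c d * (real x - real d * real m))"
    by (rule sum_divisors_swap)
  also have "\<dots> = (\<Sum>d\<in>{1..x}. c d * (\<Sum>m\<in>{1..x div d}. real x - real d * real m))"
    by (simp add: sum_distrib_left)
  also have "{1..x} = {1..D} \<union> {Suc D..<Suc x}" using Dx by auto
  also have "(\<Sum>d\<in>\<dots>. c d * (\<Sum>m\<in>{1..x div d}. real x - real d * real m)) =
     (\<Sum>d\<in>{1..D}. c d * (\<Sum>m\<in>{1..x div d}. real x - real d * real m)) +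
     (\<Sum>d\<in>{Suc D..<Suc x}. c d * (\<Sum>m\<in>{1..x div d}. real x - real d * real m))" (is "_ = ?P1 + ?P2")
    by (rule sum.union_disjoint) auto
  finally have S: "S = ?P1 + ?P2" .
  have P2: "?P2 \<le> 2 * real W * ?Y ^ 11"
  proof -
    define g where "g m d = max 0 (real x - real d * real m)" for m d :: nat
    have "?P2 = (\<Sum>d\<in>{Suc D..<Suc x}. c d * (\<Sum>m\<in>{1..x}. g m d))"
    proof (rule sum.cong[OF refl])
      fix d assume d: "d \<in> {Suc D..<Suc x}"
      have "(\<Sum>m\<in>{1..x div d}. real x - real d * real m) = (\<Sum>m\<in>{1..x}. g m d)"
      proof (rule sum.mono_neutral_cong_left)
        show "\<forall>m\<in>{1..x} - {1..x div d}. g m d = 0"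
        proof
          fix m assume "m \<in> {1..x} - {1..x div d}"
          hence "x div d < m" by auto
          hence "x < m * d" using d by (simp add: div_less_iff_less_mult)
          hence "real x < real d * real m" by (simp add: mult.commute flip: of_nat_mult)
          thus "g m d = 0" by (simp add: g_def)
        qed
        fix m assume "m \<in> {1..x div d}"
        hence "m * d \<le> x" using d by (simp add: less_eq_div_iff_mult_less_eq)
        hence "real d * real m \<le> real x" by (simp add: mult.commute flip: of_nat_mult)
        thus "real x - real d * real m = g m d" by (simp add: g_def)
      qed (auto intro: le_trans[OF _ div_le_dividend])
      thus "c d * (\<Sum>m\<in>{1..x div d}. real x - real d * real m) = c d * (\<Sum>m\<in>{1..x}. g m d)" by (rule arg_cong)
    qed
    also have "\<dots> = (\<Sum>m\<in>{1..x}. \<Sum>d\<in>{Suc D..<Suc x}. c d * g m d)"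
      unfolding sum_distrib_left by (rule sum.swap)
    also have "\<dots> \<le> (\<Sum>m\<in>{1..x}. if m \<le> y ^ 3 then 2 * real W * real x else 0)"
    proof (rule sum_mono)
      fix m assume m: "m \<in> {1..x}"
      have "norm (\<Sum>d\<in>{Suc D..<Suc x}. \<xi> d * of_real (g m d)) \<le> 2 * real W * g m (Suc D)"
        by (rule norm_sum_weighted_le)
           (use norm_sum_dchar_le[OF W \<xi>] in \<open>auto simp: g_def max_def algebra_simps\<close>)
      also have "(\<Sum>d\<in>{Suc D..<Suc x}. \<xi> d * of_real (g m d)) = of_real (\<Sum>d\<in>{Suc D..<Suc x}. c d * g m d)"
        by (simp add: \<xi>c)
      finally have 1: "(\<Sum>d\<in>{Suc D..<Suc x}. c d * g m d) \<le> 2 * real W * g m (Suc D)" by simp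
      show "(\<Sum>d\<in>{Suc D..<Suc x}. c d * g m d) \<le> (if m \<le> y ^ 3 then 2 * real W * real x else 0)"
      proof (cases "m \<le> y ^ 3")
        case True
        have "2 * real W * g m (Suc D) \<le> 2 * real W * real x" by (intro mult_left_mono) (auto simp: g_def)
        thus ?thesis using 1 True by simp
      next
        case False
        have "x = D * y ^ 3" by (simp add: x_def D_def flip: power_add)
        also have "\<dots> \<le> Suc D * m" using False by (intro mult_mono) auto
        finally have "real x \<le> real (Suc D) * real m" by (simp only: of_nat_le_iff flip: of_nat_mult)
        hence "g m (Suc D) = 0" by (simp add: g_def)
        thus ?thesis using 1 False by simp
      qed
    qed
    also have "\<dots> = (\<Sum>m\<in>{m\<in>{1..x}. m \<le> y ^ 3}. 2 * real W * real x)" by (rule sum.inter_filter[symmetric]) auto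
    also have "\<dots> = real (card {m\<in>{1..x}. m \<le> y ^ 3}) * (2 * real W * real x)" by simp
    also have "\<dots> \<le> real (y ^ 3) * (2 * real W * real x)"
    proof (intro mult_right_mono)
      have "card {m\<in>{1..x}. m \<le> y ^ 3} \<le> card {1..y ^ 3}" by (intro card_mono) auto
      thus "real (card {m\<in>{1..x}. m \<le> y ^ 3}) \<le> real (y ^ 3)" by simp
    qed auto
    also have "\<dots> = 2 * real W * (?Y ^ 3 * ?Y ^ 8)" by (simp add: rx)
    also have "?Y ^ 3 * ?Y ^ 8 = ?Y ^ 11" by (simp flip: power_add)
    finally show ?thesis .
  qed
  have P1: "?P1 \<le> real W * ?Y ^ 11 + (real W + 1) * ?Y ^ 8 + ?Y ^ 10"
  proof -
    define e where "e d = (\<Sum>m\<in>{1..x div d}. real x - real d * real m) - ((real x)\<^sup>2 / (2 * real d) - real x / 2)" for d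
    have "?P1 = (\<Sum>d\<in>{1..D}. (real x)\<^sup>2 / 2 * (c d / real d) - real x / 2 * c d + c d * e d)"
      by (intro sum.cong refl) (simp add: e_def algebra_simps)
    also have "\<dots> = (real x)\<^sup>2 / 2 * (\<Sum>d\<in>{1..D}. c d / real d) - real x / 2 * (\<Sum>d\<in>{1..D}. c d) + (\<Sum>d\<in>{1..D}. c d * e d)"
      unfolding sum.distrib sum_subtractf sum_distrib_left ..
    finally have eq: "?P1 = (real x)\<^sup>2 / 2 * (\<Sum>d\<in>{1..D}. c d / real d) - real x / 2 * (\<Sum>d\<in>{1..D}. c d) + (\<Sum>d\<in>{1..D}. c d * e d)" .
    have "(\<Sum>n\<in>{1..D}. \<xi> n / of_nat n) = of_real (\<Sum>d\<in>{1..D}. c d / real d)"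
      by (simp add: \<xi>c)
    hence "\<bar>\<Sum>d\<in>{1..D}. c d / real d\<bar> = norm (\<Sum>n\<in>{1..D}. \<xi> n / of_nat n)"
      by (simp only: norm_of_real)
    also have "\<dots> \<le> 2 * real W / real (D + 1)" using dchar_L_bound[OF W \<xi>, of D] L0 by simp
    also have "\<dots> \<le> 2 * real W / real D" using x0 by (intro divide_left_mono) auto
    finally have "(real x)\<^sup>2 / 2 * (\<Sum>d\<in>{1..D}. c d / real d) \<le> (real x)\<^sup>2 / 2 * (2 * real W / real D)"
      by (intro mult_left_mono) auto
    also have "\<dots> = real W * ((?Y ^ 8)\<^sup>2 / ?Y ^ 5)" by (simp add: rx)
    also have "(?Y ^ 8)\<^sup>2 / ?Y ^ 5 = ?Y ^ 11"
      using y by (simp add: divide_eq_eq flip: power_mult power_add)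
    finally have a: "(real x)\<^sup>2 / 2 * (\<Sum>d\<in>{1..D}. c d / real d) \<le> real W * ?Y ^ 11" .
    have b: "- (real x / 2 * (\<Sum>d\<in>{1..D}. c d)) \<le> (real W + 1) * ?Y ^ 8"
    proof -
      have "(\<Sum>n<Suc D. c n) = c 0 + (\<Sum>d\<in>{1..D}. c d)"
        by (simp add: lessThan_Suc_atMost atMost_atLeast0 sum.atLeast_Suc_atMost)
      moreover have "\<bar>\<Sum>n<Suc D. c n\<bar> \<le> real W"
      proof -
        have "\<bar>\<Sum>n<Suc D. c n\<bar> = norm (\<Sum>n<Suc D. \<xi> n)"
          unfolding \<xi>c by (metis norm_of_real of_real_sum)
        thus ?thesis using norm_sum_dchar_le[OF W \<xi>, of "Suc D"] by simp
      qed
      ultimately have "- (\<Sum>d\<in>{1..D}. c d) \<le> real W + 1" using c_abs[of 0] by linarith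
      hence "real x / 2 * (- (\<Sum>d\<in>{1..D}. c d)) \<le> real x / 2 * (real W + 1)" by (intro mult_left_mono) auto
      also have "\<dots> \<le> real x * (real W + 1)" by (intro mult_right_mono) auto
      finally show ?thesis by (simp add: rx mult.commute)
    qed
    have "(\<Sum>d\<in>{1..D}. c d * e d) \<le> (\<Sum>d\<in>{1..D}. real D)"
    proof (rule sum_mono)
      fix d assume d: "d \<in> {1..D}"
      have "c d * e d \<le> \<bar>c d\<bar> * \<bar>e d\<bar>" by (simp flip: abs_mult)
      also have "\<dots> \<le> 1 * (real d / 2)" using c_abs tent_sum_approx[of d x] d by (intro mult_mono) (auto simp: e_def)
      also have "\<dots> \<le> real D" using d by simp
      finally show "c d * e d \<le> real D" .
    qed
    also have "\<dots> = ?Y ^ 5 * ?Y ^ 5" by (simp add: rx)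
    also have "\<dots> = ?Y ^ 10" by (simp flip: power_add)
    finally show ?thesis using a b eq by linarith
  qed
  have pw: "?Y ^ 8 \<le> ?Y ^ 11" "?Y ^ 10 \<le> ?Y ^ 11" using y by (auto intro: power_increasing)
  have "?Y ^ 12 / 8 \<le> real W * ?Y ^ 11 + (real W + 1) * ?Y ^ 8 + ?Y ^ 10 + 2 * real W * ?Y ^ 11"
    using lower S P1 P2 by linarith
  also have "\<dots> \<le> real W * ?Y ^ 11 + (real W + 1) * ?Y ^ 11 + ?Y ^ 11 + 2 * real W * ?Y ^ 11"
    using pw by (intro add_mono mult_left_mono) auto
  also have "\<dots> = (4 * real W + 2) * ?Y ^ 11" by (simp add: algebra_simps)
  finally have "?Y ^ 12 / 8 \<le> (4 * real W + 2) * ?Y ^ 11" .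
  moreover have "?Y ^ 12 = ?Y ^ 11 * ?Y" by (simp add: eval_nat_numeral)
  ultimately have "?Y ^ 11 * ?Y \<le> ?Y ^ 11 * (8 * (4 * real W + 2))" by (simp add: algebra_simps)
  hence "?Y \<le> 8 * (4 * real W + 2)" using y by (subst (asm) mult_le_cancel_left_pos) auto
  thus False unfolding y_def by simp
qed

subsection \<open>Primes in progressions\<close>

text \<open>Proper prime powers contribute at most the sum of \<open>ln p / p ^ k\<close> over \<open>k \<ge> 2\<close>, which converges.\<close>
lemma sum_mangoldt_nonprime_le:
  "\<exists>C. \<forall>N. (\<Sum>n\<in>{n\<in>{1..N}. \<not> prime n}. mangoldt n / real n) \<le> C"
proof (intro exI allI)
  fix N :: nat
  let ?P = "{p. prime p \<and> p \<le> N}"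
  let ?I = "?P \<times> {2..N}"
  have "(\<Sum>n\<in>{n\<in>{1..N}. \<not> prime n}. mangoldt n / real n) = (\<Sum>n\<in>{n\<in>{1..N}. primepow n \<and> \<not> prime n}. mangoldt n / real n)"
    by (intro sum.mono_neutral_right) (auto simp: mangoldt_def split: if_splits)
  also have "\<dots> \<le> (\<Sum>n\<in>(\<lambda>(p,k). p ^ k) ` ?I. mangoldt n / real n)"
  proof (rule sum_mono2)
    show "{n\<in>{1..N}. primepow n \<and> \<not> prime n} \<subseteq> (\<lambda>(p,k). p ^ k) ` ?I"
    proof
      fix n assume n: "n \<in> {n\<in>{1..N}. primepow n \<and> \<not> prime n}"
      then obtain p k where pk: "prime p" "k > 0" "n = p ^ k" unfolding primepow_def by blast
      have "k \<noteq> 1" using pk n by auto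
      moreover have "p \<le> n" using pk self_le_power[of p k] prime_ge_1_nat[of p] by simp
      moreover have "k < n" unfolding pk(3) using pk(1) prime_gt_1_nat[of p] by (intro power_gt_expt) auto
      ultimately have "(p,k) \<in> ?I" using n pk by auto
      thus "n \<in> (\<lambda>(p,k). p ^ k) ` ?I" using pk by force
    qed
  qed (auto simp: mangoldt_nonneg)
  also have "\<dots> \<le> (\<Sum>pk\<in>?I. ((\<lambda>n. mangoldt n / real n) \<circ> (\<lambda>(p,k). p ^ k)) pk)"
    by (rule sum_image_le) (auto simp: mangoldt_nonneg)
  also have "\<dots> = (\<Sum>(p,k)\<in>?I. ln (real p) / real p ^ k)"
    by (intro sum.cong) auto
  also have "\<dots> = (\<Sum>p\<in>?P. \<Sum>k\<in>{2..N}. ln (real p) / real p ^ k)"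
    by (rule sum.cartesian_product[symmetric])
  also have "\<dots> \<le> (\<Sum>p\<in>?P. 4 * real p powr (-3/2))"
  proof (rule sum_mono)
    fix p assume "p \<in> ?P"
    hence p: "real p \<ge> 2" using prime_ge_2_nat[of p] by simp
    have "(\<Sum>k\<in>{2..N}. ln (real p) / real p ^ k) = ln (real p) * (\<Sum>k\<in>{2..N}. (1 / real p) ^ k)"
      by (simp add: sum_distrib_left power_one_over divide_inverse power_inverse)
    also have "(\<Sum>k\<in>{2..N}. (1 / real p) ^ k) \<le> 2 / (real p)\<^sup>2"
    proof -
      have "(\<Sum>k\<in>{2..<2 + j}. (1 / real p) ^ k) \<le> 2 / (real p)\<^sup>2 * (1 - (1 / real p) ^ j)" for j
      proof (induction j)
        case (Suc j)
        have "(1 / real p) ^ (2 + j) \<le> 2 / (real p)\<^sup>2 * ((1 / real p) ^ j * (1 - 1 / real p))"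
        proof -
          have "1 \<le> 2 * (1 - 1 / real p)" using p by (simp add: field_simps)
          from mult_left_mono[OF this, of "(1 / real p) ^ (2 + j)"]
          show ?thesis by (simp add: power_add power_divide power2_eq_square mult_ac)
        qed
        moreover have "(\<Sum>k\<in>{2..<2 + Suc j}. (1 / real p) ^ k) = (\<Sum>k\<in>{2..<2 + j}. (1 / real p) ^ k) + (1 / real p) ^ (2 + j)"
          by simp
        moreover have "a * (1 - v) + a * (v * (1 - w)) = a * (1 - w * v)" for a v w :: real by (simp add: algebra_simps)
        from this[of "2 / (real p)\<^sup>2" "(1 / real p) ^ j" "1 / real p"]
        have "2 / (real p)\<^sup>2 * (1 - (1 / real p) ^ j) + 2 / (real p)\<^sup>2 * ((1 / real p) ^ j * (1 - 1 / real p)) =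
            2 / (real p)\<^sup>2 * (1 - (1 / real p) ^ Suc j)" by (simp only: power_Suc)
        ultimately show ?case using Suc by linarith
      qed simp
      also have "2 / (real p)\<^sup>2 * (1 - (1 / real p) ^ j) \<le> 2 / (real p)\<^sup>2 * 1" for j
        using p by (intro mult_left_mono) auto
      finally have *: "(\<Sum>k\<in>{2..<2 + j}. (1 / real p) ^ k) \<le> 2 / (real p)\<^sup>2" for j by simp
      have "{2..N} = {2..<2 + (N - 1)}" by auto
      thus ?thesis using * by metis
    qed
    also have "ln (real p) \<le> 2 * real p powr (1/2)"
      using ln_powr[of "real p" "1/2"] p ln_le_minus_one[of "real p powr (1/2)"] by simp
    also have "2 * real p powr (1/2) * (2 / (real p)\<^sup>2) = 4 * (real p powr (1/2) * real p powr (-2))"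
      using p by (simp add: powr_minus powr_numeral field_simps)
    also have "real p powr (1/2) * real p powr (-2) = real p powr (-3/2)" by (simp flip: powr_add)
    finally show "(\<Sum>k\<in>{2..N}. ln (real p) / real p ^ k) \<le> 4 * real p powr (-3/2)"
      using p by (simp add: mult_left_mono mult_right_mono divide_right_mono)
  qed
  also have "\<dots> = 4 * (\<Sum>p\<in>?P. real p powr (-3/2))" by (rule sum_distrib_left[symmetric])
  also have "(\<Sum>p\<in>?P. real p powr (-3/2)) \<le> (\<Sum>n. real n powr (-3/2))"
    by (rule sum_le_suminf) (auto simp: summable_real_powr_iff)
  finally show "(\<Sum>n\<in>{n\<in>{1..N}. \<not> prime n}. mangoldt n / real n) \<le> 4 * (\<Sum>n. real n powr (-3/2))" by simp
qed

definition mertens_coprime :: "nat \<Rightarrow> nat \<Rightarrow> real" where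
  "mertens_coprime W N = (\<Sum>n\<in>{n\<in>{1..N}. coprime n W}. mangoldt n / real n)"

lemma mertens_principal: "dchar_mertens (principal_char W) N = of_real (mertens_coprime W N)"
  unfolding dchar_mertens_def mertens_coprime_def principal_char_def
  by (subst sum.inter_filter) (auto intro!: sum.cong)

lemma mertens_coprime_lower:
  assumes "W > 0" shows "\<exists>C. \<forall>N\<ge>1. mertens_coprime W N \<ge> ln (real N) - C"
proof -
  obtain C where C: "\<And>N. (\<Sum>n\<in>{n\<in>{1..N}. \<not> prime n}. mangoldt n / real n) \<le> C"
    using sum_mangoldt_nonprime_le by blast
  let ?D = "\<Sum>p\<in>prime_factors W. mangoldt p / real p :: real"
  have "mertens_coprime W N \<ge> ln (real N) - (1 + C + ?D)" if N: "N \<ge> 1" for N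
  proof -
    let ?A = "{n\<in>{1..N}. coprime n W}" and ?B = "{n\<in>{1..N}. \<not> prime n} \<union> prime_factors W"
    have "ln (real N) - 1 \<le> (\<Sum>n\<in>{1..N}. mangoldt n / real n)" by (rule mertens_mangoldt_lower[OF N])
    also have "\<dots> \<le> (\<Sum>n\<in>?A \<union> ?B. mangoldt n / real n)"
    proof (rule sum_mono2)
      show "{1..N} \<subseteq> ?A \<union> ?B"
      proof
        fix n assume n: "n \<in> {1..N}"
        show "n \<in> ?A \<union> ?B"
        proof (cases "prime n \<and> \<not> coprime n W")
          case True
          hence "n dvd W" using prime_imp_coprime[of n W] by auto
          thus ?thesis using True assms by (auto simp: in_prime_factors_iff)
        qed (use n in auto)
      qed
    qed (auto simp: mangoldt_nonneg)
    also have "\<dots> \<le> (\<Sum>n\<in>?A. mangoldt n / real n) + ((\<Sum>n\<in>{n\<in>{1..N}. \<not> prime n}. mangoldt n / real n) + ?D)"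
    proof -
      have un: "sum f (A \<union> B) \<le> sum f A + sum f B" if "finite A" "finite B" "\<And>n. f n \<ge> 0" for f :: "nat \<Rightarrow> real" and A B
        using sum.union_inter[OF that(1,2), of f] sum_nonneg[of "A \<inter> B" f] that(3) by simp
      show ?thesis
        by (intro order_trans[OF un] add_left_mono un) (auto simp: mangoldt_nonneg)
    qed
    finally show ?thesis using C[of N] unfolding mertens_coprime_def by linarith
  qed
  thus ?thesis by blast
qed

lemma mertens_coprime_upper: "N \<ge> 1 \<Longrightarrow> mertens_coprime W N \<le> ln (real N) + 4"
  unfolding mertens_coprime_def
  by (rule order_trans[OF sum_mono2 mertens_mangoldt_upper]) (auto simp: mangoldt_nonneg)

text \<open>Multiplying by \<open>\<xi> b\<close>, with \<open>b\<close> an inverse of \<open>a\<close>, shifts the orthogonality relation from \<open>1\<close> to \<open>a\<close>.\<close>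
lemma sum_char_mertens:
  assumes W: "W > 0" and sep: "dchars_separate W"
    and ab: "[a * b = 1] (mod W)"
  shows "(\<Sum>\<xi>\<in>dchars W. \<xi> b * dchar_mertens \<xi> N) =
    of_real (real (card (dchars W)) * (\<Sum>n\<in>{n\<in>{1..N}. [n = a] (mod W)}. mangoldt n / real n))"
proof -
  have iff: "[b * n = 1] (mod W) \<longleftrightarrow> [n = a] (mod W)" for n
  proof
    assume "[b * n = 1] (mod W)"
    hence "[a * (b * n) = a * 1] (mod W)" by (rule cong_scalar_left)
    hence A: "[a * b * n = a] (mod W)" by (simp only: mult.assoc mult_1_right)
    have "[a * b * n = 1 * n] (mod W)" using ab by (rule cong_scalar_right)
    hence "[n = a * b * n] (mod W)" by (simp only: mult_1 cong_sym_eq)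
    thus "[n = a] (mod W)" using A by (rule cong_trans)
  next
    assume "[n = a] (mod W)"
    hence "[b * n = b * a] (mod W)" by (rule cong_scalar_left)
    moreover have "[b * a = 1] (mod W)" using ab by (simp only: mult.commute)
    ultimately show "[b * n = 1] (mod W)" by (rule cong_trans)
  qed
  have "(\<Sum>\<xi>\<in>dchars W. \<xi> b * dchar_mertens \<xi> N) =
    (\<Sum>\<xi>\<in>dchars W. \<Sum>n\<in>{1..N}. \<xi> (b * n) * of_real (mangoldt n / real n))"
    unfolding dchar_mertens_def sum_distrib_left
    by (intro sum.cong refl) (simp add: dcharsD(1) del: of_real_mangoldt)
  also have "\<dots> = (\<Sum>n\<in>{1..N}. (\<Sum>\<xi>\<in>dchars W. \<xi> (b * n)) * of_real (mangoldt n / real n))"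
    unfolding sum_distrib_right by (rule sum.swap)
  also have "\<dots> = (\<Sum>n\<in>{1..N}. if [n = a] (mod W) then of_real (real (card (dchars W)) * (mangoldt n / real n)) else 0)"
    unfolding sum_dchars[OF W sep] iff by (intro sum.cong refl) (auto simp del: of_real_mangoldt)
  also have "\<dots> = (\<Sum>n\<in>{n\<in>{1..N}. [n = a] (mod W)}. of_real (real (card (dchars W)) * (mangoldt n / real n)))"
    by (rule sum.inter_filter[symmetric]) auto
  finally show ?thesis unfolding sum_distrib_left of_real_sum .
qed

text \<open>If a character that is not real had \<open>L(1) = 0\<close>, then so would its complex conjugate. The two would
  contribute \<open>- 2 * ln N\<close> to the sum of all \<open>dchar_mertens\<close>, more than the principal character's
  \<open>ln N\<close> can compensate, whereas this sum is nonnegative as it counts prime powers that are \<open>1\<close> modulo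
  \<open>W\<close>.\<close>
lemma dchar_L_nonzero:
  assumes W: "W > 0" and sep: "dchars_separate W"
    and \<xi>: "\<xi> \<in> dchars W" "\<xi> \<noteq> principal_char W"
  shows "dchar_L W \<xi> \<noteq> 0"
proof (cases "\<forall>n. cnj (\<xi> n) = \<xi> n")
  case True
  thus ?thesis using real_dchar_L_nonzero[OF W \<xi>] by blast
next
  case False
  show ?thesis
  proof
    assume L0: "dchar_L W \<xi> = 0"
    let ?\<xi>0 = "principal_char W"
    define \<psi> where "\<psi> = (\<lambda>n. cnj (\<xi> n))"
    have \<psi>: "\<psi> \<in> dchars W" unfolding \<psi>_def by (rule dchars_cnj[OF \<xi>(1)])
    have neq: "\<psi> \<noteq> \<xi>" using False unfolding \<psi>_def by metis
    have neq0: "\<psi> \<noteq> ?\<xi>0"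
    proof
      assume "\<psi> = ?\<xi>0"
      hence "cnj (cnj (\<xi> n)) = cnj (?\<xi>0 n)" for n unfolding \<psi>_def by metis
      hence "\<xi> n = ?\<xi>0 n" for n by (simp add: principal_char_def)
      thus False using \<xi>(2) by blast
    qed
    have S\<psi>: "dchar_mertens \<psi> N = cnj (dchar_mertens \<xi> N)" for N
      unfolding dchar_mertens_def \<psi>_def by (simp del: of_real_mangoldt)
    have "\<exists>K. \<forall>N>0. Re (dchar_mertens \<eta> N) \<le> K" if "\<eta> \<in> dchars W" "\<eta> \<noteq> ?\<xi>0" for \<eta>
    proof (cases "dchar_L W \<eta> = 0")
      case True
      have "Re (dchar_mertens \<eta> N) \<le> 2 * real W" if N: "N > 0" for N
        using dchar_mertens_L_zero[OF W \<open>\<eta> \<in> dchars W\<close> \<open>\<eta> \<noteq> ?\<xi>0\<close> True N]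
          complex_Re_le_cmod[of "of_real (ln (real N)) + dchar_mertens \<eta> N"] N by simp
          (smt (verit) ln_ge_zero_iff of_nat_0_less_iff of_nat_1 of_nat_le_iff Suc_leI One_nat_def)
      thus ?thesis by blast
    next
      case False
      thus ?thesis using dchar_mertens_bounded[OF W that False] complex_Re_le_cmod order_trans by blast
    qed
    then obtain K where K: "\<And>\<eta> N. \<eta> \<in> dchars W \<Longrightarrow> \<eta> \<noteq> ?\<xi>0 \<Longrightarrow> N > 0 \<Longrightarrow> Re (dchar_mertens \<eta> N) \<le> K \<eta>" by metis
    define R where "R = dchars W - {?\<xi>0, \<xi>, \<psi>}"
    define C where "C = 4 + 4 * real W + (\<Sum>\<eta>\<in>R. K \<eta>)"
    have finR: "finite R" unfolding R_def using finite_dchars[OF W] by simp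
    have "ln (real N) \<le> C" if N: "N > 0" for N
    proof -
      have "0 \<le> real (card (dchars W)) * (\<Sum>n\<in>{n\<in>{1..N}. [n = 1] (mod W)}. mangoldt n / real n)"
        by (intro mult_nonneg_nonneg sum_nonneg) (auto simp: mangoldt_nonneg)
      also have "\<dots> = Re (\<Sum>\<eta>\<in>dchars W. \<eta> 1 * dchar_mertens \<eta> N)"
        using sum_char_mertens[OF W sep, of 1 1 N] by simp
      also have "\<dots> = (\<Sum>\<eta>\<in>dchars W. Re (dchar_mertens \<eta> N))"
        unfolding Re_sum
      proof (rule sum.cong[OF refl])
        fix \<eta> assume "\<eta> \<in> dchars W"
        thus "Re (\<eta> 1 * dchar_mertens \<eta> N) = Re (dchar_mertens \<eta> N)" by (simp only: dchars_one mult_1)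
      qed
      also have "dchars W = insert ?\<xi>0 (insert \<xi> (insert \<psi> R))"
        using principal_char_in \<xi> \<psi> unfolding R_def by auto
      also have "(\<Sum>\<eta>\<in>\<dots>. Re (dchar_mertens \<eta> N)) = Re (dchar_mertens ?\<xi>0 N) + Re (dchar_mertens \<xi> N) + Re (dchar_mertens \<psi> N) + (\<Sum>\<eta>\<in>R. Re (dchar_mertens \<eta> N))"
        using finR neq neq0 \<xi>(2) by (subst sum.insert, simp, force simp: R_def)+ (simp add: R_def)
      finally have "0 \<le> Re (dchar_mertens ?\<xi>0 N) + Re (dchar_mertens \<xi> N) + Re (dchar_mertens \<psi> N) + (\<Sum>\<eta>\<in>R. Re (dchar_mertens \<eta> N))" .
      moreover have "Re (dchar_mertens ?\<xi>0 N) \<le> ln (real N) + 4"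
        unfolding mertens_principal using mertens_coprime_upper[of N W] N by simp
      moreover have "Re (dchar_mertens \<psi> N) = Re (dchar_mertens \<xi> N)" unfolding S\<psi> by simp
      moreover have "Re (dchar_mertens \<xi> N) \<le> 2 * real W - ln (real N)"
        using dchar_mertens_L_zero[OF W \<xi> L0 N]
          complex_Re_le_cmod[of "of_real (ln (real N)) + dchar_mertens \<xi> N"] by simp
      moreover have "(\<Sum>\<eta>\<in>R. Re (dchar_mertens \<eta> N)) \<le> (\<Sum>\<eta>\<in>R. K \<eta>)"
        using K N by (intro sum_mono) (auto simp: R_def)
      ultimately show ?thesis unfolding C_def by linarith
    qed
    from this[of "nat \<lceil>exp (C + 1)\<rceil>"] show False
    proof -
      assume *: "0 < nat \<lceil>exp (C + 1)\<rceil> \<Longrightarrow> ln (real (nat \<lceil>exp (C + 1)\<rceil>)) \<le> C"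
      have "exp (C + 1) \<le> real (nat \<lceil>exp (C + 1)\<rceil>)" by linarith
      moreover have "exp (C + 1) > 0" by simp
      ultimately have "0 < nat \<lceil>exp (C + 1)\<rceil>" "C + 1 \<le> ln (real (nat \<lceil>exp (C + 1)\<rceil>))"
        by (auto simp: ln_ge_iff)
      thus False using * by simp
    qed
  qed
qed

text \<open>Only the principal character contributes more than a bounded amount. Summing the result over all
  residue classes shows that there are at most \<open>totient W\<close> characters, which gives the constant.\<close>
theorem dirichlet_mertens:
  assumes W: "W > 1" and sep: "dchars_separate W"
    and a: "coprime a W"
  shows "\<exists>C. \<forall>N\<ge>1. (\<Sum>p | prime p \<and> p \<le> N \<and> [p = a] (mod W). ln (real p) / real p) \<ge>
            ln (real N) / real (totient W) - C"
proof -
  have W0: "W > 0" using W by simp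
  let ?\<xi>0 = "principal_char W"
  let ?h = "real (card (dchars W))"
  define T where "T a N = (\<Sum>n\<in>{n\<in>{1..N}. [n = a] (mod W)}. mangoldt n / real n :: real)" for a N
  have h0: "?h > 0" using principal_char_in[of W] finite_dchars[OF W0] by (auto simp: card_gt_0_iff)
  have "\<exists>K. \<forall>N>0. norm (dchar_mertens \<eta> N) \<le> K" if "\<eta> \<in> dchars W" "\<eta> \<noteq> ?\<xi>0" for \<eta>
    using dchar_mertens_bounded[OF W0 that dchar_L_nonzero[OF W0 sep that]] by blast
  then obtain K where K: "\<And>\<eta> N. \<eta> \<in> dchars W \<Longrightarrow> \<eta> \<noteq> ?\<xi>0 \<Longrightarrow> N > 0 \<Longrightarrow> norm (dchar_mertens \<eta> N) \<le> K \<eta>" by metis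
  define B where "B = (\<Sum>\<eta>\<in>dchars W - {?\<xi>0}. K \<eta>)"
  have main: "\<bar>?h * T a N - mertens_coprime W N\<bar> \<le> B" if a: "coprime a W" and N: "N > 0" for a N
  proof -
    obtain b where b: "[a * b = 1] (mod W)" using a cong_solve_coprime_nat[of a W] by auto
    have "coprime (a * b) W" using b cong_imp_coprime[of 1 "a * b" W] cong_sym by auto
    hence cb: "coprime b W" by (simp add: coprime_mult_left_iff)
    have "of_real (?h * T a N) = (\<Sum>\<eta>\<in>dchars W. \<eta> b * dchar_mertens \<eta> N)"
      unfolding T_def using sum_char_mertens[OF W0 sep b, of N] by simp
    also have "\<dots> = ?\<xi>0 b * dchar_mertens ?\<xi>0 N + (\<Sum>\<eta>\<in>dchars W - {?\<xi>0}. \<eta> b * dchar_mertens \<eta> N)"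
      using principal_char_in finite_dchars[OF W0] by (rule sum.remove[rotated])
    finally have "of_real (?h * T a N - mertens_coprime W N) = (\<Sum>\<eta>\<in>dchars W - {?\<xi>0}. \<eta> b * dchar_mertens \<eta> N)"
      using cb by (simp add: mertens_principal principal_char_def)
    moreover have "norm (\<Sum>\<eta>\<in>dchars W - {?\<xi>0}. \<eta> b * dchar_mertens \<eta> N) \<le> B"
      unfolding B_def
    proof (rule sum_norm_le)
      fix \<eta> assume \<eta>: "\<eta> \<in> dchars W - {?\<xi>0}"
      have "norm (\<eta> b * dchar_mertens \<eta> N) \<le> 1 * norm (dchar_mertens \<eta> N)"
        unfolding norm_mult using norm_dchars_le[of \<eta> W b] \<eta> W0 by (intro mult_right_mono) auto
      thus "norm (\<eta> b * dchar_mertens \<eta> N) \<le> K \<eta>" using K[of \<eta> N] \<eta> N by auto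
    qed
    ultimately show ?thesis by (metis norm_of_real)
  qed
  obtain C0 where C0: "\<And>N. N \<ge> 1 \<Longrightarrow> mertens_coprime W N \<ge> ln (real N) - C0" using mertens_coprime_lower[OF W0] by blast
  have B0: "B \<ge> 0" using main[OF a, of 1] by simp
  have sumT: "mertens_coprime W N = (\<Sum>a\<in>totatives W. T a N)" for N
  proof -
    have "{n\<in>{1..N}. coprime n W} = (\<Union>a\<in>totatives W. {n\<in>{1..N}. [n = a] (mod W)})"
    proof (intro equalityI subsetI)
      fix n assume n: "n \<in> {n\<in>{1..N}. coprime n W}"
      have "n mod W \<noteq> 0"
      proof
        assume "n mod W = 0"
        hence "W dvd n" by auto
        hence "W dvd 1" using n coprime_common_divisor[of n W W] by auto
        thus False using W by simp
      qed
      hence "n mod W \<in> totatives W" using n W by (auto simp: totatives_def less_imp_le)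
      moreover have "[n = n mod W] (mod W)" by (simp add: Cong.cong_def)
      ultimately show "n \<in> (\<Union>a\<in>totatives W. {n\<in>{1..N}. [n = a] (mod W)})" using n by blast
    next
      fix n assume "n \<in> (\<Union>a\<in>totatives W. {n\<in>{1..N}. [n = a] (mod W)})"
      then obtain a where "a \<in> totatives W" "[n = a] (mod W)" "n \<in> {1..N}" by blast
      thus "n \<in> {n\<in>{1..N}. coprime n W}" using cong_imp_coprime[of a n W] cong_sym by (auto simp: totatives_def)
    qed
    hence "mertens_coprime W N = (\<Sum>n\<in>(\<Union>a\<in>totatives W. {n\<in>{1..N}. [n = a] (mod W)}). mangoldt n / real n)"
      by (simp add: mertens_coprime_def)
    also have "\<dots> = (\<Sum>a\<in>totatives W. T a N)" unfolding T_def
    proof (rule sum.UNION_disjoint)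
      show "\<forall>i\<in>totatives W. \<forall>j\<in>totatives W. i \<noteq> j \<longrightarrow>
          {n\<in>{1..N}. [n = i] (mod W)} \<inter> {n\<in>{1..N}. [n = j] (mod W)} = {}"
      proof (intro ballI impI)
        fix i j assume ij: "i \<in> totatives W" "j \<in> totatives W" "i \<noteq> j"
        have "\<not> [i = j] (mod W)" using ij totatives_less[OF _ W] by (simp add: Cong.cong_def)
        moreover have "[i = j] (mod W)" if "[n = i] (mod W)" "[n = j] (mod W)" for n
          using cong_trans[OF cong_sym[OF that(1)] that(2)] .
        ultimately show "{n\<in>{1..N}. [n = i] (mod W)} \<inter> {n\<in>{1..N}. [n = j] (mod W)} = {}"
          by blast
      qed
    qed auto
    finally show ?thesis .
  qed
  have t0: "real (totient W) > 0" using W0 by simp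
  have h_le: "?h \<le> real (totient W)"
  proof (rule ccontr)
    assume "\<not> ?h \<le> real (totient W)"
    hence gap: "?h - real (totient W) \<ge> 1" by (simp add: not_le flip: of_nat_less_iff)
    have bound: "ln (real N) \<le> C0 + real (totient W) * B" if N: "N \<ge> 1" for N
    proof (cases "mertens_coprime W N \<ge> 0")
      case True
      have "?h * mertens_coprime W N = (\<Sum>a\<in>totatives W. ?h * T a N)" unfolding sumT by (rule sum_distrib_left)
      also have "\<dots> \<le> (\<Sum>a\<in>totatives W. mertens_coprime W N + B)"
      proof (rule sum_mono)
        fix a assume "a \<in> totatives W"
        hence "coprime a W" by (simp add: totatives_def)
        thus "?h * T a N \<le> mertens_coprime W N + B" using main[of a N] N by simp
      qed
      also have "\<dots> = real (totient W) * (mertens_coprime W N + B)" by (simp add: totient_def)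
      finally have "(?h - real (totient W)) * mertens_coprime W N \<le> real (totient W) * B" by (simp add: algebra_simps)
      moreover have "1 * mertens_coprime W N \<le> (?h - real (totient W)) * mertens_coprime W N"
        using gap True by (intro mult_right_mono) auto
      ultimately show ?thesis using C0[OF N] by linarith
    next
      case False
      have "real (totient W) * B \<ge> 0" using B0 by simp
      thus ?thesis using C0[OF N] False by linarith
    qed
    let ?c = "C0 + real (totient W) * B"
    have "exp (?c + 1) \<le> real (nat \<lceil>exp (?c + 1)\<rceil>)" by linarith
    moreover have "exp (?c + 1) > 0" by simp
    ultimately have "1 \<le> nat \<lceil>exp (?c + 1)\<rceil>" "?c + 1 \<le> ln (real (nat \<lceil>exp (?c + 1)\<rceil>))"
      by (auto simp: ln_ge_iff Suc_le_eq)
    thus False using bound[of "nat \<lceil>exp (?c + 1)\<rceil>"] by simp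
  qed
  obtain Q where Q: "\<And>N. (\<Sum>n\<in>{n\<in>{1..N}. \<not> prime n}. mangoldt n / real n) \<le> Q"
    using sum_mangoldt_nonprime_le by blast
  have "(\<Sum>p | prime p \<and> p \<le> N \<and> [p = a] (mod W). ln (real p) / real p) \<ge> ln (real N) / real (totient W) - ((\<bar>C0\<bar> + B) / real (totient W) + Q)" if N: "N \<ge> 1" for N
  proof -
    have T0: "T a N \<ge> 0" unfolding T_def by (intro sum_nonneg) (auto simp: mangoldt_nonneg)
    have "ln (real N) - (\<bar>C0\<bar> + B) \<le> ?h * T a N" using main[OF a, of N] C0[OF N] N by linarith
    also have "\<dots> \<le> real (totient W) * T a N" using h_le T0 by (intro mult_right_mono)
    finally have 1: "(ln (real N) - (\<bar>C0\<bar> + B)) / real (totient W) \<le> T a N" using t0 by (simp add: divide_le_eq mult.commute)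
    let ?A = "{p. prime p \<and> p \<le> N \<and> [p = a] (mod W)}"
    have finA: "finite ?A" by (rule finite_subset[OF _ finite_primes_le[of N]]) auto
    have "T a N \<le> (\<Sum>n\<in>?A \<union> {n\<in>{1..N}. \<not> prime n}. mangoldt n / real n)"
      unfolding T_def using finA by (intro sum_mono2) (auto simp: mangoldt_nonneg)
    also have "\<dots> = (\<Sum>n\<in>?A. mangoldt n / real n) + (\<Sum>n\<in>{n\<in>{1..N}. \<not> prime n}. mangoldt n / real n)"
      using finA by (intro sum.union_disjoint) auto
    also have "(\<Sum>n\<in>?A. mangoldt n / real n) = (\<Sum>p\<in>?A. ln (real p) / real p)" by (intro sum.cong) auto
    finally show ?thesis using 1 Q[of N] by (simp add: diff_divide_distrib)
  qed
  thus ?thesis by blast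
qed

text \<open>If all dyadic blocks beyond some point held fewer primes, the sum of \<open>ln p / p\<close> would grow by at most
  \<open>1 / (2 * totient W)\<close> per block, instead of the average \<open>ln 2 / totient W\<close>.\<close>
theorem dirichlet_dyadic:
  assumes W: "W > 1" and sep: "dchars_separate W"
    and a: "coprime a W"
  shows "\<exists>X\<ge>X0. real (card {p. prime p \<and> X < p \<and> p \<le> 2 * X \<and> [p = a] (mod W)}) \<ge>
            real X / (4 * real (totient W) * ln (real X))"
proof (rule ccontr)
  assume neg: "\<not> ?thesis"
  define t where "t = real (totient W)"
  have t0: "t > 0" using W by (simp add: t_def)
  define A where "A N = {p. prime p \<and> p \<le> N \<and> [p = a] (mod W)}" for N :: nat
  define f where "f p = ln (real p) / real p" for p :: nat
  have finA: "finite (A N)" for N unfolding A_def by (rule finite_subset[OF _ finite_primes_le[of N]]) auto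
  obtain C where C: "\<And>N. N \<ge> 1 \<Longrightarrow> (\<Sum>p\<in>A N. f p) \<ge> ln (real N) / t - C"
    using dirichlet_mertens[OF W sep a] unfolding A_def f_def t_def by blast
  define j0 where "j0 = X0 + 1"
  have X0: "X0 \<le> 2 ^ j" "j \<ge> 1" if "j \<ge> j0" for j
  proof -
    have "X0 \<le> j" using that by (simp add: j0_def)
    thus "X0 \<le> 2 ^ j" using less_exp[of j] by linarith
    show "j \<ge> 1" using that by (simp add: j0_def)
  qed
  have step: "(\<Sum>p\<in>A (2 ^ Suc j). f p) \<le> (\<Sum>p\<in>A (2 ^ j). f p) + 1 / (2 * t)" if j: "j \<ge> j0" for j
  proof -
    let ?X = "(2::nat) ^ j"
    let ?D = "{p. prime p \<and> ?X < p \<and> p \<le> 2 * ?X \<and> [p = a] (mod W)}"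
    have finD: "finite ?D" by (rule finite_subset[OF _ finite_primes_le[of "2 * ?X"]]) auto
    have lX: "ln (real ?X) = real j * ln 2" "ln (real (2 * ?X)) = (real j + 1) * ln 2"
      by (auto simp: ln_mult ln_realpow algebra_simps)
    have "A (2 ^ Suc j) = A (2 ^ j) \<union> ?D" unfolding A_def by auto
    hence split: "(\<Sum>p\<in>A (2 ^ Suc j). f p) = (\<Sum>p\<in>A (2 ^ j). f p) + (\<Sum>p\<in>?D. f p)"
      using finA finD by (simp only:) (rule sum.union_disjoint, auto simp: A_def)
    have "(\<Sum>p\<in>?D. f p) \<le> (\<Sum>p\<in>?D. ln (real (2 * ?X)) / real ?X)"
    proof (rule sum_mono)
      fix p assume p: "p \<in> ?D"
      hence 1: "real ?X \<le> real p" "real p \<le> real (2 * ?X)" "p > 0"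
        unfolding mem_Collect_eq of_nat_le_iff by (simp_all only: prime_gt_0_nat less_imp_le)
      have 2: "ln (real p) \<le> ln (real (2 * ?X))"
        using 1 by (subst ln_le_cancel_iff) auto
      have 3: "0 \<le> ln (real (2 * ?X))" by (subst lX) simp
      have 4: "0 < real ?X" by simp
      show "f p \<le> ln (real (2 * ?X)) / real ?X"
        unfolding f_def by (rule frac_le[OF 3 2 4 1(1)])
    qed
    also have "\<dots> = real (card ?D) * (ln (real (2 * ?X)) / real ?X)" by (rule sum_constant)
    also have "\<dots> \<le> (real ?X / (4 * t * ln (real ?X))) * (ln (real (2 * ?X)) / real ?X)"
    proof (rule mult_right_mono)
      have "\<not> real ?X / (4 * real (totient W) * ln (real ?X)) \<le> real (card ?D)"
        by (rule contrapos_nn[OF neg], rule exI[of _ ?X], rule conjI[OF X0(1)[OF j]])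
      thus "real (card ?D) \<le> real ?X / (4 * t * ln (real ?X))" by (simp add: t_def)
      have "0 \<le> ln (real (2 * ?X))" by (subst lX) simp
      thus "0 \<le> ln (real (2 * ?X)) / real ?X" by (rule divide_nonneg_nonneg) simp
    qed
    also have "\<dots> = (real j + 1) / (4 * t * real j)"
    proof -
      have "x / (4 * t * (real j * l)) * ((real j + 1) * l / x) = (real j + 1) / (4 * t * real j)"
        if "x > 0" "l > 0" for x l :: real using that by simp
      from this[of "real ?X" "ln 2"] show ?thesis unfolding lX by simp
    qed
    also have "\<dots> \<le> (2 * real j) / (4 * t * real j)"
      using X0(2)[OF j] t0 by (intro divide_right_mono) auto
    also have "\<dots> = 1 / (2 * t)" using X0(2)[OF j] t0 by simp
    finally show ?thesis unfolding split by (rule add_left_mono)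
  qed
  have up: "(\<Sum>p\<in>A (2 ^ (j0 + i)). f p) \<le> (\<Sum>p\<in>A (2 ^ j0). f p) + real i / (2 * t)" for i
  proof (induction i)
    case (Suc i)
    thus ?case using step[of "j0 + i"] by (simp add: add_divide_distrib)
  qed simp
  have "real i \<le> (\<Sum>p\<in>A (2 ^ j0). f p) * (6 * t) + 6 * t * C" for i
  proof -
    have "(real j0 + real i) * ln 2 / t - C \<le> (\<Sum>p\<in>A (2 ^ j0). f p) + real i / (2 * t)"
      using C[of "2 ^ (j0 + i)"] up[of i] by (simp add: ln_realpow)
    moreover have "real i * (2/3) / t \<le> (real j0 + real i) * ln 2 / t"
      using ln2_ge_two_thirds t0 by (intro divide_right_mono mult_mono) auto
    ultimately have "real i * (2/3) / t - real i / (2 * t) \<le> (\<Sum>p\<in>A (2 ^ j0). f p) + C" by linarith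
    moreover have "real i * (2/3) / t - real i / (2 * t) = real i / (6 * t)" using t0 by (simp add: field_simps)
    ultimately show ?thesis using t0 by (simp add: field_simps)
  qed
  thus False using reals_Archimedean2 not_le by blast
qed

section \<open>Every positive integer is a value\<close>

definition shifted_divisors :: "nat \<Rightarrow> nat set" where
  "shifted_divisors n = {d. d dvd n \<and> prime (d + 1)}"

lemma omega_star_eq: "omega_star n = card (shifted_divisors n)"
proof -
  have "{d. 0 < d \<and> d dvd n \<and> (\<exists>p::nat. prime p \<and> d = p - 1)} = shifted_divisors n"
  proof (intro equalityI subsetI)
    fix d assume "d \<in> {d. 0 < d \<and> d dvd n \<and> (\<exists>p::nat. prime p \<and> d = p - 1)}"
    then obtain p where "0 < d" "d dvd n" "prime p" "d = p - 1" by auto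
    moreover from this have "d + 1 = p" by simp
    ultimately show "d \<in> shifted_divisors n" by (simp add: shifted_divisors_def)
  next
    fix d assume d: "d \<in> shifted_divisors n"
    have "0 < d" using d by (auto simp: shifted_divisors_def intro: Nat.gr0I)
    thus "d \<in> {d. 0 < d \<and> d dvd n \<and> (\<exists>p::nat. prime p \<and> d = p - 1)}"
      using d unfolding shifted_divisors_def by (auto intro!: exI[of _ "d + 1"])
  qed
  thus ?thesis by (simp add: omega_star_def)
qed

lemma finite_shifted_divisors: "n > 0 \<Longrightarrow> finite (shifted_divisors n)"
  unfolding shifted_divisors_def by (rule finite_subset[of _ "{d. d dvd n}"]) auto

lemma shifted_divisors_mono: "m dvd n \<Longrightarrow> shifted_divisors m \<subseteq> shifted_divisors n"
  unfolding shifted_divisors_def using dvd_trans by blast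

text \<open>The multipliers that may create two new shifted prime divisors \<open>r * g\<close> and \<open>r * h\<close> at once.\<close>
definition double_jumps :: "nat \<Rightarrow> nat set" where
  "double_jumps m = {r. r \<ge> 2 \<and> (\<exists>g h. g dvd m \<and> h dvd m \<and> g \<noteq> h \<and> prime (r * g + 1) \<and> prime (r * h + 1))}"

text \<open>Let \<open>r\<close> be the least divisor of \<open>(p - 1) div gcd (p - 1) m\<close> for which \<open>m * r\<close> has a new shifted prime
  divisor \<open>d\<close>. Minimality forces \<open>lcm m d = m * r\<close>, that is \<open>d = r * gcd m d\<close>. So two different new
  ones would make \<open>r\<close> an element of \<open>double_jumps m\<close>.\<close>
lemma omega_star_single_jump:
  assumes m: "m > 0" and p: "prime p" "\<not> (p - 1) dvd m"
    and no: "\<And>r. r \<in> double_jumps m \<Longrightarrow> \<not> r dvd (p - 1) div gcd (p - 1) m"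
  shows "\<exists>r>0. omega_star (m * r) = omega_star m + 1"
proof -
  define q where "q = (p - 1) div gcd (p - 1) m"
  have p1: "p - 1 > 0" using p(1) prime_gt_1_nat[of p] by simp
  have q0: "q > 0" unfolding q_def using p1 m by (simp add: div_greater_zero_iff dvd_imp_le)
  let ?P = "\<lambda>r. r dvd q \<and> card (shifted_divisors (m * r)) > card (shifted_divisors m)"
  have ex: "?P q"
  proof
    have "p - 1 dvd m * q"
    proof -
      have "p - 1 = gcd (p - 1) m * q" unfolding q_def by simp
      thus ?thesis by (metis gcd_dvd2 mult_dvd_mono dvd_refl)
    qed
    hence "p - 1 \<in> shifted_divisors (m * q)" using p p1 by (simp add: shifted_divisors_def)
    moreover have "p - 1 \<notin> shifted_divisors m" using p by (simp add: shifted_divisors_def)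
    moreover have "shifted_divisors m \<subseteq> shifted_divisors (m * q)" by (rule shifted_divisors_mono) simp
    ultimately have "shifted_divisors m \<subset> shifted_divisors (m * q)" by blast
    thus "card (shifted_divisors (m * q)) > card (shifted_divisors m)"
      using m q0 by (intro psubset_card_mono finite_shifted_divisors) auto
  qed simp
  define r where "r = (LEAST r. ?P r)"
  have r: "?P r" unfolding r_def by (rule LeastI[of ?P, OF ex])
  have r_min: "r \<le> s" if "?P s" for s unfolding r_def using that by (rule Least_le)
  have r0: "r > 0" using r q0 by (auto intro: Nat.gr0I)
  let ?N = "shifted_divisors (m * r) - shifted_divisors m"
  have fin: "finite (shifted_divisors (m * r))" using m r0 by (intro finite_shifted_divisors) auto
  have sub: "shifted_divisors m \<subseteq> shifted_divisors (m * r)" by (rule shifted_divisors_mono) simp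
  have new: "d = r * gcd m d" if d: "d \<in> ?N" for d
  proof -
    have dd: "d dvd m * r" "\<not> d dvd m" "prime (d + 1)" using d by (auto simp: shifted_divisors_def)
    have d0: "d > 0" using dd m r0 by (auto intro: Nat.gr0I)
    define s where "s = lcm m d div m"
    have ms: "m * s = lcm m d" unfolding s_def by simp
    have "lcm m d dvd m * r" using dd by (intro lcm_least) auto
    hence "m * s dvd m * r" by (simp add: ms)
    hence sr: "s dvd r" using m by simp
    have "d \<in> shifted_divisors (m * s)" using dd by (simp add: shifted_divisors_def ms)
    moreover have "d \<notin> shifted_divisors m" using d by simp
    moreover have "shifted_divisors m \<subseteq> shifted_divisors (m * s)" by (rule shifted_divisors_mono) simp
    ultimately have "shifted_divisors m \<subset> shifted_divisors (m * s)" by blast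
    moreover have "m * s > 0" using ms m d0 by (simp add: lcm_pos_nat)
    ultimately have "card (shifted_divisors (m * s)) > card (shifted_divisors m)"
      by (intro psubset_card_mono finite_shifted_divisors) auto
    hence "?P s" using sr r dvd_trans by blast
    hence "r \<le> s" by (rule r_min)
    hence "s = r" using sr r0 dvd_imp_le by fastforce
    hence "lcm m d = m * r" using ms by simp
    moreover have "gcd m d * lcm m d = m * d" by (metis prod_gcd_lcm_nat)
    ultimately have "m * (r * gcd m d) = m * d" by (simp add: mult_ac)
    thus ?thesis using m by simp
  qed
  have one: "d = e" if d: "d \<in> ?N" and e: "e \<in> ?N" for d e
  proof (rule ccontr)
    assume de: "d \<noteq> e"
    have g: "gcd m d \<noteq> gcd m e" using new[OF d] new[OF e] de by metis
    have "r \<noteq> 1"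
    proof
      assume "r = 1"
      thus False using r by simp
    qed
    hence "r \<ge> 2" using r0 by simp
    moreover have "prime (r * gcd m d + 1)" "prime (r * gcd m e + 1)"
      using d e new[OF d] new[OF e] by (auto simp: shifted_divisors_def)
    moreover have "gcd m d dvd m" "gcd m e dvd m" by simp_all
    ultimately have "r \<in> double_jumps m" unfolding double_jumps_def using g r0 by blast
    thus False using no r unfolding q_def by blast
  qed
  have "card (shifted_divisors (m * r)) = card (shifted_divisors m) + card ?N"
    using fin sub by (metis card_Diff_subset card_mono finite_subset le_add_diff_inverse)
  moreover have "card ?N \<noteq> 0" using conjunct2[OF r] calculation by linarith
  moreover have "card ?N \<le> 1" using one by (simp add: card_le_Suc0_iff_eq fin)
  ultimately show ?thesis using r0 unfolding omega_star_eq by auto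
qed

lemma diff_dvd_of_nat_abs_dvd:
  assumes "nat \<bar>int a - int b\<bar> dvd D" shows "(int a - int b) dvd int D"
proof -
  have "int (nat \<bar>int a - int b\<bar>) dvd int D" using assms by (simp only: int_dvd_int_iff)
  thus ?thesis by simp
qed

lemma pair_forms_count:
  assumes "1 \<le> g" "1 \<le> h" "g \<noteq> h"
  shows "\<exists>K\<ge>0. \<forall>B\<ge>2. real (card {r\<in>{1..B}. prime (g * r + 1) \<and> prime (h * r + 1)}) \<le> K * real B / ln (real B) ^ 2"
proof -
  obtain C where C: "C > 0" and bound: "\<forall>F D B. finite F \<longrightarrow> card F = 2 \<longrightarrow> D \<ge> 1 \<longrightarrow> B \<ge> 2 \<longrightarrow>
     (\<forall>(c,d)\<in>F. c \<ge> 1 \<and> c dvd D) \<longrightarrow>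
     (\<forall>(c,d)\<in>F. \<forall>(c',d')\<in>F. (c,d) \<noteq> (c',d') \<longrightarrow> (int c * int d' - int c' * int d) dvd int D) \<longrightarrow>
     real (card {b\<in>{1..B}. \<forall>(c,d)\<in>F. prime (c * b + d)}) \<le>
       C * real B / ln (real B) ^ 2 * exp (real 2 * (\<Sum>p\<in>prime_factors D. 1 / real p))"
    using linear_forms_prime_count[of 2] by (elim exE conjE)
  define \<Delta> where "\<Delta> = nat \<bar>int g - int h\<bar>"
  define D where "D = g * h * \<Delta>"
  have \<Delta>: "\<Delta> \<ge> 1" "int \<Delta> = \<bar>int g - int h\<bar>" using assms by (auto simp: \<Delta>_def)
  have D: "D \<ge> 1" unfolding D_def using assms \<Delta> by (simp add: Suc_le_eq)
  have dv: "(int g - int h) dvd int D" "(int h - int g) dvd int D"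
    by (intro diff_dvd_of_nat_abs_dvd; simp add: D_def \<Delta>_def abs_minus_commute)+
  define K where "K = C * exp (real 2 * (\<Sum>p\<in>prime_factors D. 1 / real p))"
  show ?thesis
  proof (intro exI[of _ K] conjI allI impI)
    show "K \<ge> 0" using C by (simp add: K_def)
    fix B :: nat assume B: "2 \<le> B"
    have "real (card {b\<in>{1..B}. \<forall>(c,d)\<in>{(g,1),(h,1)}. prime (c * b + d)}) \<le>
       C * real B / ln (real B) ^ 2 * exp (real 2 * (\<Sum>p\<in>prime_factors D. 1 / real p))"
      by (rule bound[THEN spec, THEN spec, THEN spec, THEN mp, THEN mp, THEN mp, THEN mp, THEN mp, THEN mp])
         (use assms D B dv in \<open>auto simp: D_def\<close>)
    thus "real (card {r\<in>{1..B}. prime (g * r + 1) \<and> prime (h * r + 1)}) \<le> K * real B / ln (real B) ^ 2"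
      by (simp add: K_def mult_ac)
  qed
qed

lemma double_jumps_sparse:
  assumes m: "m > 0"
  shows "\<exists>K\<ge>0. \<forall>B\<ge>2. real (card {r\<in>double_jumps m. r \<le> B}) \<le> K * real B / ln (real B) ^ 2"
proof -
  let ?I = "{(g,h). g dvd m \<and> h dvd m \<and> g \<noteq> h}"
  have finI: "finite ?I" by (rule finite_subset[of _ "{d. d dvd m} \<times> {d. d dvd m}"]) (use m in auto)
  have pos: "1 \<le> g" if "g dvd m" for g using that m by (auto intro: Suc_leI Nat.gr0I)
  have "\<forall>i\<in>?I. \<exists>K\<ge>0. \<forall>B\<ge>2. real (card {r\<in>{1..B}. prime (fst i * r + 1) \<and> prime (snd i * r + 1)}) \<le> K * real B / ln (real B) ^ 2"
  proof
    fix i assume "i \<in> ?I"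
    hence "fst i dvd m" "snd i dvd m" "fst i \<noteq> snd i" by auto
    thus "\<exists>K\<ge>0. \<forall>B\<ge>2. real (card {r\<in>{1..B}. prime (fst i * r + 1) \<and> prime (snd i * r + 1)}) \<le> K * real B / ln (real B) ^ 2"
      by (intro pair_forms_count pos)
  qed
  from bchoice[OF this] obtain K where K0: "\<forall>i\<in>?I. K i \<ge> 0 \<and> (\<forall>B\<ge>2. real (card {r\<in>{1..B}. prime (fst i * r + 1) \<and> prime (snd i * r + 1)}) \<le> K i * real B / ln (real B) ^ 2)"
    by (rule exE)
  have K: "\<And>i. i \<in> ?I \<Longrightarrow> K i \<ge> 0"
    "\<And>i B. i \<in> ?I \<Longrightarrow> B \<ge> 2 \<Longrightarrow> real (card {r\<in>{1..B}. prime (fst i * r + 1) \<and> prime (snd i * r + 1)}) \<le> K i * real B / ln (real B) ^ 2"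
    using K0 by blast+
  show ?thesis
  proof (intro exI[of _ "\<Sum>i\<in>?I. K i"] conjI allI impI)
    show "0 \<le> (\<Sum>i\<in>?I. K i)" using K(1) by (rule sum_nonneg)
    fix B :: nat assume B: "2 \<le> B"
    have "{r\<in>double_jumps m. r \<le> B} \<subseteq> (\<Union>i\<in>?I. {r\<in>{1..B}. prime (fst i * r + 1) \<and> prime (snd i * r + 1)})"
    proof
      fix r assume r: "r \<in> {r\<in>double_jumps m. r \<le> B}"
      then obtain g h where gh: "g dvd m" "h dvd m" "g \<noteq> h" "prime (r * g + 1)" "prime (r * h + 1)" "r \<ge> 2"
        unfolding double_jumps_def by auto
      hence "(g,h) \<in> ?I" by simp
      moreover have "r \<in> {r\<in>{1..B}. prime (fst (g,h) * r + 1) \<and> prime (snd (g,h) * r + 1)}"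
        using gh r by (auto simp: mult.commute)
      ultimately show "r \<in> (\<Union>i\<in>?I. {r\<in>{1..B}. prime (fst i * r + 1) \<and> prime (snd i * r + 1)})" by blast
    qed
    hence "card {r\<in>double_jumps m. r \<le> B} \<le> card (\<Union>i\<in>?I. {r\<in>{1..B}. prime (fst i * r + 1) \<and> prime (snd i * r + 1)})"
      using finI by (intro card_mono) auto
    also have "\<dots> \<le> (\<Sum>i\<in>?I. card {r\<in>{1..B}. prime (fst i * r + 1) \<and> prime (snd i * r + 1)})"
      by (rule card_UN_le[OF finI])
    finally have "real (card {r\<in>double_jumps m. r \<le> B}) \<le> (\<Sum>i\<in>?I. real (card {r\<in>{1..B}. prime (fst i * r + 1) \<and> prime (snd i * r + 1)}))"
      by (simp flip: of_nat_sum)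
    also have "\<dots> \<le> (\<Sum>i\<in>?I. K i * (real B / ln (real B) ^ 2))" using K(2) B by (intro sum_mono) auto
    also have "\<dots> = (\<Sum>i\<in>?I. K i) * (real B / ln (real B) ^ 2)" by (rule sum_distrib_right[symmetric])
    finally show "real (card {r\<in>double_jumps m. r \<le> B}) \<le> (\<Sum>i\<in>?I. K i) * real B / ln (real B) ^ 2" by simp
  qed
qed

text \<open>Comparable to \<open>n / totient n\<close>, but more convenient in products.\<close>
definition euler_weight :: "nat \<Rightarrow> real" where
  "euler_weight n = exp (\<Sum>p\<in>prime_factors n. 1 / real p)"

lemma euler_weight_pos: "euler_weight n > 0" by (simp add: euler_weight_def)

lemma euler_weight_mult_le:
  assumes "a > 0" "b > 0" shows "euler_weight (a * b) \<le> euler_weight a * euler_weight b"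
proof -
  have "(\<Sum>p\<in>prime_factors (a * b). 1 / real p) \<le> (\<Sum>p\<in>prime_factors a. 1 / real p) + (\<Sum>p\<in>prime_factors b. 1 / real p)"
  proof -
    have un: "sum f (A \<union> B) \<le> sum f A + sum f B" if "finite A" "finite B" "\<And>n. f n \<ge> 0" for f :: "nat \<Rightarrow> real" and A B
      using sum.union_inter[OF that(1,2), of f] sum_nonneg[of "A \<inter> B" f] that(3) by simp
    have "prime_factors (a * b) = prime_factors a \<union> prime_factors b"
      using assms by (intro prime_factors_product) auto
    thus ?thesis using un[of "prime_factors a" "prime_factors b" "\<lambda>p. 1 / real p"] by simp
  qed
  thus ?thesis by (simp add: euler_weight_def flip: exp_add)
qed

lemma euler_weight_le_sqrt: "\<exists>c>0. \<forall>n\<ge>16. euler_weight n \<le> c * sqrt (ln (real n))"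
proof -
  obtain C where C: "C > 0" "\<forall>D x. 1 \<le> D \<longrightarrow> real D \<le> x \<longrightarrow> 16 \<le> x \<longrightarrow>
      exp (\<Sum>p\<in>prime_factors D. 1 / real p) \<le> C * ln (ln x)"
    using sum_recip_prime_factors_bound by blast
  show ?thesis
  proof (intro exI[of _ "2 * C"] conjI allI impI)
    fix n :: nat assume n: "n \<ge> 16"
    have l: "ln (real n) > 0" using n by simp
    have "euler_weight n \<le> C * ln (ln (real n))" unfolding euler_weight_def using C(2) n by auto
    also have "ln (ln (real n)) = 2 * ln (sqrt (ln (real n)))" using l by (simp add: ln_sqrt)
    also have "C * (2 * ln (sqrt (ln (real n)))) \<le> C * (2 * sqrt (ln (real n)))"
      using ln_le_minus_one[of "sqrt (ln (real n))"] l C by (intro mult_left_mono) auto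
    finally show "euler_weight n \<le> 2 * C * sqrt (ln (real n))" by simp
  qed (use C in auto)
qed

text \<open>Double jumps are as sparse as prime pairs, so the tails of this sum go to zero even with the weight,
  which is much smaller than \<open>sqrt (ln r)\<close>.\<close>
lemma double_jumps_weight_small:
  assumes m: "m > 0" and \<eta>: "\<eta> > (0::real)"
  shows "\<exists>z0. \<forall>z\<ge>z0. \<forall>F. finite F \<longrightarrow> F \<subseteq> double_jumps m \<longrightarrow> (\<forall>r\<in>F. z < r) \<longrightarrow> (\<Sum>r\<in>F. euler_weight r / real r) \<le> \<eta>"
proof -
  obtain K where K: "K \<ge> 0" "\<And>B. B \<ge> 2 \<Longrightarrow> real (card {r\<in>double_jumps m. r \<le> B}) \<le> K * real B / ln (real B) ^ 2"
    using double_jumps_sparse[OF m] by blast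
  obtain c where c: "c > 0" "\<And>n. n \<ge> 16 \<Longrightarrow> euler_weight n \<le> c * sqrt (ln (real n))" using euler_weight_le_sqrt by blast
  have "((\<lambda>z::real. 8 * K * c / sqrt (ln z)) \<longlongrightarrow> 0) at_top" by real_asymp
  hence "eventually (\<lambda>z::real. 8 * K * c / sqrt (ln z) < \<eta>) at_top" using \<eta> by (rule order_tendstoD(2))
  then obtain u where u: "\<And>z. z \<ge> u \<Longrightarrow> 8 * K * c / sqrt (ln z) < \<eta>" unfolding eventually_at_top_linorder by blast
  show ?thesis
  proof (intro exI[of _ "max 16 (nat \<lceil>u\<rceil>)"] allI impI)
    fix z F assume z: "max 16 (nat \<lceil>u\<rceil>) \<le> z" and F: "finite F" "F \<subseteq> double_jumps m" "\<forall>r\<in>F. z < r"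
    have "(\<Sum>r\<in>F. euler_weight r / real r) \<le> 8 * K * c / sqrt (ln (real z))"
    proof (rule sum_weighted_sparse_le[where A = "double_jumps m"])
      show "euler_weight b \<le> c * sqrt (ln (real b))" if "b \<in> F" for b using c(2)[of b] that F z by fastforce
      show "real (card {b\<in>double_jumps m. b \<le> B}) \<le> K * real B / ln (real B) ^ 2" if "B \<ge> z" for B
        using K(2)[of B] that z by simp
      show "finite {b\<in>double_jumps m. b \<le> B}" for B by (rule finite_subset[of _ "{..B}"]) auto
    qed (use F z K c in auto)
    also have "\<dots> \<le> \<eta>" using u[of "real z"] z by linarith
    finally show "(\<Sum>r\<in>F. euler_weight r / real r) \<le> \<eta>" .
  qed
qed

text \<open>The hypothesis says \<open>q \<le> X powr (3/4)\<close>, so that the progression has a length comparable to a power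
  of \<open>X\<close> and the sieve saves a full \<open>ln X\<close>.\<close>
lemma brun_titchmarsh_dyadic:
  "\<exists>C>0. \<forall>q c X. q \<ge> 1 \<longrightarrow> q ^ 4 \<le> X ^ 3 \<longrightarrow> X \<ge> 2 \<longrightarrow>
     real (card {p. prime p \<and> X < p \<and> p \<le> 2 * X \<and> [p = c] (mod q)}) \<le> C * (real X / (real q * ln (real X))) * euler_weight q"
proof -
  obtain C where C: "C > 0" and bound: "\<forall>F D B. finite F \<longrightarrow> card F = 1 \<longrightarrow> D \<ge> 1 \<longrightarrow> B \<ge> 2 \<longrightarrow>
     (\<forall>(c,d)\<in>F. c \<ge> 1 \<and> c dvd D) \<longrightarrow>
     (\<forall>(c,d)\<in>F. \<forall>(c',d')\<in>F. (c,d) \<noteq> (c',d') \<longrightarrow> (int c * int d' - int c' * int d) dvd int D) \<longrightarrow>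
     real (card {b\<in>{1..B}. \<forall>(c,d)\<in>F. prime (c * b + d)}) \<le>
       C * real B / ln (real B) ^ 1 * exp (real 1 * (\<Sum>p\<in>prime_factors D. 1 / real p))"
    using linear_forms_prime_count[of 1] by (elim exE conjE)
  show ?thesis
  proof (intro exI[of _ "8 * C"] conjI allI impI)
    fix q c X :: nat assume q: "q \<ge> 1" and qX: "q ^ 4 \<le> X ^ 3" and X: "X \<ge> 2"
    have qX1: "q \<le> X"
    proof (rule ccontr)
      assume "\<not> q \<le> X"
      hence "X ^ 4 < q ^ 4" by (intro power_strict_mono) auto
      moreover have "X ^ 3 \<le> X ^ 4" using X by (intro power_increasing) auto
      ultimately show False using qX by linarith
    qed
    define B where "B = 2 * X div q"
    define a where "a = c mod q"
    have B2: "B \<ge> 2" unfolding B_def using qX1 q by (simp add: less_eq_div_iff_mult_less_eq)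
    have XB: "X \<le> B * q"
    proof -
      have "2 * X < q * (B + 1)" unfolding B_def using q by (metis Suc_eq_plus1 dividend_less_times_div mult_Suc_right less_le_trans zero_less_one)
      thus ?thesis using qX1 by (simp add: algebra_simps)
    qed
    have "X ^ 4 \<le> (B * q) ^ 4" using XB by (intro power_mono) auto
    also have "\<dots> = B ^ 4 * q ^ 4" by (rule power_mult_distrib)
    also have "\<dots> \<le> B ^ 4 * X ^ 3" using qX by (intro mult_left_mono) auto
    finally have "X * X ^ 3 \<le> B ^ 4 * X ^ 3" by (simp add: power_Suc[symmetric] del: power_Suc)
    hence "X \<le> B ^ 4" using X by simp
    hence "ln (real X) \<le> ln (real (B ^ 4))" using X B2 by (subst ln_le_cancel_iff) (auto simp flip: of_nat_power)
    hence lB: "ln (real X) \<le> 4 * ln (real B)" using B2 by (simp add: ln_realpow)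
    have lX: "ln (real X) > 0" using X by simp
    let ?S = "{p. prime p \<and> X < p \<and> p \<le> 2 * X \<and> [p = c] (mod q)}"
    have S: "p = q * (p div q) + a" "p div q \<in> {1..B}" if "p \<in> ?S" for p
    proof -
      have "p mod q = a" using that by (simp add: a_def Cong.cong_def)
      thus "p = q * (p div q) + a" by (metis mult_div_mod_eq)
      have "p div q \<le> (2 * X) div q" using that by (intro div_le_mono) auto
      moreover have "p div q > 0" using that qX1 q by (auto simp: div_greater_zero_iff)
      ultimately show "p div q \<in> {1..B}" unfolding B_def by simp
    qed
    have "card ?S \<le> card {b\<in>{1..B}. \<forall>(c,d)\<in>{(q,a)}. prime (c * b + d)}"
    proof (rule card_inj_on_le)
      show "inj_on (\<lambda>p. p div q) ?S" by (rule inj_onI) (metis S(1))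
      show "(\<lambda>p. p div q) ` ?S \<subseteq> {b\<in>{1..B}. \<forall>(c,d)\<in>{(q,a)}. prime (c * b + d)}"
      proof (rule image_subsetI)
        fix p assume p: "p \<in> ?S"
        have "prime (q * (p div q) + a)" using S(1)[OF p] p by simp
        thus "p div q \<in> {b\<in>{1..B}. \<forall>(c,d)\<in>{(q,a)}. prime (c * b + d)}" using S(2)[OF p] by simp
      qed
    qed auto
    hence "real (card ?S) \<le> real (card {b\<in>{1..B}. \<forall>(c,d)\<in>{(q,a)}. prime (c * b + d)})" by simp
    also have "\<dots> \<le> C * real B / ln (real B) ^ 1 * exp (real 1 * (\<Sum>p\<in>prime_factors q. 1 / real p))"
      by (rule bound[THEN spec, THEN spec, THEN spec, THEN mp, THEN mp, THEN mp, THEN mp, THEN mp, THEN mp])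
         (use q B2 in auto)
    also have "\<dots> = C * (real B / ln (real B)) * euler_weight q" by (simp add: euler_weight_def)
    also have "\<dots> \<le> C * ((2 * real X / real q) / (ln (real X) / 4)) * euler_weight q"
    proof (intro mult_right_mono mult_left_mono frac_le)
      show "real B \<le> 2 * real X / real q"
        unfolding B_def using real_div_le[of "2 * X" q] by simp
    qed (use lB lX C euler_weight_pos[of q] in auto)
    also have "\<dots> = 8 * C * (real X / (real q * ln (real X))) * euler_weight q" by simp
    finally show "real (card ?S) \<le> 8 * C * (real X / (real q * ln (real X))) * euler_weight q" .
  qed (use C in auto)
qed

text \<open>The condition \<open>m < 2 * s\<close> keeps the form \<open>2 * s * r + 1\<close> different from the two others, whose leading
  coefficients divide \<open>m\<close>; and \<open>s\<^sup>2 \<le> X\<close> leaves a range of length \<open>sqrt X\<close> for \<open>r\<close>.\<close>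
lemma triple_forms_count:
  assumes m: "m > 0"
  shows "\<exists>C>0. \<forall>g h s X. g dvd m \<longrightarrow> h dvd m \<longrightarrow> g \<noteq> h \<longrightarrow> 1 \<le> s \<longrightarrow> m < 2 * s \<longrightarrow> s\<^sup>2 \<le> X \<longrightarrow> 16 \<le> X \<longrightarrow> m \<le> X \<longrightarrow>
     real (card {r\<in>{1..X div s}. prime (2 * s * r + 1) \<and> prime (g * r + 1) \<and> prime (h * r + 1)}) \<le>
       C * (real X * (1 / real s)) * ln (9 * ln (real X)) ^ 3 / ln (real X) ^ 3"
proof -
  obtain C where C: "C > 0" and bound: "\<forall>F D B. finite F \<longrightarrow> card F = 3 \<longrightarrow> D \<ge> 1 \<longrightarrow> B \<ge> 2 \<longrightarrow>
     (\<forall>(c,d)\<in>F. c \<ge> 1 \<and> c dvd D) \<longrightarrow>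
     (\<forall>(c,d)\<in>F. \<forall>(c',d')\<in>F. (c,d) \<noteq> (c',d') \<longrightarrow> (int c * int d' - int c' * int d) dvd int D) \<longrightarrow>
     real (card {b\<in>{1..B}. \<forall>(c,d)\<in>F. prime (c * b + d)}) \<le>
       C * real B / ln (real B) ^ 3 * exp (real 3 * (\<Sum>p\<in>prime_factors D. 1 / real p))"
    using linear_forms_prime_count[of 3] by (elim exE conjE)
  obtain C1 where C1: "C1 > 0" "\<forall>D x. 1 \<le> D \<longrightarrow> real D \<le> x \<longrightarrow> 16 \<le> x \<longrightarrow>
      exp (\<Sum>p\<in>prime_factors D. 1 / real p) \<le> C1 * ln (ln x)"
    using sum_recip_prime_factors_bound by blast
  show ?thesis
  proof (intro exI[of _ "27 * C * C1 ^ 3"] conjI allI impI)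
    fix g h s X :: nat
    assume gh: "g dvd m" "h dvd m" "g \<noteq> h" and s: "1 \<le> s" "m < 2 * s" "s\<^sup>2 \<le> X" and X: "16 \<le> X" "m \<le> X"
    have g: "1 \<le> g" "g \<le> m" and h: "1 \<le> h" "h \<le> m"
      using gh m by (auto intro: Suc_leI Nat.gr0I dvd_imp_le)
    define nd where "nd a b = nat \<bar>int a - int b\<bar>" for a b :: nat
    \<comment> \<open>the product of all leading coefficients and resultants of the three forms\<close>
    define D where "D = 2 * s * g * h * nd g h * nd (2 * s) g * nd (2 * s) h"
    define B where "B = X div s"
    have nd_pos: "nd g h \<ge> 1" "nd (2 * s) g \<ge> 1" "nd (2 * s) h \<ge> 1"
      using gh g h s unfolding nd_def by auto
    have D1: "D \<ge> 1" unfolding D_def using nd_pos g h s by (simp add: Suc_le_eq)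
    have sX: "s \<le> X" using s(1,3) self_le_power[of s 2] by simp
    have X2: "2 * X \<le> X ^ 2" using X by (simp add: power2_eq_square)
    have DX: "D \<le> X ^ 9"
    proof -
      have "2 * s \<le> X ^ 2" using sX X2 by linarith
      moreover have "g \<le> X" "h \<le> X" using g h X by auto
      moreover have "nd g h \<le> X" unfolding nd_def using \<open>g \<le> X\<close> \<open>h \<le> X\<close> by auto
      moreover have "nd (2 * s) g \<le> X ^ 2" "nd (2 * s) h \<le> X ^ 2"
        unfolding nd_def using g h s \<open>2 * s \<le> X ^ 2\<close> by auto
      ultimately have "D \<le> X ^ 2 * X * X * X * X ^ 2 * X ^ 2" unfolding D_def by (intro mult_le_mono)
      also have "\<dots> = X ^ 9" by (simp add: eval_nat_numeral)
      finally show ?thesis .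
    qed
    have lX: "ln (real X) > 0" using X by simp
    have E: "exp (real 3 * (\<Sum>p\<in>prime_factors D. 1 / real p)) \<le> C1 ^ 3 * ln (9 * ln (real X)) ^ 3"
    proof -
      have "16 \<le> X ^ 9" using X(1) self_le_power[of X 9] by simp
      hence "(16::real) \<le> real (X ^ 9)" by (metis of_nat_le_iff of_nat_numeral)
      moreover have "real D \<le> real (X ^ 9)" using DX by (simp only: of_nat_le_iff)
      ultimately have "exp (\<Sum>p\<in>prime_factors D. 1 / real p) \<le> C1 * ln (ln (real (X ^ 9)))" using C1(2) D1 by blast
      also have "ln (real (X ^ 9)) = 9 * ln (real X)" using X by (simp add: ln_realpow)
      finally have "exp (\<Sum>p\<in>prime_factors D. 1 / real p) ^ 3 \<le> (C1 * ln (9 * ln (real X))) ^ 3"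
        by (intro power_mono) auto
      thus ?thesis by (simp add: power_mult_distrib flip: exp_of_nat_mult)
    qed
    have B: "2 \<le> B" "X \<le> B ^ 3"
    proof -
      have Bs: "X < s * (B + 1)" unfolding B_def using s by (metis Suc_eq_plus1 dividend_less_times_div mult_Suc_right less_le_trans zero_less_one)
      have "s * s < s * (B + 1)" using Bs s(3) by (simp add: power2_eq_square)
      hence "s < B + 1" by (simp only: mult_less_cancel1)
      hence sB: "s \<le> B" by simp
      show "2 \<le> B"
      proof (rule ccontr)
        assume "\<not> 2 \<le> B"
        hence "s * (B + 1) \<le> 1 * 2" using sB by (intro mult_le_mono) auto
        thus False using Bs X by simp
      qed
      hence "s * (B + 1) \<le> B * (B * B)" using sB
        by (intro mult_le_mono) (auto intro: le_trans[of _ "2 * B"])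
      thus "X \<le> B ^ 3" using Bs by (simp add: power3_eq_cube)
    qed
    have "ln (real X) \<le> ln (real (B ^ 3))" using X B by (subst ln_le_cancel_iff) (auto simp flip: of_nat_power)
    hence lB: "ln (real X) / 3 \<le> ln (real B)" using B by (simp add: ln_realpow)
    have dv: "(int g - int h) dvd int D" "(int h - int g) dvd int D" "(int (2 * s) - int g) dvd int D" "(int g - int (2 * s)) dvd int D"
       "(int (2 * s) - int h) dvd int D" "(int h - int (2 * s)) dvd int D"
      by (rule diff_dvd_of_nat_abs_dvd, simp add: D_def nd_def abs_minus_commute)+
    have "real (card {b\<in>{1..B}. \<forall>(c,d)\<in>{(2 * s,1),(g,1),(h,1)}. prime (c * b + d)}) \<le>
       C * real B / ln (real B) ^ 3 * exp (real 3 * (\<Sum>p\<in>prime_factors D. 1 / real p))"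
    proof (rule bound[THEN spec, THEN spec, THEN spec, THEN mp, THEN mp, THEN mp, THEN mp, THEN mp, THEN mp])
      show "card {(2 * s,1::nat),(g,1),(h,1)} = 3" using gh g h s by auto
      show "\<forall>(c,d)\<in>{(2 * s,1),(g,1),(h,1)}. 1 \<le> c \<and> c dvd D" using g h s by (auto simp: D_def)
      show "\<forall>(c,d)\<in>{(2 * s,1),(g,1),(h,1)}. \<forall>(c',d')\<in>{(2 * s,1),(g,1),(h,1)}.
          (c,d) \<noteq> (c',d') \<longrightarrow> (int c * int d' - int c' * int d) dvd int D" using dv by auto
    qed (use D1 B in auto)
    also have "\<dots> \<le> C * (real B / ln (real B) ^ 3) * (C1 ^ 3 * ln (9 * ln (real X)) ^ 3)"
      using mult_left_mono[OF E, of "C * (real B / ln (real B) ^ 3)"] C B by simp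
    also have "\<dots> \<le> C * ((real X * (1 / real s)) / (ln (real X) / 3) ^ 3) * (C1 ^ 3 * ln (9 * ln (real X)) ^ 3)"
    proof (intro mult_right_mono mult_left_mono frac_le power_mono)
      show "real B \<le> real X * (1 / real s)" unfolding B_def using real_div_le[of X s] by simp
      have "9 * ln (real X) \<ge> 1"
      proof -
        have "ln (real X) \<ge> ln 2" using X by simp
        thus ?thesis using ln2_ge_two_thirds by linarith
      qed
      thus "0 \<le> C1 ^ 3 * ln (9 * ln (real X)) ^ 3" using C1 by simp
    qed (use lB lX C in auto)
    also have "\<dots> = 27 * C * C1 ^ 3 * (real X * (1 / real s)) * ln (9 * ln (real X)) ^ 3 / ln (real X) ^ 3"
      by (simp add: power_divide)
    finally show "real (card {r\<in>{1..X div s}. prime (2 * s * r + 1) \<and> prime (g * r + 1) \<and> prime (h * r + 1)}) \<le>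
       27 * C * C1 ^ 3 * (real X * (1 / real s)) * ln (9 * ln (real X)) ^ 3 / ln (real X) ^ 3"
      by (simp add: B_def)
  qed (use C C1 in auto)
qed

text \<open>Since \<open>exp (1 / p) \<le> 1 / (1 - 1 / p)\<close>.\<close>
lemma euler_weight_le_totient:
  assumes "W > 0" shows "euler_weight W * real (totient W) \<le> real W"
proof -
  have "euler_weight W * (\<Prod>p\<in>prime_factors W. 1 - 1 / real p) = (\<Prod>p\<in>prime_factors W. exp (1 / real p) * (1 - 1 / real p))"
    by (simp add: euler_weight_def exp_sum prod.distrib)
  also have "\<dots> \<le> 1"
  proof (rule prod_le_1)
    fix p assume "p \<in> prime_factors W"
    hence "real p \<ge> 2" using prime_ge_2_nat[of p] by auto
    hence 0: "1 - 1 / real p \<ge> 0" by simp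
    have "1 - 1 / real p \<le> exp (- (1 / real p))" using exp_ge_add_one_self[of "- (1 / real p)"] by simp
    hence "exp (1 / real p) * (1 - 1 / real p) \<le> exp (1 / real p) * exp (- (1 / real p))" by (intro mult_left_mono) auto
    thus "0 \<le> exp (1 / real p) * (1 - 1 / real p) \<and> exp (1 / real p) * (1 - 1 / real p) \<le> 1"
      using 0 by (simp add: exp_minus)
  qed
  finally have "real W * (euler_weight W * (\<Prod>p\<in>prime_factors W. 1 - 1 / real p)) \<le> real W * 1"
    by (intro mult_left_mono) auto
  thus ?thesis using totient_formula2[of W] by (simp add: mult_ac)
qed

lemma harmonic_le: "n \<ge> 1 \<Longrightarrow> (\<Sum>s\<in>{1..n}. 1 / real s) \<le> 1 + ln (real n)"
proof (induction n rule: dec_induct)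
  case (step n)
  have "ln (real n / real (Suc n)) \<le> real n / real (Suc n) - 1" using step by (intro ln_le_minus_one) auto
  moreover have "ln (real n / real (Suc n)) = ln (real n) - ln (real (Suc n))" using step by (intro ln_divide_pos) auto
  moreover have "real n / real (Suc n) - 1 = - (1 / real (Suc n))" by (simp add: field_simps)
  ultimately show ?case using step by simp
qed simp

subsection \<open>A modulus forcing p - 1 to be twice a number without small prime factors\<close>

text \<open>The factor \<open>4\<close> rather than \<open>2\<close> ensures that \<open>p = -1\<close> modulo this number makes \<open>(p - 1) / 2\<close> odd.\<close>
definition rough_modulus :: "nat \<Rightarrow> nat" where
  "rough_modulus z = 4 * \<Prod>{q. prime q \<and> q \<le> z \<and> odd q}"

lemma finite_odd_primes: "finite {q::nat. prime q \<and> q \<le> z \<and> odd q}"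
  by (rule finite_subset[OF _ finite_primes_le[of z]]) auto

lemma rough_modulus_gt_1: "rough_modulus z > 1"
proof -
  have "\<Prod>{q. prime q \<and> q \<le> z \<and> odd q} > (0::nat)" by (intro prod_pos) (auto simp: prime_gt_0_nat)
  thus ?thesis unfolding rough_modulus_def by linarith
qed

lemma prime_dvd_rough_modulus:
  assumes "prime q" "z \<ge> 2" shows "q dvd rough_modulus z \<longleftrightarrow> q \<le> z"
proof
  assume "q \<le> z"
  show "q dvd rough_modulus z"
  proof (cases "odd q")
    case True
    hence "q dvd \<Prod>{q. prime q \<and> q \<le> z \<and> odd q}" using assms \<open>q \<le> z\<close> finite_odd_primes by (intro dvd_prodI[where f = "\<lambda>x. x", simplified]) auto
    thus ?thesis unfolding rough_modulus_def by simp
  next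
    case False
    hence "q = 2" using assms prime_odd_nat[of q] prime_ge_2_nat[of q] by (cases "q = 2") auto
    thus ?thesis unfolding rough_modulus_def by simp
  qed
next
  assume "q dvd rough_modulus z"
  hence "q dvd 4 \<or> q dvd \<Prod>{q. prime q \<and> q \<le> z \<and> odd q}"
    unfolding rough_modulus_def using assms prime_dvd_mult_iff by blast
  thus "q \<le> z"
  proof
    assume "q dvd 4"
    hence "q dvd 2 ^ 2" by simp
    hence "q dvd 2" using assms prime_dvd_power by blast
    thus ?thesis using assms by (auto dest: dvd_imp_le)
  next
    assume "q dvd \<Prod>{q. prime q \<and> q \<le> z \<and> odd q}"
    then obtain l where l: "l \<in> {q. prime q \<and> q \<le> z \<and> odd q}" "q dvd l"
      using prime_dvd_prod_iff[OF finite_odd_primes, of q "\<lambda>x. x"] assms by auto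
    thus ?thesis using assms primes_dvd_imp_eq[of q l] by auto
  qed
qed

text \<open>A unit that is \<open>1\<close> modulo \<open>4\<close> and modulo all the odd primes is \<open>1\<close> modulo their product, so one of
  these moduli separates. All of them have primitive roots.\<close>
lemma rough_modulus_separate: "dchars_separate (rough_modulus z)"
  unfolding dchars_separate_def
proof (intro allI impI)
  fix n assume n: "coprime n (rough_modulus z)" "\<not> [n = 1] (mod rough_modulus z)"
  have W0: "rough_modulus z > 0" using rough_modulus_gt_1[of z] by simp
  show "\<exists>\<xi>\<in>dchars (rough_modulus z). \<xi> n \<noteq> 1"
  proof (cases "[n = 1] (mod 4)")
    case False
    obtain g where "residue_primroot 4 g" using residue_primroot_iff_in_cyclic_moduli[of 4] by (auto simp: cyclic_moduli_def)
    thus ?thesis using dchar_separating_primroot[OF W0 n(1) _ _ False] by (simp add: rough_modulus_def)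
  next
    case True
    have "[n = 1] (mod 4 * \<Prod>S)" if "finite S" "\<And>q. q \<in> S \<Longrightarrow> prime q \<and> odd q \<and> [n = 1] (mod q)" for S
      using that
    proof (induction S rule: finite_induct)
      case empty thus ?case using True by simp
    next
      case (insert q S)
      have q: "prime q" "odd q" using insert.prems by auto
      have "coprime q 4"
      proof -
        have "coprime q (2 ^ 2)" using q by (simp only: coprime_power_right_iff coprime_right_2_iff_odd simp_thms)
        thus ?thesis by simp
      qed
      moreover have "coprime q (\<Prod>S)"
      proof (rule prod_coprime_right)
        fix l assume "l \<in> S"
        thus "coprime q l" using insert.hyps insert.prems[of l] q primes_coprime[of q l] by auto
      qed
      ultimately have "coprime q (4 * \<Prod>S)" by simp
      moreover have "[n = 1] (mod q)" using insert.prems by simp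
      moreover have "[n = 1] (mod 4 * \<Prod>S)" using insert.IH insert.prems by simp
      ultimately have "[n = 1] (mod q * (4 * \<Prod>S))" using coprime_cong_mult_nat by blast
      thus ?case using insert.hyps by (simp add: mult_ac)
    qed
    from this[OF finite_odd_primes[of z]] n(2) obtain q where q: "prime q" "q \<le> z" "odd q" "\<not> [n = 1] (mod q)"
      unfolding rough_modulus_def by blast
    have "q ^ 1 \<in> cyclic_moduli" unfolding cyclic_moduli_def using q by blast
    then obtain g where g: "residue_primroot q g" using residue_primroot_iff_in_cyclic_moduli[of q] by auto
    have "q dvd \<Prod>{q. prime q \<and> q \<le> z \<and> odd q}" using q finite_odd_primes by (intro dvd_prodI[where f = "\<lambda>x. x", simplified]) auto
    hence "q dvd rough_modulus z" unfolding rough_modulus_def by simp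
    thus ?thesis using dchar_separating_primroot[OF W0 n(1) _ g q(4)] by blast
  qed
qed

text \<open>A small odd prime divides \<open>p + 1\<close> and hence not \<open>p - 1\<close>, and \<open>4\<close> divides \<open>p + 1\<close>. So \<open>(p - 1) / 2\<close>
  has only prime factors above \<open>z \<ge> m\<close>, and the greatest common divisor with the even number \<open>m\<close> is \<open>2\<close>.\<close>
lemma rough_shifted_prime:
  assumes z: "z \<ge> m" "z \<ge> 2" and m: "m > 0" "even m" and p: "prime p" "p > 2" "[p = rough_modulus z - 1] (mod rough_modulus z)"
  shows "\<exists>b. p - 1 = 2 * b \<and> b > 0 \<and> (p - 1) div gcd (p - 1) m = b \<and> (\<forall>q. prime q \<longrightarrow> q dvd b \<longrightarrow> z < q)"
proof -
  let ?W = "rough_modulus z"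
  have "[p + 1 = ?W - 1 + 1] (mod ?W)" using p(3) by (intro cong_add) auto
  also have "?W - 1 + 1 = ?W" using rough_modulus_gt_1[of z] by simp
  finally have Wp: "?W dvd p + 1" by (simp add: Cong.cong_def dvd_eq_mod_eq_0)
  have "4 dvd ?W" unfolding rough_modulus_def by simp
  hence 4: "4 dvd p + 1" using Wp dvd_trans by blast
  have "odd p" using p prime_odd_nat by auto
  then obtain b where b: "p - 1 = 2 * b" by (auto elim!: oddE)
  have b0: "b > 0" using b p by (auto intro: Nat.gr0I)
  have pb: "p + 1 = 2 * b + 2" using b p by simp
  have rough: "z < q" if q: "prime q" "q dvd b" for q
  proof (rule ccontr)
    assume "\<not> z < q"
    hence "q dvd ?W" using prime_dvd_rough_modulus[OF q(1) z(2)] by simp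
    hence "q dvd 2 * b + 2" using Wp pb dvd_trans by metis
    moreover have "q dvd 2 * b" using q(2) by simp
    ultimately have "q dvd 2" using dvd_add_right_iff by blast
    hence "q = 2" using q(1) primes_dvd_imp_eq[of q 2] by simp
    hence "4 dvd 2 * b" using q(2) by (auto elim!: dvdE)
    moreover have "4 dvd 2 * b + 2" using 4 pb by simp
    ultimately have "4 dvd (2::nat)" using dvd_add_right_iff by blast
    thus False by simp
  qed
  have "gcd (p - 1) m = 2"
  proof -
    obtain k where k: "m = 2 * k" using m(2) by (auto elim: evenE)
    have "coprime b k"
    proof (rule ccontr)
      assume "\<not> coprime b k"
      hence "gcd b k \<noteq> 1" by (simp only: coprime_iff_gcd_eq_1 not_False_eq_True)
      then obtain q where q: "prime q" "q dvd gcd b k" using prime_factor_nat by blast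
      hence "q dvd b" "q dvd m" using k by auto
      hence "z < q" "q \<le> m" using rough[OF q(1)] m(1) dvd_imp_le by auto
      thus False using z(1) by simp
    qed
    thus ?thesis unfolding b k by (simp add: gcd_mult_distrib_nat[symmetric])
  qed
  hence "(p - 1) div gcd (p - 1) m = b" using b by simp
  thus ?thesis using b b0 rough by blast
qed

lemma rough_number_gt:
  fixes n z :: nat
  assumes "n \<ge> 2" "\<And>q. prime q \<Longrightarrow> q dvd n \<Longrightarrow> z < q" shows "z < n"
proof -
  obtain q where "prime q" "q dvd n" using prime_factor_nat[of n] assms(1) by auto
  hence "z < q" "q \<le> n" using assms dvd_imp_le[of q n] by simp_all
  thus ?thesis by linarith
qed

text \<open>Suppose that every \<open>p\<close> fails and take the primes \<open>p = -1\<close> modulo \<open>W = rough_modulus z\<close> in a block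
  \<open>(X, 2 * X]\<close>, where \<open>p - 1 = 2 * r * s\<close> with a double jump \<open>r\<close>, all prime factors of \<open>r\<close> and \<open>s\<close> being
  larger than \<open>z\<close>. If \<open>r \<le> sqrt X\<close>, Brun--Titchmarsh bounds the number of such \<open>p\<close>, and the sum over
  \<open>r\<close> is small by the choice of \<open>z\<close>: at most half of the primes provided by Dirichlet. If \<open>s = 1\<close>, the
  sparsity of double jumps suffices. Otherwise \<open>1 < s \<le> sqrt X\<close> and three linear forms in \<open>r\<close> are
  simultaneously prime; one logarithm is lost in the sum over \<open>s\<close>, but three are saved.\<close>
lemma exists_prime_without_double_jump:
  assumes m: "m > 0" "even m"
  shows "\<exists>p. prime p \<and> \<not> (p - 1) dvd m \<and> (\<forall>r\<in>double_jumps m. \<not> r dvd (p - 1) div gcd (p - 1) m)"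
proof (rule ccontr)
  assume neg: "\<not> ?thesis"
  obtain C1 where C1: "C1 > 0" "\<And>q c X. q \<ge> 1 \<Longrightarrow> q ^ 4 \<le> X ^ 3 \<Longrightarrow> X \<ge> 2 \<Longrightarrow>
     real (card {p. prime p \<and> X < p \<and> p \<le> 2 * X \<and> [p = c] (mod q)}) \<le> C1 * (real X / (real q * ln (real X))) * euler_weight q"
    using brun_titchmarsh_dyadic by blast
  obtain C3 where C3: "C3 > 0" "\<And>g h s X. g dvd m \<Longrightarrow> h dvd m \<Longrightarrow> g \<noteq> h \<Longrightarrow> 1 \<le> s \<Longrightarrow> m < 2 * s \<Longrightarrow> s\<^sup>2 \<le> X \<Longrightarrow> 16 \<le> X \<Longrightarrow> m \<le> X \<Longrightarrow>
     real (card {r\<in>{1..X div s}. prime (2 * s * r + 1) \<and> prime (g * r + 1) \<and> prime (h * r + 1)}) \<le>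
       C3 * (real X * (1 / real s)) * ln (9 * ln (real X)) ^ 3 / ln (real X) ^ 3"
    using triple_forms_count[OF m(1)] by blast
  obtain K where K: "K \<ge> 0" "\<And>B. B \<ge> 2 \<Longrightarrow> real (card {r\<in>double_jumps m. r \<le> B}) \<le> K * real B / ln (real B) ^ 2"
    using double_jumps_sparse[OF m(1)] by blast
  have "1 / (8 * C1) > 0" using C1(1) by simp
  from double_jumps_weight_small[OF m(1) this] obtain z0 where z0_all: "\<forall>z\<ge>z0. \<forall>F. finite F \<longrightarrow> F \<subseteq> double_jumps m \<longrightarrow> (\<forall>r\<in>F. z < r) \<longrightarrow> (\<Sum>r\<in>F. euler_weight r / real r) \<le> 1 / (8 * C1)"
    by (rule exE)
  note z0 = z0_all[THEN spec, THEN mp, THEN spec, THEN mp, THEN mp, THEN mp]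
  define z where "z = max z0 (max m 2)"
  have z: "z \<ge> z0" "z \<ge> m" "z \<ge> 2" by (auto simp: z_def)
  define W where "W = rough_modulus z"
  have W1: "W > 1" unfolding W_def by (rule rough_modulus_gt_1)
  define t where "t = real (totient W)"
  have t0: "t > 0" using W1 by (simp add: t_def)
  define dm where "dm = {d. d dvd m}"
  have findm: "finite dm" using m by (simp add: dm_def)
  define M where "M = real (card (dm \<times> dm))"
  have "((\<lambda>x::real. K / ln x + 2 * M * C3 * ln (9 * ln x) ^ 3 / ln x) \<longlongrightarrow> 0) at_top" by real_asymp
  hence "eventually (\<lambda>x::real. K / ln x + 2 * M * C3 * ln (9 * ln x) ^ 3 / ln x < 1 / (8 * t)) at_top"
    using t0 by (intro order_tendstoD(2)) auto
  then obtain u where u: "\<And>x. x \<ge> u \<Longrightarrow> K / ln x + 2 * M * C3 * ln (9 * ln x) ^ 3 / ln x < 1 / (8 * t)"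
    unfolding eventually_at_top_linorder by blast
  define X0 where "X0 = max (max 16 (m + 1)) (max (W ^ 4) (nat \<lceil>u\<rceil>))"
  have "coprime (W - 1) W" using W1 by (intro coprime_diff_one_left_nat) auto
  from dirichlet_dyadic[OF W1 _ this, of X0]
  obtain X where X: "X \<ge> X0" and dens: "real X / (4 * t * ln (real X)) \<le> real (card {p. prime p \<and> X < p \<and> p \<le> 2 * X \<and> [p = W - 1] (mod W)})"
    using rough_modulus_separate unfolding W_def t_def by blast
  have X16: "X \<ge> 16" "X > m" "W ^ 4 \<le> X" "real X \<ge> u" using X by (auto simp: X0_def)
  have lX: "ln (real X) > 0" using X16 by simp
  let ?P = "{p. prime p \<and> X < p \<and> p \<le> 2 * X \<and> [p = W - 1] (mod W)}"
  define RI where "RI = {r\<in>double_jumps m. r\<^sup>2 \<le> X \<and> z < r \<and> coprime r W}"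
  define A1 where "A1 r = {p\<in>?P. r dvd p - 1}" for r
  define A2 where "A2 = (\<lambda>r. 2 * r + 1) ` {r\<in>double_jumps m. r \<le> X}"
  define SS where "SS = {s\<in>{1..X}. s\<^sup>2 \<le> X \<and> m < 2 * s}"
  define T where "T g h s = {r\<in>{1..X div s}. prime (2 * s * r + 1) \<and> prime (g * r + 1) \<and> prime (h * r + 1)}" for g h s
  define A3 where "A3 = (\<Union>(g,h)\<in>{(g,h)\<in>dm \<times> dm. g \<noteq> h}. \<Union>s\<in>SS. (\<lambda>r. 2 * s * r + 1) ` T g h s)"
  have finP: "finite ?P" by (rule finite_subset[OF _ finite_primes_le[of "2 * X"]]) auto
  have finRI: "finite RI"
  proof (rule finite_subset[of _ "{..X}"])
    show "RI \<subseteq> {..X}"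
    proof
      fix r assume "r \<in> RI"
      hence "r\<^sup>2 \<le> X" "r > 0" by (auto simp: RI_def)
      thus "r \<in> {..X}" using self_le_power[of r 2] by simp
    qed
  qed simp
  have finT: "finite (T g h s)" for g h s unfolding T_def by simp
  have finSS: "finite SS" unfolding SS_def by simp
  have finA2: "finite {r\<in>double_jumps m. r \<le> X}" by (rule finite_subset[of _ "{..X}"]) auto
  have finpairs: "finite {(g,h)\<in>dm \<times> dm. g \<noteq> h}" using findm by (auto intro: finite_subset[of _ "dm \<times> dm"])
  have cover: "?P \<subseteq> (\<Union>r\<in>RI. A1 r) \<union> A2 \<union> A3"
  proof
    fix p assume p: "p \<in> ?P"
    have p2: "p > 2" using p X16 by auto
    obtain b where b: "p - 1 = 2 * b" "b > 0" "(p - 1) div gcd (p - 1) m = b" and rough: "\<And>q. prime q \<Longrightarrow> q dvd b \<Longrightarrow> z < q"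
      using rough_shifted_prime[OF z(2,3) m, of p] p p2 unfolding W_def by auto
    have "\<not> p - 1 dvd m"
    proof
      assume "p - 1 dvd m"
      hence "p - 1 \<le> m" using m(1) by (rule dvd_imp_le)
      thus False using p X16 by auto
    qed
    then obtain r where r: "r \<in> double_jumps m" "r dvd b" using neg p b by auto
    then obtain s where s: "b = r * s" by auto
    have r2: "r \<ge> 2" using r by (simp add: double_jumps_def)
    have s1: "s \<ge> 1" using s b by (auto intro: Suc_leI Nat.gr0I)
    have bX: "b < X" using p b by auto
    have "p = 2 * b + 1" using b(1) p2 by linarith
    hence peq: "p = 2 * s * r + 1" by (simp add: s mult_ac)
    show "p \<in> (\<Union>r\<in>RI. A1 r) \<union> A2 \<union> A3"
    proof (cases "r\<^sup>2 \<le> X")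
      case True
      have "z < r" using rough_number_gt[OF r2] rough r dvd_trans by blast
      moreover have "coprime r W"
      proof (rule ccontr)
        assume "\<not> coprime r W"
        hence "gcd r W \<noteq> 1" by (simp only: coprime_iff_gcd_eq_1 not_False_eq_True)
        then obtain q where q: "prime q" "q dvd gcd r W" using prime_factor_nat by blast
        hence "q dvd b" "q dvd W" using r dvd_trans[of q r b] by auto
        hence "z < q" "q \<le> z" using rough[OF q(1)] prime_dvd_rough_modulus[OF q(1) z(3)] unfolding W_def by auto
        thus False by simp
      qed
      ultimately have "r \<in> RI" using r True by (simp add: RI_def)
      moreover have "p \<in> A1 r" unfolding A1_def using p b r by auto
      ultimately show ?thesis by blast
    next
      case False
      have rX: "r \<le> X" using mult_le_mono2[OF s1, of r] s bX by linarith
      show ?thesis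
      proof (cases "s = 1")
        case True
        hence "p = 2 * r + 1" using peq by simp
        thus ?thesis unfolding A2_def using r rX by blast
      next
        case s_ne: False
        have "z < s"
        proof (rule rough_number_gt)
          show "2 \<le> s" using s_ne s1 by simp
          show "z < q" if "prime q" "q dvd s" for q
            using rough[OF that(1)] that(2) s by (simp add: dvd_mult)
        qed
        hence ms: "m < 2 * s" using z by simp
        have s2: "s\<^sup>2 \<le> X"
        proof (rule ccontr)
          assume "\<not> s\<^sup>2 \<le> X"
          hence "X * X \<le> r\<^sup>2 * s\<^sup>2" using False by (intro mult_le_mono) auto
          also have "\<dots> = b * b" by (simp add: s power2_eq_square mult_ac)
          also have "\<dots> < X * X" using bX b by (intro mult_strict_mono) auto
          finally show False by simp
        qed
        hence "s \<le> X" using s1 self_le_power[of s 2] by simp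
        hence sSS: "s \<in> SS" using s1 s2 ms by (simp add: SS_def)
        obtain g h where gh: "g dvd m" "h dvd m" "g \<noteq> h" "prime (r * g + 1)" "prime (r * h + 1)"
          using r by (auto simp: double_jumps_def)
        have "r \<le> X div s" using s s1 bX by (simp add: less_eq_div_iff_mult_less_eq)
        hence "r \<in> T g h s" unfolding T_def using gh p peq r2 by (auto simp: mult.commute)
        hence "p \<in> (\<lambda>r. 2 * s * r + 1) ` T g h s" using peq by blast
        moreover have "(g,h) \<in> {(g,h)\<in>dm \<times> dm. g \<noteq> h}" using gh by (simp add: dm_def)
        ultimately have "p \<in> A3" unfolding A3_def using sSS by blast
        thus ?thesis by blast
      qed
    qed
  qed
  have c1: "real (card (\<Union>r\<in>RI. A1 r)) \<le> real X / (8 * t * ln (real X))"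
  proof -
    have "real (card (A1 r)) \<le> C1 * real X / ln (real X) * (euler_weight W / real W) * (euler_weight r / real r)" if r: "r \<in> RI" for r
    proof -
      have rr: "coprime W r" "r \<ge> 1" "r\<^sup>2 \<le> X" using r by (auto simp: RI_def coprime_commute double_jumps_def)
      obtain c where c: "[c = W - 1] (mod W)" "[c = 1] (mod r)" using binary_chinese_remainder_nat[OF rr(1)] by blast
      have "A1 r \<subseteq> {p. prime p \<and> X < p \<and> p \<le> 2 * X \<and> [p = c] (mod W * r)}"
      proof
        fix p assume p: "p \<in> A1 r"
        have p1: "p > 0" "[p = W - 1] (mod W)" "r dvd p - 1" using p by (auto simp: A1_def)
        have "[p = c] (mod W)" using p1(2) c(1) by (metis cong_sym cong_trans)
        moreover have "[p - 1 + 1 = 0 + 1] (mod r)" using p1(3) by (intro cong_add) (auto simp: cong_0_iff)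
        hence "[p = 1] (mod r)" using p1(1) by simp
        hence "[p = c] (mod r)" using c(2) by (metis cong_sym cong_trans)
        ultimately have "[p = c] (mod W * r)" using rr(1) by (intro coprime_cong_mult_nat)
        thus "p \<in> {p. prime p \<and> X < p \<and> p \<le> 2 * X \<and> [p = c] (mod W * r)}" using p by (auto simp: A1_def)
      qed
      hence "card (A1 r) \<le> card {p. prime p \<and> X < p \<and> p \<le> 2 * X \<and> [p = c] (mod W * r)}"
        by (intro card_mono finite_subset[OF _ finite_primes_le[of "2 * X"]]) auto
      hence "real (card (A1 r)) \<le> real (card {p. prime p \<and> X < p \<and> p \<le> 2 * X \<and> [p = c] (mod W * r)})" by simp
      also have "\<dots> \<le> C1 * (real X / (real (W * r) * ln (real X))) * euler_weight (W * r)"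
      proof (rule C1(2))
        show "1 \<le> W * r" using W1 rr by simp
        have "(W * r) ^ 4 = W ^ 4 * (r\<^sup>2)\<^sup>2" by (simp add: power_mult_distrib flip: power_mult)
        also have "\<dots> \<le> X * X\<^sup>2" using X16 rr by (intro mult_le_mono power_mono) auto
        finally show "(W * r) ^ 4 \<le> X ^ 3" by (simp add: power2_eq_square power3_eq_cube)
        show "2 \<le> X" using X16 by simp
      qed
      also have "\<dots> \<le> C1 * (real X / (real (W * r) * ln (real X))) * (euler_weight W * euler_weight r)"
        using C1(1) lX W1 rr by (intro mult_left_mono euler_weight_mult_le) auto
      also have "\<dots> = C1 * real X / ln (real X) * (euler_weight W / real W) * (euler_weight r / real r)"
        by (simp add: mult_ac)
      finally show ?thesis .
    qed
    note A1_le = this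
    have "card (\<Union>r\<in>RI. A1 r) \<le> (\<Sum>r\<in>RI. card (A1 r))" by (rule card_UN_le[OF finRI])
    hence "real (card (\<Union>r\<in>RI. A1 r)) \<le> (\<Sum>r\<in>RI. real (card (A1 r)))" by (simp flip: of_nat_sum)
    also have "\<dots> \<le> (\<Sum>r\<in>RI. C1 * real X / ln (real X) * (euler_weight W / real W) * (euler_weight r / real r))"
      by (intro sum_mono A1_le)
    also have "\<dots> = C1 * real X / ln (real X) * (euler_weight W / real W) * (\<Sum>r\<in>RI. euler_weight r / real r)"
      by (rule sum_distrib_left[symmetric])
    also have "\<dots> \<le> C1 * real X / ln (real X) * (1 / t) * (1 / (8 * C1))"
    proof (intro mult_mono mult_left_mono)
      show "euler_weight W / real W \<le> 1 / t"
        using euler_weight_le_totient[of W] W1 t0 by (simp add: t_def field_simps)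
      show "(\<Sum>r\<in>RI. euler_weight r / real r) \<le> 1 / (8 * C1)"
        using finRI by (intro z0[OF z(1)]) (auto simp: RI_def)
      show "0 \<le> (\<Sum>r\<in>RI. euler_weight r / real r)" using euler_weight_pos by (intro sum_nonneg divide_nonneg_nonneg) (auto intro: less_imp_le)
      show "0 \<le> euler_weight W / real W" using euler_weight_pos[of W] by simp
    qed (use C1(1) lX t0 in auto)
    also have "\<dots> = real X / (8 * t * ln (real X))" using C1(1) by simp
    finally show ?thesis .
  qed
  have c2: "real (card A2) \<le> real X / ln (real X) * (K / ln (real X))"
  proof -
    have "card A2 \<le> card {r\<in>double_jumps m. r \<le> X}" unfolding A2_def by (rule card_image_le[OF finA2])
    hence "real (card A2) \<le> real (card {r\<in>double_jumps m. r \<le> X})" by simp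
    also have "\<dots> \<le> K * real X / ln (real X) ^ 2" using X16 by (intro K(2)) auto
    finally show ?thesis by (simp add: power2_eq_square mult.commute)
  qed
  have c3: "real (card A3) \<le> real X / ln (real X) * (2 * M * C3 * ln (9 * ln (real X)) ^ 3 / ln (real X))"
  proof -
    define L where "L = C3 * real X * ln (9 * ln (real X)) ^ 3 / ln (real X) ^ 3"
    have "9 * ln (real X) \<ge> 1"
    proof -
      have "ln (real X) \<ge> ln 2" using X16 by simp
      thus ?thesis using ln2_ge_two_thirds by linarith
    qed
    hence L0: "L \<ge> 0" unfolding L_def using C3(1) lX by simp
    have inner: "real (card (\<Union>s\<in>SS. (\<lambda>r. 2 * s * r + 1) ` T g h s)) \<le> L * (2 * ln (real X))" if gh: "(g,h) \<in> {(g,h)\<in>dm \<times> dm. g \<noteq> h}" for g h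
    proof -
      have "card (\<Union>s\<in>SS. (\<lambda>r. 2 * s * r + 1) ` T g h s) \<le> (\<Sum>s\<in>SS. card ((\<lambda>r. 2 * s * r + 1) ` T g h s))"
        by (rule card_UN_le[OF finSS])
      also have "\<dots> \<le> (\<Sum>s\<in>SS. card (T g h s))" by (intro sum_mono card_image_le finT)
      finally have "real (card (\<Union>s\<in>SS. (\<lambda>r. 2 * s * r + 1) ` T g h s)) \<le> (\<Sum>s\<in>SS. real (card (T g h s)))" by (simp flip: of_nat_sum)
      also have "\<dots> \<le> (\<Sum>s\<in>SS. L * (1 / real s))"
      proof (rule sum_mono)
        fix s assume "s \<in> SS"
        hence "real (card (T g h s)) \<le> C3 * (real X * (1 / real s)) * ln (9 * ln (real X)) ^ 3 / ln (real X) ^ 3"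
          unfolding T_def using gh X16 by (intro C3(2)) (auto simp: SS_def dm_def)
        thus "real (card (T g h s)) \<le> L * (1 / real s)" by (simp add: L_def mult_ac)
      qed
      also have "\<dots> = L * (\<Sum>s\<in>SS. 1 / real s)" by (rule sum_distrib_left[symmetric])
      also have "\<dots> \<le> L * (2 * ln (real X))"
      proof (intro mult_left_mono L0)
        have "(\<Sum>s\<in>SS. 1 / real s) \<le> (\<Sum>s\<in>{1..X}. 1 / real s)" by (intro sum_mono2) (auto simp: SS_def)
        also have "\<dots> \<le> 1 + ln (real X)" using X16 by (intro harmonic_le) auto
        also have "1 \<le> ln (real X)" using X16 exp_le by (subst ln_ge_iff) auto
        finally show "(\<Sum>s\<in>SS. 1 / real s) \<le> 2 * ln (real X)" by simp
      qed
      finally show ?thesis .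
    qed
    have "A3 = (\<Union>i\<in>{(g,h)\<in>dm \<times> dm. g \<noteq> h}. \<Union>s\<in>SS. (\<lambda>r. 2 * s * r + 1) ` T (fst i) (snd i) s)"
      unfolding A3_def by (simp only: case_prod_unfold)
    hence "card A3 \<le> (\<Sum>i\<in>{(g,h)\<in>dm \<times> dm. g \<noteq> h}. card (\<Union>s\<in>SS. (\<lambda>r. 2 * s * r + 1) ` T (fst i) (snd i) s))"
      using card_UN_le[OF finpairs] by simp
    hence "real (card A3) \<le> (\<Sum>i\<in>{(g,h)\<in>dm \<times> dm. g \<noteq> h}. real (card (\<Union>s\<in>SS. (\<lambda>r. 2 * s * r + 1) ` T (fst i) (snd i) s)))"
      by (simp flip: of_nat_sum)
    also have "\<dots> \<le> (\<Sum>i\<in>{(g,h)\<in>dm \<times> dm. g \<noteq> h}. L * (2 * ln (real X)))"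
      by (intro sum_mono inner) auto
    also have "\<dots> = real (card {(g,h)\<in>dm \<times> dm. g \<noteq> h}) * (L * (2 * ln (real X)))" by simp
    also have "\<dots> \<le> M * (L * (2 * ln (real X)))"
    proof (intro mult_right_mono)
      have "card {(g,h)\<in>dm \<times> dm. g \<noteq> h} \<le> card (dm \<times> dm)" using findm by (intro card_mono) auto
      thus "real (card {(g,h)\<in>dm \<times> dm. g \<noteq> h}) \<le> M" unfolding M_def by simp
    qed (use L0 lX in auto)
    also have "\<dots> = real X / ln (real X) * (2 * M * C3 * ln (9 * ln (real X)) ^ 3 / ln (real X))"
      using lX by (simp add: L_def power3_eq_cube)
    finally show ?thesis .
  qed
  have fin3: "finite A3" unfolding A3_def using finpairs finSS finT by auto
  have fin1: "finite (\<Union>r\<in>RI. A1 r)" using finRI finP by (auto simp: A1_def)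
  have "card ?P \<le> card ((\<Union>r\<in>RI. A1 r) \<union> A2 \<union> A3)"
    by (intro card_mono cover) (use fin1 fin3 finA2 in \<open>auto simp: A2_def\<close>)
  also have "\<dots> \<le> card (\<Union>r\<in>RI. A1 r) + card A2 + card A3"
    by (intro order_trans[OF card_Un_le] add_right_mono card_Un_le)
  finally have "real (card ?P) \<le> real (card (\<Union>r\<in>RI. A1 r)) + real (card A2) + real (card A3)" by simp
  also have "\<dots> \<le> real X / (8 * t * ln (real X)) + real X / ln (real X) * (K / ln (real X) + 2 * M * C3 * ln (9 * ln (real X)) ^ 3 / ln (real X))"
    using c1 c2 c3 unfolding distrib_left by linarith
  also have "\<dots> < real X / (8 * t * ln (real X)) + real X / ln (real X) * (1 / (8 * t))"
    using u[OF X16(4)] X16 lX by (intro add_strict_left_mono mult_strict_left_mono) auto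
  also have "\<dots> = real X / (4 * t * ln (real X))" using t0 lX by (simp add: field_simps)
  finally show False using dens by simp
qed

text \<open>The values \<open>1\<close> and \<open>2\<close> are taken at \<open>1\<close> and \<open>2\<close>. From then on the numbers stay even, and each step
  is a single jump.\<close>
theorem omega_star_attained:
  assumes "k \<ge> 1" shows "\<exists>n>0. omega_star n = k"
proof -
  have even: "\<exists>n>0. even n \<and> omega_star n = j + 2" for j
  proof (induction j)
    case 0
    have "d \<in> {1, 2}" if "d dvd 2" for d :: nat using that two_is_prime_nat prime_nat_iff by blast
    moreover have "prime (1 + 1 :: nat)" by (simp only: one_add_one two_is_prime_nat)
    moreover have "prime (2 + 1 :: nat)" by simp
    moreover have "1 dvd (2::nat)" "2 dvd (2::nat)" by simp_all
    ultimately have "shifted_divisors 2 = {1, 2}" unfolding shifted_divisors_def by blast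
    hence "omega_star 2 = 2" unfolding omega_star_eq by simp
    thus ?case by (intro exI[of _ 2]) auto
  next
    case (Suc j)
    then obtain m where m: "m > 0" "even m" "omega_star m = j + 2" by blast
    obtain p where p: "prime p" "\<not> (p - 1) dvd m" "\<forall>r\<in>double_jumps m. \<not> r dvd (p - 1) div gcd (p - 1) m"
      using exists_prime_without_double_jump[OF m(1,2)] by blast
    obtain r where "r > 0" "omega_star (m * r) = omega_star m + 1"
      using omega_star_single_jump[OF m(1) p(1,2)] p(3) by blast
    thus ?case using m by (intro exI[of _ "m * r"]) auto
  qed
  show ?thesis
  proof (cases "k = 1")
    case True
    have "prime (1 + 1 :: nat)" by (simp only: one_add_one two_is_prime_nat)
    hence "shifted_divisors 1 = {1}" unfolding shifted_divisors_def by auto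
    thus ?thesis using True unfolding omega_star_eq by (intro exI[of _ 1]) auto
  next
    case False
    thus ?thesis using even[of "k - 2"] assms by auto
  qed
qed

section \<open>Natural densities\<close>

definition counting :: "nat set \<Rightarrow> nat \<Rightarrow> nat" where
  "counting A x = card (A \<inter> {1..x})"

lemma counting_le: "counting A x \<le> x"
proof -
  have "counting A x \<le> card {1..x}" unfolding counting_def by (intro card_mono) auto
  thus ?thesis by simp
qed

lemma counting_mono: "A \<inter> {1..x} \<subseteq> B \<Longrightarrow> counting A x \<le> counting B x"
  unfolding counting_def by (intro card_mono) auto

lemma counting_Un: "counting (A \<union> B) x \<le> counting A x + counting B x"
  unfolding counting_def Int_Un_distrib2 by (rule card_Un_le)

text \<open>The limit over real \<open>x\<close> agrees with the limit over integers, as the floor of \<open>x\<close> is asymptotic to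
  \<open>x\<close>.\<close>
lemma has_natural_density_iff:
  "has_natural_density A \<delta> \<longleftrightarrow> (\<lambda>x. real (counting A x) / real x) \<longlonglongrightarrow> \<delta>"
proof
  have eq: "{n\<in>A. 1 \<le> real n \<and> real n \<le> real x} = A \<inter> {1..x}" for x by auto
  {
    assume "has_natural_density A \<delta>"
    hence "((\<lambda>x::real. real (card {n \<in> A. 1 \<le> real n \<and> real n \<le> x}) / x) \<longlongrightarrow> \<delta>) at_top"
      by (simp add: has_natural_density_def)
    from filterlim_compose[OF this filterlim_real_sequentially]
    show "(\<lambda>x. real (counting A x) / real x) \<longlonglongrightarrow> \<delta>" unfolding counting_def eq .
  next
    assume lim: "(\<lambda>x. real (counting A x) / real x) \<longlonglongrightarrow> \<delta>"
    have fl: "filterlim (\<lambda>x::real. nat \<lfloor>x\<rfloor>) sequentially at_top"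
      by (rule filterlim_compose[OF filterlim_nat_sequentially filterlim_floor_sequentially])
    have "((\<lambda>x::real. real (counting A (nat \<lfloor>x\<rfloor>)) / real (nat \<lfloor>x\<rfloor>) * (real (nat \<lfloor>x\<rfloor>) / x)) \<longlongrightarrow> \<delta> * 1) at_top"
    proof (intro tendsto_mult)
      show "((\<lambda>x::real. real (counting A (nat \<lfloor>x\<rfloor>)) / real (nat \<lfloor>x\<rfloor>)) \<longlongrightarrow> \<delta>) at_top"
        by (rule filterlim_compose[OF lim fl])
      show "((\<lambda>x::real. real (nat \<lfloor>x\<rfloor>) / x) \<longlongrightarrow> 1) at_top"
      proof (rule tendsto_sandwich)
        show "((\<lambda>x::real. (x - 1) / x) \<longlongrightarrow> 1) at_top" by real_asymp
        show "((\<lambda>x::real. x / x) \<longlongrightarrow> 1) at_top" by real_asymp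
        show "eventually (\<lambda>x::real. (x - 1) / x \<le> real (nat \<lfloor>x\<rfloor>) / x) at_top"
          using eventually_ge_at_top[of 1] by eventually_elim (intro divide_right_mono; linarith)
        show "eventually (\<lambda>x::real. real (nat \<lfloor>x\<rfloor>) / x \<le> x / x) at_top"
          using eventually_ge_at_top[of 1] by eventually_elim (intro divide_right_mono; linarith)
      qed
    qed
    moreover have "eventually (\<lambda>x::real. real (counting A (nat \<lfloor>x\<rfloor>)) / real (nat \<lfloor>x\<rfloor>) * (real (nat \<lfloor>x\<rfloor>) / x) =
       real (card {n \<in> A. 1 \<le> real n \<and> real n \<le> x}) / x) at_top"
      using eventually_ge_at_top[of 1]
    proof eventually_elim
      case (elim x)
      have "{n \<in> A. 1 \<le> real n \<and> real n \<le> x} = A \<inter> {1..nat \<lfloor>x\<rfloor>}"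
        using elim by (auto simp: le_nat_iff le_floor_iff)
      moreover have "nat \<lfloor>x\<rfloor> > 0" using elim by simp
      ultimately show ?case by (simp add: counting_def)
    qed
    ultimately show "has_natural_density A \<delta>"
      unfolding has_natural_density_def mult_1_right by (rule Lim_transform_eventually)
  }
qed

lemma periodic_density:
  assumes q: "q > 0" and per: "\<And>n. (n + q \<in> A) = (n \<in> A)"
  shows "\<exists>\<delta>. \<forall>x. \<bar>real (counting A x) - \<delta> * real x\<bar> \<le> real q"
proof -
  define c where "c = card (A \<inter> {1..q})"
  have cq: "c \<le> q" using counting_le[of A q] unfolding c_def counting_def .
  have perk: "n + k * q \<in> A \<longleftrightarrow> n \<in> A" for n k
  proof (induction k)
    case (Suc k)
    have "n + Suc k * q = (n + k * q) + q" by simp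
    thus ?case using per Suc by metis
  qed simp
  have step: "counting A (q + y) = c + counting A y" for y
  proof -
    have "A \<inter> {1..q + y} = (A \<inter> {1..q}) \<union> (\<lambda>n. n + q) ` (A \<inter> {1..y})"
    proof (intro equalityI subsetI)
      fix n assume n: "n \<in> A \<inter> {1..q + y}"
      show "n \<in> (A \<inter> {1..q}) \<union> (\<lambda>n. n + q) ` (A \<inter> {1..y})"
      proof (cases "n \<le> q")
        case False
        hence q: "n - q + q = n" "n - q \<in> {1..y}" using n by auto
        hence "n - q \<in> A" using n per[of "n - q"] by simp
        thus ?thesis using q by (intro UnI2 image_eqI[of _ _ "n - q"]) auto
      qed (use n in auto)
    qed (use per in auto)
    hence "counting A (q + y) = card ((A \<inter> {1..q}) \<union> (\<lambda>n. n + q) ` (A \<inter> {1..y}))" by (simp add: counting_def)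
    also have "\<dots> = c + card ((\<lambda>n. n + q) ` (A \<inter> {1..y}))" unfolding c_def by (rule card_Un_disjoint) auto
    also have "card ((\<lambda>n. n + q) ` (A \<inter> {1..y})) = counting A y" unfolding counting_def by (rule card_image) auto
    finally show ?thesis .
  qed
  have count: "counting A (k * q + r) = k * c + counting A r" for k r
  proof (induction k)
    case (Suc k)
    have "Suc k * q + r = q + (k * q + r)" by simp
    thus ?case using step Suc by (simp only:) simp
  qed simp
  show ?thesis
  proof (intro exI[of _ "real c / real q"] allI)
    fix x
    define k where "k = x div q"
    define r where "r = x mod q"
    have x: "x = k * q + r" by (simp add: k_def r_def)
    have r: "r < q" using q by (simp add: r_def)
    have "real (counting A x) - real c / real q * real x = real (counting A r) - real c * real r / real q"
      unfolding x count using q by (simp add: field_simps)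
    moreover have "real (counting A r) \<le> real q" using counting_le[of A r] r by simp
    moreover have "real c * real r / real q \<le> real q"
    proof -
      have "real c * real r \<le> real q * real q" using cq r by (intro mult_mono) auto
      thus ?thesis using q by (simp add: divide_le_eq)
    qed
    moreover have "real c * real r / real q \<ge> 0" by simp
    ultimately show "\<bar>real (counting A x) - real c / real q * real x\<bar> \<le> real q" by linarith
  qed
qed

text \<open>Such counting functions make the density quotients a Cauchy sequence.\<close>
lemma density_by_approximation:
  assumes "\<And>\<epsilon>::real. \<epsilon> > 0 \<Longrightarrow> \<exists>\<delta> K. \<forall>x. \<bar>real (counting A x) - \<delta> * real x\<bar> \<le> \<epsilon> * real x + K"
  shows "\<exists>\<delta>. has_natural_density A \<delta>"
proof -
  define f where "f x = real (counting A x) / real x" for x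
  have "Cauchy f"
  proof (rule metric_CauchyI)
    fix e :: real assume e: "e > 0"
    obtain \<delta> K where K: "\<And>x. \<bar>real (counting A x) - \<delta> * real x\<bar> \<le> e / 4 * real x + K"
      using assms[of "e / 4"] e by auto
    obtain M :: nat where M: "4 * \<bar>K\<bar> / e < real M" using reals_Archimedean2 by blast
    have close: "\<bar>f x - \<delta>\<bar> < e / 2" if "x \<ge> M + 1" for x
    proof -
      have x: "real x > 0" "real x > 4 * \<bar>K\<bar> / e" using that M by auto
      have "f x - \<delta> = (real (counting A x) - \<delta> * real x) / real x" using x by (simp add: f_def field_simps)
      hence "\<bar>f x - \<delta>\<bar> = \<bar>real (counting A x) - \<delta> * real x\<bar> / real x" using x by (simp add: abs_divide)
      also have "\<dots> \<le> (e / 4 * real x + K) / real x" using K[of x] x by (intro divide_right_mono) auto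
      also have "\<dots> = e / 4 + K / real x" using x by (simp add: field_simps)
      also have "K / real x < e / 4"
      proof -
        have "4 * \<bar>K\<bar> < e * real x" using x e by (simp add: divide_less_eq mult.commute)
        hence "4 * K < e * real x" by linarith
        thus ?thesis using x by (simp add: divide_less_eq)
      qed
      finally show ?thesis by simp
    qed
    show "\<exists>M. \<forall>m\<ge>M. \<forall>n\<ge>M. dist (f m) (f n) < e"
    proof (intro exI allI impI)
      fix m n assume "M + 1 \<le> m" "M + 1 \<le> n"
      hence "\<bar>f m - \<delta>\<bar> < e / 2" "\<bar>f n - \<delta>\<bar> < e / 2" using close by auto
      thus "dist (f m) (f n) < e" unfolding dist_real_def by linarith
    qed
  qed
  then obtain \<delta> where "f \<longlonglongrightarrow> \<delta>" using Cauchy_convergent_iff convergentD by blast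
  thus ?thesis unfolding has_natural_density_iff f_def by blast
qed

definition truncated_omega :: "nat \<Rightarrow> nat \<Rightarrow> nat" where
  "truncated_omega Y n = card {d. d dvd n \<and> prime (d + 1) \<and> d \<le> Y}"

definition tail_set :: "nat \<Rightarrow> nat set" where
  "tail_set Y = {n. \<exists>d. d dvd n \<and> prime (d + 1) \<and> Y < d}"

lemma tail_set_small:
  fixes \<epsilon> :: real assumes "\<epsilon> > 0" shows "\<exists>Y. \<forall>x. real (counting (tail_set Y) x) \<le> \<epsilon> * real x"
proof -
  obtain Y where "\<And>x. real (card {n\<in>{1..x}. \<exists>d. d dvd n \<and> prime (d + 1) \<and> Y < d}) \<le> \<epsilon> * real x"
    using shifted_prime_divisor_tail[OF assms] by blast
  moreover have "counting (tail_set Y) x = card {n\<in>{1..x}. \<exists>d. d dvd n \<and> prime (d + 1) \<and> Y < d}" for x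
    unfolding counting_def tail_set_def by (intro arg_cong[where f = card]) auto
  ultimately show ?thesis by metis
qed

lemma truncated_omega_eq:
  assumes "n > 0" "n \<notin> tail_set Y" shows "truncated_omega Y n = omega_star n"
proof -
  have "{d. d dvd n \<and> prime (d + 1) \<and> d \<le> Y} = shifted_divisors n"
    using assms unfolding tail_set_def shifted_divisors_def by (auto simp: not_less)
  thus ?thesis unfolding truncated_omega_def omega_star_eq by simp
qed

lemma truncated_omega_periodic: "truncated_omega Y (n + fact Y) = truncated_omega Y n"
proof -
  have "{d. d dvd n + fact Y \<and> prime (d + 1) \<and> d \<le> Y} = {d. d dvd n \<and> prime (d + 1) \<and> d \<le> Y}"
  proof (intro Collect_cong)
    fix d
    show "(d dvd n + fact Y \<and> prime (d + 1) \<and> d \<le> Y) = (d dvd n \<and> prime (d + 1) \<and> d \<le> Y)"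
    proof (cases "prime (d + 1) \<and> d \<le> Y")
      case True
      hence "d \<ge> 1" by (cases d) auto
      hence "d dvd fact Y" using True dvd_fact by blast
      thus ?thesis using True by (simp add: dvd_add_left_iff)
    qed auto
  qed
  thus ?thesis by (simp add: truncated_omega_def)
qed

text \<open>Up to the tail set, \<open>L_set k\<close> agrees with a periodic set.\<close>
lemma L_set_density_exists: "\<exists>\<delta>. has_natural_density (L_set k) \<delta>"
proof (rule density_by_approximation)
  fix \<epsilon> :: real assume \<epsilon>: "\<epsilon> > 0"
  obtain Y where Y: "\<And>x. real (counting (tail_set Y) x) \<le> \<epsilon> * real x" using tail_set_small[OF \<epsilon>] by blast
  let ?B = "{n. truncated_omega Y n = k}"
  obtain \<delta> where \<delta>: "\<And>x. \<bar>real (counting ?B x) - \<delta> * real x\<bar> \<le> real (fact Y)"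
    using periodic_density[of "fact Y" ?B] truncated_omega_periodic by auto
  have "\<bar>real (counting (L_set k) x) - \<delta> * real x\<bar> \<le> \<epsilon> * real x + real (fact Y)" for x
  proof -
    have "counting (L_set k) x \<le> counting (?B \<union> tail_set Y) x"
      by (rule counting_mono) (use truncated_omega_eq in \<open>force simp: L_set_def\<close>)
    also have "\<dots> \<le> counting ?B x + counting (tail_set Y) x" by (rule counting_Un)
    finally have 1: "real (counting (L_set k) x) \<le> real (counting ?B x) + real (counting (tail_set Y) x)" by simp
    have "counting ?B x \<le> counting (L_set k \<union> tail_set Y) x"
      by (rule counting_mono) (use truncated_omega_eq in \<open>force simp: L_set_def\<close>)
    also have "\<dots> \<le> counting (L_set k) x + counting (tail_set Y) x" by (rule counting_Un)
    finally have 2: "real (counting ?B x) \<le> real (counting (L_set k) x) + real (counting (tail_set Y) x)" by simp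
    show ?thesis using 1 2 \<delta>[of x] Y[of x] by linarith
  qed
  thus "\<exists>\<delta> K. \<forall>x. \<bar>real (counting (L_set k) x) - \<delta> * real x\<bar> \<le> \<epsilon> * real x + K" by blast
qed

section \<open>Positivity of the densities\<close>

definition nonmultiples :: "nat set \<Rightarrow> nat set" where
  "nonmultiples B = {n. \<forall>b\<in>B. \<not> b dvd n}"

text \<open>A nonmultiple of all elements of \<open>B\<close> that is a multiple of \<open>a\<close> has the form \<open>a * m\<close>, where \<open>m\<close> is
  again a nonmultiple of all elements of \<open>B\<close>.\<close>
lemma nonmultiples_insert_bound:
  assumes a: "a > 0"
  shows "counting (nonmultiples B) x \<le> counting (nonmultiples (insert a B)) x + counting (nonmultiples B) (x div a)"
proof -
  have "nonmultiples B \<inter> {1..x} \<subseteq> (nonmultiples (insert a B) \<inter> {1..x}) \<union> (\<lambda>m. a * m) ` (nonmultiples B \<inter> {1..x div a})"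
  proof
    fix n assume n: "n \<in> nonmultiples B \<inter> {1..x}"
    show "n \<in> (nonmultiples (insert a B) \<inter> {1..x}) \<union> (\<lambda>m. a * m) ` (nonmultiples B \<inter> {1..x div a})"
    proof (cases "a dvd n")
      case True
      then obtain m where m: "n = a * m" by auto
      have "m \<in> {1..x div a}" using n m a by (auto simp: less_eq_div_iff_mult_less_eq mult.commute Suc_le_eq)
      moreover have "m \<in> nonmultiples B" using n m by (auto simp: nonmultiples_def)
      ultimately show ?thesis using m by blast
    qed (use n in \<open>auto simp: nonmultiples_def\<close>)
  qed
  hence "counting (nonmultiples B) x \<le> card ((nonmultiples (insert a B) \<inter> {1..x}) \<union> (\<lambda>m. a * m) ` (nonmultiples B \<inter> {1..x div a}))"
    unfolding counting_def by (intro card_mono) auto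
  also have "\<dots> \<le> card (nonmultiples (insert a B) \<inter> {1..x}) + card ((\<lambda>m. a * m) ` (nonmultiples B \<inter> {1..x div a}))"
    by (rule card_Un_le)
  also have "card ((\<lambda>m. a * m) ` (nonmultiples B \<inter> {1..x div a})) \<le> card (nonmultiples B \<inter> {1..x div a})"
    by (rule card_image_le) auto
  finally show ?thesis by (simp add: counting_def)
qed

text \<open>The Heilbronn--Rohrbach inequality for one additional divisor: the density shrinks at most by the
  factor \<open>1 - 1 / a \<ge> 1 / 2\<close>.\<close>
lemma nonmultiples_density_insert:
  assumes a: "a \<ge> 2" and c: "c > 0" and lim: "(\<lambda>x. real (counting (nonmultiples B) x) / real x) \<longlonglongrightarrow> c"
    and ex: "(\<lambda>x. real (counting (nonmultiples (insert a B)) x) / real x) \<longlonglongrightarrow> d"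
  shows "d > 0"
proof -
  have fl: "filterlim (\<lambda>x. x div a) sequentially sequentially"
    using a by (intro filterlim_at_top_div_const_nat) auto
  have "(\<lambda>x. real (counting (nonmultiples (insert a B)) x) / real x + real (counting (nonmultiples B) (x div a)) / real (x div a) * (1 / real a)) \<longlonglongrightarrow> d + c * (1 / real a)"
    by (intro tendsto_intros ex filterlim_compose[OF lim fl])
  moreover have "eventually (\<lambda>x. real (counting (nonmultiples B) x) / real x \<le>
      real (counting (nonmultiples (insert a B)) x) / real x + real (counting (nonmultiples B) (x div a)) / real (x div a) * (1 / real a)) sequentially"
    using eventually_ge_at_top[of a]
  proof eventually_elim
    case (elim x)
    have x: "x > 0" "x div a > 0" using elim a by (auto simp: div_greater_zero_iff)
    have "real (counting (nonmultiples B) x) \<le> real (counting (nonmultiples (insert a B)) x) + real (counting (nonmultiples B) (x div a))"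
      using nonmultiples_insert_bound[of a B x] a by linarith
    hence "real (counting (nonmultiples B) x) / real x \<le> (real (counting (nonmultiples (insert a B)) x) + real (counting (nonmultiples B) (x div a))) / real x"
      by (intro divide_right_mono) auto
    also have "\<dots> = real (counting (nonmultiples (insert a B)) x) / real x + real (counting (nonmultiples B) (x div a)) / real x"
      by (rule add_divide_distrib)
    also have "real (counting (nonmultiples B) (x div a)) / real x \<le> real (counting (nonmultiples B) (x div a)) / (real (x div a) * real a)"
    proof (intro divide_left_mono)
      have "x div a * a \<le> x" by simp
      thus "real (x div a) * real a \<le> real x" by (metis of_nat_le_iff of_nat_mult)
    qed (use x a in auto)
    finally show ?case by (simp add: mult.commute)
  qed
  ultimately have "c \<le> d + c * (1 / real a)" by (rule tendsto_le[OF sequentially_bot _ lim])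
  moreover have "c * (1 / real a) \<le> c * (1 / 2)" using a c by (intro mult_left_mono divide_left_mono) auto
  ultimately show ?thesis using c by linarith
qed

text \<open>The conditions on a cofactor \<open>m\<close> that keep the elements of \<open>S\<close> from dividing \<open>n0 * m\<close>.\<close>
definition reduced_divisors :: "nat \<Rightarrow> nat set \<Rightarrow> nat set" where
  "reduced_divisors n0 S = (\<lambda>d. d div gcd d n0) ` S"

lemma reduced_divisor_dvd_iff:
  fixes d n0 m :: nat
  assumes "d > 0" shows "d div gcd d n0 dvd m \<longleftrightarrow> d dvd n0 * m"
proof -
  define g where "g = gcd d n0"
  have g: "g > 0" using assms by (simp add: g_def)
  define d' where "d' = d div g"
  define n' where "n' = n0 div g"
  have d: "d = g * d'" and n: "n0 = g * n'" by (simp_all add: g_def d'_def n'_def)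
  have cop: "coprime d' n'" unfolding d'_def n'_def g_def using assms by (intro div_gcd_coprime) auto
  have "d dvd n0 * m \<longleftrightarrow> g * d' dvd g * (n' * m)" by (subst d, subst n) (simp only: mult.assoc)
  also have "\<dots> \<longleftrightarrow> d' dvd n' * m" using g by simp
  also have "\<dots> \<longleftrightarrow> d' dvd m" using cop by (rule coprime_dvd_mult_right_iff)
  finally show ?thesis by (simp add: d'_def g_def)
qed

lemma nonmultiples_reduced_iff:
  assumes "S \<subseteq> {d. prime (d + 1)}"
  shows "m \<in> nonmultiples (reduced_divisors n0 S) \<longleftrightarrow> (\<forall>d\<in>S. \<not> d dvd n0 * m)"
proof -
  have "d > 0" if "d \<in> S" for d using assms that by (cases d) auto
  thus ?thesis by (auto simp: nonmultiples_def reduced_divisors_def reduced_divisor_dvd_iff)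
qed

lemma counting_scaled_tail_le:
  assumes "n0 > 0"
  shows "counting {m. n0 * m \<in> A} x \<le> counting A (n0 * x)"
proof -
  have "card ({m. n0 * m \<in> A} \<inter> {1..x}) = card ((\<lambda>m. n0 * m) ` ({m. n0 * m \<in> A} \<inter> {1..x}))"
    by (rule card_image[symmetric]) (use assms in \<open>auto intro: inj_onI\<close>)
  also have "\<dots> \<le> card (A \<inter> {1..n0 * x})"
    by (intro card_mono) (use assms in \<open>auto simp: Suc_le_eq\<close>)
  finally show ?thesis by (simp add: counting_def)
qed

text \<open>Again an approximation by periodic sets: the condition on \<open>m\<close> coming from \<open>d\<close> says that \<open>d\<close> does not
  divide \<open>n0 * m\<close>, and the \<open>d\<close> above \<open>Y\<close> only matter if \<open>n0 * m\<close> is in the tail set.\<close>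
lemma nonmultiples_reduced_density_exists:
  assumes n0: "n0 > 0" and S: "S \<subseteq> {d. prime (d + 1)}"
  shows "\<exists>\<delta>. has_natural_density (nonmultiples (reduced_divisors n0 S)) \<delta>"
proof (rule density_by_approximation)
  fix \<epsilon> :: real assume \<epsilon>: "\<epsilon> > 0"
  let ?A = "nonmultiples (reduced_divisors n0 S)"
  obtain Y where Y: "\<And>x. real (counting (tail_set Y) x) \<le> \<epsilon> / real n0 * real x"
    using tail_set_small[of "\<epsilon> / real n0"] \<epsilon> n0 by auto
  let ?S = "S \<inter> {..Y}"
  let ?B = "nonmultiples (reduced_divisors n0 ?S)"
  let ?T = "{m. n0 * m \<in> tail_set Y}"
  have S': "?S \<subseteq> {d. prime (d + 1)}" using S by blast
  have per: "n + fact Y \<in> ?B \<longleftrightarrow> n \<in> ?B" for n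
  proof -
    have "d dvd n0 * (n + fact Y) \<longleftrightarrow> d dvd n0 * n" if d: "d \<in> ?S" for d
    proof -
      have "d \<ge> 1" using S d by (cases d) auto
      hence "d dvd fact Y" using d dvd_fact by blast
      hence "d dvd n0 * fact Y" by simp
      thus ?thesis unfolding distrib_left by (rule dvd_add_left_iff)
    qed
    thus ?thesis unfolding nonmultiples_reduced_iff[OF S'] by blast
  qed
  obtain \<delta> where \<delta>: "\<And>x. \<bar>real (counting ?B x) - \<delta> * real x\<bar> \<le> real (fact Y)"
    using periodic_density[of "fact Y" ?B] per by auto
  have T: "real (counting ?T x) \<le> \<epsilon> * real x" for x
  proof -
    have "real (counting ?T x) \<le> real (counting (tail_set Y) (n0 * x))"
      using counting_scaled_tail_le[OF n0] by simp
    also have "\<dots> \<le> \<epsilon> / real n0 * real (n0 * x)" by (rule Y)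
    also have "\<dots> = \<epsilon> * real x" using n0 by simp
    finally show ?thesis .
  qed
  have "\<bar>real (counting ?A x) - \<delta> * real x\<bar> \<le> \<epsilon> * real x + real (fact Y)" for x
  proof -
    have "?A \<subseteq> ?B" unfolding nonmultiples_def reduced_divisors_def by blast
    hence 1: "counting ?A x \<le> counting ?B x" by (intro counting_mono) blast
    have "?B \<subseteq> ?A \<union> ?T"
    proof
      fix m assume m: "m \<in> ?B"
      show "m \<in> ?A \<union> ?T"
      proof (cases "m \<in> ?A")
        case False
        then obtain d where d: "d \<in> S" "d dvd n0 * m" unfolding nonmultiples_reduced_iff[OF S] by blast
        hence "\<not> d \<le> Y" using m unfolding nonmultiples_reduced_iff[OF S'] by blast
        thus ?thesis using d S unfolding tail_set_def by (auto simp: not_le)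
      qed simp
    qed
    hence "counting ?B x \<le> counting (?A \<union> ?T) x" by (intro counting_mono) blast
    also have "\<dots> \<le> counting ?A x + counting ?T x" by (rule counting_Un)
    finally have 2: "real (counting ?B x) \<le> real (counting ?A x) + real (counting ?T x)" by simp
    show ?thesis using 1 2 \<delta>[of x] T[of x] by linarith
  qed
  thus "\<exists>\<delta> K. \<forall>x. \<bar>real (counting ?A x) - \<delta> * real x\<bar> \<le> \<epsilon> * real x + K" by blast
qed

lemma nonmultiples_reduced_density_extend:
  assumes n0: "n0 > 0" and S: "S \<subseteq> {d. prime (d + 1)}"
    and c: "has_natural_density (nonmultiples (reduced_divisors n0 S)) c" "c > 0"
    and F: "finite F" "F \<subseteq> {d. prime (d + 1) \<and> \<not> d dvd n0}"
  shows "\<exists>c>0. has_natural_density (nonmultiples (reduced_divisors n0 (S \<union> F))) c"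
  using F
proof (induction F rule: finite_induct)
  case (insert d F)
  then obtain c' where c': "c' > 0" "has_natural_density (nonmultiples (reduced_divisors n0 (S \<union> F))) c'" by auto
  have d: "prime (d + 1)" "\<not> d dvd n0" using insert by auto
  hence d0: "d > 0" by (cases d) auto
  define a where "a = d div gcd d n0"
  have "a \<noteq> 0" using d0 by (auto simp: a_def div_eq_0_iff not_less dvd_imp_le)
  moreover have "a \<noteq> 1" using reduced_divisor_dvd_iff[OF d0, of n0 1] d unfolding a_def by auto
  ultimately have a: "a \<ge> 2" by simp
  have "insert d (S \<union> F) \<subseteq> {d. prime (d + 1)}" using S insert.prems by blast
  then obtain e where e: "has_natural_density (nonmultiples (reduced_divisors n0 (insert d (S \<union> F)))) e"
    using nonmultiples_reduced_density_exists[OF n0] by blast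
  have "reduced_divisors n0 (insert d (S \<union> F)) = insert a (reduced_divisors n0 (S \<union> F))"
    by (simp add: reduced_divisors_def a_def)
  hence "e > 0"
    using nonmultiples_density_insert[OF a c'(1)] c'(2) e unfolding has_natural_density_iff by simp
  thus ?case using e by auto
qed (use c in auto)

lemma has_natural_density_ge:
  assumes "has_natural_density A \<delta>" "\<And>x. x \<ge> x0 \<Longrightarrow> c * real x - K \<le> real (counting A x)"
  shows "c \<le> \<delta>"
proof (rule tendsto_le[OF sequentially_bot])
  show "(\<lambda>x. real (counting A x) / real x) \<longlonglongrightarrow> \<delta>" using assms(1) by (simp add: has_natural_density_iff)
  have "(\<lambda>x. c - K * (1 / real x)) \<longlonglongrightarrow> c - K * 0"
    by (intro tendsto_intros lim_1_over_n)
  thus "(\<lambda>x. c - K * (1 / real x)) \<longlonglongrightarrow> c" by simp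
  show "eventually (\<lambda>x. c - K * (1 / real x) \<le> real (counting A x) / real x) sequentially"
    using eventually_ge_at_top[of "max 1 x0"]
  proof eventually_elim
    case (elim x)
    have "(c * real x - K) / real x \<le> real (counting A x) / real x"
      using assms(2)[of x] elim by (intro divide_right_mono) auto
    moreover have "(c * real x - K) / real x = c - K * (1 / real x)" using elim by (simp add: field_simps)
    ultimately show ?case by simp
  qed
qed

text \<open>Starting from the shifted primes above \<open>Y\<close>, which by the tail bound exclude at most half of all
  cofactors, add the finitely many remaining ones one by one. All numbers \<open>n0 * m\<close> with an admissible
  cofactor \<open>m\<close> have the same shifted prime divisors as \<open>n0\<close>.\<close>
lemma L_set_density_positive:
  assumes k: "k \<ge> 1" and \<delta>: "has_natural_density (L_set k) \<delta>"
  shows "\<delta> > 0"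
proof -
  obtain n0 where n0: "n0 > 0" "omega_star n0 = k" using omega_star_attained[OF k] by blast
  define S where "S Y = {d. prime (d + 1) \<and> \<not> d dvd n0 \<and> Y < d}" for Y
  define F where "F Y = {d. prime (d + 1) \<and> \<not> d dvd n0 \<and> d \<le> Y}" for Y
  have S: "S Y \<subseteq> {d. prime (d + 1)}" for Y by (auto simp: S_def)
  have F: "finite (F Y)" "F Y \<subseteq> {d. prime (d + 1) \<and> \<not> d dvd n0}" for Y
    by (rule finite_subset[of _ "{..Y}"]) (auto simp: F_def)
  obtain Y where Y: "\<And>x. real (counting (tail_set Y) x) \<le> 1 / (2 * real n0) * real x"
    using tail_set_small[of "1 / (2 * real n0)"] n0 by auto
  obtain c where c: "has_natural_density (nonmultiples (reduced_divisors n0 (S Y))) c"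
    using nonmultiples_reduced_density_exists[OF n0(1) S] by blast
  have "1/2 \<le> c"
  proof (rule has_natural_density_ge[OF c, of 0 _ 0])
    fix x :: nat
    let ?N = "nonmultiples (reduced_divisors n0 (S Y))" and ?T = "{m. n0 * m \<in> tail_set Y}"
    have "m \<in> ?N \<union> ?T" for m
      unfolding Un_iff nonmultiples_reduced_iff[OF S] by (auto simp: S_def tail_set_def)
    hence "counting UNIV x \<le> counting (?N \<union> ?T) x" by (intro counting_mono) blast
    also have "\<dots> \<le> counting ?N x + counting ?T x" by (rule counting_Un)
    also have "counting ?T x \<le> counting (tail_set Y) (n0 * x)" by (rule counting_scaled_tail_le[OF n0(1)])
    finally have "real x \<le> real (counting ?N x) + real (counting (tail_set Y) (n0 * x))"
      by (simp add: counting_def)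
    moreover have "real (counting (tail_set Y) (n0 * x)) \<le> 1/2 * real x"
      using Y[of "n0 * x"] n0 by simp
    ultimately show "1/2 * real x - 0 \<le> real (counting ?N x)" by linarith
  qed
  hence "c > 0" by simp
  then obtain e where e: "e > 0" "has_natural_density (nonmultiples (reduced_divisors n0 (S Y \<union> F Y))) e"
    using nonmultiples_reduced_density_extend[OF n0(1) S c _ F] by blast
  let ?N = "nonmultiples (reduced_divisors n0 (S Y \<union> F Y))"
  have SF: "S Y \<union> F Y \<subseteq> {d. prime (d + 1)}" by (auto simp: S_def F_def)
  have inL: "n0 * m \<in> L_set k" if "m \<in> ?N" "m > 0" for m
  proof -
    have "\<not> d dvd n0 * m" if "prime (d + 1)" "\<not> d dvd n0" for d
      using \<open>m \<in> ?N\<close> that unfolding nonmultiples_reduced_iff[OF SF] by (auto simp: S_def F_def not_le)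
    hence "shifted_divisors (n0 * m) = shifted_divisors n0"
      unfolding shifted_divisors_def by auto
    thus ?thesis using n0 \<open>m > 0\<close> by (simp add: L_set_def omega_star_eq)
  qed
  have cnt: "counting ?N x \<le> counting (L_set k) (n0 * x)" for x
  proof -
    have "counting ?N x \<le> counting {m. n0 * m \<in> L_set k} x"
      by (intro counting_mono) (use inL in auto)
    also have "\<dots> \<le> counting (L_set k) (n0 * x)" by (rule counting_scaled_tail_le[OF n0(1)])
    finally show ?thesis .
  qed
  have "e \<le> \<delta> * real n0"
  proof (rule tendsto_le[OF sequentially_bot])
    show "(\<lambda>x. real (counting ?N x) / real x) \<longlonglongrightarrow> e" using e by (simp add: has_natural_density_iff)
    have fl: "filterlim (\<lambda>x. n0 * x) sequentially sequentially"
      using n0 by (intro filterlim_subseq) (auto simp: strict_mono_def)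
    have "(\<lambda>x. real (counting (L_set k) x) / real x) \<longlonglongrightarrow> \<delta>" using \<delta> by (simp add: has_natural_density_iff)
    from filterlim_compose[OF this fl]
    show "(\<lambda>x. real (counting (L_set k) (n0 * x)) / real (n0 * x) * real n0) \<longlonglongrightarrow> \<delta> * real n0"
      by (intro tendsto_intros)
    have "real (counting ?N x) / real x \<le> real (counting (L_set k) (n0 * x)) / real (n0 * x) * real n0" for x
      using cnt[of x] n0 by (auto intro: divide_right_mono)
    thus "eventually (\<lambda>x. real (counting ?N x) / real x \<le> real (counting (L_set k) (n0 * x)) / real (n0 * x) * real n0) sequentially"
      by simp
  qed
  hence "0 < \<delta> * real n0" using e by linarith
  thus ?thesis using n0 by (simp add: zero_less_mult_iff)
qed

section \<open>The densities sum to one\<close>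

lemma has_natural_density_nonneg:
  assumes "has_natural_density A \<delta>" shows "\<delta> \<ge> 0"
  by (rule has_natural_density_ge[OF assms, of 0 _ 0]) simp

lemma omega_star_pos: assumes "n > 0" shows "omega_star n \<ge> 1"
proof -
  have "finite (shifted_divisors n)"
    by (rule finite_subset[of _ "{..n}"]) (use assms in \<open>auto simp: shifted_divisors_def dvd_imp_le\<close>)
  moreover have "1 \<in> shifted_divisors n" by (simp add: shifted_divisors_def two_is_prime_nat numeral_2_eq_2[symmetric])
  ultimately have "card (shifted_divisors n) > 0" by (auto simp: card_gt_0_iff)
  thus ?thesis by (simp add: omega_star_eq)
qed

lemma omega_star_le_of_no_tail:
  assumes "n > 0" "n \<notin> tail_set Y" shows "omega_star n \<le> Y + 1"
proof -
  have "card {d. d dvd n \<and> prime (d + 1) \<and> d \<le> Y} \<le> card {..Y}" by (intro card_mono) auto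
  thus ?thesis using truncated_omega_eq[OF assms] by (simp add: truncated_omega_def)
qed

lemma counting_L_sets:
  "(\<Sum>k<K. counting (L_set (Suc k)) x) = card {n\<in>{1..x}. omega_star n \<le> K}"
proof -
  have "(\<Sum>k<K. counting (L_set (Suc k)) x) = card (\<Union>k<K. L_set (Suc k) \<inter> {1..x})"
    unfolding counting_def by (rule card_UN_disjoint[symmetric]) (auto simp: L_set_def)
  also have "(\<Union>k<K. L_set (Suc k) \<inter> {1..x}) = {n\<in>{1..x}. omega_star n \<le> K}"
  proof (intro equalityI subsetI)
    fix n assume n: "n \<in> {n\<in>{1..x}. omega_star n \<le> K}"
    then obtain k where k: "omega_star n = Suc k" using omega_star_pos[of n] by (cases "omega_star n") auto
    hence "k < K" "n \<in> L_set (Suc k)" using n by (auto simp: L_set_def)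
    thus "n \<in> (\<Union>k<K. L_set (Suc k) \<inter> {1..x})" using n by blast
  qed (auto simp: L_set_def)
  finally show ?thesis .
qed

text \<open>The partial sums are densities of the sets \<open>omega_star n \<le> K\<close>, hence at most \<open>1\<close>; for \<open>K > Y\<close> these
  sets contain everything outside the tail set.\<close>
lemma L_set_densities_sum:
  assumes \<delta>: "\<And>k. k \<ge> 1 \<Longrightarrow> has_natural_density (L_set k) (\<delta> k)"
  shows "(\<lambda>k. \<delta> (Suc k)) sums 1"
proof -
  let ?s = "\<lambda>K. \<Sum>k<K. \<delta> (Suc k)"
  have lim: "(\<lambda>x. real (card {n\<in>{1..x}. omega_star n \<le> K}) / real x) \<longlonglongrightarrow> ?s K" for K
  proof -
    have "(\<lambda>x. \<Sum>k<K. real (counting (L_set (Suc k)) x) / real x) \<longlonglongrightarrow> ?s K"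
      using \<delta> by (intro tendsto_sum) (auto simp: has_natural_density_iff)
    moreover have "(\<Sum>k<K. real (counting (L_set (Suc k)) x) / real x) = real (card {n\<in>{1..x}. omega_star n \<le> K}) / real x" for x
      unfolding counting_L_sets[symmetric] by (simp add: sum_divide_distrib)
    ultimately show ?thesis by simp
  qed
  have le1: "?s K \<le> 1" for K
  proof (rule LIMSEQ_le_const2[OF lim[of K]], intro exI allI impI)
    fix x :: nat
    have "card {n\<in>{1..x}. omega_star n \<le> K} \<le> card {1..x}" by (intro card_mono) auto
    thus "real (card {n\<in>{1..x}. omega_star n \<le> K}) / real x \<le> 1" by (simp add: divide_le_eq)
  qed
  have mono: "?s K \<le> ?s K'" if "K \<le> K'" for K K'
    using that \<delta> has_natural_density_nonneg by (intro sum_mono2) auto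
  show ?thesis unfolding sums_def
  proof (rule LIMSEQ_I)
    fix r :: real assume r: "r > 0"
    obtain Y where Y: "\<And>x. real (counting (tail_set Y) x) \<le> r / 2 * real x"
      using tail_set_small[of "r / 2"] r by auto
    have "1 - r / 2 \<le> ?s (Y + 1)"
    proof (rule LIMSEQ_le_const[OF lim[of "Y + 1"]], intro exI[of _ 1] allI impI)
      fix x :: nat assume x: "1 \<le> x"
      let ?A = "{n\<in>{1..x}. omega_star n \<le> Y + 1}"
      have "{1..x} \<subseteq> ?A \<union> (tail_set Y \<inter> {1..x})" using omega_star_le_of_no_tail by fastforce
      hence "card {1..x} \<le> card (?A \<union> (tail_set Y \<inter> {1..x}))" by (intro card_mono) auto
      also have "\<dots> \<le> card ?A + counting (tail_set Y) x" unfolding counting_def by (rule card_Un_le)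
      finally have "real x \<le> real (card ?A) + real (counting (tail_set Y) x)" by simp
      hence "(1 - r / 2) * real x \<le> real (card ?A)" using Y[of x] by (simp add: algebra_simps)
      thus "1 - r / 2 \<le> real (card ?A) / real x" using x by (simp add: le_divide_eq)
    qed
    have "norm (?s K - 1) < r" if "K \<ge> Y + 1" for K
    proof -
      have "1 - r / 2 \<le> ?s K" using \<open>1 - r / 2 \<le> ?s (Y + 1)\<close> mono[OF that] by linarith
      thus ?thesis unfolding real_norm_def using le1[of K] r by linarith
    qed
    thus "\<exists>no. \<forall>K\<ge>no. norm (?s K - 1) < r" by blast
  qed
qed

theorem theorem2:
  shows "\<exists>\<delta> :: nat \<Rightarrow> real.
           (\<forall>k\<ge>1. has_natural_density (L_set k) (\<delta> k) \<and> \<delta> k > 0) \<and>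
           (\<lambda>k. \<delta> (Suc k)) sums 1"
proof -
  obtain \<delta> where \<delta>: "\<And>k. has_natural_density (L_set k) (\<delta> k)"
    using L_set_density_exists by metis
  show ?thesis
    using \<delta> L_set_density_positive L_set_densities_sum by blast
qed

end
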